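(* Sending a marked cubic surface to the relations of the quiver $Q$ determined by its full strong exceptional collection $(E_{i,j})$ gives a locally closed immersion $$\iota\colon M_{\mathrm{cubic}}\to M^\circ .$$
   Context: Work over an algebraically closed field $\mathbf k$ of characteristic $0$. **Marked cubic surfaces.** Six points of $\mathbb P^2$ are in general position if they do not lie on a conic and no three are collinear. $(\mathbb P^2)^6_{\mathrm{gen}}\subset(\mathbb P^2)^6$ is the space of six ordered points in general position, and $M_{\mathrm{cubic}}=(\mathbb P^2)^6_{\mathrm{gen}}/\mathrm{Aut}\,\mathbb P^2$ (a free diagonal action) is the moduli scheme of marked cubic surfaces: the marked cubic surface is the blow-up $X$ of $\mathbb P^2$ at the six points, with exceptional curves $l_1,\dots,l_6$; let $l$ be the pullback of the class of a line in $\mathbb P^2$. **Exceptional collection.** On $X$ consider the nine line bundles $E_{0,0}=\mathcal O_X$, $E_{1,0}=\mathcal O_X(-2l+\sum_{i=1}^6l_i)$, $E_{2,0}=\mathcal O_X(-l+l_1+l_2+l_3)$; $E_{0,1}=\mathcal O_X(l_1)$, $E_{1,1}=\mathcal O_X(l_2)$, $E_{2,1}=\mathcal O_X(l_3)$; $E_{0,2}=\mathcal O_X(l-l_4)$, $E_{1,2}=\mathcal O_X(l-l_5)$, $E_{2,2}=\mathcal O_X(l-l_6)$. They form a full strong exceptional collection. **Quiver and relations.** $Q$ is the quiver with vertices $Q_0=\{0,1,2\}\times\{0,1,2\}$ and 18 arrows $x_{i,j,k}\colon(i,j)\to(i+k,j+1)$, $i,k\in\mathbb Z/3$, $j\in\{0,1\}$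 (first entries of vertices modulo 3; paths composed right to left). For each such $(i,j,k)$ the space $\mathrm{Hom}(E_{i,j},E_{i+k,j+1})$ is one-dimensional; choosing basis elements and identifying them with the arrows gives a surjection $\mathbf kQ\to\mathrm{End}(\bigoplus_vE_v)$ whose kernel $I$ is spanned by nine relations, one for each $(i,w)\in(\mathbb Z/3)^2$: $\sum_{j+k=w-i}c_{i,j,k}\,x_{i+j,1,k}\,x_{i,0,j}$, with $(c_{i,j,k})_{j+k=w-i}\neq0$ determined up to a common scalar. Different choices of bases rescale the arrows. **Target.** Let $\rho\colon(\mathbb G_m)^{27}\to(\mathbb G_m)^{27}$, $\rho((\alpha_{i,j,k}))=(\alpha_{i+j+k,2,-j-k}\,\alpha_{i+j,1,k}\,\alpha_{i,0,j})_{i,j,k\in\mathbb Z/3}$, and let $K$ be its image. $M^\circ=(\mathbb G_m)^{27}/K\cong(\mathbb G_m)^8$ is the dense torus, where all 27 coordinates $c_{i,j,k}$ are nonzero, of the toric variety $\overline M_\chi=(\mathbb A^{27})^{\chi\text{-ss}}/\!/K$ for any generic character $\chi$ of $K$. The map $\iota$ sends the marked cubic surface to the class of the coefficient vector $(c_{i,j,k})$ of its ideal of relations $I$. *)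

theory Defs
  imports "HOL-Analysis.Analysis" "HOL-Computational_Algebra.Polynomial"
begin

section \<open>Varieties as spaces with functions\<close>

text \<open>
  Over an algebraically closed field, a variety (a reduced scheme of finite type) is encoded
  classically by its closed points, its Zariski topology and its sheaf of regular functions with
  values in the ground field.  A regular function on an open set \<open>U\<close> is represented by a total
  function of which only the values on \<open>U\<close> matter.
\<close>

datatype ('x, 'k) kspace =
  KSpace (ktop: "'x topology") (regular: "'x set \<Rightarrow> ('x \<Rightarrow> 'k) \<Rightarrow> bool")

inductive polyfun :: "(('i \<Rightarrow> 'k::field) \<Rightarrow> 'k) \<Rightarrow> bool" where
  const: "polyfun (\<lambda>_. a)"
| coord: "polyfun (\<lambda>v. v i)"
| add: "polyfun f \<Longrightarrow> polyfun g \<Longrightarrow> polyfun (\<lambda>v. f v + g v)"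
| mult: "polyfun f \<Longrightarrow> polyfun g \<Longrightarrow> polyfun (\<lambda>v. f v * g v)"

definition zariski :: "('i::finite \<Rightarrow> 'k::field) topology" where
  "zariski = topology_generated_by {{v. f v \<noteq> 0} | f. polyfun f}"

definition affine_sp :: "('i::finite \<Rightarrow> 'k::field, 'k) kspace" where
  "affine_sp = KSpace zariski
     (\<lambda>U f. openin zariski U \<and>
        (\<forall>x\<in>U. \<exists>V g h. openin zariski V \<and> x \<in> V \<and> V \<subseteq> U \<and> polyfun g \<and> polyfun h \<and>
           (\<forall>y\<in>V. h y \<noteq> 0 \<and> f y = g y / h y)))"

text \<open>The structure induced on a subset (used for locally closed subsets: reduced structure).\<close>

definition subsp :: "('x, 'k) kspace \<Rightarrow> 'x set \<Rightarrow> ('x, 'k) kspace" where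
  "subsp X Y = KSpace (subtopology (ktop X) Y)
     (\<lambda>U f. openin (subtopology (ktop X) Y) U \<and>
        (\<forall>x\<in>U. \<exists>W g. openin (ktop X) W \<and> x \<in> W \<and> regular X W g \<and> (\<forall>y\<in>W \<inter> U. f y = g y)))"

definition quot_topology :: "'x topology \<Rightarrow> ('x \<Rightarrow> 'y) \<Rightarrow> 'y topology" where
  "quot_topology T q =
     topology (\<lambda>U. U \<subseteq> q ` topspace T \<and> openin T {x \<in> topspace T. q x \<in> U})"

lemma openin_quot_topology:
  "openin (quot_topology T q) U \<longleftrightarrow>
     U \<subseteq> q ` topspace T \<and> openin T {x \<in> topspace T. q x \<in> U}"
proof -
  have "istopology (\<lambda>U. U \<subseteq> q ` topspace T \<and> openin T {x \<in> topspace T. q x \<in> U})"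
    unfolding istopology_def
  proof (intro conjI allI impI)
    fix A B
    assume "A \<subseteq> q ` topspace T \<and> openin T {x \<in> topspace T. q x \<in> A}"
      and "B \<subseteq> q ` topspace T \<and> openin T {x \<in> topspace T. q x \<in> B}"
    moreover have "{x \<in> topspace T. q x \<in> A \<inter> B} =
        {x \<in> topspace T. q x \<in> A} \<inter> {x \<in> topspace T. q x \<in> B}"
      by auto
    ultimately show "A \<inter> B \<subseteq> q ` topspace T" "openin T {x \<in> topspace T. q x \<in> A \<inter> B}"
      by auto
  next
    fix \<K>
    assume *: "\<forall>K\<in>\<K>. K \<subseteq> q ` topspace T \<and> openin T {x \<in> topspace T. q x \<in> K}"
    then show "\<Union>\<K> \<subseteq> q ` topspace T" by blast
    have "{x \<in> topspace T. q x \<in> \<Union>\<K>} = (\<Union>K\<in>\<K>. {x \<in> topspace T. q x \<in> K})"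
      by auto
    then show "openin T {x \<in> topspace T. q x \<in> \<Union>\<K>}"
      using * by auto
  qed
  then show ?thesis
    by (simp add: quot_topology_def topology_inverse')
qed

text \<open>
  The structure coinduced by a surjection \<open>q\<close>: a set is open, and a function on it is regular, when
  its pullback along \<open>q\<close> is.  All quotients below are by free actions with geometric quotients,
  whose structure sheaf is the sheaf of invariant functions.
\<close>

definition quotsp :: "('x, 'k) kspace \<Rightarrow> ('x \<Rightarrow> 'y) \<Rightarrow> ('y, 'k) kspace" where
  "quotsp X q = KSpace (quot_topology (ktop X) q)
     (\<lambda>U f. openin (quot_topology (ktop X) q) U \<and>
        regular X {x \<in> topspace (ktop X). q x \<in> U} (f \<circ> q))"

definition morphism :: "('x, 'k) kspace \<Rightarrow> ('y, 'k) kspace \<Rightarrow> ('x \<Rightarrow> 'y) \<Rightarrow> bool" where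
  "morphism X Y \<phi> \<longleftrightarrow> continuous_map (ktop X) (ktop Y) \<phi> \<and>
     (\<forall>U f. openin (ktop Y) U \<and> regular Y U f \<longrightarrow>
        regular X {x \<in> topspace (ktop X). \<phi> x \<in> U} (f \<circ> \<phi>))"

definition isomorphism :: "('x, 'k) kspace \<Rightarrow> ('y, 'k) kspace \<Rightarrow> ('x \<Rightarrow> 'y) \<Rightarrow> bool" where
  "isomorphism X Y \<phi> \<longleftrightarrow> morphism X Y \<phi> \<and>
     (\<exists>\<psi>. morphism Y X \<psi> \<and> (\<forall>x\<in>topspace (ktop X). \<psi> (\<phi> x) = x) \<and>
          (\<forall>y\<in>topspace (ktop Y). \<phi> (\<psi> y) = y))"

definition locally_closed_in :: "'x topology \<Rightarrow> 'x set \<Rightarrow> bool" where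
  "locally_closed_in T Z \<longleftrightarrow> (\<exists>U C. openin T U \<and> closedin T C \<and> Z = U \<inter> C)"

text \<open>
  For reduced \<open>X\<close> the scheme-theoretic image is reduced, so a locally closed immersion is an
  isomorphism onto a locally closed subset with its reduced structure.
\<close>

definition locally_closed_immersion ::
  "('x, 'k) kspace \<Rightarrow> ('y, 'k) kspace \<Rightarrow> ('x \<Rightarrow> 'y) \<Rightarrow> bool" where
  "locally_closed_immersion X Y \<phi> \<longleftrightarrow>
     locally_closed_in (ktop Y) (\<phi> ` topspace (ktop X)) \<and>
     isomorphism X (subsp Y (\<phi> ` topspace (ktop X))) \<phi>"


section \<open>Products of projective planes and marked cubic surfaces\<close>

text \<open>
  A point of \<open>\<bbbP>\<^sup>2\<close> is a line through the origin in \<open>k\<^sup>3\<close>; a power \<open>(\<bbbP>\<^sup>2)\<^sup>I\<close> is the quotient of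
  \<open>(k\<^sup>3 - 0)\<^sup>I\<close>, an open subset of an affine space, by rescaling each factor.
\<close>

definition proj_power :: "('i::finite \<Rightarrow> ('k::field ^ 3) set, 'k) kspace" where
  "proj_power = quotsp (subsp affine_sp {v :: 'i \<times> 3 \<Rightarrow> 'k. \<forall>i. \<exists>a. v (i, a) \<noteq> 0})
     (\<lambda>v i. vec.span {\<chi> a. v (i, a)})"

text \<open>The line with equation \<open>h\<close> (for \<open>h \<noteq> 0\<close>).\<close>

definition on_line :: "'k::field ^ 3 \<Rightarrow> ('k ^ 3) set \<Rightarrow> bool" where
  "on_line h P \<longleftrightarrow> (\<forall>u\<in>P. (\<Sum>a\<in>UNIV. h $ a * u $ a) = 0)"

definition qform :: "'k::field ^ 3 ^ 3 \<Rightarrow> 'k ^ 3 \<Rightarrow> 'k" where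
  "qform Q u = (\<Sum>a\<in>UNIV. \<Sum>b\<in>UNIV. Q $ a $ b * u $ a * u $ b)"

text \<open>
  Six points are indexed by the type \<open>6\<close>, where \<open>6 = 0\<close>: the points are \<open>p 1, \<dots>, p 6\<close>.
\<close>

definition general_position :: "(6 \<Rightarrow> ('k::field ^ 3) set) set" where
  "general_position = {p \<in> topspace (ktop proj_power).
     (\<forall>i j k. i \<noteq> j \<and> j \<noteq> k \<and> i \<noteq> k \<longrightarrow>
        \<not> (\<exists>h. h \<noteq> 0 \<and> on_line h (p i) \<and> on_line h (p j) \<and> on_line h (p k))) \<and>
     \<not> (\<exists>Q. (\<exists>u. qform Q u \<noteq> 0) \<and> (\<forall>i. \<forall>u\<in>p i. qform Q u = 0))}"

definition aut_orbit :: "(6 \<Rightarrow> ('k::field ^ 3) set) \<Rightarrow> (6 \<Rightarrow> ('k ^ 3) set) set" where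
  "aut_orbit p = {\<lambda>i. (\<lambda>u. A *v u) ` p i | A :: 'k ^ 3 ^ 3. invertible A}"

definition M_cubic :: "((6 \<Rightarrow> ('k::field ^ 3) set) set, 'k) kspace" where
  "M_cubic = quotsp (subsp proj_power general_position) aut_orbit"


section \<open>The blow-up and its line bundles\<close>

text \<open>
  The blow-up of \<open>\<bbbP>\<^sup>2\<close> in the points \<open>p i\<close> is the incidence variety of tuples consisting of a point
  \<open>z None\<close> of \<open>\<bbbP>\<^sup>2\<close> and, for each \<open>i\<close>, a line through \<open>z None\<close> and \<open>p i\<close>, given by the point
  \<open>z (Some i)\<close> of the dual plane.
\<close>

definition blowup :: "(6 \<Rightarrow> ('k::field ^ 3) set) \<Rightarrow> (6 option \<Rightarrow> ('k ^ 3) set, 'k) kspace" where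
  "blowup p = subsp proj_power {z \<in> topspace (ktop proj_power).
     \<forall>i. \<forall>h\<in>z (Some i). on_line h (z None) \<and> on_line h (p i)}"

definition exc_curve ::
  "(6 \<Rightarrow> ('k::field ^ 3) set) \<Rightarrow> 6 \<Rightarrow> (6 option \<Rightarrow> ('k ^ 3) set) set" where
  "exc_curve p i = {z \<in> topspace (ktop (blowup p)). z None = p i}"

definition pullback_line ::
  "(6 \<Rightarrow> ('k::field ^ 3) set) \<Rightarrow> 'k ^ 3 \<Rightarrow> (6 option \<Rightarrow> ('k ^ 3) set) set" where
  "pullback_line p h = {z \<in> topspace (ktop (blowup p)). on_line h (z None)}"

text \<open>Sheaves of functions; local sections over \<open>U\<close> are normalised to vanish outside \<open>U\<close>.\<close>

type_synonym ('x, 'k) fsheaf = "'x set \<Rightarrow> ('x \<Rightarrow> 'k) set"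

definition restr :: "'x set \<Rightarrow> ('x \<Rightarrow> 'k::zero) \<Rightarrow> 'x \<Rightarrow> 'k" where
  "restr V f = (\<lambda>x. if x \<in> V then f x else 0)"

text \<open>\<open>t\<close> generates the ideal sheaf of the closed subset \<open>C\<close> over the open set \<open>V\<close>.\<close>

definition local_equation ::
  "('x, 'k::field) kspace \<Rightarrow> 'x set \<Rightarrow> 'x set \<Rightarrow> ('x \<Rightarrow> 'k) \<Rightarrow> bool" where
  "local_equation X C V t \<longleftrightarrow>
     openin (ktop X) V \<and> regular X V t \<and> (\<forall>y\<in>V \<inter> C. t y = 0) \<and>
     (\<forall>W g. openin (ktop X) W \<and> W \<subseteq> V \<and> regular X W g \<and> (\<forall>y\<in>W \<inter> C. g y = 0) \<longrightarrow>
        (\<exists>h. regular X W h \<and> (\<forall>y\<in>W. g y = h y * t y)))"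

text \<open>
  The line bundle \<open>O(D)\<close> of a divisor \<open>D\<close> with finite support, given by the multiplicities of curves.
  Its sections over \<open>U\<close> are the rational functions with \<open>div f + D \<ge> 0\<close> on \<open>U\<close>; they are regular
  away from the support \<open>S\<close> of \<open>D\<close>, and are represented by their restrictions to \<open>U - S\<close>, extended
  by zero.
\<close>

definition line_bundle ::
  "('x, 'k::field) kspace \<Rightarrow> ('x set \<Rightarrow> int) \<Rightarrow> ('x, 'k) fsheaf" where
  "line_bundle X D U =
     (let S = \<Union>{C. D C \<noteq> 0} in
      {f. regular X (U - S) f \<and> (\<forall>x. x \<notin> U - S \<longrightarrow> f x = 0) \<and>
          (\<forall>x\<in>U. \<exists>V t g. x \<in> V \<and> V \<subseteq> U \<and> openin (ktop X) V \<and> regular X V g \<and>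
             (\<forall>C. D C \<noteq> 0 \<longrightarrow> local_equation X C V (t C)) \<and>
             (\<forall>y\<in>V - S. f y * (\<Prod>C | D C \<noteq> 0. t C y powi D C) = g y))})"

text \<open>
  Morphisms of sheaves of modules over the structure sheaf, given by their components over the open
  sets and normalised to be \<open>0\<close> off their domain of definition.
\<close>

type_synonym ('x, 'k) sheaf_hom = "'x set \<Rightarrow> ('x \<Rightarrow> 'k) \<Rightarrow> 'x \<Rightarrow> 'k"

definition Hom ::
  "('x, 'k::field) kspace \<Rightarrow> ('x, 'k) fsheaf \<Rightarrow> ('x, 'k) fsheaf \<Rightarrow> ('x, 'k) sheaf_hom set" where
  "Hom X E F = {\<phi>.
     (\<forall>U f. \<not> (openin (ktop X) U \<and> f \<in> E U) \<longrightarrow> \<phi> U f = (\<lambda>_. 0)) \<and>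
     (\<forall>U. openin (ktop X) U \<longrightarrow>
        (\<forall>f\<in>E U. \<phi> U f \<in> F U) \<and>
        (\<forall>f\<in>E U. \<forall>g\<in>E U. \<phi> U (\<lambda>x. f x + g x) = (\<lambda>x. \<phi> U f x + \<phi> U g x)) \<and>
        (\<forall>a. regular X U a \<longrightarrow> (\<forall>f\<in>E U. \<phi> U (\<lambda>x. a x * f x) = (\<lambda>x. a x * \<phi> U f x))) \<and>
        (\<forall>V. openin (ktop X) V \<and> V \<subseteq> U \<longrightarrow>
           (\<forall>f\<in>E U. \<phi> V (restr V f) = restr V (\<phi> U f))))}"

definition id_hom :: "('x, 'k::field) kspace \<Rightarrow> ('x, 'k) fsheaf \<Rightarrow> ('x, 'k) sheaf_hom" where
  "id_hom X E = (\<lambda>U f. if openin (ktop X) U \<and> f \<in> E U then f else (\<lambda>_. 0))"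

definition comp_hom ::
  "('x, 'k) sheaf_hom \<Rightarrow> ('x, 'k) sheaf_hom \<Rightarrow> ('x, 'k) sheaf_hom" where
  "comp_hom \<phi> \<psi> = (\<lambda>U f. \<phi> U (\<psi> U f))"

text \<open>\<open>\<phi>\<close> alone is a basis of the vector space of morphisms from \<open>E\<close> to \<open>F\<close>.\<close>

definition is_basis_hom ::
  "('x, 'k::field) kspace \<Rightarrow> ('x, 'k) fsheaf \<Rightarrow> ('x, 'k) fsheaf \<Rightarrow> ('x, 'k) sheaf_hom \<Rightarrow> bool" where
  "is_basis_hom X E F \<phi> \<longleftrightarrow> \<phi> \<in> Hom X E F \<and> \<phi> \<noteq> (\<lambda>_ _ _. 0) \<and>
     (\<forall>\<psi>\<in>Hom X E F. \<exists>t. \<psi> = (\<lambda>U f x. t * \<phi> U f x))"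


section \<open>The exceptional collection\<close>

definition single :: "6 \<Rightarrow> 6 \<Rightarrow> int" where
  "single i = (\<lambda>m. if m = i then 1 else 0)"

text \<open>The pair \<open>(d, m)\<close> stands for the class \<open>d l + m\<^sub>1 l\<^sub>1 + \<dots> + m\<^sub>6 l\<^sub>6\<close>.\<close>

definition E_class :: "3 \<times> 3 \<Rightarrow> int \<times> (6 \<Rightarrow> int)" where
  "E_class v =
    (if v = (0, 0) then (0, \<lambda>_. 0)
     else if v = (1, 0) then (- 2, \<lambda>_. 1)
     else if v = (2, 0) then (- 1, \<lambda>m. single 1 m + single 2 m + single 3 m)
     else if v = (0, 1) then (0, single 1)
     else if v = (1, 1) then (0, single 2)
     else if v = (2, 1) then (0, single 3)
     else if v = (0, 2) then (1, \<lambda>m. - single 4 m)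
     else if v = (1, 2) then (1, \<lambda>m. - single 5 m)
     else (1, \<lambda>m. - single 6 m))"

text \<open>
  The class \<open>l\<close> is represented by the pullback of a line \<open>h\<close> through none of the six points, whose
  preimage in the blow-up is a reduced curve.
\<close>

definition avoiding_line :: "(6 \<Rightarrow> ('k::field ^ 3) set) \<Rightarrow> 'k ^ 3 \<Rightarrow> bool" where
  "avoiding_line p h \<longleftrightarrow> h \<noteq> 0 \<and> (\<forall>i. \<not> on_line h (p i))"

definition divisor_of ::
  "(6 \<Rightarrow> ('k::field ^ 3) set) \<Rightarrow> 'k ^ 3 \<Rightarrow> int \<times> (6 \<Rightarrow> int) \<Rightarrow>
   (6 option \<Rightarrow> ('k ^ 3) set) set \<Rightarrow> int" where
  "divisor_of p h = (\<lambda>(d, m) C. (if C = pullback_line p h then d else 0) +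
     (\<Sum>i\<in>UNIV. if C = exc_curve p i then m i else 0))"

definition E_bundle ::
  "(6 \<Rightarrow> ('k::field ^ 3) set) \<Rightarrow> 'k ^ 3 \<Rightarrow> 3 \<times> 3 \<Rightarrow> (6 option \<Rightarrow> ('k ^ 3) set, 'k) fsheaf" where
  "E_bundle p h v = line_bundle (blowup p) (divisor_of p h (E_class v))"


section \<open>The quiver and its relations\<close>

text \<open>
  The type \<open>3\<close> is the ring of integers modulo 3.  The triple \<open>(i, j, k)\<close> with \<open>j \<noteq> 2\<close> is the arrow
  \<open>x\<^bsub>i,j,k\<^esub>\<close>.
\<close>

type_synonym vertex = "3 \<times> 3"
type_synonym arrow = "3 \<times> 3 \<times> 3"

definition arrows :: "arrow set" where
  "arrows = {(i, j, k). j \<noteq> 2}"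

fun src :: "arrow \<Rightarrow> vertex" where
  "src (i, j, k) = (i, j)"

fun tgt :: "arrow \<Rightarrow> vertex" where
  "tgt (i, j, k) = (i + k, j + 1)"

text \<open>A path is its starting vertex together with its arrows in the order of travel.\<close>

type_synonym qpath = "vertex \<times> arrow list"

fun is_path :: "vertex \<Rightarrow> arrow list \<Rightarrow> bool" where
  "is_path v [] \<longleftrightarrow> True"
| "is_path v (a # as) \<longleftrightarrow> a \<in> arrows \<and> src a = v \<and> is_path (tgt a) as"

definition paths :: "qpath set" where
  "paths = {(v, as). is_path v as}"

fun path_end :: "qpath \<Rightarrow> vertex" where
  "path_end (v, as) = (if as = [] then v else tgt (last as))"

text \<open>The path algebra as a vector space; there are only finitely many paths.\<close>

definition path_algebra :: "(qpath \<Rightarrow> 'k::field) set" where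
  "path_algebra = {a. \<forall>q. q \<notin> paths \<longrightarrow> a q = 0}"

fun path_hom ::
  "('x, 'k::field) kspace \<Rightarrow> (vertex \<Rightarrow> ('x, 'k) fsheaf) \<Rightarrow> (arrow \<Rightarrow> ('x, 'k) sheaf_hom) \<Rightarrow>
   vertex \<Rightarrow> arrow list \<Rightarrow> ('x, 'k) sheaf_hom" where
  "path_hom X E x v [] = id_hom X (E v)"
| "path_hom X E x v (a # as) = comp_hom (path_hom X E x (tgt a) as) (x a)"

text \<open>
  The image of \<open>a\<close> under the algebra map from the path algebra to the endomorphisms of the direct sum
  of the \<open>E v\<close>; a section of the direct sum is a family \<open>s\<close> of sections of the summands.
\<close>

definition end_image ::
  "('x, 'k::field) kspace \<Rightarrow> (vertex \<Rightarrow> ('x, 'k) fsheaf) \<Rightarrow> (arrow \<Rightarrow> ('x, 'k) sheaf_hom) \<Rightarrow>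
   (qpath \<Rightarrow> 'k) \<Rightarrow> 'x set \<Rightarrow> (vertex \<Rightarrow> 'x \<Rightarrow> 'k) \<Rightarrow> vertex \<Rightarrow> 'x \<Rightarrow> 'k" where
  "end_image X E x a U s w = (\<lambda>z. \<Sum>(v, as) | (v, as) \<in> paths \<and> path_end (v, as) = w.
     a (v, as) * path_hom X E x v as U (s v) z)"

definition relation_ideal ::
  "('x, 'k::field) kspace \<Rightarrow> (vertex \<Rightarrow> ('x, 'k) fsheaf) \<Rightarrow> (arrow \<Rightarrow> ('x, 'k) sheaf_hom) \<Rightarrow>
   (qpath \<Rightarrow> 'k) set" where
  "relation_ideal X E x = {a \<in> path_algebra.
     \<forall>U s. openin (ktop X) U \<and> (\<forall>v. s v \<in> E v U) \<longrightarrow> end_image X E x a U s = (\<lambda>_ _. 0)}"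

text \<open>The relation \<open>\<Sum>\<^bsub>j+k=w-i\<^esub> c\<^bsub>i,j,k\<^esub> x\<^bsub>i+j,1,k\<^esub> x\<^bsub>i,0,j\<^esub>\<close>.\<close>

definition relation :: "(3 \<times> 3 \<times> 3 \<Rightarrow> 'k::field) \<Rightarrow> 3 \<times> 3 \<Rightarrow> qpath \<Rightarrow> 'k" where
  "relation c = (\<lambda>(i, w) q. \<Sum>(j, k) | j + k = w - i.
     if q = ((i, 0), [(i, 0, j), (i + j, 1, k)]) then c (i, j, k) else 0)"

text \<open>
  \<open>c\<close> is a coefficient vector of the ideal of relations of the marked cubic surface given by \<open>p\<close>, for
  some choice of the line representing \<open>l\<close> and of basis elements \<open>x\<close> of the morphism spaces.
\<close>

definition coefficient_vector ::
  "(6 \<Rightarrow> ('k::field ^ 3) set) \<Rightarrow> (3 \<times> 3 \<times> 3 \<Rightarrow> 'k) \<Rightarrow> bool" where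
  "coefficient_vector p c \<longleftrightarrow>
     (\<exists>h x. avoiding_line p h \<and>
        (\<forall>a\<in>arrows. is_basis_hom (blowup p) (E_bundle p h (src a)) (E_bundle p h (tgt a)) (x a)) \<and>
        (\<forall>i w. \<exists>j k. j + k = w - i \<and> c (i, j, k) \<noteq> 0) \<and>
        relation_ideal (blowup p) (E_bundle p h) x =
          range (\<lambda>(t :: 3 \<times> 3 \<Rightarrow> 'k) q. \<Sum>r\<in>UNIV. t r * relation c r q))"


section \<open>The target torus\<close>

definition torus27 :: "(3 \<times> 3 \<times> 3 \<Rightarrow> 'k::field) set" where
  "torus27 = {c. \<forall>r. c r \<noteq> 0}"

definition rho :: "(3 \<times> 3 \<times> 3 \<Rightarrow> 'k::field) \<Rightarrow> 3 \<times> 3 \<times> 3 \<Rightarrow> 'k" where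
  "rho \<alpha> = (\<lambda>(i, j, k). \<alpha> (i + j + k, 2, - j - k) * \<alpha> (i + j, 1, k) * \<alpha> (i, 0, j))"

definition K_class :: "(3 \<times> 3 \<times> 3 \<Rightarrow> 'k::field) \<Rightarrow> (3 \<times> 3 \<times> 3 \<Rightarrow> 'k) set" where
  "K_class c = {\<lambda>r. \<kappa> r * c r | \<kappa>. \<kappa> \<in> rho ` torus27}"

definition M_circ :: "((3 \<times> 3 \<times> 3 \<Rightarrow> 'k::field) set, 'k) kspace" where
  "M_circ = quotsp (subsp affine_sp torus27) K_class"

end

theory Submission
  imports Defs
begin

text \<open>
  Write the points as \<open>span {v i}\<close> and let \<open>h\<close> be a line avoiding them.  A morphism
  \<open>O(D) \<rightarrow> O(D')\<close> is multiplication by a section of \<open>O(D' - D)\<close>, and for the arrows of the quiver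
  these sections are the multiples of \<open>F / h\<^sup>d\<close> for a single form \<open>F\<close>: a constant, the line through
  two of the points, or the conic through five of them.  Uniqueness follows by restricting to lines of
  the plane, where a section becomes a polynomial in one variable of degree at most \<open>d\<close>.

  The relations are then the linear dependences between the three products of two such forms along the
  paths from \<open>(i, 0)\<close> to \<open>(w, 2)\<close>.  Up to the action of \<open>K\<close>, their coefficients are the brackets
  \<open>det (v (a + 1), v (a + 2), v (w + 4))\<close> of the points for \<open>i = 0\<close>, where the indices \<open>a + 1\<close> and \<open>a + 2\<close>
  run cyclically over the first three points, the coordinates of the first three points with respect
  to the last three for \<open>i = 1\<close>, and \<open>1\<close> for \<open>i = 2\<close>.  The
  coordinates, up to scaling of rows and columns, determine the six points up to projective
  equivalence, and the brackets are polynomials in the coordinates.  So the image is closed in the open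
  set where the points reconstructed from the part \<open>i = 1\<close> are in general position, and the
  reconstruction is the inverse morphism.
\<close>

section \<open>Spaces with functions\<close>

text \<open>Sections are handled through their values on the dense complement of seven curves, the
  exceptional ones and the pullback of the auxiliary line, so bundles with different supports are
  compared by one function there.

  The conic through five points comes from the quadratic transformation centred at the last three
  points: conics through these are pullbacks of lines, so the required conic is the pullback of the
  line joining the images of two of the first three points. Likewise six points, the last three not
  collinear, lie on a conic exactly when the images of the first three are linearly dependent. The
  relation for \<open>i = 1\<close> is then Cramer's rule for these images.

  An element of \<open>K\<close> is a product of a function of \<open>(i, w)\<close>, one of
  \<open>(a, w)\<close> and one of \<open>(i, a)\<close>, with \<open>a\<close> the middle vertex.
  Normalising \<open>i = 2\<close> to 1 uses up the second factor. What remains is two 3 by 3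
  matrices, for \<open>i = 0\<close> and \<open>i = 1\<close>, up to scaling of rows and columns: 4
  + 4 = 8 parameters. The image is the graph of a map from an open subset of the second four
  parameters to the first four.\<close>

locale function_space =
  fixes X :: "('x, 'k::field) kspace"
  assumes regular_openin: "regular X U f \<Longrightarrow> openin (ktop X) U"
    and regular_local: "openin (ktop X) U \<Longrightarrow>
      (\<And>x. x \<in> U \<Longrightarrow> \<exists>W g. openin (ktop X) W \<and> x \<in> W \<and> regular X W g \<and> (\<forall>y\<in>W \<inter> U. f y = g y)) \<Longrightarrow>
      regular X U f"
    and regular_const: "openin (ktop X) U \<Longrightarrow> regular X U (\<lambda>_. c)"
    and regular_add: "regular X U f \<Longrightarrow> regular X U g \<Longrightarrow> regular X U (\<lambda>x. f x + g x)"
    and regular_mult: "regular X U f \<Longrightarrow> regular X U g \<Longrightarrow> regular X U (\<lambda>x. f x * g x)"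
    and openin_nonzero: "regular X U f \<Longrightarrow> openin (ktop X) {x \<in> U. f x \<noteq> 0}"
    and regular_inverse_nonzero:
      "regular X U f \<Longrightarrow> regular X {x \<in> U. f x \<noteq> 0} (\<lambda>x. inverse (f x))"
begin

lemma regular_subset:
  assumes "regular X W g" "openin (ktop X) U" "U \<subseteq> W" "\<And>y. y \<in> U \<Longrightarrow> f y = g y"
  shows "regular X U f"
proof (rule regular_local[OF assms(2)])
  fix x assume "x \<in> U"
  then show "\<exists>W g. openin (ktop X) W \<and> x \<in> W \<and> regular X W g \<and> (\<forall>y\<in>W \<inter> U. f y = g y)"
    using assms regular_openin[OF assms(1)] by (intro exI[of _ W] exI[of _ g]) auto
qed

lemma regular_cong:
  assumes "regular X U g" "\<And>y. y \<in> U \<Longrightarrow> f y = g y"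
  shows "regular X U f"
  by (rule regular_subset[OF assms(1) regular_openin[OF assms(1)] order.refl assms(2)])

lemma regular_inverse:
  assumes "regular X U f" "\<And>x. x \<in> U \<Longrightarrow> f x \<noteq> 0"
  shows "regular X U (\<lambda>x. inverse (f x))"
proof -
  have "{x \<in> U. f x \<noteq> 0} = U" using assms(2) by auto
  then show ?thesis using regular_inverse_nonzero[OF assms(1)] by simp
qed

lemma regular_divide:
  assumes "regular X U f" "regular X U g" "\<And>x. x \<in> U \<Longrightarrow> g x \<noteq> 0"
  shows "regular X U (\<lambda>x. f x / g x)"
  using regular_mult[OF assms(1) regular_inverse[OF assms(2,3)]] by (simp add: divide_inverse)

lemma regular_power: "regular X U f \<Longrightarrow> regular X U (\<lambda>x. f x ^ n)"
  by (induction n) (auto intro: regular_mult regular_const regular_openin)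

lemma regular_powi:
  assumes "regular X U f" "\<And>x. x \<in> U \<Longrightarrow> f x \<noteq> 0"
  shows "regular X U (\<lambda>x. f x powi m)"
  using regular_power[OF assms(1)] regular_power[OF regular_inverse[OF assms]]
  by (cases "m \<ge> 0") (auto simp: power_int_def)

lemma regular_prod:
  assumes "finite A" "openin (ktop X) U" "\<And>i. i \<in> A \<Longrightarrow> regular X U (f i)"
  shows "regular X U (\<lambda>x. \<Prod>i\<in>A. f i x)"
  using assms by (induction A) (auto intro: regular_mult regular_const)

lemma regular_polyfun:
  assumes "polyfun P" "\<And>i. regular X U (\<lambda>x. \<kappa> x i)" "openin (ktop X) U"
  shows "regular X U (\<lambda>x. P (\<kappa> x))"
  using assms by induction (auto intro: regular_mult regular_const regular_add)

end

section \<open>Polynomial functions and the Zariski topology of affine space\<close>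

lemma polyfun_compose:
  assumes "polyfun f" "\<And>j. polyfun (\<lambda>v. \<gamma> v j)"
  shows "polyfun (\<lambda>v. f (\<gamma> v))"
  using assms by induction (auto intro: polyfun.intros)

lemma polyfun_uminus: "polyfun f \<Longrightarrow> polyfun (\<lambda>v. - f v)"
  using polyfun.mult[OF polyfun.const[of "- 1"], of f] by simp

lemma polyfun_diff: "polyfun f \<Longrightarrow> polyfun g \<Longrightarrow> polyfun (\<lambda>v. f v - g v)"
  using polyfun.add[OF _ polyfun_uminus, of f g] by simp

lemma polyfun_sum: "(\<And>i. i \<in> A \<Longrightarrow> polyfun (f i)) \<Longrightarrow> polyfun (\<lambda>v. \<Sum>i\<in>A. f i v)"
  by (induction A rule: infinite_finite_induct) (auto intro: polyfun.intros)

lemma polyfun_prod: "(\<And>i. i \<in> A \<Longrightarrow> polyfun (f i)) \<Longrightarrow> polyfun (\<lambda>v. \<Prod>i\<in>A. f i v)"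
  by (induction A rule: infinite_finite_induct) (auto intro: polyfun.intros)

lemma polyfun_power: "polyfun f \<Longrightarrow> polyfun (\<lambda>v. f v ^ n)"
  by (induction n) (auto intro: polyfun.intros)

lemmas polyfun_intros = polyfun.intros polyfun_uminus polyfun_diff polyfun_sum polyfun_prod polyfun_power

text \<open>Principal open sets are closed under intersection, since a product is nonzero exactly
  where both factors are. So the generating family is already a basis.\<close>

lemma openin_zariski:
  "openin zariski U \<longleftrightarrow> (\<forall>x\<in>U. \<exists>f. polyfun f \<and> f x \<noteq> 0 \<and> {v. f v \<noteq> 0} \<subseteq> U)"
proof
  assume "openin zariski U"
  then have "generate_topology_on {{v. f v \<noteq> 0} | f. polyfun f} U"
    unfolding zariski_def by (simp add: openin_topology_generated_by_iff)
  then show "\<forall>x\<in>U. \<exists>f. polyfun f \<and> f x \<noteq> 0 \<and> {v. f v \<noteq> 0} \<subseteq> U"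
  proof induction
    case (Int a b)
    show ?case
    proof
      fix x assume "x \<in> a \<inter> b"
      then obtain f g where "polyfun f" "f x \<noteq> 0" "{v. f v \<noteq> 0} \<subseteq> a"
        "polyfun g" "g x \<noteq> 0" "{v. g v \<noteq> 0} \<subseteq> b"
        using Int.IH by (metis IntE)
      then show "\<exists>f. polyfun f \<and> f x \<noteq> 0 \<and> {v. f v \<noteq> 0} \<subseteq> a \<inter> b"
        by (intro exI[of _ "\<lambda>v. f v * g v"]) (auto intro: polyfun.mult)
    qed
  next
    case (UN K)
    show ?case
    proof
      fix x assume "x \<in> \<Union> K"
      then obtain k where k: "k \<in> K" "x \<in> k" by blast
      then obtain f where "polyfun f" "f x \<noteq> 0" "{v. f v \<noteq> 0} \<subseteq> k" using UN.IH by metis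
      then show "\<exists>f. polyfun f \<and> f x \<noteq> 0 \<and> {v. f v \<noteq> 0} \<subseteq> \<Union> K" using k(1) by blast
    qed
  qed auto
next
  assume *: "\<forall>x\<in>U. \<exists>f. polyfun f \<and> f x \<noteq> 0 \<and> {v. f v \<noteq> 0} \<subseteq> U"
  have "openin zariski {v. f v \<noteq> 0}" if "polyfun f" for f :: "('a \<Rightarrow> 'b) \<Rightarrow> 'b"
    unfolding zariski_def openin_topology_generated_by_iff
    using that by (intro generate_topology_on.Basis) auto
  then have op: "openin zariski {v. f v \<noteq> 0}" if "polyfun f" for f :: "('a \<Rightarrow> 'b) \<Rightarrow> 'b"
    using that by simp
  show "openin zariski U"
  proof (subst openin_subopen, intro ballI)
    fix x assume "x \<in> U"
    then obtain f where "polyfun f" "f x \<noteq> 0" "{v. f v \<noteq> 0} \<subseteq> U" using * by metis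
    then show "\<exists>T. openin zariski T \<and> x \<in> T \<and> T \<subseteq> U" by (intro exI[of _ "{v. f v \<noteq> 0}"]) (auto intro: op)
  qed
qed

lemma topspace_zariski [simp]: "topspace zariski = UNIV"
proof -
  have "openin zariski (UNIV :: ('a \<Rightarrow> 'b) set)"
    unfolding openin_zariski by (auto intro!: exI[of _ "\<lambda>_. 1"] polyfun.const)
  then show ?thesis by (meson openin_subset top.extremum_uniqueI)
qed

lemma openin_zariski_nonzero: "polyfun f \<Longrightarrow> openin zariski {v. f v \<noteq> 0}"
  unfolding openin_zariski by blast

lemma ktop_affine_sp [simp]: "ktop affine_sp = zariski"
  by (simp add: affine_sp_def)

text \<open>Shrinking to a principal open set \<open>d \<noteq> 0\<close> is absorbed in the
  fraction by multiplying numerator and denominator by \<open>d\<close>. The neighbourhood is then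
  just the set where the denominator does not vanish.\<close>

lemma regular_affine_sp:
  fixes U :: "('i::finite \<Rightarrow> 'k::field) set"
  shows "regular affine_sp U f \<longleftrightarrow>
     (\<forall>x\<in>U. \<exists>g h. polyfun g \<and> polyfun h \<and> h x \<noteq> 0 \<and> {y. h y \<noteq> 0} \<subseteq> U \<and>
        (\<forall>y. h y \<noteq> 0 \<longrightarrow> f y = g y / h y))"
proof
  assume *: "regular affine_sp U f"
  show "\<forall>x\<in>U. \<exists>g h. polyfun g \<and> polyfun h \<and> h x \<noteq> 0 \<and> {y. h y \<noteq> 0} \<subseteq> U \<and>
        (\<forall>y. h y \<noteq> 0 \<longrightarrow> f y = g y / h y)"
  proof
    fix x assume "x \<in> U"
    with * obtain V g h where V: "openin zariski V" "x \<in> V" "V \<subseteq> U" "polyfun g" "polyfun h"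
      "\<And>y. y \<in> V \<Longrightarrow> h y \<noteq> 0 \<and> f y = g y / h y"
      unfolding affine_sp_def by auto
    then obtain d where d: "polyfun d" "d x \<noteq> 0" "{y. d y \<noteq> 0} \<subseteq> V"
      unfolding openin_zariski by blast
    show "\<exists>g h. polyfun g \<and> polyfun h \<and> h x \<noteq> 0 \<and> {y. h y \<noteq> 0} \<subseteq> U \<and>
        (\<forall>y. h y \<noteq> 0 \<longrightarrow> f y = g y / h y)"
      using V d by (intro exI[of _ "\<lambda>y. g y * d y"] exI[of _ "\<lambda>y. h y * d y"])
        (auto intro!: polyfun.mult)
  qed
next
  assume *: "\<forall>x\<in>U. \<exists>g h. polyfun g \<and> polyfun h \<and> h x \<noteq> 0 \<and> {y. h y \<noteq> 0} \<subseteq> U \<and>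
        (\<forall>y. h y \<noteq> 0 \<longrightarrow> f y = g y / h y)"
  then have "openin zariski U" unfolding openin_zariski by meson
  moreover have "\<exists>V g h. openin zariski V \<and> x \<in> V \<and> V \<subseteq> U \<and> polyfun g \<and> polyfun h \<and>
           (\<forall>y\<in>V. h y \<noteq> 0 \<and> f y = g y / h y)" if that': "x \<in> U" for x
  proof -
    obtain g h where "polyfun g" "polyfun h" "h x \<noteq> 0" "{y. h y \<noteq> 0} \<subseteq> U"
        "\<forall>y. h y \<noteq> 0 \<longrightarrow> f y = g y / h y" using *[rule_format, OF that'] by metis
    then show ?thesis
      by (intro exI[of _ "{y. h y \<noteq> 0}"] exI[of _ g] exI[of _ h]) (auto simp: openin_zariski_nonzero)
  qed
  ultimately show "regular affine_sp U f" by (simp add: affine_sp_def)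
qed

lemma regular_affine_spE:
  fixes U :: "('i::finite \<Rightarrow> 'k::field) set"
  assumes "regular affine_sp U f" "x \<in> U"
  obtains g h where "polyfun g" "polyfun h" "h x \<noteq> 0" "{y. h y \<noteq> 0} \<subseteq> U"
    "\<And>y. h y \<noteq> 0 \<Longrightarrow> f y = g y / h y"
proof -
  from bspec[OF assms(1)[unfolded regular_affine_sp] assms(2)] show ?thesis
    by (elim exE conjE) (rule that, assumption+, simp)
qed

lemma function_space_affine_sp:
  "function_space (affine_sp :: ('i::finite \<Rightarrow> 'k::field, 'k) kspace)"
proof
  fix U and f :: "('i \<Rightarrow> 'k) \<Rightarrow> 'k" assume *: "regular affine_sp U f"
  then show U: "openin (ktop affine_sp) U" by (simp add: affine_sp_def)
  let ?N = "{x \<in> U. f x \<noteq> 0}"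
  have "\<exists>g h. polyfun g \<and> polyfun h \<and> h x \<noteq> 0 \<and> {y. h y \<noteq> 0} \<subseteq> ?N \<and>
        (\<forall>y. h y \<noteq> 0 \<longrightarrow> inverse (f y) = g y / h y)" if that': "x \<in> ?N" for x
  proof -
    obtain g h where "polyfun g" "polyfun h" "h x \<noteq> 0" "{y. h y \<noteq> 0} \<subseteq> U"
        "\<And>y. h y \<noteq> 0 \<Longrightarrow> f y = g y / h y" using regular_affine_spE[OF *, of x] that' unfolding mem_Collect_eq by metis
    \<comment> \<open>The inverse of \<open>g / h\<close> is written as
      \<open>h * h / (g * h)\<close>: the extra \<open>h\<close> keeps the principal open set inside
      the set where \<open>f = g / h\<close>.\<close>
    then show ?thesis using that
      by (intro exI[of _ "\<lambda>y. h y * h y"] exI[of _ "\<lambda>y. g y * h y"]) (auto intro!: polyfun.mult)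
  qed
  then show "regular affine_sp ?N (\<lambda>x. inverse (f x))"
    unfolding regular_affine_sp by (intro ballI)
  then show "openin (ktop affine_sp) ?N" by (simp add: affine_sp_def)
next
  fix U and f :: "('i \<Rightarrow> 'k) \<Rightarrow> 'k"
  assume U: "openin (ktop affine_sp) U" and
    *: "\<And>x. x \<in> U \<Longrightarrow> \<exists>W g. openin (ktop affine_sp) W \<and> x \<in> W \<and> regular affine_sp W g \<and>
          (\<forall>y\<in>W \<inter> U. f y = g y)"
  show "regular affine_sp U f"
    unfolding regular_affine_sp
  proof
    fix x assume x: "x \<in> U"
    obtain W g where W: "x \<in> W" "regular affine_sp W g" "\<And>y. y \<in> W \<inter> U \<Longrightarrow> f y = g y"
      using *[OF x] by blast
    obtain a b where ab: "polyfun a" "polyfun b" "b x \<noteq> 0" "{y. b y \<noteq> 0} \<subseteq> W"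
        "\<And>y. b y \<noteq> 0 \<Longrightarrow> g y = a y / b y" using regular_affine_spE[OF W(2,1)] by metis
    obtain d where d: "polyfun d" "d x \<noteq> 0" "{y. d y \<noteq> 0} \<subseteq> U"
      using bspec[OF U[unfolded ktop_affine_sp openin_zariski] x] by blast
    have "f y = a y * d y / (b y * d y)" if "b y * d y \<noteq> 0" for y
    proof -
      have "y \<in> W" "y \<in> U" using that ab(4) d(3) by auto
      then show ?thesis using W(3)[of y] ab(5)[of y] that by simp
    qed
    then show "\<exists>g h. polyfun g \<and> polyfun h \<and> h x \<noteq> 0 \<and> {y. h y \<noteq> 0} \<subseteq> U \<and>
        (\<forall>y. h y \<noteq> 0 \<longrightarrow> f y = g y / h y)"
      using ab d
      by (intro exI[of _ "\<lambda>y. a y * d y"] exI[of _ "\<lambda>y. b y * d y"]) (auto intro!: polyfun.mult)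
  qed
next
  fix U and c :: 'k assume U: "openin (ktop (affine_sp :: ('i \<Rightarrow> 'k, 'k) kspace)) U"
  show "regular affine_sp U (\<lambda>_. c)"
    unfolding regular_affine_sp
  proof
    fix x assume "x \<in> U"
    then obtain d where "polyfun d" "d x \<noteq> 0" "{y. d y \<noteq> 0} \<subseteq> U"
      using U unfolding ktop_affine_sp openin_zariski by blast
    then show "\<exists>g h. polyfun g \<and> polyfun h \<and> h x \<noteq> 0 \<and> {y. h y \<noteq> 0} \<subseteq> U \<and>
        (\<forall>y. h y \<noteq> 0 \<longrightarrow> c = g y / h y)"
      by (intro exI[of _ "\<lambda>y. c * d y"] exI[of _ d]) (auto intro!: polyfun.intros)
  qed
next
  fix U and f g :: "('i \<Rightarrow> 'k) \<Rightarrow> 'k"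
  assume *: "regular affine_sp U f" "regular affine_sp U g"
  have "\<exists>p q d. polyfun p \<and> polyfun q \<and> polyfun d \<and> d x \<noteq> 0 \<and> {y. d y \<noteq> 0} \<subseteq> U \<and>
        (\<forall>y. d y \<noteq> 0 \<longrightarrow> f y = p y / d y \<and> g y = q y / d y)" if x: "x \<in> U" for x
  proof -
    obtain a b where ab: "polyfun a" "polyfun b" "b x \<noteq> 0" "{y. b y \<noteq> 0} \<subseteq> U"
        "\<And>y. b y \<noteq> 0 \<Longrightarrow> f y = a y / b y" using regular_affine_spE[OF *(1) x] by metis
    obtain a' b' where ab': "polyfun a'" "polyfun b'" "b' x \<noteq> 0" "{y. b' y \<noteq> 0} \<subseteq> U"
        "\<And>y. b' y \<noteq> 0 \<Longrightarrow> g y = a' y / b' y" using regular_affine_spE[OF *(2) x] by metis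
    show ?thesis using ab ab'
      by (intro exI[of _ "\<lambda>y. a y * b' y"] exI[of _ "\<lambda>y. b y * a' y"] exI[of _ "\<lambda>y. b y * b' y"])
         (auto intro!: polyfun.mult)
  qed note common = this
  show "regular affine_sp U (\<lambda>x. f x + g x)"
    unfolding regular_affine_sp
  proof
    fix x assume "x \<in> U"
    from common[OF this] obtain p q d where "polyfun p" "polyfun q" "polyfun d" "d x \<noteq> 0"
      "{y. d y \<noteq> 0} \<subseteq> U" "\<And>y. d y \<noteq> 0 \<Longrightarrow> f y = p y / d y \<and> g y = q y / d y" by metis
    then show "\<exists>a h. polyfun a \<and> polyfun h \<and> h x \<noteq> 0 \<and> {y. h y \<noteq> 0} \<subseteq> U \<and>
        (\<forall>y. h y \<noteq> 0 \<longrightarrow> f y + g y = a y / h y)"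
      by (intro exI[of _ "\<lambda>y. p y + q y"] exI[of _ d])
         (auto intro!: polyfun.add simp: add_divide_distrib)
  qed
  show "regular affine_sp U (\<lambda>x. f x * g x)"
    unfolding regular_affine_sp
  proof
    fix x assume "x \<in> U"
    from common[OF this] obtain p q d where "polyfun p" "polyfun q" "polyfun d" "d x \<noteq> 0"
      "{y. d y \<noteq> 0} \<subseteq> U" "\<And>y. d y \<noteq> 0 \<Longrightarrow> f y = p y / d y \<and> g y = q y / d y" by metis
    then show "\<exists>a h. polyfun a \<and> polyfun h \<and> h x \<noteq> 0 \<and> {y. h y \<noteq> 0} \<subseteq> U \<and>
        (\<forall>y. h y \<noteq> 0 \<longrightarrow> f y * g y = a y / h y)"
      by (intro exI[of _ "\<lambda>y. p y * q y"] exI[of _ "\<lambda>y. d y * d y"])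
         (auto intro!: polyfun.mult)
  qed
qed

section \<open>Induced structures on subsets and coinduced structures on quotients\<close>

lemma ktop_subsp [simp]: "ktop (subsp X Y) = subtopology (ktop X) Y"
  by (simp add: subsp_def)

lemma regular_subsp:
  "regular (subsp X Y) U f \<longleftrightarrow> openin (subtopology (ktop X) Y) U \<and>
     (\<forall>x\<in>U. \<exists>W g. openin (ktop X) W \<and> x \<in> W \<and> regular X W g \<and> (\<forall>y\<in>W \<inter> U. f y = g y))"
  by (simp add: subsp_def)

context function_space
begin

lemma common_nbhd:
  assumes "regular (subsp X Y) U f" "regular (subsp X Y) U g" "x \<in> U"
  obtains W f' g' where "openin (ktop X) W" "x \<in> W" "regular X W f'" "regular X W g'"
    "\<And>y. y \<in> W \<inter> U \<Longrightarrow> f y = f' y \<and> g y = g' y"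
proof -
  obtain W1 f' where 1: "openin (ktop X) W1" "x \<in> W1" "regular X W1 f'" "\<forall>y\<in>W1 \<inter> U. f y = f' y"
    using assms(1,3) unfolding regular_subsp by blast
  obtain W2 g' where 2: "openin (ktop X) W2" "x \<in> W2" "regular X W2 g'" "\<forall>y\<in>W2 \<inter> U. g y = g' y"
    using assms(2,3) unfolding regular_subsp by blast
  show ?thesis
    by (rule that[of "W1 \<inter> W2" f' g']) (use 1 2 in \<open>auto intro: regular_subset\<close>)
qed

lemma function_space_subsp: "function_space (subsp X Y)"
proof
  fix U f assume *: "regular (subsp X Y) U f"
  then show U: "openin (ktop (subsp X Y)) U" by (simp add: regular_subsp)
  let ?N = "{x \<in> U. f x \<noteq> 0}"
  have loc: "\<exists>W g. openin (ktop X) W \<and> x \<in> W \<and> regular X W g \<and> W \<inter> U \<subseteq> ?N \<and>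
      (\<forall>y\<in>W \<inter> U. inverse (f y) = g y)" if that': "x \<in> ?N" for x
  proof -
    obtain W g where W: "openin (ktop X) W" "x \<in> W" "regular X W g" "\<forall>y\<in>W \<inter> U. f y = g y"
      using * that' unfolding regular_subsp by blast
    moreover have "x \<in> {x \<in> W. g x \<noteq> 0}" using W that by auto
    moreover have "{x \<in> W. g x \<noteq> 0} \<inter> U \<subseteq> ?N" using W(4) by auto
    moreover have "\<forall>y\<in>{x \<in> W. g x \<noteq> 0} \<inter> U. inverse (f y) = inverse (g y)" using W(4) by auto
    ultimately show ?thesis using openin_nonzero[OF W(3)] regular_inverse_nonzero[OF W(3)] by blast
  qed
  have "\<exists>T. openin (ktop (subsp X Y)) T \<and> x \<in> T \<and> T \<subseteq> ?N" if that': "x \<in> ?N" for x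
  proof -
    obtain W where "openin (ktop X) W" "x \<in> W" "W \<inter> U \<subseteq> ?N" using loc[OF that'] by blast
    then show ?thesis using U that
      by (intro exI[of _ "W \<inter> U"]) (auto simp: openin_subtopology)
  qed
  then show N: "openin (ktop (subsp X Y)) ?N" by (subst openin_subopen) blast
  show "regular (subsp X Y) ?N (\<lambda>x. inverse (f x))"
    unfolding regular_subsp using N loc by fastforce
next
  fix U f assume U: "openin (ktop (subsp X Y)) U" and
    *: "\<And>x. x \<in> U \<Longrightarrow> \<exists>W g. openin (ktop (subsp X Y)) W \<and> x \<in> W \<and> regular (subsp X Y) W g \<and>
          (\<forall>y\<in>W \<inter> U. f y = g y)"
  have "\<exists>W g. openin (ktop X) W \<and> x \<in> W \<and> regular X W g \<and> (\<forall>y\<in>W \<inter> U. f y = g y)"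
    if x: "x \<in> U" for x
  proof -
    obtain W g where W: "openin (ktop (subsp X Y)) W" "x \<in> W" "regular (subsp X Y) W g"
      "\<forall>y\<in>W \<inter> U. f y = g y" using *[OF x] by blast
    obtain W' g' where W': "openin (ktop X) W'" "x \<in> W'" "regular X W' g'" "\<forall>y\<in>W' \<inter> W. g y = g' y"
      using W(2,3) unfolding regular_subsp by blast
    obtain T where T: "openin (ktop X) T" "W = T \<inter> Y" using W(1) by (auto simp: openin_subtopology)
    have "U \<subseteq> Y" using U by (auto simp: openin_subtopology)
    then show ?thesis using W W' T
      by (intro exI[of _ "W' \<inter> T"] exI[of _ g']) (auto intro: regular_subset)
  qed
  then show "regular (subsp X Y) U f" using U by (simp add: regular_subsp)
next
  fix U c assume U: "openin (ktop (subsp X Y)) U"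
  then obtain T where "openin (ktop X) T" "U = T \<inter> Y" by (auto simp: openin_subtopology)
  with U show "regular (subsp X Y) U (\<lambda>_. c)"
    unfolding regular_subsp by (auto intro!: exI[of _ T] exI[of _ "\<lambda>_. c"] regular_const)
next
  fix U f g assume *: "regular (subsp X Y) U f" "regular (subsp X Y) U g"
  then have U: "openin (subtopology (ktop X) Y) U" by (simp add: regular_subsp)
  show "regular (subsp X Y) U (\<lambda>x. f x + g x)"
    unfolding regular_subsp
  proof (intro conjI U ballI)
    fix x assume "x \<in> U"
    from common_nbhd[OF * this] obtain W f' g' where "openin (ktop X) W" "x \<in> W" "regular X W f'"
      "regular X W g'" "\<And>y. y \<in> W \<inter> U \<Longrightarrow> f y = f' y \<and> g y = g' y" by metis
    then show "\<exists>W h. openin (ktop X) W \<and> x \<in> W \<and> regular X W h \<and> (\<forall>y\<in>W \<inter> U. f y + g y = h y)"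
      by (intro exI[of _ W] exI[of _ "\<lambda>y. f' y + g' y"]) (auto intro: regular_add)
  qed
  show "regular (subsp X Y) U (\<lambda>x. f x * g x)"
    unfolding regular_subsp
  proof (intro conjI U ballI)
    fix x assume "x \<in> U"
    from common_nbhd[OF * this] obtain W f' g' where "openin (ktop X) W" "x \<in> W" "regular X W f'"
      "regular X W g'" "\<And>y. y \<in> W \<inter> U \<Longrightarrow> f y = f' y \<and> g y = g' y" by metis
    then show "\<exists>W h. openin (ktop X) W \<and> x \<in> W \<and> regular X W h \<and> (\<forall>y\<in>W \<inter> U. f y * g y = h y)"
      by (intro exI[of _ W] exI[of _ "\<lambda>y. f' y * g' y"]) (auto intro: regular_mult)
  qed
qed

lemma regular_subspI:
  assumes "regular X W f" "openin (subtopology (ktop X) Y) U" "U \<subseteq> W"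
  shows "regular (subsp X Y) U f"
  unfolding regular_subsp using assms regular_openin by blast

lemma regular_subsp_open:
  assumes "openin (ktop X) Y"
  shows "regular (subsp X Y) U f \<longleftrightarrow> U \<subseteq> Y \<and> regular X U f"
proof
  assume *: "regular (subsp X Y) U f"
  then have "openin (ktop X) U" "U \<subseteq> Y"
    using assms by (auto simp: regular_subsp openin_open_subtopology)
  then show "U \<subseteq> Y \<and> regular X U f"
    using * by (auto simp: regular_subsp intro: regular_local)
next
  assume "U \<subseteq> Y \<and> regular X U f"
  then show "regular (subsp X Y) U f"
    using assms regular_openin by (auto simp: openin_open_subtopology intro: regular_subspI)
qed

end

lemma ktop_quotsp [simp]: "ktop (quotsp X q) = quot_topology (ktop X) q"
  by (simp add: quotsp_def)

lemma regular_quotsp: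
  "regular (quotsp X q) U f \<longleftrightarrow> openin (quot_topology (ktop X) q) U \<and>
        regular X {x \<in> topspace (ktop X). q x \<in> U} (f \<circ> q)"
  by (simp add: quotsp_def)

lemma topspace_quot_topology [simp]: "topspace (quot_topology T q) = q ` topspace T"
proof -
  have "openin (quot_topology T q) (q ` topspace T)"
  proof -
    have "{x \<in> topspace T. q x \<in> q ` topspace T} = topspace T" by auto
    then show ?thesis by (simp add: openin_quot_topology)
  qed
  moreover have "topspace (quot_topology T q) \<subseteq> q ` topspace T"
    using openin_topspace[of "quot_topology T q"] unfolding openin_quot_topology by simp
  ultimately show ?thesis using openin_subset by blast
qed

context function_space
begin

lemma function_space_quotsp: "function_space (quotsp X q)"
proof
  fix U f assume *: "regular (quotsp X q) U f"
  let ?P = "{x \<in> topspace (ktop X). q x \<in> U}"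
  have "{x \<in> topspace (ktop X). q x \<in> {y \<in> U. f y \<noteq> 0}} = {x \<in> ?P. (f \<circ> q) x \<noteq> 0}" by auto
  then show "openin (ktop (quotsp X q)) U" "openin (ktop (quotsp X q)) {x \<in> U. f x \<noteq> 0}"
    "regular (quotsp X q) {x \<in> U. f x \<noteq> 0} (\<lambda>x. inverse (f x))"
    using * openin_nonzero[of ?P "f \<circ> q"] regular_inverse_nonzero[of ?P "f \<circ> q"]
    by (auto simp: regular_quotsp openin_quot_topology comp_def)
next
  fix U f assume U: "openin (ktop (quotsp X q)) U" and
    *: "\<And>x. x \<in> U \<Longrightarrow> \<exists>W g. openin (ktop (quotsp X q)) W \<and> x \<in> W \<and> regular (quotsp X q) W g \<and>
          (\<forall>y\<in>W \<inter> U. f y = g y)"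
  have "regular X {x \<in> topspace (ktop X). q x \<in> U} (f \<circ> q)"
  proof (rule regular_local)
    show "openin (ktop X) {x \<in> topspace (ktop X). q x \<in> U}"
      using U by (simp add: openin_quot_topology)
    fix x assume x: "x \<in> {x \<in> topspace (ktop X). q x \<in> U}"
    then obtain W g where "openin (ktop (quotsp X q)) W" "q x \<in> W" "regular (quotsp X q) W g"
      "\<forall>y\<in>W \<inter> U. f y = g y" using *[of "q x"] by blast
    then show "\<exists>W g. openin (ktop X) W \<and> x \<in> W \<and> regular X W g \<and>
        (\<forall>y\<in>W \<inter> {x \<in> topspace (ktop X). q x \<in> U}. (f \<circ> q) y = g y)"
      using x by (intro exI[of _ "{x \<in> topspace (ktop X). q x \<in> W}"] exI[of _ "g \<circ> q"])
        (auto simp: regular_quotsp openin_quot_topology)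
  qed
  then show "regular (quotsp X q) U f" using U by (simp add: regular_quotsp)
next
  fix U c assume "openin (ktop (quotsp X q)) U"
  then show "regular (quotsp X q) U (\<lambda>_. c)"
    by (auto simp: regular_quotsp openin_quot_topology comp_def intro: regular_const)
next
  fix U f g assume *: "regular (quotsp X q) U f" "regular (quotsp X q) U g"
  then show "regular (quotsp X q) U (\<lambda>x. f x + g x)"
    by (auto simp: regular_quotsp comp_def intro: regular_add)
  show "regular (quotsp X q) U (\<lambda>x. f x * g x)"
    using * by (auto simp: regular_quotsp comp_def intro: regular_mult)
qed

end

section \<open>Morphisms into and out of subspaces and quotients\<close>

lemma morphism_compose:
  assumes f: "morphism X Y f" and g: "morphism Y Z g"
  shows "morphism X Z (\<lambda>x. g (f x))"
  unfolding morphism_def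
proof (intro conjI allI impI)
  show "continuous_map (ktop X) (ktop Z) (\<lambda>x. g (f x))"
    using assms continuous_map_compose[of "ktop X" "ktop Y" f "ktop Z" g] unfolding morphism_def comp_def by simp
  fix U h assume *: "openin (ktop Z) U \<and> regular Z U h"
  let ?V = "{y \<in> topspace (ktop Y). g y \<in> U}"
  have "openin (ktop Y) ?V"
    using g * openin_continuous_map_preimage unfolding morphism_def by blast
  moreover have "regular Y ?V (h \<circ> g)" using g * unfolding morphism_def by blast
  ultimately have "regular X {x \<in> topspace (ktop X). f x \<in> ?V} (h \<circ> g \<circ> f)"
    using f unfolding morphism_def by blast
  moreover have "{x \<in> topspace (ktop X). f x \<in> ?V} = {x \<in> topspace (ktop X). g (f x) \<in> U}"
    using f unfolding morphism_def continuous_map_def by blast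
  ultimately show "regular X {x \<in> topspace (ktop X). g (f x) \<in> U} (h \<circ> (\<lambda>x. g (f x)))"
    by (simp add: comp_def)
qed

lemma morphism_openin_preimage:
  assumes "morphism X Y f" "openin (ktop Y) U"
  shows "openin (ktop X) {x \<in> topspace (ktop X). f x \<in> U}"
  using assms openin_continuous_map_preimage unfolding morphism_def by blast

lemma morphism_regular_preimage:
  assumes "morphism X Y f" "openin (ktop Y) U" "regular Y U h"
  shows "regular X {x \<in> topspace (ktop X). f x \<in> U} (h \<circ> f)"
  using assms unfolding morphism_def by blast

lemma morphism_topspace:
  "morphism X Y f \<Longrightarrow> x \<in> topspace (ktop X) \<Longrightarrow> f x \<in> topspace (ktop Y)"
  unfolding morphism_def continuous_map_def by blast

lemma morphism_cong:
  assumes "function_space X" "morphism X Y f" "\<And>x. x \<in> topspace (ktop X) \<Longrightarrow> f x = g x"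
  shows "morphism X Y g"
proof -
  interpret function_space X by fact
  have eq: "{x \<in> topspace (ktop X). g x \<in> U} = {x \<in> topspace (ktop X). f x \<in> U}" for U
    using assms(3) by auto
  show ?thesis
    unfolding morphism_def
  proof (intro conjI allI impI)
    show "continuous_map (ktop X) (ktop Y) g"
      using assms(2,3) continuous_map_eq unfolding morphism_def by blast
    fix U h assume "openin (ktop Y) U \<and> regular Y U h"
    then have "regular X {x \<in> topspace (ktop X). f x \<in> U} (h \<circ> f)"
      using assms(2) unfolding morphism_def by blast
    then show "regular X {x \<in> topspace (ktop X). g x \<in> U} (h \<circ> g)"
      unfolding eq by (rule regular_cong) (use assms(3) in auto)
  qed
qed

lemma (in function_space) morphism_into_subsp:
  assumes f: "morphism X Y f" and S: "\<And>x. x \<in> topspace (ktop X) \<Longrightarrow> f x \<in> S"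
  shows "morphism X (subsp Y S) f"
  unfolding morphism_def
proof (intro conjI allI impI)
  show "continuous_map (ktop X) (ktop (subsp Y S)) f"
    using assms unfolding morphism_def by (auto simp: continuous_map_in_subtopology)
  fix U h assume *: "openin (ktop (subsp Y S)) U \<and> regular (subsp Y S) U h"
  then obtain T where T: "openin (ktop Y) T" "U = T \<inter> S" by (auto simp: openin_subtopology)
  have eq: "{x \<in> topspace (ktop X). f x \<in> U} = {x \<in> topspace (ktop X). f x \<in> T}"
    using S T by auto
  show "regular X {x \<in> topspace (ktop X). f x \<in> U} (h \<circ> f)"
  proof (rule regular_local)
    show "openin (ktop X) {x \<in> topspace (ktop X). f x \<in> U}"
      unfolding eq using f T(1) by (rule morphism_openin_preimage)
    fix x assume x: "x \<in> {x \<in> topspace (ktop X). f x \<in> U}"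
    then obtain W g where "openin (ktop Y) W" "f x \<in> W" "regular Y W g" "\<forall>y\<in>W \<inter> U. h y = g y"
      using * unfolding regular_subsp by blast
    then show "\<exists>W g. openin (ktop X) W \<and> x \<in> W \<and> regular X W g \<and>
       (\<forall>y\<in>W \<inter> {x \<in> topspace (ktop X). f x \<in> U}. (h \<circ> f) y = g y)"
      using x f by (intro exI[of _ "{x \<in> topspace (ktop X). f x \<in> W}"] exI[of _ "g \<circ> f"])
        (auto intro: morphism_openin_preimage morphism_regular_preimage)
  qed
qed

lemma (in function_space) morphism_from_subsp:
  assumes f: "morphism X Y f"
  shows "morphism (subsp X S) Y f"
  unfolding morphism_def
proof (intro conjI allI impI)
  show "continuous_map (ktop (subsp X S)) (ktop Y) f"
    using assms unfolding morphism_def by (simp add: continuous_map_from_subtopology)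
  fix U h assume "openin (ktop Y) U \<and> regular Y U h"
  then have "openin (ktop X) {x \<in> topspace (ktop X). f x \<in> U}"
     "regular X {x \<in> topspace (ktop X). f x \<in> U} (h \<circ> f)"
    using f by (auto intro: morphism_openin_preimage morphism_regular_preimage)
  then show "regular (subsp X S) {x \<in> topspace (ktop (subsp X S)). f x \<in> U} (h \<circ> f)"
    by (intro regular_subspI) (auto simp: openin_subtopology)
qed

text \<open>Compares the structure induced on \<open>Z\<close> in one step with the one induced
  through \<open>G\<close>. It lets a morphism that is only defined on \<open>subsp X G\<close> be
  restricted to \<open>Z\<close>.\<close>

lemma subsp_subsp_open:
  assumes "function_space X" "Z \<subseteq> G"
  shows "morphism (subsp X Z) (subsp (subsp X G) Z) (\<lambda>x. x)"
proof -
  interpret function_space X by fact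
  interpret Z: function_space "subsp X Z" by (rule function_space_subsp)
  have "{x \<in> topspace (ktop X). x \<in> U} = U" if "openin (ktop X) U" for U
    using openin_subset[OF that] by auto
  then have "morphism X X (\<lambda>x. x)"
    unfolding morphism_def comp_def by (simp add: continuous_map_def)
  from morphism_from_subsp[OF this]
  have "morphism (subsp X Z) X (\<lambda>x. x)" .
  then show ?thesis using assms(2) by (intro Z.morphism_into_subsp) auto
qed

lemma morphism_quotsp: "morphism X (quotsp X q) q"
  unfolding morphism_def
  by (auto simp: continuous_map_def openin_quot_topology regular_quotsp Collect_conj_eq)

lemma morphism_from_quotsp:
  assumes "morphism X Y (\<lambda>x. f (q x))"
  shows "morphism (quotsp X q) Y f"
  unfolding morphism_def
proof (intro conjI allI impI)
  have eq: "{x \<in> topspace (ktop X). q x \<in> q ` topspace (ktop X) \<and> f (q x) \<in> U} =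
    {x \<in> topspace (ktop X). f (q x) \<in> U}" for U by auto
  show "continuous_map (ktop (quotsp X q)) (ktop Y) f"
    unfolding continuous_map_def
    using morphism_topspace[OF assms] morphism_openin_preimage[OF assms]
    by (auto simp: openin_quot_topology eq)
  fix U h assume "openin (ktop Y) U \<and> regular Y U h"
  then show "regular (quotsp X q) {x \<in> topspace (ktop (quotsp X q)). f x \<in> U} (h \<circ> f)"
    using morphism_openin_preimage[OF assms] morphism_regular_preimage[OF assms]
    by (auto simp: regular_quotsp openin_quot_topology eq comp_def)
qed

text \<open>The universal property of the quotient over an open set \<open>G\<close>. As
  \<open>G\<close> and its preimage are open, regular functions on these subspaces are regular
  functions of the ambient spaces, so restricting commutes with taking the quotient.\<close>

lemma (in function_space) morphism_from_subsp_quotsp: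
  assumes G: "openin (quot_topology (ktop X) q) G"
    and f: "morphism (subsp X {x \<in> topspace (ktop X). q x \<in> G}) Y (\<lambda>x. f (q x))"
  shows "morphism (subsp (quotsp X q) G) Y f"
proof -
  interpret Q: function_space "quotsp X q" by (rule function_space_quotsp)
  let ?G = "{x \<in> topspace (ktop X). q x \<in> G}"
  have oG: "openin (ktop X) ?G" and GX: "G \<subseteq> q ` topspace (ktop X)"
    using G by (auto simp: openin_quot_topology)
  have top: "topspace (ktop (subsp (quotsp X q) G)) = G" using GX by auto
  have eq: "{x \<in> topspace (ktop X). q x \<in> {y \<in> G. f y \<in> U}} =
    {x \<in> topspace (ktop (subsp X ?G)). f (q x) \<in> U}" for U by auto
  have op: "openin (quot_topology (ktop X) q) {y \<in> G. f y \<in> U}" if "openin (ktop Y) U" for U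
    using morphism_openin_preimage[OF f that] oG GX
    by (auto simp: openin_quot_topology eq openin_open_subtopology)
  show ?thesis
    unfolding morphism_def
  proof (intro conjI allI impI)
    show "continuous_map (ktop (subsp (quotsp X q) G)) (ktop Y) f"
      unfolding continuous_map_def top
      using morphism_topspace[OF f] GX op G
      by (auto simp: openin_open_subtopology)
    fix U h assume *: "openin (ktop Y) U \<and> regular Y U h"
    have "regular X {x \<in> topspace (ktop (subsp X ?G)). f (q x) \<in> U} (h \<circ> (\<lambda>x. f (q x)))"
      using morphism_regular_preimage[OF f] * regular_subsp_open[OF oG] by blast
    then have "regular (quotsp X q) {x \<in> G. f x \<in> U} (h \<circ> f)"
      using op * by (simp add: regular_quotsp eq[symmetric] comp_def)
    then show "regular (subsp (quotsp X q) G)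
        {x \<in> topspace (ktop (subsp (quotsp X q) G)). f x \<in> U} (h \<circ> f)"
      unfolding top using Q.regular_subsp_open G by auto
  qed
qed

lemma (in function_space) morphism_into_affine_sp:
  fixes \<kappa> :: "'x \<Rightarrow> 'j::finite \<Rightarrow> 'k"
  assumes "\<And>j. regular X (topspace (ktop X)) (\<lambda>x. \<kappa> x j)"
  shows "morphism X affine_sp \<kappa>"
  unfolding morphism_def
proof (intro conjI allI impI)
  have poly: "regular X (topspace (ktop X)) (\<lambda>x. P (\<kappa> x))" if "polyfun P" for P
    using regular_polyfun[OF that assms] by simp
  have op: "openin (ktop X) {x \<in> topspace (ktop X). \<kappa> x \<in> U}" if U: "openin zariski U" for U
  proof (subst openin_subopen, intro ballI)
    fix x assume x: "x \<in> {x \<in> topspace (ktop X). \<kappa> x \<in> U}"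
    then obtain d where d: "polyfun d" "d (\<kappa> x) \<noteq> 0" "{v. d v \<noteq> 0} \<subseteq> U"
      using U unfolding openin_zariski by blast
    then show "\<exists>T. openin (ktop X) T \<and> x \<in> T \<and> T \<subseteq> {x \<in> topspace (ktop X). \<kappa> x \<in> U}"
      using openin_nonzero[OF poly[OF d(1)]] x by blast
  qed
  then show "continuous_map (ktop X) (ktop affine_sp) \<kappa>"
    by (simp add: continuous_map_def)
  fix U h assume *: "openin (ktop (affine_sp :: ('j \<Rightarrow> 'k, 'k) kspace)) U \<and> regular affine_sp U h"
  show "regular X {x \<in> topspace (ktop X). \<kappa> x \<in> U} (h \<circ> \<kappa>)"
  proof (rule regular_local)
    show "openin (ktop X) {x \<in> topspace (ktop X). \<kappa> x \<in> U}" using op * by simp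
    fix x assume x: "x \<in> {x \<in> topspace (ktop X). \<kappa> x \<in> U}"
    then have U: "regular affine_sp U h" "\<kappa> x \<in> U" using * by auto
    obtain a b where ab: "polyfun a" "polyfun b" "b (\<kappa> x) \<noteq> 0" "\<And>y. b y \<noteq> 0 \<Longrightarrow> h y = a y / b y"
      using regular_affine_spE[OF U] by metis
    let ?W = "{x \<in> topspace (ktop X). b (\<kappa> x) \<noteq> 0}"
    have W: "openin (ktop X) ?W" using openin_nonzero[OF poly[OF ab(2)]] .
    have "regular X ?W (\<lambda>x. a (\<kappa> x) / b (\<kappa> x))"
      by (rule regular_divide) (use W poly ab in \<open>auto intro: regular_subset\<close>)
    then show "\<exists>W g. openin (ktop X) W \<and> x \<in> W \<and> regular X W g \<and>
        (\<forall>y\<in>W \<inter> {x \<in> topspace (ktop X). \<kappa> x \<in> U}. (h \<circ> \<kappa>) y = g y)"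
      using W ab x by (intro exI[of _ ?W] exI[of _ "\<lambda>x. a (\<kappa> x) / b (\<kappa> x)"]) auto
  qed
qed

lemma regular_affine_sp_polyfun:
  assumes "polyfun P"
  shows "regular affine_sp UNIV P"
  unfolding regular_affine_sp
  by (intro ballI exI[of _ P] exI[of _ "\<lambda>_. 1"]) (auto intro: assms polyfun.const)

lemma morphism_polyfun:
  assumes "\<And>j. polyfun (\<lambda>v. \<gamma> v j)"
  shows "morphism affine_sp affine_sp \<gamma>"
proof -
  interpret function_space affine_sp by (rule function_space_affine_sp)
  show ?thesis using assms by (intro morphism_into_affine_sp) (simp add: regular_affine_sp_polyfun)
qed

context function_space
begin

text \<open>The values \<open>r\<close> are prescribed only on the dense set \<open>G\<close>. Two
  local solutions agree on \<open>G\<close>, and the set where they differ is open by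
  \<open>openin_nonzero\<close>, hence empty; so they glue.\<close>

lemma regular_glue:
  assumes dense: "\<And>W. openin (ktop X) W \<Longrightarrow> W \<noteq> {} \<Longrightarrow> W \<inter> G \<noteq> {}"
    and U: "openin (ktop X) U"
    and loc: "\<And>x. x \<in> U \<Longrightarrow> \<exists>V g. openin (ktop X) V \<and> x \<in> V \<and> regular X V g \<and>
      (\<forall>y\<in>V \<inter> U \<inter> G. r y = g y)"
  obtains f where "regular X U f" "\<And>y. y \<in> U \<Longrightarrow> y \<in> G \<Longrightarrow> f y = r y"
proof -
  have eqI: "f y = g y"
    if "regular X W f" "regular X W g" "\<And>y. y \<in> W \<Longrightarrow> y \<in> G \<Longrightarrow> f y = g y" "y \<in> W" for W f g y
  proof -
    have W: "openin (ktop X) W" using that(1) by (rule regular_openin)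
    have "regular X W (\<lambda>x. f x + (- 1) * g x)"
      using that W by (intro regular_add regular_mult regular_const)
    then have "openin (ktop X) {x \<in> W. f x + (- 1) * g x \<noteq> 0}" by (rule openin_nonzero)
    from dense[OF this] show ?thesis using that(3,4) by fastforce
  qed
  have "\<forall>x\<in>U. \<exists>V g. openin (ktop X) V \<and> x \<in> V \<and> regular X V g \<and> (\<forall>y\<in>V \<inter> U \<inter> G. r y = g y)"
    using loc by blast
  from bchoice[OF this] obtain V where "\<forall>x\<in>U. \<exists>g. openin (ktop X) (V x) \<and> x \<in> V x \<and>
      regular X (V x) g \<and> (\<forall>y\<in>V x \<inter> U \<inter> G. r y = g y)"
    by (elim exE)
  from bchoice[OF this] obtain g where "\<forall>x\<in>U. openin (ktop X) (V x) \<and> x \<in> V x \<and>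
      regular X (V x) (g x) \<and> (\<forall>y\<in>V x \<inter> U \<inter> G. r y = g x y)"
    by (elim exE)
  then have V: "\<And>x. x \<in> U \<Longrightarrow> openin (ktop X) (V x)" "\<And>x. x \<in> U \<Longrightarrow> x \<in> V x"
    "\<And>x. x \<in> U \<Longrightarrow> regular X (V x) (g x)"
    "\<And>x y. x \<in> U \<Longrightarrow> y \<in> V x \<Longrightarrow> y \<in> U \<Longrightarrow> y \<in> G \<Longrightarrow> r y = g x y"
    by blast+
  \<comment> \<open>The glued function takes at \<open>y\<close> the value of the local function
    chosen for \<open>y\<close> itself; near \<open>x\<close> it equals the one chosen for
    \<open>x\<close>.\<close>
  have fg: "g y y = g x y" if x: "x \<in> U" and y: "y \<in> U" "y \<in> V x" for x y
  proof (rule eqI[of "V x \<inter> V y \<inter> U" "g y" "g x" y])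
    have o: "openin (ktop X) (V x \<inter> V y \<inter> U)" using V(1) x y U by blast
    show "regular X (V x \<inter> V y \<inter> U) (g y)" using V(3)[OF y(1)] o by (rule regular_subset) auto
    show "regular X (V x \<inter> V y \<inter> U) (g x)" using V(3)[OF x] o by (rule regular_subset) auto
    show "y \<in> V x \<inter> V y \<inter> U" using y V(2) by blast
  qed (use V(4)[OF x] V(4)[OF y(1)] in fastforce)
  show ?thesis
  proof (rule that[of "\<lambda>y. g y y"])
    show "regular X U (\<lambda>y. g y y)"
    proof (rule regular_local[OF U])
      fix x assume x: "x \<in> U"
      then show "\<exists>W h. openin (ktop X) W \<and> x \<in> W \<and> regular X W h \<and> (\<forall>y\<in>W \<inter> U. g y y = h y)"
        using V(1,2,3)[OF x] fg[OF x] by blast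
    qed
  qed (use V(2,4) in fastforce)
qed

end

section \<open>Line bundles and their homomorphisms on an irreducible space\<close>

lemma local_equation_subset:
  assumes "local_equation X C V t" "function_space X" "openin (ktop X) V'" "V' \<subseteq> V"
  shows "local_equation X C V' t"
proof -
  interpret function_space X by fact
  have "regular X V t" using assms(1) by (simp add: local_equation_def)
  then have "regular X V' t" using assms(3,4) by (rule regular_subset) simp
  moreover have "\<exists>h. regular X W h \<and> (\<forall>y\<in>W. g y = h y * t y)"
    if "openin (ktop X) W" "W \<subseteq> V'" "regular X W g" "\<forall>y\<in>W \<inter> C. g y = 0" for W g
  proof -
    have "W \<subseteq> V" using that(2) assms(4) by simp
    with that show ?thesis using assms(1) unfolding local_equation_def by simp
  qed
  ultimately show ?thesis using assms(1,3,4) unfolding local_equation_def by (simp add: subset_iff)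
qed

text \<open>The constant 1 vanishes on the empty set \<open>(V - C) \<inter> C\<close>, so it is a
  multiple of \<open>t\<close> on \<open>V - C\<close>.\<close>

lemma local_equation_nonzero:
  assumes "local_equation X C V t" "function_space X" "closedin (ktop X) C" "y \<in> V" "y \<notin> C"
  shows "t y \<noteq> 0"
proof -
  interpret function_space X by fact
  let ?W = "V - C"
  have V: "openin (ktop X) V" using assms(1) by (simp add: local_equation_def)
  have W: "openin (ktop X) ?W" using V assms(3) by (simp add: openin_diff)
  have "\<exists>h. regular X ?W h \<and> (\<forall>y\<in>?W. 1 = h y * t y)"
    using assms(1) W regular_const[OF W, of 1] unfolding local_equation_def
    by (auto dest!: spec[of _ ?W] spec[of _ "\<lambda>_. 1"])
  then show ?thesis using assms(4,5) by (metis DiffI mult_zero_right zero_neq_one)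
qed

lemma Hom_outside:
  assumes "\<phi> \<in> Hom X E F" "\<not> (openin (ktop X) U \<and> f \<in> E U)"
  shows "\<phi> U f = (\<lambda>_. 0)"
  using assms unfolding Hom_def mem_Collect_eq by simp

lemma Hom_maps:
  assumes "\<phi> \<in> Hom X E F" "openin (ktop X) U" "f \<in> E U"
  shows "\<phi> U f \<in> F U"
  using assms unfolding Hom_def mem_Collect_eq by simp

text \<open>What the argument on homomorphisms uses of the blow-up: density from irreducibility, and
  near each point equations for all the curves on one common neighbourhood.\<close>

locale divisor_space = function_space X for X :: "('x, 'k::field) kspace" +
  fixes Cs :: "'x set set"
  assumes irreducible: "\<And>U V. openin (ktop X) U \<Longrightarrow> openin (ktop X) V \<Longrightarrow> U \<noteq> {} \<Longrightarrow> V \<noteq> {} \<Longrightarrow>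
      U \<inter> V \<noteq> {}"
    and finite_Cs: "finite Cs"
    and closedin_Cs: "\<And>C. C \<in> Cs \<Longrightarrow> closedin (ktop X) C"
    and nonempty: "topspace (ktop X) - \<Union>Cs \<noteq> {}"
    and local_equations: "\<And>x. x \<in> topspace (ktop X) \<Longrightarrow>
      \<exists>V t. openin (ktop X) V \<and> x \<in> V \<and> (\<forall>C\<in>Cs. local_equation X C V (t C))"
begin

text \<open>It avoids all curves of \<open>Cs\<close>, not only those in the support of one divisor,
  so that sections of different line bundles are compared on one dense open set.\<close>

definition generic_part :: "'x set" where
  "generic_part = topspace (ktop X) - \<Union>Cs"

lemma openin_generic_part: "openin (ktop X) generic_part"
  unfolding generic_part_def using finite_Cs closedin_Cs
  by (intro openin_diff openin_topspace closedin_Union) auto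

lemma generic_part_nonempty: "generic_part \<noteq> {}"
  unfolding generic_part_def by (rule nonempty)

lemma dense_generic_part: "openin (ktop X) W \<Longrightarrow> W \<noteq> {} \<Longrightarrow> W \<inter> generic_part \<noteq> {}"
  by (rule irreducible[OF _ openin_generic_part _ generic_part_nonempty])

lemma regular_eqI:
  assumes "regular X U f" "regular X U g" "\<And>y. y \<in> U \<Longrightarrow> y \<in> generic_part \<Longrightarrow> f y = g y" "y \<in> U"
  shows "f y = g y"
proof -
  have U: "openin (ktop X) U" using assms(1) by (rule regular_openin)
  have "regular X U (\<lambda>x. f x + (- 1) * g x)"
    using assms U by (intro regular_add regular_mult regular_const)
  then have "openin (ktop X) {x \<in> U. f x + (- 1) * g x \<noteq> 0}" by (rule openin_nonzero)
  from dense_generic_part[OF this] show ?thesis using assms(3,4) by fastforce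
qed

text \<open>Each of the two equations divides the other. The product of the two quotients is 1 on
  \<open>generic_part\<close>, where \<open>t\<close> does not vanish, hence everywhere by
  density.\<close>

lemma local_equation_unit:
  assumes t: "local_equation X C V t" and t': "local_equation X C V t'" and C: "C \<in> Cs"
  obtains u where "regular X V u" "\<And>y. y \<in> V \<Longrightarrow> u y \<noteq> 0" "\<And>y. y \<in> V \<Longrightarrow> t' y = u y * t y"
proof -
  have V: "openin (ktop X) V" using t by (simp add: local_equation_def)
  have reg: "regular X V t" "regular X V t'" and van: "\<forall>y\<in>V \<inter> C. t y = 0" "\<forall>y\<in>V \<inter> C. t' y = 0"
    using t t' by (auto simp: local_equation_def)
  obtain u where u: "regular X V u" "\<forall>y\<in>V. t' y = u y * t y"
    using t V reg van unfolding local_equation_def by blast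
  obtain w where w: "regular X V w" "\<forall>y\<in>V. t y = w y * t' y"
    using t' V reg van unfolding local_equation_def by blast
  have "u y * w y = 1" if "y \<in> V" "y \<in> generic_part" for y
  proof -
    have "t y \<noteq> 0"
      using local_equation_nonzero[OF t function_space_axioms closedin_Cs[OF C]] that C
      by (auto simp: generic_part_def)
    moreover have "t y = (u y * w y) * t y"
      using u(2) w(2) that(1) by (metis mult.assoc mult.commute)
    ultimately show ?thesis by simp
  qed
  then have "u y * w y = 1" if "y \<in> V" for y
    using regular_eqI[of V "\<lambda>y. u y * w y" "\<lambda>_. 1"] that u w V regular_mult regular_const by blast
  then have "u y \<noteq> 0" if "y \<in> V" for y using that by fastforce
  with u that show ?thesis by blast
qed

section \<open>Sections of \<open>O(D)\<close> through local equations\<close>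

definition eqn_prod :: "('x set \<Rightarrow> 'x \<Rightarrow> 'k) \<Rightarrow> ('x set \<Rightarrow> int) \<Rightarrow> 'x \<Rightarrow> 'k" where
  "eqn_prod t D y = (\<Prod>C\<in>Cs. t C y powi D C)"

text \<open>\<open>r\<close> is a section of \<open>O(D)\<close> over \<open>U\<close>; only its values on \<open>generic_part\<close> matter.\<close>

definition sec :: "('x set \<Rightarrow> int) \<Rightarrow> 'x set \<Rightarrow> ('x \<Rightarrow> 'k) \<Rightarrow> bool" where
  "sec D U r \<longleftrightarrow> openin (ktop X) U \<and> (\<forall>x\<in>U. \<exists>V t g. x \<in> V \<and> V \<subseteq> U \<and> openin (ktop X) V \<and> regular X V g \<and>
     (\<forall>C\<in>Cs. local_equation X C V (t C)) \<and>
     (\<forall>y\<in>V \<inter> generic_part. r y * eqn_prod t D y = g y))"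

lemma secE:
  assumes "sec D U r" "x \<in> U"
  obtains V t g where "x \<in> V" "V \<subseteq> U" "openin (ktop X) V" "regular X V g"
    "\<forall>C\<in>Cs. local_equation X C V (t C)" "\<forall>y\<in>V \<inter> generic_part. r y * eqn_prod t D y = g y"
proof -
  from assms have "\<exists>V t g. x \<in> V \<and> V \<subseteq> U \<and> openin (ktop X) V \<and> regular X V g \<and>
     (\<forall>C\<in>Cs. local_equation X C V (t C)) \<and> (\<forall>y\<in>V \<inter> generic_part. r y * eqn_prod t D y = g y)"
    unfolding sec_def by (elim conjE) (erule bspec)
  then show ?thesis by (elim exE conjE) (rule that)
qed

lemma eqn_prod_add:
  assumes "\<forall>C\<in>Cs. local_equation X C V (t C)" "y \<in> V" "y \<in> generic_part"
  shows "eqn_prod t (\<lambda>C. D C + D' C) y = eqn_prod t D y * eqn_prod t D' y"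
  unfolding eqn_prod_def prod.distrib[symmetric]
proof (rule prod.cong)
  fix C assume C: "C \<in> Cs"
  then have "t C y \<noteq> 0"
    using assms by (auto simp: generic_part_def
      dest: local_equation_nonzero[OF _ function_space_axioms closedin_Cs])
  then show "t C y powi (D C + D' C) = t C y powi D C * t C y powi D' C"
    by (simp add: power_int_add)
qed simp

lemma regular_eqn_prod:
  assumes t: "\<forall>C\<in>Cs. local_equation X C V (t C)" and V': "openin (ktop X) V'" "V' \<subseteq> V"
    and D: "\<And>C. C \<in> Cs \<Longrightarrow> D C < 0 \<Longrightarrow> V' \<inter> C = {}"
  shows "regular X V' (eqn_prod t D)"
proof -
  have "regular X V' (\<lambda>y. \<Prod>C\<in>Cs. t C y powi D C)"
  proof (intro regular_prod finite_Cs V')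
    fix C assume C: "C \<in> Cs"
    then have r: "regular X V' (t C)"
      using t V' regular_subset[of V "t C" V' "t C"] by (auto simp: local_equation_def)
    show "regular X V' (\<lambda>y. t C y powi D C)"
    proof (cases "D C \<ge> 0")
      case True
      then have "(\<lambda>y. t C y powi D C) = (\<lambda>y. t C y ^ nat (D C))" by (simp add: power_int_def)
      then show ?thesis using regular_power[OF r] by simp
    next
      case False
      then have "V' \<inter> C = {}" using D[OF C] by simp
      then show ?thesis using t C V'
        by (intro regular_powi r) (auto dest: local_equation_nonzero[OF _ function_space_axioms closedin_Cs])
    qed
  qed
  then show ?thesis by (simp add: eqn_prod_def[abs_def])
qed

text \<open>Membership in \<open>sec\<close> refers to some equations near each point; this lemma
  allows any. Two systems differ by units, and powers of units are regular whatever the sign of the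
  exponent.\<close>

lemma sec_at:
  assumes r: "sec D U r" and x: "x \<in> U" "x \<in> V" and V: "openin (ktop X) V"
    and t: "\<forall>C\<in>Cs. local_equation X C V (t C)"
  obtains V' g where "openin (ktop X) V'" "x \<in> V'" "V' \<subseteq> V" "V' \<subseteq> U" "regular X V' g"
    "\<And>y. y \<in> V' \<Longrightarrow> y \<in> generic_part \<Longrightarrow> r y * eqn_prod t D y = g y"
proof -
  obtain V1 t1 g1 where 1: "x \<in> V1" "V1 \<subseteq> U" "openin (ktop X) V1" "regular X V1 g1"
    "\<forall>C\<in>Cs. local_equation X C V1 (t1 C)" "\<forall>y\<in>V1 \<inter> generic_part. r y * eqn_prod t1 D y = g1 y"
    using secE[OF r x(1)] by metis
  let ?V = "V \<inter> V1"
  have V': "openin (ktop X) ?V" using V 1 by blast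
  have "\<forall>C\<in>Cs. \<exists>u. regular X ?V u \<and> (\<forall>y\<in>?V. u y \<noteq> 0) \<and> (\<forall>y\<in>?V. t C y = u y * t1 C y)"
  proof
    fix C assume C: "C \<in> Cs"
    have "local_equation X C ?V (t1 C)" "local_equation X C ?V (t C)"
      using C 1(5) t local_equation_subset[OF _ function_space_axioms V'] by auto
    from local_equation_unit[OF this C]
    show "\<exists>u. regular X ?V u \<and> (\<forall>y\<in>?V. u y \<noteq> 0) \<and> (\<forall>y\<in>?V. t C y = u y * t1 C y)" by metis
  qed
  then obtain u where u: "\<forall>C\<in>Cs. regular X ?V (u C) \<and> (\<forall>y\<in>?V. u C y \<noteq> 0) \<and>
      (\<forall>y\<in>?V. t C y = u C y * t1 C y)" by metis
  let ?g = "\<lambda>y. g1 y * (\<Prod>C\<in>Cs. u C y powi D C)"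
  show ?thesis
  proof (rule that[of ?V ?g])
    have "regular X ?V g1" using 1(4) V' by (rule regular_subset) auto
    then show "regular X ?V ?g"
      using u V' finite_Cs by (intro regular_mult regular_prod regular_powi) auto
    fix y assume y: "y \<in> ?V" "y \<in> generic_part"
    have "eqn_prod t D y = (\<Prod>C\<in>Cs. u C y powi D C) * eqn_prod t1 D y"
      unfolding eqn_prod_def prod.distrib[symmetric] using u y
      by (intro prod.cong) (auto simp: power_int_mult_distrib)
    then show "r y * eqn_prod t D y = ?g y"
      using 1(6) y by (auto simp: mult_ac)
  qed (use V' x 1 in auto)
qed

lemma sec_openin: "sec D U r \<Longrightarrow> openin (ktop X) U"
  by (simp add: sec_def)

lemma secI:
  assumes "openin (ktop X) U"
    and "\<And>x. x \<in> U \<Longrightarrow> \<exists>V t g. x \<in> V \<and> openin (ktop X) V \<and> regular X V g \<and>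
      (\<forall>C\<in>Cs. local_equation X C V (t C)) \<and>
      (\<forall>y\<in>V \<inter> U \<inter> generic_part. r y * eqn_prod t D y = g y)"
  shows "sec D U r"
  unfolding sec_def
proof (intro conjI ballI assms(1))
  fix x assume x: "x \<in> U"
  from assms(2)[OF x] obtain V t g where V: "x \<in> V" "openin (ktop X) V" "regular X V g"
      "\<forall>C\<in>Cs. local_equation X C V (t C)"
      "\<forall>y\<in>V \<inter> U \<inter> generic_part. r y * eqn_prod t D y = g y" by metis
  have o: "openin (ktop X) (V \<inter> U)" using V assms(1) by blast
  show "\<exists>V t g. x \<in> V \<and> V \<subseteq> U \<and> openin (ktop X) V \<and> regular X V g \<and>
     (\<forall>C\<in>Cs. local_equation X C V (t C)) \<and> (\<forall>y\<in>V \<inter> generic_part. r y * eqn_prod t D y = g y)"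
    using V x o by (intro exI[of _ "V \<inter> U"] exI[of _ t] exI[of _ g])
      (auto intro: regular_subset[OF V(3) o] local_equation_subset[OF _ function_space_axioms o])
qed

lemma sec_local:
  assumes "openin (ktop X) U" "\<And>x. x \<in> U \<Longrightarrow> \<exists>V. x \<in> V \<and> sec D V r"
  shows "sec D U r"
proof (rule secI[OF assms(1)])
  fix x assume x: "x \<in> U"
  then obtain V where V: "x \<in> V" "sec D V r" using assms(2) by blast
  from secE[OF V(2,1)] obtain W t g where "x \<in> W" "openin (ktop X) W" "regular X W g"
    "\<forall>C\<in>Cs. local_equation X C W (t C)" "\<forall>y\<in>W \<inter> generic_part. r y * eqn_prod t D y = g y"
    by metis
  then show "\<exists>V t g. x \<in> V \<and> openin (ktop X) V \<and> regular X V g \<and>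
      (\<forall>C\<in>Cs. local_equation X C V (t C)) \<and>
      (\<forall>y\<in>V \<inter> U \<inter> generic_part. r y * eqn_prod t D y = g y)"
    by (intro exI[of _ W] exI[of _ t] exI[of _ g]) auto
qed

lemma sec_subset:
  assumes "sec D U r" "openin (ktop X) U'" "U' \<subseteq> U" "\<And>y. y \<in> U' \<Longrightarrow> y \<in> generic_part \<Longrightarrow> r' y = r y"
  shows "sec D U' r'"
proof (rule secI[OF assms(2)])
  fix x assume "x \<in> U'"
  then have "x \<in> U" using assms(3) by blast
  from secE[OF assms(1) this] obtain V t g where "x \<in> V" "V \<subseteq> U" "openin (ktop X) V" "regular X V g"
    "\<forall>C\<in>Cs. local_equation X C V (t C)" "\<forall>y\<in>V \<inter> generic_part. r y * eqn_prod t D y = g y"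
    by metis
  then show "\<exists>V t g. x \<in> V \<and> openin (ktop X) V \<and> regular X V g \<and>
      (\<forall>C\<in>Cs. local_equation X C V (t C)) \<and>
      (\<forall>y\<in>V \<inter> U' \<inter> generic_part. r' y * eqn_prod t D y = g y)"
    using assms(4) by (intro exI[of _ V] exI[of _ t] exI[of _ g]) auto
qed

lemma sec_common:
  assumes "sec D U r" "sec D' U r'" "x \<in> U"
  obtains V t g g' where "openin (ktop X) V" "x \<in> V" "V \<subseteq> U" "\<forall>C\<in>Cs. local_equation X C V (t C)"
    "regular X V g" "regular X V g'" "\<And>y. y \<in> V \<Longrightarrow> y \<in> generic_part \<Longrightarrow> r y * eqn_prod t D y = g y"
    "\<And>y. y \<in> V \<Longrightarrow> y \<in> generic_part \<Longrightarrow> r' y * eqn_prod t D' y = g' y"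
proof -
  have U: "openin (ktop X) U" using assms(1) by (rule sec_openin)
  have "x \<in> topspace (ktop X)" using U assms(3) openin_subset by blast
  then obtain V0 t where V0: "openin (ktop X) V0" "x \<in> V0" "\<forall>C\<in>Cs. local_equation X C V0 (t C)"
    using local_equations by blast
  obtain V1 g where 1: "openin (ktop X) V1" "x \<in> V1" "V1 \<subseteq> V0" "V1 \<subseteq> U" "regular X V1 g"
    "\<And>y. y \<in> V1 \<Longrightarrow> y \<in> generic_part \<Longrightarrow> r y * eqn_prod t D y = g y"
    using sec_at[OF assms(1,3) V0(2,1,3)] by metis
  obtain V2 g' where 2: "openin (ktop X) V2" "x \<in> V2" "V2 \<subseteq> V0" "V2 \<subseteq> U" "regular X V2 g'"
    "\<And>y. y \<in> V2 \<Longrightarrow> y \<in> generic_part \<Longrightarrow> r' y * eqn_prod t D' y = g' y"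
    using sec_at[OF assms(2,3) V0(2,1,3)] by metis
  have o: "openin (ktop X) (V1 \<inter> V2)" using 1 2 by blast
  show ?thesis
    by (rule that[of "V1 \<inter> V2" t g g'])
      (use 1 2 V0 o in \<open>auto intro: regular_subset local_equation_subset[OF _ function_space_axioms o]\<close>)
qed

lemma sec_mult:
  assumes "sec D U r" "sec D' U r'"
  shows "sec (\<lambda>C. D C + D' C) U (\<lambda>x. r x * r' x)"
proof (rule secI[OF sec_openin[OF assms(1)]])
  fix x assume "x \<in> U"
  from sec_common[OF assms this] obtain V t g g' where V: "openin (ktop X) V" "x \<in> V" "V \<subseteq> U"
    "\<forall>C\<in>Cs. local_equation X C V (t C)" "regular X V g" "regular X V g'"
    "\<And>y. y \<in> V \<Longrightarrow> y \<in> generic_part \<Longrightarrow> r y * eqn_prod t D y = g y"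
    "\<And>y. y \<in> V \<Longrightarrow> y \<in> generic_part \<Longrightarrow> r' y * eqn_prod t D' y = g' y" by metis
  have "r y * r' y * eqn_prod t (\<lambda>C. D C + D' C) y = g y * g' y"
    if "y \<in> V \<inter> U \<inter> generic_part" for y
  proof -
    have y: "y \<in> V" "y \<in> generic_part" using that by auto
    have "r y * r' y * eqn_prod t (\<lambda>C. D C + D' C) y = (r y * eqn_prod t D y) * (r' y * eqn_prod t D' y)"
      unfolding eqn_prod_add[OF V(4) y] by (simp only: mult_ac)
    then show ?thesis unfolding V(7)[OF y] V(8)[OF y] .
  qed
  then show "\<exists>V t g. x \<in> V \<and> openin (ktop X) V \<and> regular X V g \<and>
      (\<forall>C\<in>Cs. local_equation X C V (t C)) \<and>
      (\<forall>y\<in>V \<inter> U \<inter> generic_part. r y * r' y * eqn_prod t (\<lambda>C. D C + D' C) y = g y)"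
    using V by (intro exI[of _ V] exI[of _ t] exI[of _ "\<lambda>y. g y * g' y"]) (auto intro: regular_mult)
qed

lemma sec_add:
  assumes "sec D U r" "sec D U r'"
  shows "sec D U (\<lambda>x. r x + r' x)"
proof (rule secI[OF sec_openin[OF assms(1)]])
  fix x assume "x \<in> U"
  from sec_common[OF assms this] obtain V t g g' where V: "openin (ktop X) V" "x \<in> V" "V \<subseteq> U"
    "\<forall>C\<in>Cs. local_equation X C V (t C)" "regular X V g" "regular X V g'"
    "\<And>y. y \<in> V \<Longrightarrow> y \<in> generic_part \<Longrightarrow> r y * eqn_prod t D y = g y"
    "\<And>y. y \<in> V \<Longrightarrow> y \<in> generic_part \<Longrightarrow> r' y * eqn_prod t D y = g' y" by metis
  then show "\<exists>V t g. x \<in> V \<and> openin (ktop X) V \<and> regular X V g \<and>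
      (\<forall>C\<in>Cs. local_equation X C V (t C)) \<and>
      (\<forall>y\<in>V \<inter> U \<inter> generic_part. (r y + r' y) * eqn_prod t D y = g y)"
    by (intro exI[of _ V] exI[of _ t] exI[of _ "\<lambda>y. g y + g' y"])
      (auto intro: regular_add simp: distrib_right)
qed

lemma sec_regular:
  assumes "regular X U r" "\<And>C. C \<in> Cs \<Longrightarrow> D C < 0 \<Longrightarrow> U \<inter> C = {}"
  shows "sec D U r"
proof (rule secI[OF regular_openin[OF assms(1)]])
  fix x assume x: "x \<in> U"
  have U: "openin (ktop X) U" using assms(1) by (rule regular_openin)
  then have "x \<in> topspace (ktop X)" using x openin_subset by blast
  then obtain V t where V: "openin (ktop X) V" "x \<in> V" "\<forall>C\<in>Cs. local_equation X C V (t C)"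
    using local_equations by blast
  let ?V = "V \<inter> U"
  have o: "openin (ktop X) ?V" using V U by blast
  have "regular X ?V (eqn_prod t D)"
    using V(3) o by (rule regular_eqn_prod) (use assms(2) in auto)
  moreover have "regular X ?V r" using assms(1) o by (rule regular_subset) auto
  ultimately have "regular X ?V (\<lambda>y. r y * eqn_prod t D y)" by (rule regular_mult[rotated])
  then show "\<exists>V t g. x \<in> V \<and> openin (ktop X) V \<and> regular X V g \<and>
      (\<forall>C\<in>Cs. local_equation X C V (t C)) \<and>
      (\<forall>y\<in>V \<inter> U \<inter> generic_part. r y * eqn_prod t D y = g y)"
    using x V o by (intro exI[of _ ?V] exI[of _ t] exI[of _ "\<lambda>y. r y * eqn_prod t D y"])
      (auto intro: local_equation_subset[OF _ function_space_axioms o])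
qed

section \<open>The sheaf \<open>O(D)\<close> in terms of values on the generic part\<close>

definition supp :: "('x set \<Rightarrow> int) \<Rightarrow> 'x set" where
  "supp D = \<Union>{C. D C \<noteq> 0}"

lemma supp_disjoint: "D C \<noteq> 0 \<Longrightarrow> (V - supp D) \<inter> C = {}"
  by (auto simp: supp_def)

lemma closedin_supp: "{C. D C \<noteq> 0} \<subseteq> Cs \<Longrightarrow> closedin (ktop X) (supp D)"
  unfolding supp_def using finite_Cs closedin_Cs by (intro closedin_Union) (auto dest: finite_subset)

lemma supp_generic: "{C. D C \<noteq> 0} \<subseteq> Cs \<Longrightarrow> y \<in> generic_part \<Longrightarrow> y \<notin> supp D"
  unfolding supp_def generic_part_def by blast

lemma eqn_prod_supp:
  "{C. D C \<noteq> 0} \<subseteq> Cs \<Longrightarrow> eqn_prod t D y = (\<Prod>C | D C \<noteq> 0. t C y powi D C)"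
  unfolding eqn_prod_def using finite_Cs by (intro prod.mono_neutral_right) auto

text \<open>\<open>line_bundle\<close> mentions only equations of curves in the support of
  \<open>D\<close>, while \<open>sec\<close> uses all curves of \<open>Cs\<close> and looks only at
  \<open>generic_part\<close>. The two agree because curves of multiplicity 0 contribute the factor
  1, and because an equation between regular functions extends from the dense part to
  \<open>V - supp D\<close>.\<close>

lemma line_bundle_iff:
  assumes D: "{C. D C \<noteq> 0} \<subseteq> Cs" and U: "openin (ktop X) U"
  shows "f \<in> line_bundle X D U \<longleftrightarrow>
    regular X (U - supp D) f \<and> (\<forall>x. x \<notin> U - supp D \<longrightarrow> f x = 0) \<and> sec D U f"
proof
  assume "f \<in> line_bundle X D U"
  then have f: "regular X (U - supp D) f" "\<forall>x. x \<notin> U - supp D \<longrightarrow> f x = 0"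
    "\<forall>x\<in>U. \<exists>V t g. x \<in> V \<and> V \<subseteq> U \<and> openin (ktop X) V \<and> regular X V g \<and>
             (\<forall>C. D C \<noteq> 0 \<longrightarrow> local_equation X C V (t C)) \<and>
             (\<forall>y\<in>V - supp D. f y * (\<Prod>C | D C \<noteq> 0. t C y powi D C) = g y)"
    by (auto simp: line_bundle_def supp_def Let_def)
  have "sec D U f"
  proof (rule secI[OF U])
    fix x assume x: "x \<in> U"
    then obtain V t g where V: "x \<in> V" "V \<subseteq> U" "openin (ktop X) V" "regular X V g"
      "\<forall>C. D C \<noteq> 0 \<longrightarrow> local_equation X C V (t C)"
      "\<forall>y\<in>V - supp D. f y * (\<Prod>C | D C \<noteq> 0. t C y powi D C) = g y" using f(3) by meson
    have "x \<in> topspace (ktop X)" using U x openin_subset by blast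
    then obtain V0 t0 where V0: "openin (ktop X) V0" "x \<in> V0" "\<forall>C\<in>Cs. local_equation X C V0 (t0 C)"
      using local_equations by blast
    \<comment> \<open>Curves outside the support get some equation from
      \<open>local_equations\<close>; its exponent is 0.\<close>
    let ?V = "V \<inter> V0" and ?t = "\<lambda>C. if D C \<noteq> 0 then t C else t0 C"
    have o: "openin (ktop X) ?V" using V V0 by blast
    have "\<forall>C\<in>Cs. local_equation X C ?V (?t C)"
      using V(5) V0(3) by (auto intro: local_equation_subset[OF _ function_space_axioms o])
    moreover have "f y * eqn_prod ?t D y = g y" if "y \<in> ?V \<inter> U \<inter> generic_part" for y
    proof -
      have "(\<Prod>C | D C \<noteq> 0. ?t C y powi D C) = (\<Prod>C | D C \<noteq> 0. t C y powi D C)"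
        by (rule prod.cong) auto
      then show ?thesis using V(6) that supp_generic[OF D, of y] by (simp add: eqn_prod_supp[OF D])
    qed
    moreover have "regular X ?V g" using V(4) o by (rule regular_subset) auto
    ultimately show "\<exists>V t g. x \<in> V \<and> openin (ktop X) V \<and> regular X V g \<and>
      (\<forall>C\<in>Cs. local_equation X C V (t C)) \<and>
      (\<forall>y\<in>V \<inter> U \<inter> generic_part. f y * eqn_prod t D y = g y)"
      using o V V0 by (intro exI[of _ ?V] exI[of _ ?t] exI[of _ g]) auto
  qed
  with f show "regular X (U - supp D) f \<and> (\<forall>x. x \<notin> U - supp D \<longrightarrow> f x = 0) \<and> sec D U f" by blast
next
  assume f: "regular X (U - supp D) f \<and> (\<forall>x. x \<notin> U - supp D \<longrightarrow> f x = 0) \<and> sec D U f"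
  have "\<exists>V t g. x \<in> V \<and> V \<subseteq> U \<and> openin (ktop X) V \<and> regular X V g \<and>
             (\<forall>C. D C \<noteq> 0 \<longrightarrow> local_equation X C V (t C)) \<and>
             (\<forall>y\<in>V - supp D. f y * (\<Prod>C | D C \<noteq> 0. t C y powi D C) = g y)" if x: "x \<in> U" for x
  proof -
    obtain V t g where V: "x \<in> V" "V \<subseteq> U" "openin (ktop X) V" "regular X V g"
      "\<forall>C\<in>Cs. local_equation X C V (t C)" "\<forall>y\<in>V \<inter> generic_part. f y * eqn_prod t D y = g y"
      using secE[OF conjunct2[OF conjunct2[OF f]] x] by metis
    let ?V = "V - supp D"
    have o: "openin (ktop X) ?V" using V(3) closedin_supp[OF D] by blast
    have "f y * eqn_prod t D y = g y" if "y \<in> ?V" for y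
    proof (rule regular_eqI[of ?V "\<lambda>y. f y * eqn_prod t D y" g])
      have "regular X ?V (eqn_prod t D)"
        using V(5) o by (rule regular_eqn_prod) (auto intro!: supp_disjoint)
      moreover have "regular X ?V f"
        by (rule regular_subset[OF _ o, of "U - supp D" f]) (use f V in auto)
      ultimately show "regular X ?V (\<lambda>y. f y * eqn_prod t D y)" by (rule regular_mult[rotated])
      show "regular X ?V g" using V(4) o by (rule regular_subset) auto
    qed (use V that in auto)
    then show ?thesis using V D
      by (intro exI[of _ V] exI[of _ t] exI[of _ g]) (auto simp: eqn_prod_supp[OF D])
  qed
  then show "f \<in> line_bundle X D U" using f by (simp add: line_bundle_def supp_def Let_def)
qed

lemma line_bundle_eqI:
  assumes D: "{C. D C \<noteq> 0} \<subseteq> Cs" and U: "openin (ktop X) U"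
    and f: "f \<in> line_bundle X D U" and g: "g \<in> line_bundle X D U"
    and eq: "\<And>y. y \<in> U \<Longrightarrow> y \<in> generic_part \<Longrightarrow> f y = g y"
  shows "f = g"
proof
  fix x
  show "f x = g x"
    using regular_eqI[of "U - supp D" f g x] f g eq
    by (cases "x \<in> U - supp D") (auto simp: line_bundle_iff[OF D U])
qed

text \<open>Off the support, \<open>r\<close> agrees on \<open>generic_part\<close> with
  \<open>g\<close> times the equations to the powers \<open>- D C\<close>, a regular function.
  Gluing these gives a regular function on \<open>U - supp D\<close>; elsewhere the section is 0 by
  the normalisation in \<open>line_bundle\<close>.\<close>

lemma sec_extend:
  assumes D: "{C. D C \<noteq> 0} \<subseteq> Cs" and r: "sec D U r"
  obtains f where "f \<in> line_bundle X D U" "\<And>y. y \<in> U \<Longrightarrow> y \<in> generic_part \<Longrightarrow> f y = r y"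
proof -
  have U: "openin (ktop X) U" using r by (rule sec_openin)
  let ?S = "supp D"
  have US: "openin (ktop X) (U - ?S)" using U closedin_supp[OF D] by blast
  have loc: "\<exists>V g. openin (ktop X) V \<and> x \<in> V \<and> regular X V g \<and> (\<forall>y\<in>V \<inter> (U - ?S) \<inter> generic_part. r y = g y)"
    if x: "x \<in> U - ?S" for x
  proof -
    from x have "x \<in> U" by simp
    from secE[OF r this] obtain V t g where V: "x \<in> V" "V \<subseteq> U" "openin (ktop X) V" "regular X V g"
      "\<forall>C\<in>Cs. local_equation X C V (t C)" "\<forall>y\<in>V \<inter> generic_part. r y * eqn_prod t D y = g y"
      by metis
    let ?V = "V - ?S" and ?g = "\<lambda>y. g y * eqn_prod t (\<lambda>C. - D C) y"
    have o: "openin (ktop X) ?V" using V(3) closedin_supp[OF D] by blast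
    have "regular X ?V (eqn_prod t (\<lambda>C. - D C))"
      using V(5) o by (rule regular_eqn_prod) (auto intro!: supp_disjoint)
    moreover have "regular X ?V g" using V(4) o by (rule regular_subset) auto
    ultimately have "regular X ?V ?g" by (rule regular_mult[rotated])
    moreover have "r y = ?g y" if "y \<in> ?V \<inter> generic_part" for y
    proof -
      have "eqn_prod t D y * eqn_prod t (\<lambda>C. - D C) y = 1"
        using eqn_prod_add[OF V(5), of y D "\<lambda>C. - D C"] that by (simp add: eqn_prod_def)
      moreover have "r y * eqn_prod t D y = g y" using V(6) that by auto
      ultimately show ?thesis by (metis mult.assoc mult_1_right)
    qed
    ultimately show ?thesis
      using o V x by (intro exI[of _ ?V] exI[of _ ?g]) auto
  qed
  obtain f' where f': "regular X (U - ?S) f'" "\<And>y. y \<in> U - ?S \<Longrightarrow> y \<in> generic_part \<Longrightarrow> f' y = r y"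
    by (rule regular_glue[OF dense_generic_part US, of r]) (assumption, assumption, rule loc, assumption, fastforce intro: that)
  define f where "f x = (if x \<in> U - ?S then f' x else 0)" for x
  have "regular X (U - ?S) f" using f'(1) by (rule regular_cong) (simp add: f_def)
  moreover have fr: "f y = r y" if "y \<in> U" "y \<in> generic_part" for y
    using f'(2)[of y] that supp_generic[OF D, of y] by (simp add: f_def)
  moreover have "sec D U f" using r U by (rule sec_subset) (auto simp: fr)
  moreover have "\<forall>x. x \<notin> U - ?S \<longrightarrow> f x = 0" by (simp add: f_def)
  ultimately show ?thesis using that line_bundle_iff[OF D U] by blast
qed

lemma line_bundle_add:
  assumes D: "{C. D C \<noteq> 0} \<subseteq> Cs" and U: "openin (ktop X) U"
    and "f \<in> line_bundle X D U" "g \<in> line_bundle X D U"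
  shows "(\<lambda>x. f x + g x) \<in> line_bundle X D U"
  using assms(3,4) by (auto simp: line_bundle_iff[OF D U] intro: regular_add sec_add)

lemma line_bundle_scale:
  assumes D: "{C. D C \<noteq> 0} \<subseteq> Cs" and U: "openin (ktop X) U"
    and a: "regular X U a" and f: "f \<in> line_bundle X D U"
  shows "(\<lambda>x. a x * f x) \<in> line_bundle X D U"
proof -
  have "openin (ktop X) (U - supp D)" using U closedin_supp[OF D] by blast
  then have "regular X (U - supp D) a" by (rule regular_subset[OF a]) auto
  moreover have "sec (\<lambda>C. 0 + D C) U (\<lambda>x. a x * f x)"
    using f by (intro sec_mult sec_regular[OF a]) (auto simp: line_bundle_iff[OF D U])
  ultimately show ?thesis using f by (auto simp: line_bundle_iff[OF D U] intro: regular_mult)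
qed

lemma line_bundle_restr:
  assumes D: "{C. D C \<noteq> 0} \<subseteq> Cs" and U: "openin (ktop X) U" and V: "openin (ktop X) V" "V \<subseteq> U"
    and f: "f \<in> line_bundle X D U"
  shows "restr V f \<in> line_bundle X D V"
proof -
  have o: "openin (ktop X) (V - supp D)" using V closedin_supp[OF D] by blast
  have f': "regular X (U - supp D) f" "sec D U f" "\<And>x. x \<notin> U - supp D \<Longrightarrow> f x = 0"
    using f by (auto simp: line_bundle_iff[OF D U])
  have "regular X (V - supp D) (restr V f)"
    using f'(1) o by (rule regular_subset) (use V in \<open>auto simp: restr_def\<close>)
  moreover have "sec D V (restr V f)"
    using f'(2) V by (rule sec_subset) (auto simp: restr_def)
  ultimately show ?thesis using f'(3) V by (auto simp: line_bundle_iff[OF D V(1)] restr_def)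
qed

lemma line_bundle_zero:
  assumes D: "{C. D C \<noteq> 0} \<subseteq> Cs" and U: "openin (ktop X) U"
  shows "(\<lambda>_. 0) \<in> line_bundle X D U"
proof -
  have "openin (ktop X) (U - supp D)" using U closedin_supp[OF D] by blast
  moreover have "sec D U (\<lambda>_. 0)"
  proof (rule secI[OF U])
    fix x assume "x \<in> U"
    then have "x \<in> topspace (ktop X)" using U openin_subset by blast
    then obtain V t where "openin (ktop X) V" "x \<in> V" "\<forall>C\<in>Cs. local_equation X C V (t C)"
      using local_equations by blast
    then show "\<exists>V t g. x \<in> V \<and> openin (ktop X) V \<and> regular X V g \<and>
      (\<forall>C\<in>Cs. local_equation X C V (t C)) \<and>
      (\<forall>y\<in>V \<inter> U \<inter> generic_part. 0 * eqn_prod t D y = g y)"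
      by (intro exI[of _ V] exI[of _ t] exI[of _ "\<lambda>_. 0"]) (auto intro: regular_const)
  qed
  ultimately show ?thesis by (auto simp: line_bundle_iff[OF D U] intro: regular_const)
qed

text \<open>The test section: over \<open>generic_part\<close> every \<open>O(D)\<close> is
  trivialised by 1, and a homomorphism is determined by the image of this section.\<close>

lemma line_bundle_generic_one:
  assumes D: "{C. D C \<noteq> 0} \<subseteq> Cs"
  shows "restr generic_part (\<lambda>_. 1) \<in> line_bundle X D generic_part"
proof -
  have "generic_part - supp D = generic_part" using supp_generic[OF D] by blast
  moreover have r: "regular X generic_part (restr generic_part (\<lambda>_. 1))"
    by (rule regular_cong[OF regular_const[OF openin_generic_part, of 1]]) (simp add: restr_def)
  moreover have "sec D generic_part (restr generic_part (\<lambda>_. 1))"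
    by (rule sec_regular[OF r]) (auto simp: generic_part_def)
  ultimately show ?thesis by (simp add: line_bundle_iff[OF D openin_generic_part] restr_def)
qed

text \<open>A function vanishing on \<open>C0\<close> is divisible by the equation of
  \<open>C0\<close>, which compensates an exponent of -1.\<close>

lemma sec_vanishing:
  assumes r: "regular X U r" and C0: "C0 \<in> Cs" and van: "\<And>y. y \<in> U \<Longrightarrow> y \<in> C0 \<Longrightarrow> r y = 0"
    and D0: "D C0 \<ge> - 1" and D: "\<And>C. C \<in> Cs \<Longrightarrow> C \<noteq> C0 \<Longrightarrow> D C < 0 \<Longrightarrow> U \<inter> C = {}"
  shows "sec D U r"
proof (rule secI[OF regular_openin[OF r]])
  fix x assume x: "x \<in> U"
  have U: "openin (ktop X) U" using r by (rule regular_openin)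
  then have "x \<in> topspace (ktop X)" using x openin_subset by blast
  then obtain V t where V: "openin (ktop X) V" "x \<in> V" "\<forall>C\<in>Cs. local_equation X C V (t C)"
    using local_equations by blast
  let ?V = "V \<inter> U"
  have o: "openin (ktop X) ?V" using V U by blast
  have rV: "regular X ?V r" using r o by (rule regular_subset) auto
  have "local_equation X C0 V (t C0)" using V(3) C0 by blast
  then obtain g where g: "regular X ?V g" "\<forall>y\<in>?V. r y = g y * t C0 y"
    using o rV van unfolding local_equation_def by (metis IntD1 IntD2 inf_le1)
  \<comment> \<open>\<open>e\<close> is the divisor \<open>C0\<close> itself. Splitting off its
    equation from \<open>r\<close> leaves the exponents of \<open>e + D\<close>, which is
    nonnegative on \<open>C0\<close>.\<close>
  define e where "e C = (if C = C0 then 1 else 0 :: int)" for C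
  have t0: "eqn_prod t e y = t C0 y" for y
  proof -
    have "eqn_prod t e y = (\<Prod>C\<in>Cs. if C = C0 then t C0 y else 1)"
      unfolding eqn_prod_def e_def by (rule prod.cong) auto
    then show ?thesis using C0 finite_Cs by simp
  qed
  have "regular X ?V (eqn_prod t (\<lambda>C. e C + D C))"
    using V(3) o by (rule regular_eqn_prod) (use D D0 in \<open>auto simp: e_def split: if_splits\<close>)
  then have "regular X ?V (\<lambda>y. g y * eqn_prod t (\<lambda>C. e C + D C) y)" using g(1) by (rule regular_mult[rotated])
  moreover have "r y * eqn_prod t D y = g y * eqn_prod t (\<lambda>C. e C + D C) y"
    if "y \<in> ?V \<inter> U \<inter> generic_part" for y
    using that g(2) eqn_prod_add[OF V(3), of y e D] t0 by simp
  ultimately show "\<exists>V t g. x \<in> V \<and> openin (ktop X) V \<and> regular X V g \<and>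
      (\<forall>C\<in>Cs. local_equation X C V (t C)) \<and>
      (\<forall>y\<in>V \<inter> U \<inter> generic_part. r y * eqn_prod t D y = g y)"
    using x V o by (intro exI[of _ ?V] exI[of _ t] exI[of _ "\<lambda>y. g y * eqn_prod t (\<lambda>C. e C + D C) y"])
      (auto intro: local_equation_subset[OF _ function_space_axioms o])
qed

text \<open>At a point where \<open>D\<close> has no positive multiplicity a section has no pole, so
  it has a value there, and this value is 0 if a curve of negative multiplicity passes through the
  point. This is how multiplicity -1 on an exceptional curve becomes a zero of a polynomial on a
  line.\<close>

lemma sec_value:
  assumes r: "sec D U r" and x: "x \<in> U" and D: "\<And>C. C \<in> Cs \<Longrightarrow> x \<in> C \<Longrightarrow> D C \<le> 0"
  shows "\<exists>V g. openin (ktop X) V \<and> x \<in> V \<and> regular X V g \<and> (\<forall>y\<in>V \<inter> generic_part. r y = g y) \<and>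
    (\<forall>C\<in>Cs. x \<in> C \<longrightarrow> D C < 0 \<longrightarrow> g x = 0)"
proof -
  have "x \<in> topspace (ktop X)" using sec_openin[OF r] x openin_subset by blast
  then obtain V t where V: "openin (ktop X) V" "x \<in> V" "\<forall>C\<in>Cs. local_equation X C V (t C)"
    using local_equations by blast
  obtain W g where W: "openin (ktop X) W" "x \<in> W" "W \<subseteq> V" "W \<subseteq> U" "regular X W g"
    "\<And>y. y \<in> W \<Longrightarrow> y \<in> generic_part \<Longrightarrow> r y * eqn_prod t D y = g y"
    using sec_at[OF r x V(2,1,3)] by metis
  \<comment> \<open>Removing the curves that miss \<open>x\<close> leaves only curves with
    \<open>- D C \<ge> 0\<close>, so the powers with exponents \<open>- D C\<close> are
    regular.\<close>
  let ?W = "W - \<Union>{C \<in> Cs. x \<notin> C}"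
  have o: "openin (ktop X) ?W"
    using W(1) finite_Cs closedin_Cs by (intro openin_diff closedin_Union) auto
  let ?g = "\<lambda>y. g y * eqn_prod t (\<lambda>C. - D C) y"
  have "regular X ?W (eqn_prod t (\<lambda>C. - D C))"
    using V(3) o
  proof (rule regular_eqn_prod)
    fix C assume "C \<in> Cs" "- D C < 0"
    then have "x \<notin> C" using D[of C] by force
    then show "?W \<inter> C = {}" using \<open>C \<in> Cs\<close> by blast
  qed (use W(3) in blast)
  moreover have "regular X ?W g" using W(5) o by (rule regular_subset) auto
  ultimately have reg: "regular X ?W ?g" by (rule regular_mult[rotated])
  have eq: "r y = ?g y" if y: "y \<in> ?W" "y \<in> generic_part" for y
  proof -
    have yV: "y \<in> V" using y W(3) by blast
    have "eqn_prod t D y * eqn_prod t (\<lambda>C. - D C) y = 1"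
      using eqn_prod_add[OF V(3) yV y(2), of D "\<lambda>C. - D C"] by (simp add: eqn_prod_def)
    moreover have "r y * eqn_prod t D y = g y" using W(6) y by blast
    ultimately show ?thesis by (metis mult.assoc mult_1_right)
  qed
  have zero: "?g x = 0" if C: "C \<in> Cs" "x \<in> C" "D C < 0" for C
  proof -
    have "t C x = 0" using V(2,3) C by (auto simp: local_equation_def)
    then have "t C x powi (- D C) = 0" using C(3) by simp
    then have "eqn_prod t (\<lambda>C. - D C) x = 0"
      unfolding eqn_prod_def using C(1) finite_Cs by (intro prod_zero) auto
    then show ?thesis by simp
  qed
  have "x \<in> ?W" using W(2) by blast
  then show ?thesis using o reg eq zero by (intro exI[of _ ?W] exI[of _ ?g] conjI) blast+
qed

section \<open>Homomorphisms as multiplications\<close>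

definition hom_mult :: "('x set \<Rightarrow> int) \<Rightarrow> ('x set \<Rightarrow> int) \<Rightarrow> ('x, 'k) sheaf_hom \<Rightarrow> ('x \<Rightarrow> 'k) \<Rightarrow> bool" where
  "hom_mult D1 D2 \<phi> r \<longleftrightarrow> \<phi> \<in> Hom X (line_bundle X D1) (line_bundle X D2) \<and>
     (\<forall>U f y. openin (ktop X) U \<longrightarrow> f \<in> line_bundle X D1 U \<longrightarrow> y \<in> U \<longrightarrow> y \<in> generic_part \<longrightarrow>
        \<phi> U f y = r y * f y)"

text \<open>The multiplier is the image of the section 1 over \<open>generic_part\<close>:
  compatibility with restriction and linearity over functions force all other values. Near any point
  \<open>O(D1)\<close> is generated by the product of the equations to the powers
  \<open>- D1 C\<close>. The image of this generator times \<open>eqn_prod t D1\<close> is the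
  multiplier, which is therefore a section of \<open>O(D2 - D1)\<close>.\<close>

lemma hom_multE:
  assumes D1: "{C. D1 C \<noteq> 0} \<subseteq> Cs" and D2: "{C. D2 C \<noteq> 0} \<subseteq> Cs"
    and \<phi>: "\<phi> \<in> Hom X (line_bundle X D1) (line_bundle X D2)"
  obtains r where "hom_mult D1 D2 \<phi> r" "sec (\<lambda>C. D2 C - D1 C) (topspace (ktop X)) r"
proof -
  let ?L1 = "line_bundle X D1" and ?L2 = "line_bundle X D2" and ?G = generic_part
  have lin: "\<phi> U (\<lambda>x. a x * f x) = (\<lambda>x. a x * \<phi> U f x)"
    if "openin (ktop X) U" "regular X U a" "f \<in> ?L1 U" for U a f
    using \<phi> that unfolding Hom_def by blast
  have res: "\<phi> V (restr V f) = restr V (\<phi> U f)"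
    if "openin (ktop X) U" "openin (ktop X) V" "V \<subseteq> U" "f \<in> ?L1 U" for U V f
    using \<phi> that unfolding Hom_def by blast
  have maps: "\<phi> U f \<in> ?L2 U" if "openin (ktop X) U" "f \<in> ?L1 U" for U f
    using \<phi> that by (rule Hom_maps)
  define e where "e = restr ?G (\<lambda>_. 1::'k)"
  define r where "r = \<phi> ?G e"
  have e: "e \<in> ?L1 ?G" unfolding e_def by (rule line_bundle_generic_one[OF D1])
  have mult: "\<phi> U f y = r y * f y"
    if U: "openin (ktop X) U" and f: "f \<in> ?L1 U" and y: "y \<in> U" "y \<in> ?G" for U f y
  proof -
    let ?V = "U \<inter> ?G"
    have V: "openin (ktop X) ?V" using U openin_generic_part by blast
    have "regular X ?V f"
      by (rule regular_subset[OF _ V, of "U - supp D1" f])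
        (use f supp_generic[OF D1] in \<open>auto simp: line_bundle_iff[OF D1 U]\<close>)
    moreover have "restr ?V e \<in> ?L1 ?V"
      using D1 openin_generic_part V _ e by (rule line_bundle_restr) auto
    ultimately have "\<phi> ?V (\<lambda>x. f x * restr ?V e x) = (\<lambda>x. f x * \<phi> ?V (restr ?V e) x)"
      using lin[OF V] by blast
    moreover have "(\<lambda>x. f x * restr ?V e x) = restr ?V f" by (auto simp: restr_def e_def)
    ultimately have "restr ?V (\<phi> U f) y = f y * restr ?V r y"
      using res[OF U V _ f] res[OF openin_generic_part V _ e] by (simp add: r_def)
    then show ?thesis using y by (simp add: restr_def mult.commute)
  qed
  have "sec (\<lambda>C. D2 C - D1 C) (topspace (ktop X)) r"
  proof (rule sec_local[OF openin_topspace])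
    fix x assume "x \<in> topspace (ktop X)"
    then obtain V t where V: "openin (ktop X) V" "x \<in> V" "\<forall>C\<in>Cs. local_equation X C V (t C)"
      using local_equations by blast
    have "sec D1 V (eqn_prod t (\<lambda>C. - D1 C))"
    proof (rule secI[OF V(1)])
      fix x assume "x \<in> V"
      have "eqn_prod t (\<lambda>C. - D1 C) y * eqn_prod t D1 y = 1" if "y \<in> V" "y \<in> ?G" for y
        using eqn_prod_add[OF V(3) that, of "\<lambda>C. - D1 C" D1] by (simp add: eqn_prod_def)
      then show "\<exists>W t' g. x \<in> W \<and> openin (ktop X) W \<and> regular X W g \<and>
        (\<forall>C\<in>Cs. local_equation X C W (t' C)) \<and>
        (\<forall>y\<in>W \<inter> V \<inter> ?G. eqn_prod t (\<lambda>C. - D1 C) y * eqn_prod t' D1 y = g y)"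
        using V \<open>x \<in> V\<close> by (intro exI[of _ V] exI[of _ t] exI[of _ "\<lambda>_. 1"]) (auto intro: regular_const)
    qed
    from sec_extend[OF D1 this] obtain f where f: "f \<in> ?L1 V"
      "\<And>y. y \<in> V \<Longrightarrow> y \<in> ?G \<Longrightarrow> f y = eqn_prod t (\<lambda>C. - D1 C) y" by metis
    have s2: "sec D2 V (\<phi> V f)" using maps[OF V(1) f(1)] by (simp add: line_bundle_iff[OF D2 V(1)])
    have s1: "sec (\<lambda>C. - D1 C) V (eqn_prod t D1)"
    proof (rule secI[OF V(1)])
      fix x assume "x \<in> V"
      have "eqn_prod t D1 y * eqn_prod t (\<lambda>C. - D1 C) y = 1" if "y \<in> V" "y \<in> ?G" for y
        using eqn_prod_add[OF V(3) that, of "\<lambda>C. D1 C" "\<lambda>C. - D1 C"] by (simp add: eqn_prod_def)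
      then show "\<exists>W t' g. x \<in> W \<and> openin (ktop X) W \<and> regular X W g \<and>
        (\<forall>C\<in>Cs. local_equation X C W (t' C)) \<and>
        (\<forall>y\<in>W \<inter> V \<inter> ?G. eqn_prod t D1 y * eqn_prod t' (\<lambda>C. - D1 C) y = g y)"
        using V \<open>x \<in> V\<close> by (intro exI[of _ V] exI[of _ t] exI[of _ "\<lambda>_. 1"]) (auto intro: regular_const)
    qed
    have "sec (\<lambda>C. D2 C + (- D1 C)) V r"
    proof (rule sec_subset[OF sec_mult[OF s2 s1] V(1) order.refl])
      fix y assume y: "y \<in> V" "y \<in> ?G"
      have "eqn_prod t (\<lambda>C. - D1 C) y * eqn_prod t D1 y = 1"
        using eqn_prod_add[OF V(3) y, of "\<lambda>C. - D1 C" D1] by (simp add: eqn_prod_def)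
      then show "r y = \<phi> V f y * eqn_prod t D1 y"
        using mult[OF V(1) f(1) y] f(2)[OF y] by (simp add: mult.assoc)
    qed
    then show "\<exists>V. x \<in> V \<and> sec (\<lambda>C. D2 C - D1 C) V r" using V(2) by auto
  qed
  moreover have "hom_mult D1 D2 \<phi> r" using \<phi> mult by (simp add: hom_mult_def)
  ultimately show ?thesis by (intro that)
qed

text \<open>The value on a section \<open>f\<close> is the extension of \<open>r * f\<close> from
  \<open>generic_part\<close> by \<open>sec_extend\<close>. Such an extension is unique, so
  additivity, linearity and compatibility with restriction only have to be checked on
  \<open>generic_part\<close>.\<close>

lemma hom_mult_exists:
  assumes D1: "{C. D1 C \<noteq> 0} \<subseteq> Cs" and D2: "{C. D2 C \<noteq> 0} \<subseteq> Cs"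
    and r: "sec (\<lambda>C. D2 C - D1 C) (topspace (ktop X)) r"
  obtains \<phi> where "hom_mult D1 D2 \<phi> r"
proof -
  let ?L1 = "line_bundle X D1" and ?L2 = "line_bundle X D2" and ?G = generic_part
  have ex: "\<exists>g\<in>?L2 U. \<forall>y\<in>U \<inter> ?G. g y = r y * f y" if U: "openin (ktop X) U" and f: "f \<in> ?L1 U" for U f
  proof -
    have "sec (\<lambda>C. D2 C - D1 C) U r" using r U openin_subset[OF U] by (rule sec_subset) simp
    then have "sec (\<lambda>C. (D2 C - D1 C) + D1 C) U (\<lambda>x. r x * f x)"
      using f by (intro sec_mult) (auto simp: line_bundle_iff[OF D1 U])
    then have "sec D2 U (\<lambda>x. r x * f x)" by simp
    from sec_extend[OF D2 this] show ?thesis by (metis IntE)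
  qed
  define \<phi> where "\<phi> U f = (if openin (ktop X) U \<and> f \<in> ?L1 U
      then (SOME g. g \<in> ?L2 U \<and> (\<forall>y\<in>U \<inter> ?G. g y = r y * f y)) else (\<lambda>_. 0))" for U f
  have \<phi>: "\<phi> U f \<in> ?L2 U \<and> (\<forall>y\<in>U \<inter> ?G. \<phi> U f y = r y * f y)"
    if "openin (ktop X) U" "f \<in> ?L1 U" for U f
    using someI_ex[of "\<lambda>g. g \<in> ?L2 U \<and> (\<forall>y\<in>U \<inter> ?G. g y = r y * f y)"] ex[OF that] that
    unfolding \<phi>_def by auto
  note eqI = line_bundle_eqI[OF D2]
  have "\<phi> \<in> Hom X ?L1 ?L2"
    unfolding Hom_def mem_Collect_eq
  proof (intro conjI allI impI ballI)
    fix U f g assume U: "openin (ktop X) U" and f: "f \<in> ?L1 U" and g: "g \<in> ?L1 U"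
    show "\<phi> U (\<lambda>x. f x + g x) = (\<lambda>x. \<phi> U f x + \<phi> U g x)"
      using \<phi>[OF U f] \<phi>[OF U g] \<phi>[OF U line_bundle_add[OF D1 U f g]]
      by (intro eqI[OF U] line_bundle_add[OF D2 U]) (auto simp: algebra_simps)
  next
    fix U a f assume U: "openin (ktop X) U" and a: "regular X U a" and f: "f \<in> ?L1 U"
    show "\<phi> U (\<lambda>x. a x * f x) = (\<lambda>x. a x * \<phi> U f x)"
      using \<phi>[OF U f] \<phi>[OF U line_bundle_scale[OF D1 U a f]]
      by (intro eqI[OF U] line_bundle_scale[OF D2 U a]) (auto simp: algebra_simps)
  next
    fix U V f assume U: "openin (ktop X) U" and V: "openin (ktop X) V \<and> V \<subseteq> U" and f: "f \<in> ?L1 U"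
    then have V1: "openin (ktop X) V" and V2: "V \<subseteq> U" by auto
    show "\<phi> V (restr V f) = restr V (\<phi> U f)"
      using \<phi>[OF U f] \<phi>[OF V1 line_bundle_restr[OF D1 U V1 V2 f]] V2
      by (intro eqI[OF V1] line_bundle_restr[OF D2 U V1 V2]) (auto simp: restr_def)
  qed (use \<phi> in \<open>auto simp: \<phi>_def\<close>)
  then have "hom_mult D1 D2 \<phi> r" using \<phi> by (simp add: hom_mult_def)
  then show ?thesis by (rule that)
qed

text \<open>A homomorphism and its multiplier on \<open>generic_part\<close> determine each other,
  so one-dimensionality of the sections of \<open>O(D2 - D1)\<close> passes to the space of
  homomorphisms.\<close>

lemma basis_hom:
  assumes D1: "{C. D1 C \<noteq> 0} \<subseteq> Cs" and D2: "{C. D2 C \<noteq> 0} \<subseteq> Cs"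
    and r: "sec (\<lambda>C. D2 C - D1 C) (topspace (ktop X)) r" and y0: "y0 \<in> generic_part" "r y0 \<noteq> 0"
    and uniq: "\<And>s. sec (\<lambda>C. D2 C - D1 C) (topspace (ktop X)) s \<Longrightarrow> \<exists>c. \<forall>y\<in>generic_part. s y = c * r y"
  shows "\<exists>\<phi>. is_basis_hom X (line_bundle X D1) (line_bundle X D2) \<phi>"
    and "is_basis_hom X (line_bundle X D1) (line_bundle X D2) \<phi> \<Longrightarrow>
      \<exists>c. c \<noteq> 0 \<and> hom_mult D1 D2 \<phi> (\<lambda>y. c * r y)"
proof -
  let ?L1 = "line_bundle X D1" and ?L2 = "line_bundle X D2" and ?G = generic_part
  have zero: "\<phi> U f = (\<lambda>_. 0)" if "\<phi> \<in> Hom X ?L1 ?L2" "\<not> (openin (ktop X) U \<and> f \<in> ?L1 U)" for \<phi> U f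
    using that by (rule Hom_outside)
  have maps: "\<phi> U f \<in> ?L2 U" if "\<phi> \<in> Hom X ?L1 ?L2" "openin (ktop X) U" "f \<in> ?L1 U" for \<phi> U f
    using that by (rule Hom_maps)
  have scaled: "\<psi> = (\<lambda>U f x. c * \<phi> U f x)"
    if \<phi>: "hom_mult D1 D2 \<phi> s" and \<psi>: "hom_mult D1 D2 \<psi> s'" and eq: "\<And>y. y \<in> ?G \<Longrightarrow> s' y = c * s y"
    for \<phi> \<psi> s s' c
  proof (intro ext)
    fix U f x
    show "\<psi> U f x = c * \<phi> U f x"
    proof (cases "openin (ktop X) U \<and> f \<in> ?L1 U")
      case True
      then have U: "openin (ktop X) U" and f: "f \<in> ?L1 U" by auto
      have "\<psi> U f = (\<lambda>x. c * \<phi> U f x)"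
      proof (rule line_bundle_eqI[OF D2 U])
        show "\<psi> U f \<in> ?L2 U" using maps \<psi> U f by (auto simp: hom_mult_def)
        show "(\<lambda>x. c * \<phi> U f x) \<in> ?L2 U"
          using maps \<phi> U f by (intro line_bundle_scale[OF D2 U] regular_const) (auto simp: hom_mult_def)
        fix y assume "y \<in> U" "y \<in> ?G"
        then show "\<psi> U f y = c * \<phi> U f y" using \<phi> \<psi> U f eq by (simp add: hom_mult_def)
      qed
      then show ?thesis by simp
    next
      case False
      then show ?thesis using zero \<phi> \<psi> by (auto simp: hom_mult_def)
    qed
  qed
  obtain \<phi>0 where \<phi>0: "hom_mult D1 D2 \<phi>0 r" using hom_mult_exists[OF D1 D2 r] by metis
  have "\<phi>0 ?G (restr ?G (\<lambda>_. 1)) y0 = r y0"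
    using \<phi>0 y0 openin_generic_part line_bundle_generic_one[OF D1] by (simp add: hom_mult_def restr_def)
  then have "\<phi>0 \<noteq> (\<lambda>_ _ _. 0)" using y0(2) by auto
  moreover have "\<exists>t. \<psi> = (\<lambda>U f x. t * \<phi>0 U f x)" if \<psi>: "\<psi> \<in> Hom X ?L1 ?L2" for \<psi>
  proof -
    obtain s where s: "hom_mult D1 D2 \<psi> s" "sec (\<lambda>C. D2 C - D1 C) (topspace (ktop X)) s"
      using hom_multE[OF D1 D2 \<psi>] by metis
    obtain c where "\<forall>y\<in>?G. s y = c * r y" using uniq[OF s(2)] by blast
    then show ?thesis using scaled[OF \<phi>0 s(1)] by blast
  qed
  ultimately show "\<exists>\<phi>. is_basis_hom X ?L1 ?L2 \<phi>"
    using \<phi>0 by (auto simp: is_basis_hom_def hom_mult_def)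
  assume b: "is_basis_hom X ?L1 ?L2 \<phi>"
  then have H: "\<phi> \<in> Hom X ?L1 ?L2" and nz: "\<phi> \<noteq> (\<lambda>_ _ _. 0)" by (auto simp: is_basis_hom_def)
  obtain s where s: "hom_mult D1 D2 \<phi> s" "sec (\<lambda>C. D2 C - D1 C) (topspace (ktop X)) s"
    using hom_multE[OF D1 D2 H] by metis
  obtain c where c: "\<forall>y\<in>?G. s y = c * r y" using uniq[OF s(2)] by blast
  have "c \<noteq> 0" using scaled[OF \<phi>0 s(1), of c] c nz by auto
  moreover have "hom_mult D1 D2 \<phi> (\<lambda>y. c * r y)" using s(1) c by (simp add: hom_mult_def)
  ultimately show "\<exists>c. c \<noteq> 0 \<and> hom_mult D1 D2 \<phi> (\<lambda>y. c * r y)" by blast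
qed

end

section \<open>Polynomial functions\<close>

lemma polyfun_line:
  assumes "polyfun P"
  obtains p where "\<And>t. P (\<lambda>i. v i + t * w i) = poly p t"
proof -
  from assms have "\<exists>p. \<forall>t. P (\<lambda>i. v i + t * w i) = poly p t"
  proof induction
    case (const a)
    show ?case by (rule exI[of _ "[:a:]"]) simp
  next
    case (coord i)
    show ?case by (rule exI[of _ "[:v i, w i:]"]) simp
  next
    case (add f g)
    then show ?case by (metis poly_add)
  next
    case (mult f g)
    then show ?case by (metis poly_mult)
  qed
  then show ?thesis using that by blast
qed

lemma polyfun_unit:
  assumes "polyfun P"
  obtains p where "\<And>t. P (\<lambda>_ :: unit. t) = poly p t"
  using polyfun_line[OF assms, of "\<lambda>_. 0" "\<lambda>_. 1"] by auto

lemma poly_neq_zero_infinite: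
  fixes p :: "'k::field_char_0 poly"
  assumes "p \<noteq> 0" "finite T"
  obtains t where "poly p t \<noteq> 0" "t \<notin> T"
proof -
  have "finite ({t. poly p t = 0} \<union> T)" using assms poly_roots_finite by blast
  from ex_new_if_finite[OF infinite_UNIV_char_0 this] show ?thesis using that by blast
qed

text \<open>On the line from \<open>a\<close> to \<open>b\<close> both functions become nonzero
  polynomials in one variable, and so does their product.\<close>

lemma polyfun_nonzero_common:
  fixes f g :: "('i \<Rightarrow> 'k::field_char_0) \<Rightarrow> 'k"
  assumes "polyfun f" "polyfun g" "f a \<noteq> 0" "g b \<noteq> 0"
  obtains c where "f c \<noteq> 0" "g c \<noteq> 0"
proof -
  let ?c = "\<lambda>t i. a i + t * (b i - a i)"
  obtain p where p: "\<And>t. f (?c t) = poly p t" using polyfun_line[OF assms(1)] by metis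
  obtain q where q: "\<And>t. g (?c t) = poly q t" using polyfun_line[OF assms(2)] by metis
  have "poly p 0 \<noteq> 0" "poly q 1 \<noteq> 0" using p[of 0] q[of 1] assms by simp_all
  then have "p * q \<noteq> 0" by auto
  then obtain t where "poly (p * q) t \<noteq> 0" using poly_neq_zero_infinite[of "p * q" "{}"] by auto
  then show ?thesis using that[of "?c t"] p q by simp
qed

lemma openin_zariskiE:
  assumes "openin zariski U" "x \<in> U"
  obtains f where "polyfun f" "f x \<noteq> 0" "{v. f v \<noteq> 0} \<subseteq> U"
proof -
  from bspec[OF assms(1)[unfolded openin_zariski] assms(2)] show ?thesis
    by (elim exE conjE) (rule that)
qed

lemma zariski_irreducible:
  fixes U V :: "('i::finite \<Rightarrow> 'k::field_char_0) set"
  assumes "openin zariski U" "openin zariski V" "U \<noteq> {}" "V \<noteq> {}"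
  shows "U \<inter> V \<noteq> {}"
proof -
  obtain a b where "a \<in> U" "b \<in> V" using assms by blast
  obtain f where f: "polyfun f" "f a \<noteq> 0" "{v. f v \<noteq> 0} \<subseteq> U"
    using openin_zariskiE[OF assms(1) \<open>a \<in> U\<close>] by metis
  obtain g where g: "polyfun g" "g b \<noteq> 0" "{v. g v \<noteq> 0} \<subseteq> V"
    using openin_zariskiE[OF assms(2) \<open>b \<in> V\<close>] by metis
  obtain c where "f c \<noteq> 0" "g c \<noteq> 0" 
    using polyfun_nonzero_common[of f g a b] f g by blast
  then show ?thesis using f g by blast
qed

text \<open>Divisibility of \<open>P v - P (v(i := 0))\<close> by the coordinate \<open>v i\<close>.
  The quotient is built by induction, since \<open>polyfun\<close> is a predicate on functions and
  not on formal polynomials.\<close>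

lemma polyfun_split_coordinate:
  assumes "polyfun P"
  obtains Q where "polyfun Q" "\<And>v. P v = P (v(i := 0)) + v i * Q v"
proof -
  from assms have "\<exists>Q. polyfun Q \<and> (\<forall>v. P v = P (v(i := 0)) + v i * Q v)"
  proof induction
    case (const a)
    show ?case by (rule exI[of _ "\<lambda>_. 0"]) (simp add: polyfun.const)
  next
    case (coord j)
    show ?case by (rule exI[of _ "\<lambda>_. if i = j then 1 else 0"]) (simp add: polyfun.const)
  next
    case (add f g)
    then obtain Q R where QR: "polyfun Q" "polyfun R" "\<And>v. f v = f (v(i := 0)) + v i * Q v"
      "\<And>v. g v = g (v(i := 0)) + v i * R v" by metis
    have "f v + g v = f (v(i := 0)) + g (v(i := 0)) + v i * (Q v + R v)" for v
      using QR(3,4)[of v] by (simp add: algebra_simps)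
    then show ?case using QR by (metis (no_types, lifting) polyfun.add)
  next
    case (mult f g)
    then obtain Q R where QR: "polyfun Q" "polyfun R" "\<And>v. f v = f (v(i := 0)) + v i * Q v"
      "\<And>v. g v = g (v(i := 0)) + v i * R v" by metis
    \<comment> \<open>The factor \<open>g v - v i * R v\<close> is \<open>g (v(i := 0))\<close>,
      written as a polynomial in terms already available.\<close>
    have "f v * g v = f (v(i := 0)) * g (v(i := 0)) + v i * (f v * R v + Q v * (g v - v i * R v))" for v
      unfolding QR(3)[of v] QR(4)[of v] by (simp add: algebra_simps)
    moreover have "polyfun (\<lambda>v. f v * R v + Q v * (g v - v i * R v))"
      using mult.hyps QR by (intro polyfun_intros)
    ultimately show ?case by blast
  qed
  then show ?thesis using that by blast
qed

text \<open>A function that is regular on the affine line and has a pole of order at most \<open>d\<close> at infinity.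
  The exceptional set \<open>T\<close> consists of parameters where the values of \<open>f\<close> are irrelevant.\<close>

lemma regular_on_line_is_poly:
  fixes f :: "'k::{alg_closed_field, field_char_0} \<Rightarrow> 'k"
  assumes T: "finite T"
    and loc: "\<And>t. \<exists>a b. poly b t \<noteq> 0 \<and> (\<forall>s. s \<notin> T \<longrightarrow> poly b s \<noteq> 0 \<longrightarrow> f s = poly a s / poly b s)"
    and inf: "\<exists>a b. poly b 0 \<noteq> 0 \<and>
      (\<forall>s. s \<noteq> 0 \<longrightarrow> 1 / s \<notin> T \<longrightarrow> poly b s \<noteq> 0 \<longrightarrow> s ^ d * f (1 / s) = poly a s / poly b s)"
  shows "\<exists>p. degree p \<le> d \<and> (\<forall>t. t \<notin> T \<longrightarrow> f t = poly p t) \<and>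
    (\<forall>t a b. poly b t \<noteq> 0 \<longrightarrow> (\<forall>s. s \<notin> T \<longrightarrow> poly b s \<noteq> 0 \<longrightarrow> f s = poly a s / poly b s) \<longrightarrow>
       poly p t = poly a t / poly b t)"
proof -
  \<comment> \<open>\<open>R a b\<close> says that \<open>f\<close> equals \<open>a / b\<close> up
    to finitely many parameters. By \<open>eq\<close>, this determines the fraction.\<close>
  define R where "R a b \<longleftrightarrow> b \<noteq> 0 \<and> finite {s. f s * poly b s \<noteq> poly a s}" for a b :: "'k poly"
  have eq: "a * b' = a' * b" if "R a b" "R a' b'" for a b a' b'
  proof (rule ccontr)
    assume "a * b' \<noteq> a' * b"
    then have 1: "a * b' - a' * b \<noteq> 0" by simp
    have 2: "finite ({s. f s * poly b s \<noteq> poly a s} \<union> {s. f s * poly b' s \<noteq> poly a' s})"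
      using that by (simp add: R_def)
    obtain t where t: "poly (a * b' - a' * b) t \<noteq> 0"
      "t \<notin> {s. f s * poly b s \<noteq> poly a s} \<union> {s. f s * poly b' s \<noteq> poly a' s}"
      using poly_neq_zero_infinite[OF 1 2] by blast
    then have "poly a t = f t * poly b t" "poly a' t = f t * poly b' t" by auto
    then show False using t(1) by simp
  qed
  have local: "R a b" if "poly b t \<noteq> 0" "\<And>s. s \<notin> T \<Longrightarrow> poly b s \<noteq> 0 \<Longrightarrow> f s = poly a s / poly b s" for a b t
  proof -
    have b: "b \<noteq> 0" using that by auto
    have "{s. f s * poly b s \<noteq> poly a s} \<subseteq> T \<union> {s. poly b s = 0}"
    proof
      fix s assume s: "s \<in> {s. f s * poly b s \<noteq> poly a s}"
      show "s \<in> T \<union> {s. poly b s = 0}"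
      proof (rule ccontr)
        assume "s \<notin> T \<union> {s. poly b s = 0}"
        then show False using that(2)[of s] s by simp
      qed
    qed
    then have "finite {s. f s * poly b s \<noteq> poly a s}" using T poly_roots_finite[OF b]
      by (meson finite_UnI finite_subset)
    then show ?thesis using b by (simp add: R_def)
  qed
  obtain a0 b0 where "R a0 b0" using loc[of 0] local by metis
  \<comment> \<open>A denominator of least degree is constant: at a root \<open>t\<close> of it, the
    local representation at \<open>t\<close> shows that the numerator vanishes too, and a common
    linear factor could be cancelled.\<close>
  define n where "n = (LEAST n. \<exists>a b. R a b \<and> degree b = n)"
  have "\<exists>a b. R a b \<and> degree b = n"
    unfolding n_def by (rule LeastI[of _ "degree b0"]) (use \<open>R a0 b0\<close> in blast)
  then obtain a b where ab: "R a b" "degree b = n" by blast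
  have min: "n \<le> degree b'" if "R a' b'" for a' b'
    unfolding n_def by (rule Least_le) (use that in blast)
  have "degree b = 0"
  proof (rule ccontr)
    assume "degree b \<noteq> 0"
    then obtain t where t: "poly b t = 0" using alg_closed_imp_poly_has_root[of b] by auto
    obtain a' b' where 1: "poly b' t \<noteq> 0" "\<And>s. s \<notin> T \<Longrightarrow> poly b' s \<noteq> 0 \<Longrightarrow> f s = poly a' s / poly b' s"
      using loc[of t] by metis
    have "a * b' = a' * b" using eq[OF ab(1) local[OF 1]] .
    then have "poly a t * poly b' t = poly a' t * poly b t" by (metis poly_mult)
    then have "poly a t = 0" using t 1(1) by simp
    then obtain c where c: "a = [:- t, 1:] * c" unfolding poly_eq_0_iff_dvd by blast
    obtain e where e: "b = [:- t, 1:] * e" using t unfolding poly_eq_0_iff_dvd by blast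
    have e0: "e \<noteq> 0" using ab(1) e by (auto simp: R_def)
    have "{s. f s * poly e s \<noteq> poly c s} \<subseteq> {s. f s * poly b s \<noteq> poly a s} \<union> {t}"
    proof
      fix s assume s: "s \<in> {s. f s * poly e s \<noteq> poly c s}"
      have "f s * poly b s - poly a s = (s - t) * (f s * poly e s - poly c s)"
        by (simp add: c e algebra_simps)
      then show "s \<in> {s. f s * poly b s \<noteq> poly a s} \<union> {t}" using s by auto
    qed
    then have "R c e" using ab(1) e0 finite_subset unfolding R_def by blast
    moreover have "degree b = Suc (degree e)" unfolding e using e0 by (simp add: degree_mult_eq del: mult_pCons_left)
    ultimately show False using min ab(2) by fastforce
  qed
  then obtain \<beta> where \<beta>: "b = [:\<beta>:]" by (metis degree_eq_zeroE)
  with ab(1) have "\<beta> \<noteq> 0" by (auto simp: R_def)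
  define p where "p = smult (inverse \<beta>) a"
  have p: "R p 1"
  proof -
    have "{s. f s * poly 1 s \<noteq> poly p s} = {s. f s * poly b s \<noteq> poly a s}"
      using \<open>\<beta> \<noteq> 0\<close> by (auto simp: p_def \<beta> field_simps)
    then show ?thesis using ab(1) by (simp add: R_def)
  qed
  \<comment> \<open>At parameters of \<open>T\<close> the value of \<open>f\<close> means nothing,
    but every local representation of \<open>f\<close> still has the value of \<open>p\<close>
    there. This detects zeros at blown-up points.\<close>
  have val: "poly p t = poly a t / poly b t"
    if "poly b t \<noteq> 0" "\<And>s. s \<notin> T \<Longrightarrow> poly b s \<noteq> 0 \<Longrightarrow> f s = poly a s / poly b s" for t a b
    using eq[OF p local[OF that]] that(1) by (metis mult_1_right nonzero_eq_divide_eq poly_mult)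
  have fp: "f t = poly p t" if "t \<notin> T" for t
  proof -
    obtain a b where 1: "poly b t \<noteq> 0" "\<And>s. s \<notin> T \<Longrightarrow> poly b s \<noteq> 0 \<Longrightarrow> f s = poly a s / poly b s"
      using loc[of t] by metis
    show ?thesis using val[OF 1] 1(2)[OF that 1(1)] by simp
  qed
  have deg: "degree p \<le> d"
  proof (rule ccontr)
    assume "\<not> degree p \<le> d"
    then obtain m where m: "degree p = d + Suc m" by (metis add_Suc_right less_imp_Suc_add not_le)
    obtain a b where b: "poly b 0 \<noteq> 0" and
      ab: "\<And>s. s \<noteq> 0 \<Longrightarrow> 1 / s \<notin> T \<Longrightarrow> poly b s \<noteq> 0 \<Longrightarrow> s ^ d * f (1 / s) = poly a s / poly b s"
      using inf by metis
    \<comment> \<open>If the degree were \<open>d + m + 1\<close>, then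
      \<open>s ^ d * f (1 / s)\<close> would be the reversed polynomial divided by
      \<open>s ^ (m + 1)\<close>. At 0 the reversed polynomial takes the leading coefficient of
      \<open>p\<close>, which is nonzero, against regularity there.\<close>
    have "reflect_poly p * b = monom 1 (Suc m) * a"
    proof (rule ccontr)
      assume "reflect_poly p * b \<noteq> monom 1 (Suc m) * a"
      then have ne: "(reflect_poly p * b - monom 1 (Suc m) * a) * b \<noteq> 0" using b by auto
      have "finite ((\<lambda>s. 1 / s) ` T \<union> {0})" using T by simp
      from poly_neq_zero_infinite[OF ne this] obtain s where
        s: "poly ((reflect_poly p * b - monom 1 (Suc m) * a) * b) s \<noteq> 0" "s \<notin> (\<lambda>s. 1 / s) ` T \<union> {0}" .
      then have "s \<noteq> 0" "1 / s \<notin> T" "poly b s \<noteq> 0"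
        using image_eqI[of s "\<lambda>s. 1 / s" "1 / s" T] by auto
      then have "s ^ d * poly p (1 / s) * poly b s = poly a s" using ab[of s] fp[of "1 / s"] by simp
      moreover have "poly (reflect_poly p) s = s ^ Suc m * (s ^ d * poly p (1 / s))"
        using \<open>s \<noteq> 0\<close> by (simp add: poly_reflect_poly_nz m inverse_eq_divide power_add mult_ac)
      ultimately show False using s(1) by (simp add: poly_monom mult_ac)
    qed
    then have "poly (reflect_poly p * b) 0 = 0" by (simp add: poly_monom)
    then show False using b m leading_coeff_0_iff[of p] by auto
  qed
  show ?thesis
  proof (intro exI conjI allI impI)
    show "degree p \<le> d" by (rule deg)
    show "f t = poly p t" if "t \<notin> T" for t using that by (rule fp)
    show "poly p t = poly a t / poly b t"
      if *: "poly b t \<noteq> 0" "\<forall>s. s \<notin> T \<longrightarrow> poly b s \<noteq> 0 \<longrightarrow> f s = poly a s / poly b s" for t a b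
    proof (rule val[OF *(1)])
      show "f s = poly a s / poly b s" if "s \<notin> T" "poly b s \<noteq> 0" for s using *(2) that by blast
    qed
  qed
qed

section \<open>Charts and local equations\<close>

context function_space
begin

lemma local_equation_trivial:
  assumes "openin (ktop X) V" "V \<inter> C = {}"
  shows "local_equation X C V (\<lambda>_. 1)"
  unfolding local_equation_def using assms by (auto intro: regular_const)

end

text \<open>Off the hyperplane \<open>g y / y i\<close> is regular. At a point on it write
  \<open>g = P / Q\<close>; then \<open>P\<close> vanishes on the hyperplane and is divisible by the
  coordinate. The pieces glue because the complement of the hyperplane is dense.\<close>

lemma regular_coordinate_factor:
  fixes i :: "'i::finite" and g :: "('i \<Rightarrow> 'k::field_char_0) \<Rightarrow> 'k"
  assumes W: "openin zariski W" and g: "regular affine_sp W g" and van: "\<And>y. y \<in> W \<Longrightarrow> y i = 0 \<Longrightarrow> g y = 0"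
  obtains h where "regular affine_sp W h" "\<And>y. y \<in> W \<Longrightarrow> g y = h y * y i"
proof -
  interpret function_space "affine_sp :: ('i \<Rightarrow> 'k, 'k) kspace" by (rule function_space_affine_sp)
  let ?G = "{v :: 'i \<Rightarrow> 'k. v i \<noteq> 0}"
  have oG: "openin zariski ?G" by (intro openin_zariski_nonzero polyfun.coord)
  have "(\<lambda>_. 1) \<in> ?G" by simp
  then have "\<exists>v. v \<in> ?G" by (rule exI[of _ "\<lambda>_. 1"])
  then have "?G \<noteq> {}" unfolding ex_in_conv .
  then have dense: "W \<inter> ?G \<noteq> {}" if "openin (ktop affine_sp) W" "W \<noteq> {}" for W
    using zariski_irreducible[of W ?G] oG that by simp

    have "\<exists>V h. openin (ktop affine_sp) V \<and> x \<in> V \<and> regular affine_sp V h \<and>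
      (\<forall>y\<in>V \<inter> W \<inter> ?G. g y / y i = h y)" if x: "x \<in> W" for x
    proof (cases "x i = 0")
      case False
      have "openin (ktop affine_sp) (W \<inter> ?G)" using W oG by auto
      moreover have "regular affine_sp (W \<inter> ?G) (\<lambda>y. g y / y i)"
      proof (rule regular_divide)
        show "regular affine_sp (W \<inter> ?G) g" using g calculation by (rule regular_subset) auto
        show "regular affine_sp (W \<inter> ?G) (\<lambda>y. y i)"
          using regular_affine_sp_polyfun[OF polyfun.coord[of i]] calculation by (rule regular_subset) auto
      qed auto
      ultimately show ?thesis using x False
        by (intro exI[of _ "W \<inter> ?G"] exI[of _ "\<lambda>y. g y / y i"]) auto
    next
      case True
      obtain P Q where PQ: "polyfun P" "polyfun Q" "Q x \<noteq> 0" "{y. Q y \<noteq> 0} \<subseteq> W"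
        "\<And>y. Q y \<noteq> 0 \<Longrightarrow> g y = P y / Q y" using regular_affine_spE[OF g x] by metis
      have pf: "polyfun (\<lambda>v. F (v(i := 0)))" if "polyfun F" for F :: "('i \<Rightarrow> 'k) \<Rightarrow> 'k"
        using that
      proof (rule polyfun_compose)
        show "polyfun (\<lambda>v. (v(i := 0)) j)" for j by (cases "j = i") (auto intro: polyfun.intros)
      qed
      \<comment> \<open>\<open>P\<close> vanishes on the whole hyperplane, not only near
        \<open>x\<close>: from a hyperplane point with \<open>P\<close> nonzero and from
        \<open>x\<close>, where \<open>Q\<close> is nonzero, one gets a hyperplane point where both
        are nonzero, and it lies in \<open>W\<close>.\<close>
      have P0: "P (v(i := 0)) = 0" for v
      proof (rule ccontr)
        assume "P (v(i := 0)) \<noteq> 0"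
        moreover have "Q (x(i := 0)) \<noteq> 0" using PQ(3) True by (metis fun_upd_triv)
        ultimately obtain c where c: "P (c(i := 0)) \<noteq> 0" "Q (c(i := 0)) \<noteq> 0"
          using polyfun_nonzero_common[of "\<lambda>v. P (v(i := 0))" "\<lambda>v. Q (v(i := 0))" v x, OF pf[OF PQ(1)] pf[OF PQ(2)]] by metis
        then have "g (c(i := 0)) = 0" using van[of "c(i := 0)"] PQ(4) by auto
        then show False using PQ(5)[OF c(2)] c by simp
      qed
      obtain R where R: "polyfun R" "\<And>v. P v = P (v(i := 0)) + v i * R v"
        using polyfun_split_coordinate[OF PQ(1)] by metis
      let ?V = "{y. Q y \<noteq> 0}"
      have o: "openin (ktop affine_sp) ?V" using openin_zariski_nonzero[OF PQ(2)] by simp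
      have "regular affine_sp ?V (\<lambda>y. R y / Q y)"
      proof (rule regular_divide)
        show "regular affine_sp ?V R"
          using regular_affine_sp_polyfun[OF R(1)] o by (rule regular_subset) auto
        show "regular affine_sp ?V Q"
          using regular_affine_sp_polyfun[OF PQ(2)] o by (rule regular_subset) auto
      qed simp
      moreover have "\<forall>y\<in>?V \<inter> W \<inter> ?G. g y / y i = R y / Q y"
      proof
        fix y assume "y \<in> ?V \<inter> W \<inter> ?G"
        moreover have "P y = y i * R y" using R(2)[of y] P0[of y] by simp
        ultimately show "g y / y i = R y / Q y" using PQ(5)[of y] by simp
      qed
      ultimately show ?thesis using o PQ(3) by (intro exI[of _ ?V] exI[of _ "\<lambda>y. R y / Q y"]) auto
    qed
    from regular_glue[OF dense, of W "\<lambda>y. g y / y i", OF _ _ _ this]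
    obtain h where h: "regular affine_sp W h" "\<And>y. y \<in> W \<Longrightarrow> y \<in> ?G \<Longrightarrow> h y = g y / y i"
      using W by auto
    have "g y = h y * y i" if "y \<in> W" for y
      using h(2)[OF that] van[OF that] by (cases "y i = 0") auto
    with h(1) show ?thesis by (rule that)
qed

text \<open>A function vanishing on \<open>C\<close> is pulled back along \<open>\<gamma>\<close> to
  an open set of affine space, divided by the coordinate there, and the quotient is pulled back
  along \<open>\<kappa>\<close>.\<close>

lemma local_equation_chart:
  fixes \<kappa> :: "'x \<Rightarrow> 'i::finite \<Rightarrow> 'k::field_char_0" and \<gamma> :: "('i \<Rightarrow> 'k) \<Rightarrow> 'x"
  assumes X: "function_space X" and V: "openin (ktop X) V" and N: "openin zariski N"
    and \<kappa>: "\<And>j. regular X V (\<lambda>z. \<kappa> z j)" and \<gamma>: "morphism (subsp affine_sp N) X \<gamma>"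
    and inv: "\<And>z. z \<in> V \<Longrightarrow> \<kappa> z \<in> N" "\<And>z. z \<in> V \<Longrightarrow> \<gamma> (\<kappa> z) = z"
    and C: "\<And>z. z \<in> V \<Longrightarrow> z \<in> C \<Longrightarrow> \<kappa> z i = 0" "\<And>v. v \<in> N \<Longrightarrow> v i = 0 \<Longrightarrow> \<gamma> v \<in> C"
  shows "local_equation X C V (\<lambda>z. \<kappa> z i)"
proof -
  interpret function_space X by fact
  interpret A: function_space "affine_sp :: ('i \<Rightarrow> 'k, 'k) kspace" by (rule function_space_affine_sp)
  interpret VX: function_space "subsp X V" by (rule function_space_subsp)
  have topV: "topspace (ktop (subsp X V)) = V" using openin_subset[OF V] by auto
  have \<kappa>V: "regular (subsp X V) V (\<lambda>z. \<kappa> z j)" for j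
    using \<kappa> V by (simp add: regular_subsp_open)
  have \<kappa>m: "morphism (subsp X V) affine_sp \<kappa>"
    by (rule VX.morphism_into_affine_sp) (unfold topV, rule \<kappa>V)
  have "\<exists>h. regular X W h \<and> (\<forall>y\<in>W. g y = h y * \<kappa> y i)"
    if W: "openin (ktop X) W" "W \<subseteq> V" and g: "regular X W g" and van: "\<forall>y\<in>W \<inter> C. g y = 0" for W g
  proof -
    let ?W = "{v \<in> topspace (ktop (subsp affine_sp N)). \<gamma> v \<in> W}"
    have g': "regular affine_sp ?W (g \<circ> \<gamma>)"
      using morphism_regular_preimage[OF \<gamma> W(1) g] N by (simp add: A.regular_subsp_open)
    have oW: "openin zariski ?W" using A.regular_openin[OF g'] by simp
    obtain h where h: "regular affine_sp ?W h" "\<And>v. v \<in> ?W \<Longrightarrow> (g \<circ> \<gamma>) v = h v * v i"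
      by (rule regular_coordinate_factor[OF oW g', of i]) (use van C(2) in auto)
    have pre: "{z \<in> topspace (ktop (subsp X V)). \<kappa> z \<in> ?W} = W"
      unfolding topV using W(2) inv by auto
    have "regular (subsp X V) W (h \<circ> \<kappa>)"
      using morphism_regular_preimage[OF \<kappa>m _ h(1)] oW unfolding pre by simp
    then have "regular X W (h \<circ> \<kappa>)" using V by (simp add: regular_subsp_open)
    moreover have "g y = (h \<circ> \<kappa>) y * \<kappa> y i" if "y \<in> W" for y
    proof -
      have "y \<in> V" using that W(2) by blast
      then have "\<kappa> y \<in> ?W" using inv[of y] that by simp
      then show ?thesis using h(2)[of "\<kappa> y"] inv(2)[OF \<open>y \<in> V\<close>] by simp
    qed
    ultimately show ?thesis by blast
  qed
  then show ?thesis unfolding local_equation_def using V \<kappa> C(1) by simp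
qed

section \<open>Vectors in three-space and powers of the projective plane\<close>

definition vdot :: "'k::field ^ 3 \<Rightarrow> 'k ^ 3 \<Rightarrow> 'k" where
  "vdot a u = a $ 1 * u $ 1 + a $ 2 * u $ 2 + a $ 3 * u $ 3"

text \<open>The cross product: the line joining two points, and dually the common point of two
  lines.\<close>

definition cr :: "'k::field ^ 3 \<Rightarrow> 'k ^ 3 \<Rightarrow> 'k ^ 3" where
  "cr u v = vector [u $ 2 * v $ 3 - u $ 3 * v $ 2, u $ 3 * v $ 1 - u $ 1 * v $ 3, u $ 1 * v $ 2 - u $ 2 * v $ 1]"

definition det3 :: "'k::field ^ 3 \<Rightarrow> 'k ^ 3 \<Rightarrow> 'k ^ 3 \<Rightarrow> 'k" where
  "det3 u v w = vdot u (cr v w)"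

lemmas vec3_defs = det3_def vdot_def cr_def vec_eq_iff forall_3 vector_3
  vector_add_component vector_minus_component vector_uminus_component vector_smult_component zero_index

lemma vdot_add: "vdot a (u + w) = vdot a u + vdot a w"
  by (simp add: vec3_defs algebra_simps)

lemma vdot_scale: "vdot a (c *s u) = c * vdot a u"
  by (simp add: vec3_defs algebra_simps)

lemma vdot_scale_left: "vdot (c *s a) u = c * vdot a u"
  by (simp add: vec3_defs algebra_simps)

lemma vdot_commute: "vdot a u = vdot u a"
  by (simp add: vec3_defs)

lemma vdot_zero [simp]: "vdot a 0 = 0" "vdot 0 a = 0"
  by (simp_all add: vec3_defs)

lemma cr_scale: "cr a (c *s u) = c *s cr a u"
  by (simp add: vec3_defs algebra_simps)

lemma cr_scale_left: "cr (c *s a) u = c *s cr a u"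
  by (simp add: vec3_defs algebra_simps)

lemma cr_zero [simp]: "cr a 0 = 0" "cr 0 a = 0" "cr a a = 0"
  by (simp_all add: vec3_defs)

lemma vdot_cr_self [simp]: "vdot (cr a b) a = 0" "vdot (cr a b) b = 0" "vdot a (cr a b) = 0" "vdot b (cr a b) = 0"
  by (simp_all add: vec3_defs algebra_simps)

lemma cr_antisym: "cr a b = (- 1) *s cr b a"
  by (simp add: vec3_defs algebra_simps)

lemma cr_eq_0_commute: "cr a b = 0 \<longleftrightarrow> cr b a = 0"
  by (auto simp: vec3_defs algebra_simps)

lemma det3_eq_0 [simp]: "det3 a a b = 0" "det3 a b a = 0" "det3 b a a = 0"
  by (simp_all add: vec3_defs algebra_simps)

lemma det3_rotate: "det3 a b c = det3 b c a"
  by (simp add: vec3_defs algebra_simps)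

lemma det3_swap: "det3 a b c = - det3 b a c" "det3 a b c = - det3 a c b"
  by (simp_all add: vec3_defs algebra_simps)

lemma det3_linear:
  "det3 (u + w) b c = det3 u b c + det3 w b c" "det3 (t *s u) b c = t * det3 u b c"
  "det3 a (u + w) c = det3 a u c + det3 a w c" "det3 a (t *s u) c = t * det3 a u c"
  "det3 a b (u + w) = det3 a b u + det3 a b w" "det3 a b (t *s u) = t * det3 a b u"
  by (simp_all add: vec3_defs algebra_simps)

lemma cr_eq_0:
  assumes "cr u w = 0" "u \<noteq> 0"
  obtains c where "w = c *s u"
proof -
  have eqs: "u $ 2 * w $ 3 = u $ 3 * w $ 2" "u $ 3 * w $ 1 = u $ 1 * w $ 3" "u $ 1 * w $ 2 = u $ 2 * w $ 1"
    using assms(1) by (simp_all add: vec3_defs)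
  consider "u $ 1 \<noteq> 0" | "u $ 2 \<noteq> 0" | "u $ 3 \<noteq> 0" using assms(2) by (auto simp: vec3_defs)
  then show ?thesis
  proof cases
    case 1
    then have "w = (w $ 1 / u $ 1) *s u" using eqs by (simp add: vec3_defs field_simps)
    then show ?thesis by (rule that)
  next
    case 2
    then have "w = (w $ 2 / u $ 2) *s u" using eqs by (simp add: vec3_defs field_simps)
    then show ?thesis by (rule that)
  next
    case 3
    then have "w = (w $ 3 / u $ 3) *s u" using eqs by (simp add: vec3_defs field_simps)
    then show ?thesis by (rule that)
  qed
qed

lemma vdot_cr_expand: "cr (cr u w) a = vdot u a *s w - vdot w a *s u"
  by (simp add: vec3_defs algebra_simps)

lemma vdot_eq_0_all:
  assumes "\<And>a. vdot a u = 0"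
  shows "u = 0"
  using assms[of "vector [1, 0, 0]"] assms[of "vector [0, 1, 0]"] assms[of "vector [0, 0, 1]"]
  by (simp add: vec3_defs)

lemma span_single: "vec.span {u} = {c *s u | c. True}"
  by (auto simp: vec.span_singleton)

lemma on_line_span: "on_line a (vec.span {u}) \<longleftrightarrow> vdot a u = 0"
proof -
  have "on_line a (vec.span {u}) \<longleftrightarrow> (\<forall>c. c * vdot a u = 0)"
    unfolding on_line_def span_single
    by (auto simp: vdot_def sum_3 algebra_simps)
  then show ?thesis by (metis mult_1 mult_zero_right)
qed

lemma span_scale:
  assumes "c \<noteq> 0"
  shows "vec.span {c *s u} = vec.span {u :: 'k::field ^ 3}"
proof -
  have "\<exists>k'. k *s u = k' *s (c *s u)" for k
    by (rule exI[of _ "k / c"]) (simp add: vector_smult_assoc assms)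
  moreover have "\<exists>k'. k *s (c *s u) = k' *s u" for k
    by (rule exI[of _ "k * c"]) (simp add: vector_smult_assoc)
  ultimately show ?thesis unfolding span_single by blast
qed

lemma span_eqD:
  assumes "vec.span {u} = vec.span {w}" "w \<noteq> 0"
  obtains c where "c \<noteq> 0" "w = c *s (u :: 'k::field ^ 3)"
proof -
  have "w \<in> vec.span {u}" using assms(1) vec.span_base[of w "{w}"] by simp
  then obtain c where "w = c *s u" unfolding span_single by auto
  moreover then have "c \<noteq> 0" using assms(2) by auto
  ultimately show ?thesis using that by blast
qed

lemma span_eq_iff:
  assumes "u \<noteq> 0" "w \<noteq> 0"
  shows "vec.span {u} = vec.span {w} \<longleftrightarrow> cr u w = 0"
proof
  assume "vec.span {u} = vec.span {w}"
  then obtain c where "w = c *s u" using span_eqD assms(2) by metis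
  then show "cr u w = 0" by (simp add: cr_scale)
next
  assume "cr u w = 0"
  then obtain c where c: "w = c *s u" using cr_eq_0 assms(1) by metis
  then have "c \<noteq> 0" using assms(2) by auto
  then show "vec.span {u} = vec.span {w}" unfolding c by (simp add: span_scale)
qed

lemma span_orthogonal:
  assumes "vdot l u = 0" "vdot l w = 0" "cr u w \<noteq> 0" "l \<noteq> 0"
  shows "vec.span {l} = vec.span {cr u w}"
proof -
  have "cr (cr u w) l = 0"
    using assms(1,2) by (simp add: vdot_cr_expand vdot_commute[of _ l])
  then show ?thesis using span_eq_iff[OF assms(4,3)] cr_eq_0_commute by blast
qed

text \<open>Any nonzero vector of the line will do: \<open>ratio\<close> and the open sets defined
  from it are unchanged by rescaling.\<close>

definition rv :: "('k::field ^ 3) set \<Rightarrow> 'k ^ 3" where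
  "rv P = (SOME u. u \<noteq> 0 \<and> P = vec.span {u})"

lemma rv_span:
  assumes "u \<noteq> 0"
  shows "rv (vec.span {u}) \<noteq> 0" "vec.span {rv (vec.span {u})} = vec.span {u}"
proof -
  have "rv (vec.span {u}) \<noteq> 0 \<and> vec.span {u} = vec.span {rv (vec.span {u})}"
    unfolding rv_def by (rule someI[of _ u]) (use assms in auto)
  then show "rv (vec.span {u}) \<noteq> 0" "vec.span {rv (vec.span {u})} = vec.span {u}" by auto
qed

lemma rv_scale:
  assumes "u \<noteq> 0"
  obtains c where "c \<noteq> 0" "rv (vec.span {u}) = c *s u"
  using span_eqD[of u "rv (vec.span {u})"] rv_span[OF assms] by metis

section \<open>Powers of the plane as quotients of cones, and homogeneous forms\<close>

definition pcone :: "('i \<times> 3 \<Rightarrow> 'k::field) set" where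
  "pcone = {v. \<forall>i. \<exists>a. v (i, a) \<noteq> 0}"

definition lines :: "('i \<times> 3 \<Rightarrow> 'k::field) \<Rightarrow> 'i \<Rightarrow> ('k ^ 3) set" where
  "lines v = (\<lambda>i. vec.span {\<chi> a. v (i, a)})"

lemma proj_power_eq: "proj_power = quotsp (subsp affine_sp pcone) lines"
  by (simp add: proj_power_def pcone_def lines_def[abs_def])

lemma pcone_vec: "v \<in> pcone \<longleftrightarrow> (\<forall>i. (\<chi> a. v (i, a)) \<noteq> 0)"
  by (simp add: pcone_def vec_eq_iff)

lemma openin_zariski_Collect_ex:
  "(\<And>j. polyfun (f j)) \<Longrightarrow> openin zariski {v. \<exists>j. f j v \<noteq> 0}"
proof -
  assume "\<And>j. polyfun (f j)"
  then have "openin zariski (\<Union>j. {v. f j v \<noteq> 0})"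
    by (intro openin_Union) (auto intro: openin_zariski_nonzero)
  moreover have "(\<Union>j. {v. f j v \<noteq> 0}) = {v. \<exists>j. f j v \<noteq> 0}" by auto
  ultimately show ?thesis by simp
qed

lemma openin_zariski_Collect_all:
  assumes "\<And>i :: 'a::finite. openin zariski {v. P i v}"
  shows "openin zariski {v. \<forall>i. P i v}"
proof -
  have "openin zariski (\<Inter>i. {v. P i v})" using assms by (intro openin_INT2) auto
  moreover have "(\<Inter>i. {v. P i v}) = {v. \<forall>i. P i v}" by auto
  ultimately show ?thesis by simp
qed

lemma openin_pcone: "openin zariski (pcone :: ('i::finite \<times> 3 \<Rightarrow> 'k::field) set)"
  unfolding pcone_def
  by (intro openin_zariski_Collect_all openin_zariski_Collect_ex polyfun.coord)

lemma topspace_proj_power: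
  "z \<in> topspace (ktop (proj_power :: ('i::finite \<Rightarrow> ('k::field ^ 3) set, 'k) kspace)) \<longleftrightarrow>
     (\<forall>i. \<exists>u. u \<noteq> 0 \<and> z i = vec.span {u})"
proof
  assume "z \<in> topspace (ktop (proj_power :: ('i \<Rightarrow> ('k ^ 3) set, 'k) kspace))"
  then obtain v where "v \<in> pcone" "z = lines v" by (auto simp: proj_power_eq)
  then show "\<forall>i. \<exists>u. u \<noteq> 0 \<and> z i = vec.span {u}" unfolding pcone_vec lines_def by blast
next
  assume "\<forall>i. \<exists>u. u \<noteq> 0 \<and> z i = vec.span {u}"
  then obtain u where u: "\<And>i. u i \<noteq> 0" "\<And>i. z i = vec.span {u i}" by metis
  let ?v = "\<lambda>(i, a). u i $ a"
  have "?v \<in> pcone" "lines ?v = z" using u by (simp_all add: pcone_vec lines_def fun_eq_iff)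
  then show "z \<in> topspace (ktop (proj_power :: ('i \<Rightarrow> ('k ^ 3) set, 'k) kspace))"
    by (auto simp: proj_power_eq intro!: image_eqI[of z lines ?v])
qed

lemma function_space_proj_power:
  "function_space (proj_power :: ('i::finite \<Rightarrow> ('k::field ^ 3) set, 'k) kspace)"
  unfolding proj_power_eq
  by (intro function_space.function_space_quotsp function_space.function_space_subsp function_space_affine_sp)

lemma openin_proj_power:
  "openin (ktop proj_power) V \<longleftrightarrow>
     V \<subseteq> topspace (ktop proj_power) \<and> openin zariski {v :: 'i::finite \<times> 3 \<Rightarrow> 'k::field. v \<in> pcone \<and> lines v \<in> V}"
  unfolding proj_power_eq
  by (auto simp: openin_quot_topology openin_open_subtopology[OF openin_pcone])

lemma regular_proj_power:
  "regular proj_power V f \<longleftrightarrow> openin (ktop proj_power) V \<and>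
     regular affine_sp {v :: 'i::finite \<times> 3 \<Rightarrow> 'k::field. v \<in> pcone \<and> lines v \<in> V} (f \<circ> lines)"
proof -
  interpret function_space "affine_sp :: ('i \<times> 3 \<Rightarrow> 'k, 'k) kspace" by (rule function_space_affine_sp)
  show ?thesis
    unfolding proj_power_eq regular_quotsp by (auto simp: regular_subsp_open openin_pcone)
qed

lemma morphism_into_proj_power:
  fixes F :: "('j::finite \<Rightarrow> 'k::field) \<Rightarrow> 'i::finite \<Rightarrow> 'k ^ 3"
  assumes "\<And>i a. polyfun (\<lambda>t. F t i $ a)" "\<And>t i. t \<in> N \<Longrightarrow> F t i \<noteq> 0"
  shows "morphism (subsp affine_sp N) proj_power (\<lambda>t i. vec.span {F t i})"
proof -
  interpret A: function_space "affine_sp :: ('j \<Rightarrow> 'k, 'k) kspace" by (rule function_space_affine_sp)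
  interpret N: function_space "subsp (affine_sp :: ('j \<Rightarrow> 'k, 'k) kspace) N" by (rule A.function_space_subsp)
  let ?g = "\<lambda>t (i, a). F t i $ a"
  have "morphism affine_sp affine_sp ?g"
    by (rule morphism_polyfun) (auto split: prod.split intro: assms(1))
  then have "morphism (subsp affine_sp N) affine_sp ?g" by (rule A.morphism_from_subsp)
  then have "morphism (subsp affine_sp N) (subsp affine_sp pcone) ?g"
    by (rule N.morphism_into_subsp) (use assms(2) in \<open>auto simp: pcone_vec\<close>)
  from morphism_compose[OF this morphism_quotsp[of _ lines]] show ?thesis
    unfolding proj_power_eq by (simp add: lines_def)
qed

text \<open>For a form \<open>F\<close> of degree \<open>d\<close>, a function on the part of the
  plane where \<open>b\<close> does not vanish; it does not depend on the vector chosen by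
  \<open>rv\<close>, see \<open>ratio_span\<close>.\<close>

definition ratio :: "('k::field ^ 3 \<Rightarrow> 'k) \<Rightarrow> 'k ^ 3 \<Rightarrow> nat \<Rightarrow> ('k ^ 3) set \<Rightarrow> 'k" where
  "ratio F b d P = F (rv P) / vdot b (rv P) ^ d"

definition is_form :: "nat \<Rightarrow> ('k::field ^ 3 \<Rightarrow> 'k) \<Rightarrow> bool" where
  "is_form d F \<longleftrightarrow> polyfun (\<lambda>v. F (\<chi> a. v a)) \<and> (\<forall>c u. F (c *s u) = c ^ d * F u)"

lemma is_form_scale: "is_form d F \<Longrightarrow> F (c *s u) = c ^ d * F u"
  by (simp add: is_form_def)

lemma is_form_polyfun:
  assumes "is_form d F" "\<And>a. polyfun (\<lambda>t. G t $ a)"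
  shows "polyfun (\<lambda>t. F (G t))"
  using polyfun_compose[of "\<lambda>v. F (\<chi> a. v a)" "\<lambda>t a. G t $ a"] assms by (simp add: is_form_def)

lemma is_form_vdot: "is_form 1 (vdot b)"
  unfolding is_form_def by (auto simp: vdot_scale) (simp add: vdot_def polyfun_intros)

lemma is_form_mult:
  assumes "is_form d F" "is_form e G"
  shows "is_form (d + e) (\<lambda>u. F u * G u)"
  using assms unfolding is_form_def by (auto intro: polyfun.mult simp: power_add mult_ac)

lemma is_form_add:
  assumes "is_form d F" "is_form d G"
  shows "is_form d (\<lambda>u. F u + G u)"
  using assms unfolding is_form_def by (auto intro: polyfun.add simp: distrib_left)

lemma is_form_cmult:
  assumes "is_form d F"
  shows "is_form d (\<lambda>u. c * F u)"
  using assms unfolding is_form_def by (auto intro: polyfun_intros simp: mult_ac)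

lemma is_form_const: "is_form 0 (\<lambda>_. c)"
  unfolding is_form_def by (auto intro: polyfun.const)

lemma ratio_span:
  assumes "is_form d F" "u \<noteq> 0"
  shows "ratio F b d (vec.span {u}) = F u / vdot b u ^ d"
proof -
  obtain c where "c \<noteq> 0" "rv (vec.span {u}) = c *s u" using rv_scale[OF assms(2)] by metis
  then show ?thesis
    by (simp add: ratio_def is_form_scale[OF assms(1)] vdot_scale power_mult_distrib)
qed

lemma vdot_rv_eq_0:
  assumes "u \<noteq> 0"
  shows "vdot b (rv (vec.span {u})) = 0 \<longleftrightarrow> vdot b u = 0"
proof -
  obtain c where "c \<noteq> 0" "rv (vec.span {u}) = c *s u" using rv_scale[OF assms] by metis
  then show ?thesis by (simp add: vdot_scale)
qed

lemma polyfun_vdot: "polyfun (\<lambda>v. vdot b (\<chi> a. v (i, a)))"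
  unfolding vdot_def by (auto intro!: polyfun_intros)

lemma openin_vdot_rv:
  "openin (ktop proj_power) {z \<in> topspace (ktop proj_power). vdot b (rv (z (i :: 'i::finite))) \<noteq> (0 :: 'k::field)}"
    (is "openin _ ?V")
proof -
  have "{v :: 'i \<times> 3 \<Rightarrow> 'k. v \<in> pcone \<and> lines v \<in> ?V} = pcone \<inter> {v. vdot b (\<chi> a. v (i, a)) \<noteq> 0}"
    by (auto simp: lines_def pcone_vec vdot_rv_eq_0 topspace_proj_power) blast
  then show ?thesis
    unfolding openin_proj_power using openin_pcone openin_zariski_nonzero[OF polyfun_vdot[of b i]] by auto
qed

lemma regular_ratio:
  assumes F: "is_form d F"
  shows "regular proj_power {z \<in> topspace (ktop proj_power). vdot b (rv (z (i :: 'i::finite))) \<noteq> (0 :: 'k::field)}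
    (\<lambda>z. ratio F b d (z i))" (is "regular _ ?V _")
proof -
  interpret function_space "affine_sp :: ('i \<times> 3 \<Rightarrow> 'k, 'k) kspace" by (rule function_space_affine_sp)
  let ?W = "{v :: 'i \<times> 3 \<Rightarrow> 'k. v \<in> pcone \<and> lines v \<in> ?V}"
  have W: "openin zariski ?W" using openin_vdot_rv[of b i] unfolding openin_proj_power by simp
  have 1: "polyfun (\<lambda>v. F (\<chi> a. v (i, a)))" by (rule is_form_polyfun[OF F]) (simp add: polyfun.coord)
  have 2: "polyfun (\<lambda>v. vdot b (\<chi> a. v (i, a)) ^ d)" by (intro polyfun_power polyfun_vdot)
  have "regular affine_sp ?W (\<lambda>v. F (\<chi> a. v (i, a)) / vdot b (\<chi> a. v (i, a)) ^ d)"
  proof (rule regular_divide)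
    show "regular affine_sp ?W (\<lambda>v. F (\<chi> a. v (i, a)))"
      by (rule regular_subset[OF regular_affine_sp_polyfun[OF 1]]) (use W in auto)
    show "regular affine_sp ?W (\<lambda>v. vdot b (\<chi> a. v (i, a)) ^ d)"
      by (rule regular_subset[OF regular_affine_sp_polyfun[OF 2]]) (use W in auto)
  qed (auto simp: lines_def pcone_vec vdot_rv_eq_0)
  then have "regular affine_sp ?W ((\<lambda>z. ratio F b d (z i)) \<circ> lines)"
    by (rule regular_cong) (auto simp: lines_def pcone_vec ratio_span[OF F])
  then show ?thesis unfolding regular_proj_power using openin_vdot_rv by blast
qed

section \<open>The blow-up of the plane in six points\<close>

lemma polyfun_cr:
  assumes "\<And>a. polyfun (\<lambda>t. F t $ a)"
  shows "polyfun (\<lambda>t. cr b (F t) $ a)"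
proof -
  have "a = 1 \<or> a = 2 \<or> a = 3" by (rule exhaust_3)
  then show ?thesis using assms by (auto simp: cr_def vector_3 intro!: polyfun_intros)
qed

lemma vdot_uminus_left: "vdot (- a) u = - vdot a u"
  by (simp add: vec3_defs algebra_simps)

lemma det3_alt: "det3 a b c = vdot (cr a b) c"
  by (simp add: vec3_defs algebra_simps)

lemma cramer3: "det3 a b c *s u = det3 u b c *s a + det3 a u c *s b + det3 a b u *s c"
  by (simp add: vec3_defs algebra_simps)

lemma vdot_exists:
  assumes "u \<noteq> 0"
  obtains a where "vdot a u = (1 :: 'k::field)"
proof -
  obtain a where a: "vdot a u \<noteq> 0" using vdot_eq_0_all assms by blast
  have "vdot ((1 / vdot a u) *s a) u = 1" using a by (simp add: vdot_scale_left)
  then show ?thesis by (rule that)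
qed

text \<open>With \<open>vdot c u = 1\<close> take \<open>w = cr l c\<close>: the double cross
  product \<open>cr u (cr l c)\<close> is \<open>vdot c u\<close> times \<open>l\<close> minus
  \<open>vdot l u\<close> times \<open>c\<close>, which is \<open>l\<close>.\<close>

lemma orthogonal_exists:
  assumes "vdot l u = 0" "l \<noteq> 0" "u \<noteq> (0 :: 'k::field ^ 3)"
  obtains w where "vdot l w = 0" "cr u w = l"
proof -
  obtain c where c: "vdot c u = 1" using vdot_exists[OF assms(3)] .
  have "cr u (cr l c) = vdot c u *s l - vdot l u *s c"
    by (simp add: vec3_defs algebra_simps)
  then show ?thesis using that[of "cr l c"] c assms(1) by simp
qed

definition pts :: "(6 \<Rightarrow> 'k::field ^ 3) \<Rightarrow> 6 \<Rightarrow> ('k ^ 3) set" where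
  "pts v i = vec.span {v i}"

locale six_points =
  fixes v :: "6 \<Rightarrow> 'k::{alg_closed_field, field_char_0} ^ 3" and h :: "'k ^ 3"
  assumes det_nonzero: "\<And>i j k. i \<noteq> j \<Longrightarrow> j \<noteq> k \<Longrightarrow> i \<noteq> k \<Longrightarrow> det3 (v i) (v j) (v k) \<noteq> 0"
    and avoid: "\<And>i. vdot h (v i) \<noteq> 0"
begin

abbreviation X :: "(6 option \<Rightarrow> ('k ^ 3) set, 'k) kspace" where
  "X \<equiv> blowup (pts v)"

abbreviation TX :: "(6 option \<Rightarrow> ('k ^ 3) set) set" where
  "TX \<equiv> topspace (ktop X)"

lemma v_nonzero: "v i \<noteq> 0"
  using avoid[of i] by auto

lemma h_nonzero: "h \<noteq> 0"
  using avoid[of 0] by auto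

lemma cr_v_nonzero:
  assumes "i \<noteq> j"
  shows "cr (v i) (v j) \<noteq> 0"
proof -
  have "card {i, j} < card (UNIV :: 6 set)" by (simp add: card_insert_if)
  then have "{i, j} \<noteq> UNIV" by auto
  then obtain k where "k \<noteq> i" "k \<noteq> j" by blast
  then have "det3 (v i) (v j) (v k) \<noteq> 0" using assms by (intro det_nonzero) auto
  then show ?thesis by (auto simp: det3_alt)
qed

lemma TX_eq:
  "TX = {z \<in> topspace (ktop proj_power). \<forall>i. \<forall>l\<in>z (Some i). on_line l (z None) \<and> on_line l (pts v i)}"
  by (auto simp: blowup_def)

lemma TX_E:
  assumes "z \<in> TX"
  obtains u l where "u \<noteq> 0" "\<And>i. l i \<noteq> 0" "z None = vec.span {u}" "\<And>i. z (Some i) = vec.span {l i}"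
    "\<And>i. vdot (l i) u = 0" "\<And>i. vdot (l i) (v i) = 0"
proof -
  have z: "\<forall>i. \<exists>u. u \<noteq> 0 \<and> z i = vec.span {u}"
    "\<forall>i. \<forall>l\<in>z (Some i). on_line l (z None) \<and> on_line l (pts v i)"
    using assms unfolding TX_eq by (auto simp: topspace_proj_power)
  obtain w where w: "\<And>i. w i \<noteq> 0" "\<And>i. z i = vec.span {w i}" using z(1) by metis
  have "w i \<in> z i" for i using w(2) vec.span_base[of "w i" "{w i}"] by simp
  then have "on_line (w (Some i)) (z None) \<and> on_line (w (Some i)) (pts v i)" for i
    using z(2) by blast
  then have "vdot (w (Some i)) (w None) = 0 \<and> vdot (w (Some i)) (v i) = 0" for i
    by (simp add: w(2) pts_def on_line_span)
  then show ?thesis using that[of "w None" "\<lambda>i. w (Some i)"] w by blast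
qed

lemma TX_I:
  assumes "\<And>i. F i \<noteq> 0" "\<And>i. vdot (F (Some i)) (F None) = 0" "\<And>i. vdot (F (Some i)) (v i) = 0"
  shows "(\<lambda>i. vec.span {F i}) \<in> TX"
proof -
  have "on_line l (vec.span {F None}) \<and> on_line l (pts v i)" if l: "l \<in> vec.span {F (Some i)}" for l i
  proof -
    obtain c where "l = c *s F (Some i)" using l by (auto simp: span_single)
    then show ?thesis using assms by (simp add: pts_def on_line_span vdot_scale_left)
  qed
  moreover have "\<exists>u. u \<noteq> 0 \<and> vec.span {F i} = vec.span {u}" for i using assms(1) by blast
  ultimately show ?thesis unfolding TX_eq by (simp add: topspace_proj_power)
qed

lemma function_space_X: "function_space X"
  unfolding blowup_def by (intro function_space.function_space_subsp function_space_proj_power)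

sublocale X: function_space X
  by (rule function_space_X)

lemma morphism_into_X:
  fixes F :: "('j::finite \<Rightarrow> 'k) \<Rightarrow> 6 option \<Rightarrow> 'k ^ 3"
  assumes "\<And>i a. polyfun (\<lambda>t. F t i $ a)" "\<And>t i. t \<in> N \<Longrightarrow> F t i \<noteq> 0"
    "\<And>t i. t \<in> N \<Longrightarrow> vdot (F t (Some i)) (F t None) = 0" "\<And>t i. t \<in> N \<Longrightarrow> vdot (F t (Some i)) (v i) = 0"
  shows "morphism (subsp affine_sp N) X (\<lambda>t i. vec.span {F t i})"
proof -
  interpret A: function_space "affine_sp :: ('j \<Rightarrow> 'k, 'k) kspace" by (rule function_space_affine_sp)
  interpret N: function_space "subsp (affine_sp :: ('j \<Rightarrow> 'k, 'k) kspace) N" by (rule A.function_space_subsp)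
  have "(\<lambda>i. vec.span {F t i}) \<in> TX" if "t \<in> N" for t
    using assms(2-4)[OF that] by (rule TX_I)
  then show ?thesis
    unfolding blowup_def using morphism_into_proj_power[of F N, OF assms(1,2)]
    by (intro N.morphism_into_subsp) (auto simp: TX_eq)
qed

lemma openin_X_vdot: "openin (ktop X) {z \<in> TX. vdot b (rv (z i)) \<noteq> 0}"
proof -
  have "{z \<in> TX. vdot b (rv (z i)) \<noteq> 0} = {z \<in> topspace (ktop proj_power). vdot b (rv (z i)) \<noteq> 0} \<inter>
      {z \<in> topspace (ktop proj_power). \<forall>i. \<forall>l\<in>z (Some i). on_line l (z None) \<and> on_line l (pts v i)}"
    unfolding TX_eq by auto
  then show ?thesis
    unfolding blowup_def ktop_subsp openin_subtopology using openin_vdot_rv[of b i] by blast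
qed

lemma regular_X_ratio:
  assumes "is_form d F"
  shows "regular X {z \<in> TX. vdot b (rv (z i)) \<noteq> 0} (\<lambda>z. ratio F b d (z i))"
proof -
  interpret P: function_space "proj_power :: (6 option \<Rightarrow> ('k ^ 3) set, 'k) kspace"
    by (rule function_space_proj_power)
  show ?thesis
    using P.regular_subspI[OF regular_ratio[OF assms, of b i]] openin_X_vdot[of b i]
    unfolding blowup_def ktop_subsp by (auto simp: TX_eq[unfolded blowup_def ktop_subsp])
qed

lemma regular_X_ratio_subset:
  assumes "is_form d F" "openin (ktop X) V" "\<And>z. z \<in> V \<Longrightarrow> vdot b (rv (z i)) \<noteq> 0"
  shows "regular X V (\<lambda>z. ratio F b d (z i))"
  using regular_X_ratio[OF assms(1)] assms(2)
  by (rule X.regular_subset) (use assms(3) openin_subset[OF assms(2)] in auto)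

lemma openin_X_cr: "openin (ktop X) {z \<in> TX. cr b (rv (z i)) \<noteq> 0}"
proof -
  have "vdot (cr c b) u = vdot c (cr b u)" for c u by (simp add: vec3_defs algebra_simps)
  then have eq: "cr b u = 0 \<longleftrightarrow> (\<forall>c. vdot (cr c b) u = 0)" for u
    by (metis vdot_eq_0_all vdot_zero(1))
  have "{z \<in> TX. cr b (rv (z i)) \<noteq> 0} = (\<Union>c. {z \<in> TX. vdot (cr c b) (rv (z i)) \<noteq> 0})"
    unfolding set_eq_iff by (simp add: eq)
  moreover have "openin (ktop X) (\<Union>c. {z \<in> TX. vdot (cr c b) (rv (z i)) \<noteq> 0})"
    by (rule openin_Union) (auto intro: openin_X_vdot)
  ultimately show ?thesis by simp
qed

lemma TX_rv:
  assumes "z \<in> TX"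
  shows "rv (z i) \<noteq> 0" "z i = vec.span {rv (z i)}" "vdot (rv (z (Some j))) (rv (z None)) = 0"
    "vdot (rv (z (Some j))) (v j) = 0"
proof -
  obtain u l where ul: "u \<noteq> 0" "\<And>i. l i \<noteq> 0" "z None = vec.span {u}" "\<And>i. z (Some i) = vec.span {l i}"
    "\<And>i. vdot (l i) u = 0" "\<And>i. vdot (l i) (v i) = 0" using TX_E[OF assms] by metis
  have "\<exists>y. y \<noteq> 0 \<and> z i = vec.span {y}"
    using ul(1-4) by (cases i) blast+
  then obtain y where y: "y \<noteq> 0" "z i = vec.span {y}" by blast
  show "rv (z i) \<noteq> 0" "z i = vec.span {rv (z i)}"
    unfolding y(2) using rv_span[OF y(1)] by simp_all
  obtain c where "rv (z None) = c *s u" using rv_scale[OF ul(1)] ul(3) by metis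
  moreover obtain c' where "rv (z (Some j)) = c' *s l j" using rv_scale[OF ul(2)] ul(4) by metis
  ultimately show "vdot (rv (z (Some j))) (rv (z None)) = 0" "vdot (rv (z (Some j))) (v j) = 0"
    using ul(5,6) by (simp_all add: vdot_scale vdot_scale_left)
qed

section \<open>The blow-up away from the exceptional curves, and lifted lines\<close>

definition good :: "'k ^ 3 \<Rightarrow> bool" where
  "good u \<longleftrightarrow> (\<forall>i. cr (v i) u \<noteq> 0)"

text \<open>Over a point different from the six, the lines to the six points are forced, so this is
  the inverse of the blow-down there.\<close>

definition plane_pt :: "'k ^ 3 \<Rightarrow> 6 option \<Rightarrow> ('k ^ 3) set" where
  "plane_pt u = (\<lambda>i. vec.span {case i of None \<Rightarrow> u | Some j \<Rightarrow> cr (v j) u})"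

lemma good_nonzero: "good u \<Longrightarrow> u \<noteq> 0"
  unfolding good_def by auto

lemma good_scale: "c \<noteq> 0 \<Longrightarrow> good (c *s u) \<longleftrightarrow> good u"
  unfolding good_def by (simp add: cr_scale)

lemma plane_pt_TX: "good u \<Longrightarrow> plane_pt u \<in> TX"
  unfolding plane_pt_def by (rule TX_I) (auto simp: good_def good_nonzero split: option.split)

lemma plane_pt_None: "plane_pt u None = vec.span {u}"
  by (simp add: plane_pt_def)

lemma some_eq_cr:
  assumes "z \<in> TX" "z None = vec.span {u}" "cr (v i) u \<noteq> 0"
  shows "z (Some i) = vec.span {cr (v i) u}"
proof -
  have "u \<noteq> 0" using assms(3) by auto
  obtain c where "c \<noteq> 0" "rv (z None) = c *s u" using rv_scale[OF \<open>u \<noteq> 0\<close>] assms(2) by metis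
  then have "vdot (rv (z (Some i))) u = 0" using TX_rv(3)[OF assms(1), of i] by (simp add: vdot_scale)
  then show ?thesis
    using span_orthogonal[OF TX_rv(4)[OF assms(1)] _ assms(3) TX_rv(1)[OF assms(1)]] TX_rv(2)[OF assms(1)]
    by metis
qed

lemma plane_pt_unique:
  assumes "z \<in> TX" "z None = vec.span {u}" "good u"
  shows "z = plane_pt u"
proof
  fix i show "z i = plane_pt u i"
    using assms some_eq_cr[OF assms(1,2)] by (cases i) (auto simp: plane_pt_def good_def)
qed

lemma plane_pt_rv:
  assumes "z \<in> TX" "good (rv (z None))"
  shows "z = plane_pt (rv (z None))"
  using plane_pt_unique[OF assms(1) TX_rv(2)[OF assms(1)] assms(2)] .

lemma plane_pt_scale:
  assumes "c \<noteq> 0" "good u"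
  shows "plane_pt (c *s u) = plane_pt u"
  using assms by (intro plane_pt_unique plane_pt_TX) (auto simp: good_scale plane_pt_None span_scale)

lemma openin_good: "openin zariski {x :: 3 \<Rightarrow> 'k. good (\<chi> a. x a)}"
proof -
  have "openin zariski {x :: 3 \<Rightarrow> 'k. \<forall>i. \<exists>a. cr (v i) (\<chi> a. x a) $ a \<noteq> 0}"
    by (intro openin_zariski_Collect_all openin_zariski_Collect_ex polyfun_cr) (simp add: polyfun.coord)
  then show ?thesis by (simp add: good_def vec_eq_iff)
qed

lemma morphism_plane_pt:
  fixes G :: "('j::finite \<Rightarrow> 'k) \<Rightarrow> 'k ^ 3"
  assumes "\<And>a. polyfun (\<lambda>t. G t $ a)"
  shows "morphism (subsp affine_sp {t. good (G t)}) X (\<lambda>t. plane_pt (G t))"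
  unfolding plane_pt_def
proof (rule morphism_into_X)
  show "polyfun (\<lambda>t. (case i of None \<Rightarrow> G t | Some j \<Rightarrow> cr (v j) (G t)) $ a)" for i a
    by (cases i) (simp_all add: assms polyfun_cr)
qed (auto simp: good_def good_nonzero split: option.split)

text \<open>The lift of a parametrised line to the blow-up. The component at \<open>v j\<close> is
  the join of \<open>v j\<close> with the moving point. If \<open>v j\<close> is itself on the line,
  the join is the line and stays meaningful when the point reaches \<open>v j\<close>, so the lift
  is defined for all parameters.\<close>

definition line_pt :: "'k ^ 3 \<Rightarrow> 'k ^ 3 \<Rightarrow> 'k \<Rightarrow> 6 option \<Rightarrow> ('k ^ 3) set" where
  "line_pt a w t = (\<lambda>i. vec.span {case i of None \<Rightarrow> a + t *s w
     | Some j \<Rightarrow> if det3 (v j) a w = 0 then cr a w else cr (v j) (a + t *s w)})"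

lemma line_point_nonzero: "cr a w \<noteq> 0 \<Longrightarrow> a + t *s w \<noteq> 0"
proof
  assume "cr a w \<noteq> 0" "a + t *s w = 0"
  moreover have "cr a w = cr (a + t *s w) w" by (simp add: vec3_defs algebra_simps)
  ultimately show False by simp
qed

lemma line_cr_nonzero: "det3 (v j) a w \<noteq> 0 \<Longrightarrow> cr (v j) (a + t *s w) \<noteq> 0"
proof
  assume "det3 (v j) a w \<noteq> 0" "cr (v j) (a + t *s w) = 0"
  moreover have "det3 (v j) a w = vdot (cr (v j) (a + t *s w)) w" by (simp add: vec3_defs algebra_simps)
  ultimately show False by simp
qed

lemma line_incidence:
  "vdot (cr a w) (a + t *s w) = 0" "det3 (v j) a w = 0 \<Longrightarrow> vdot (cr a w) (v j) = 0"
  by (simp_all add: vec3_defs algebra_simps)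

lemma line_pt_TX: "cr a w \<noteq> 0 \<Longrightarrow> line_pt a w t \<in> TX"
  unfolding line_pt_def
  by (rule TX_I) (auto simp: line_point_nonzero line_cr_nonzero line_incidence split: option.split)

lemma morphism_line_pt:
  assumes "cr a w \<noteq> 0"
  shows "morphism affine_sp X (\<lambda>t :: unit \<Rightarrow> 'k. line_pt a w (t ()))"
proof -
  have "morphism (subsp affine_sp UNIV) X (\<lambda>t :: unit \<Rightarrow> 'k. line_pt a w (t ()))"
    unfolding line_pt_def
  proof (rule morphism_into_X)
    fix i a'
    have p: "polyfun (\<lambda>t :: unit \<Rightarrow> 'k. (a + t () *s w) $ b)" for b by (auto intro!: polyfun_intros)
    show "polyfun (\<lambda>t :: unit \<Rightarrow> 'k. (case i of None \<Rightarrow> a + t () *s w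
     | Some j \<Rightarrow> if det3 (v j) a w = 0 then cr a w else cr (v j) (a + t () *s w)) $ a')"
    proof (cases i)
      case None
      then show ?thesis using p by simp
    next
      case (Some j)
      then show ?thesis using polyfun_cr[of "\<lambda>t. a + t () *s w", OF p, of "v j" a']
        by (cases "det3 (v j) a w = 0") (auto intro: polyfun.const)
    qed
  qed (use assms in \<open>auto simp: line_point_nonzero line_cr_nonzero line_incidence split: option.split\<close>)
  moreover have "morphism affine_sp (subsp affine_sp UNIV) (\<lambda>t :: unit \<Rightarrow> 'k. t)"
    by (rule function_space.morphism_into_subsp[OF function_space_affine_sp])
      (auto intro: morphism_polyfun polyfun.coord)
  ultimately show ?thesis using morphism_compose by fastforce
qed

lemma line_pt_plane_pt:
  assumes "cr a w \<noteq> 0" "good (a + t *s w)"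
  shows "line_pt a w t = plane_pt (a + t *s w)"
  by (rule plane_pt_unique[OF line_pt_TX[OF assms(1)] _ assms(2)]) (simp add: line_pt_def)

lemma finite_not_good:
  assumes "cr a w \<noteq> 0"
  shows "finite {t. \<not> good (a + t *s w)}"
proof -
  have "finite {t. cr (v i) (a + t *s w) = 0}" for i
  proof (cases "\<exists>s. cr (v i) (a + s *s w) = 0")
    case True
    then obtain s where s: "cr (v i) (a + s *s w) = 0" by blast
    have "t = s" if t: "cr (v i) (a + t *s w) = 0" for t
    proof (rule ccontr)
      assume "t \<noteq> s"
      obtain c where c: "a + t *s w = c *s v i" using cr_eq_0[OF t v_nonzero] by metis
      obtain d where d: "a + s *s w = d *s v i" using cr_eq_0[OF s v_nonzero] by metis
      have "(s - t) *s cr a w = cr (a + t *s w) (a + s *s w)" by (simp add: vec3_defs algebra_simps)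
      also have "\<dots> = 0" unfolding c d by (simp add: cr_scale cr_scale_left)
      finally show False using assms \<open>t \<noteq> s\<close> by simp
    qed
    then have "{t. cr (v i) (a + t *s w) = 0} \<subseteq> {s}" by blast
    then show ?thesis using finite_subset by blast
  qed simp
  moreover have "{t. \<not> good (a + t *s w)} = (\<Union>i. {t. cr (v i) (a + t *s w) = 0})"
    by (auto simp: good_def)
  ultimately show ?thesis by simp
qed

text \<open>Over a good point any line through it will do. A point of the exceptional curve over
  \<open>v i\<close> is a direction at \<open>v i\<close>, and the lift of the line through
  \<open>v i\<close> in this direction passes through it.\<close>

lemma line_through:
  assumes z: "z \<in> TX"
  obtains a w where "cr a w \<noteq> 0" "line_pt a w 0 = z"
proof (cases "good (rv (z None))")
  case True
  let ?u = "rv (z None)"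
  have "rv (z (Some 0)) \<noteq> 0" "vdot (rv (z (Some 0))) ?u = 0" "?u \<noteq> 0"
    using TX_rv[OF z] by auto
  then obtain w where "cr ?u w \<noteq> 0" using orthogonal_exists by metis
  moreover have "line_pt ?u w 0 = z"
    using line_pt_plane_pt[OF calculation, of 0] plane_pt_rv[OF z] True by simp
  ultimately show ?thesis by (rule that)
next
  case False
  then obtain i where "cr (v i) (rv (z None)) = 0" by (auto simp: good_def)
  then have N: "z None = vec.span {v i}"
    using span_eq_iff[OF v_nonzero TX_rv(1)[OF z]] TX_rv(2)[OF z] by metis
  let ?l = "rv (z (Some i))"
  obtain w where w: "vdot ?l w = 0" "cr (v i) w = ?l"
    using orthogonal_exists[OF TX_rv(4)[OF z] TX_rv(1)[OF z] v_nonzero] by metis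
  have nz: "cr (v i) w \<noteq> 0" using w TX_rv(1)[OF z] by simp
  have "line_pt (v i) w 0 o' = z o'" for o'
  proof (cases o')
    case None
    then show ?thesis using N by (simp add: line_pt_def)
  next
    case (Some j)
    show ?thesis
    proof (cases "j = i")
      case True
      then show ?thesis using Some w TX_rv(2)[OF z, of "Some i"] by (simp add: line_pt_def)
    next
      case False
      then have c: "cr (v j) (v i) \<noteq> 0" by (rule cr_v_nonzero)
      have zj: "z (Some j) = vec.span {cr (v j) (v i)}" using some_eq_cr[OF z N c] .
      show ?thesis
      proof (cases "det3 (v j) (v i) w = 0")
        case True
        have "vec.span {cr (v i) w} = vec.span {cr (v j) (v i)}"
          using True by (intro span_orthogonal[OF _ _ c nz]) (auto simp: line_incidence)
        then show ?thesis using Some zj True by (simp add: line_pt_def)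
      next
        case False
        then show ?thesis using Some zj by (simp add: line_pt_def)
      qed
    qed
  qed
  then show ?thesis using that nz by blast
qed

lemma openin_preimage_line:
  assumes "openin (ktop X) W" "cr a w \<noteq> 0"
  shows "openin zariski {t :: unit \<Rightarrow> 'k. line_pt a w (t ()) \<in> W}"
  using morphism_openin_preimage[OF morphism_line_pt[OF assms(2)] assms(1)] by simp

lemma openin_unit_cofinite:
  assumes "openin zariski (W :: (unit \<Rightarrow> 'k) set)" "(\<lambda>_. t0) \<in> W" "finite T"
  obtains t where "(\<lambda>_. t) \<in> W" "t \<notin> T"
proof -
  obtain f where f: "polyfun f" "f (\<lambda>_. t0) \<noteq> 0" "{v. f v \<noteq> 0} \<subseteq> W" using openin_zariskiE[OF assms(1,2)] by metis
  obtain p where p: "\<And>t. f (\<lambda>_. t) = poly p t" using polyfun_unit[OF f(1)] by metis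
  have "p \<noteq> 0" using f(2) p by auto
  then obtain t where "poly p t \<noteq> 0" "t \<notin> T" using poly_neq_zero_infinite assms(3) by metis
  then have "(\<lambda>_. t) \<in> {v. f v \<noteq> 0}" using p by simp
  then have "(\<lambda>_. t) \<in> W" using f(3) by (rule subsetD[rotated])
  then show ?thesis using \<open>t \<notin> T\<close> by (rule that)
qed

lemma openin_plane_preimage:
  assumes "openin (ktop X) W"
  shows "openin zariski {x :: 3 \<Rightarrow> 'k. good (\<chi> a. x a) \<and> plane_pt (\<chi> a. x a) \<in> W}"
proof -
  have "morphism (subsp affine_sp {x :: 3 \<Rightarrow> 'k. good (\<chi> a. x a)}) X (\<lambda>x. plane_pt (\<chi> a. x a))"
    by (rule morphism_plane_pt) (simp add: polyfun.coord)
  from morphism_openin_preimage[OF this assms] show ?thesis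
    by (simp add: openin_open_subtopology[OF openin_good])
qed

text \<open>Through a point of \<open>W\<close> runs the lift of a line. A nonempty open set of
  parameters is cofinite, so it contains a good one, and \<open>W\<close> meets the part of the
  blow-up that comes from the plane.\<close>

lemma dense_plane:
  assumes W: "openin (ktop X) W" "W \<noteq> {}"
  shows "{x :: 3 \<Rightarrow> 'k. good (\<chi> a. x a) \<and> plane_pt (\<chi> a. x a) \<in> W} \<noteq> {}"
proof -
  obtain z where z: "z \<in> W" using W(2) by blast
  then have "z \<in> TX" using openin_subset[OF W(1)] by blast
  then obtain a w where aw: "cr a w \<noteq> 0" "line_pt a w 0 = z" by (rule line_through)
  have "(\<lambda>_. 0) \<in> {t :: unit \<Rightarrow> 'k. line_pt a w (t ()) \<in> W}" using aw z by simp
  from openin_unit_cofinite[OF openin_preimage_line[OF W(1) aw(1)] this finite_not_good[OF aw(1)]]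
  obtain t where t: "line_pt a w t \<in> W" "good (a + t *s w)" by auto
  then have "plane_pt (a + t *s w) \<in> W" using line_pt_plane_pt[OF aw(1)] by simp
  then have "(\<lambda>b. (a + t *s w) $ b) \<in> {x :: 3 \<Rightarrow> 'k. good (\<chi> a. x a) \<and> plane_pt (\<chi> a. x a) \<in> W}"
    unfolding mem_Collect_eq vec_nth_inverse using t(2) by blast
  then show ?thesis by (metis emptyE)
qed

text \<open>By \<open>dense_plane\<close> both sets have nonempty open preimages in three-space,
  which is irreducible.\<close>

lemma X_irreducible:
  assumes "openin (ktop X) U" "openin (ktop X) V" "U \<noteq> {}" "V \<noteq> {}"
  shows "U \<inter> V \<noteq> {}"
  using zariski_irreducible[OF openin_plane_preimage[OF assms(1)] openin_plane_preimage[OF assms(2)]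
    dense_plane[OF assms(1,3)] dense_plane[OF assms(2,4)]] by blast

section \<open>The seven curves and their local equations\<close>

definition E :: "6 \<Rightarrow> (6 option \<Rightarrow> ('k ^ 3) set) set" where
  "E i = exc_curve (pts v) i"

definition H :: "(6 option \<Rightarrow> ('k ^ 3) set) set" where
  "H = pullback_line (pts v) h"

definition curves :: "(6 option \<Rightarrow> ('k ^ 3) set) set set" where
  "curves = insert H (range E)"

lemma E_iff: "z \<in> E i \<longleftrightarrow> z \<in> TX \<and> cr (v i) (rv (z None)) = 0"
proof -
  have "z None = vec.span {v i} \<longleftrightarrow> cr (v i) (rv (z None)) = 0" if "z \<in> TX"
    using span_eq_iff[OF v_nonzero TX_rv(1)[OF that]] TX_rv(2)[OF that] by metis
  then show ?thesis by (auto simp: E_def exc_curve_def pts_def)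
qed

lemma H_iff: "z \<in> H \<longleftrightarrow> z \<in> TX \<and> vdot h (rv (z None)) = 0"
proof -
  have "on_line h (z None) \<longleftrightarrow> vdot h (rv (z None)) = 0" if "z \<in> TX"
    by (subst TX_rv(2)[OF that]) (rule on_line_span)
  then show ?thesis by (auto simp: H_def pullback_line_def)
qed

lemma E_None: "z \<in> E i \<longleftrightarrow> z \<in> TX \<and> z None = vec.span {v i}"
  by (auto simp: E_def exc_curve_def pts_def)

lemma H_None:
  assumes "z \<in> TX" "z None = vec.span {u}"
  shows "z \<in> H \<longleftrightarrow> vdot h u = 0"
  using assms by (auto simp: H_def pullback_line_def on_line_span)

lemma plane_pt_curves:
  assumes "good u"
  shows "plane_pt u \<notin> E i" "plane_pt u \<in> H \<longleftrightarrow> vdot h u = 0"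
  using assms span_eq_iff[OF good_nonzero v_nonzero, of u i] cr_eq_0_commute[of "v i" u] H_None[OF plane_pt_TX plane_pt_None]
  by (auto simp: E_None plane_pt_None good_def)

lemma not_curves:
  assumes "z \<in> TX" "\<And>i. z \<notin> E i"
  shows "good (rv (z None))" "z = plane_pt (rv (z None))"
  using assms plane_pt_rv[OF assms(1)] by (auto simp: E_iff good_def)

lemma disjoint_curves: "i \<noteq> j \<Longrightarrow> E i \<inter> E j = {}" "E i \<inter> H = {}"
proof -
  assume "i \<noteq> j"
  then have "vec.span {v i} \<noteq> vec.span {v j}"
    using span_eq_iff[OF v_nonzero v_nonzero] cr_v_nonzero by blast
  then show "E i \<inter> E j = {}" by (auto simp: E_None)
next
  show "E i \<inter> H = {}" using H_None avoid by (auto simp: E_None)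
qed

lemma E_nonempty: "E i \<noteq> {}"
proof -
  obtain j where "j \<noteq> i" using exists_least_iff[of "\<lambda>j. j \<noteq> i"] by (metis zero_neq_one)
  then have c: "cr (v i) (v j) \<noteq> 0" using cr_v_nonzero by metis
  then have "line_pt (v i) (v j) 0 \<in> E i" using line_pt_TX[OF c] by (simp add: E_None line_pt_def)
  then show ?thesis by blast
qed

text \<open>\<open>divisor_of\<close> tells curves apart as sets, so multiplicities would add up if
  two of the sets coincided. The curves are disjoint, and the exceptional ones are not
  empty.\<close>

lemma curves_distinct: "E i = E j \<longleftrightarrow> i = j" "E i \<noteq> H" "H \<noteq> E i"
  using disjoint_curves(1)[of i j] disjoint_curves(2)[of i] E_nonempty[of i] by auto

lemma openin_minus_E: "openin (ktop X) (TX - E i)"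
proof -
  have "TX - E i = {z \<in> TX. cr (v i) (rv (z None)) \<noteq> 0}" by (auto simp: E_iff)
  then show ?thesis using openin_X_cr by simp
qed

lemma openin_minus_H: "openin (ktop X) (TX - H)"
proof -
  have "TX - H = {z \<in> TX. vdot h (rv (z None)) \<noteq> 0}" by (auto simp: H_iff)
  then show ?thesis using openin_X_vdot by simp
qed

lemma openin_off_E: "openin (ktop X) {z \<in> TX. \<forall>i. i \<notin> J \<longrightarrow> z \<notin> E i}"
proof -
  have "openin (ktop X) ((\<Inter>i\<in>- J. (TX - E i)) \<inter> TX)"
    by (rule openin_INT) (auto intro: openin_minus_E)
  moreover have "(\<Inter>i\<in>- J. (TX - E i)) \<inter> TX = {z \<in> TX. \<forall>i. i \<notin> J \<longrightarrow> z \<notin> E i}" by auto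
  ultimately show ?thesis by simp
qed

text \<open>Take a basis of the point \<open>?u\<close>, a second point \<open>e'\<close> of the
  line \<open>h\<close> and a vector \<open>e\<close> with \<open>vdot h e = 1\<close>. Dividing by
  the first coordinate gives an affine chart of the plane in which \<open>h\<close> is the
  coordinate of \<open>e\<close>. Since \<open>z\<close> is on no exceptional curve, the chart lifts
  to the blow-up.\<close>

lemma local_equation_H:
  assumes z: "z \<in> H"
  obtains b V where "openin (ktop X) V" "z \<in> V" "\<And>i. V \<inter> E i = {}"
    "\<And>y. y \<in> V \<Longrightarrow> vdot b (rv (y None)) \<noteq> 0"
    "local_equation X H V (\<lambda>y. ratio (vdot h) b 1 (y None))"
proof -
  let ?u = "rv (z None)"
  have zT: "z \<in> TX" and hu: "vdot h ?u = 0" using z by (auto simp: H_iff)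
  have u0: "?u \<noteq> 0" using TX_rv(1)[OF zT] .
  obtain e' where e': "vdot h e' = 0" "cr ?u e' = h" using orthogonal_exists[OF hu h_nonzero u0] by metis
  obtain e where "vdot e h = 1" using vdot_exists[OF h_nonzero] .
  then have e: "vdot h e = 1" by (simp add: vdot_commute)
  have \<delta>: "det3 ?u e' e = 1" using e e'(2) by (simp add: det3_alt)
  \<comment> \<open>The linear form with value 1 at \<open>?u\<close> and 0 at \<open>e'\<close> and
    \<open>e\<close>, the denominator of the chart.\<close>
  let ?b = "cr e' e"
  have hdet: "det3 ?u e' y = vdot h y" for y by (simp add: det3_alt e'(2))
  have expand: "y = vdot ?b y *s ?u + vdot (cr e ?u) y *s e' + vdot h y *s e" for y
  proof -
    have "det3 y e' e = vdot ?b y" "det3 ?u y e = vdot (cr e ?u) y" by (simp_all add: vec3_defs algebra_simps)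
    then show ?thesis using cramer3[of ?u e' e y] hdet \<delta> by simp
  qed
  define V where "V = {y \<in> TX. vdot ?b (rv (y None)) \<noteq> 0} \<inter> {y \<in> TX. \<forall>i. i \<notin> {} \<longrightarrow> y \<notin> E i}"
  have oV: "openin (ktop X) V" unfolding V_def by (intro openin_Int openin_X_vdot openin_off_E)
  have "vdot ?b ?u = 1" using \<delta> by (simp add: det3_def vdot_commute)
  then have zV: "z \<in> V" using zT z disjoint_curves(2) by (auto simp: V_def)
  have VE: "V \<inter> E i = {}" for i by (auto simp: V_def)
  \<comment> \<open>\<open>True\<close> marks the coordinate of \<open>e\<close>, the equation of
    \<open>H\<close>, and \<open>False\<close> that of \<open>e'\<close>.\<close>
  define \<kappa> where "\<kappa> y c = (if c then ratio (vdot h) ?b 1 (y None) else ratio (vdot (cr e ?u)) ?b 1 (y None))"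
    for y :: "6 option \<Rightarrow> ('k ^ 3) set" and c
  define G where "G t = ?u + t False *s e' + t True *s e" for t :: "bool \<Rightarrow> 'k"
  define N where "N = {t. good (G t)}"
  have pG: "polyfun (\<lambda>t. G t $ a)" for a unfolding G_def by (auto intro!: polyfun_intros)
  have "openin zariski {t :: bool \<Rightarrow> 'k. \<forall>i. \<exists>a. cr (v i) (G t) $ a \<noteq> 0}"
    by (intro openin_zariski_Collect_all openin_zariski_Collect_ex polyfun_cr pG)
  then have oN: "openin zariski N" by (simp add: N_def good_def vec_eq_iff)
  have \<kappa>G: "\<exists>c. c \<noteq> 0 \<and> G (\<kappa> y) = c *s rv (y None)" if y: "y \<in> V" for y
  proof -
    let ?w = "rv (y None)"
    have b: "vdot ?b ?w \<noteq> 0" using y by (simp add: V_def)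
    have "(1 / vdot ?b ?w) *s ?w = (1 / vdot ?b ?w) *s (vdot ?b ?w *s ?u + vdot (cr e ?u) ?w *s e' + vdot h ?w *s e)"
      using expand[of ?w] by simp
    also have "\<dots> = G (\<kappa> y)"
      using b by (simp add: G_def \<kappa>_def ratio_def vector_add_ldistrib vector_smult_assoc)
    finally show ?thesis using b by (intro exI[of _ "1 / vdot ?b ?w"]) simp
  qed
  have Vgood: "good (rv (y None)) \<and> y = plane_pt (rv (y None))" if "y \<in> V" for y
    using not_curves[of y] that by (auto simp: V_def)
  have le: "local_equation X H V (\<lambda>y. \<kappa> y True)"
  proof (rule local_equation_chart[OF function_space_X oV oN])
    show "regular X V (\<lambda>y. \<kappa> y j)" for j
    proof -
      have "regular X V (\<lambda>y. ratio (vdot a) ?b 1 (y None))" for a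
        by (rule regular_X_ratio_subset[OF is_form_vdot oV]) (simp add: V_def)
      then show ?thesis by (cases j) (simp_all add: \<kappa>_def)
    qed
    show "morphism (subsp affine_sp N) X (\<lambda>t. plane_pt (G t))"
      unfolding N_def by (rule morphism_plane_pt[OF pG])
    fix y assume y: "y \<in> V"
    obtain c where "c \<noteq> 0" "G (\<kappa> y) = c *s rv (y None)" using \<kappa>G[OF y] by blast
    then show "\<kappa> y \<in> N" "plane_pt (G (\<kappa> y)) = y"
      using Vgood[OF y] good_scale plane_pt_scale by (auto simp: N_def)
  next
    fix y assume "y \<in> V" "y \<in> H"
    then show "\<kappa> y True = 0" by (simp add: \<kappa>_def ratio_def H_iff)
  next
    fix t assume "t \<in> N" "t True = 0"
    then show "plane_pt (G t) \<in> H"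
      using plane_pt_curves(2)[of "G t"] hu e'(1) by (simp add: N_def G_def vdot_add vdot_scale)
  qed
  show ?thesis
    by (rule that[OF oV zV VE _ ]) (use le in \<open>auto simp: \<kappa>_def V_def\<close>)
qed

text \<open>The usual chart of a blow-up. In a basis \<open>v i\<close>, \<open>e\<close>,
  \<open>e'\<close> for which \<open>z\<close> is the direction from \<open>v i\<close> to
  \<open>e\<close>, a nearby point is \<open>v i\<close> plus \<open>x\<close> times
  \<open>e\<close> plus \<open>x s\<close> times \<open>e'\<close>, together with the line from
  \<open>v i\<close> to \<open>e\<close> plus \<open>s\<close> times \<open>e'\<close>. The
  exceptional curve is \<open>x = 0\<close>.\<close>

lemma local_equation_E:
  assumes z: "z \<in> E i"
  obtains V t where "openin (ktop X) V" "z \<in> V" "V \<inter> H = {}" "\<And>j. j \<noteq> i \<Longrightarrow> V \<inter> E j = {}"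
    "local_equation X (E i) V t"
proof -
  have zT: "z \<in> TX" and zN: "z None = vec.span {v i}" using z by (auto simp: E_None)
  let ?l = "rv (z (Some i))"
  have l0: "?l \<noteq> 0" using TX_rv(1)[OF zT] .
  obtain e where e: "vdot ?l e = 0" "cr (v i) e = ?l"
    using orthogonal_exists[OF TX_rv(4)[OF zT] l0 v_nonzero] by metis
  obtain e' where e': "vdot e' ?l = 1" using vdot_exists[OF l0] .
  have \<delta>: "det3 (v i) e e' = 1" using e(2) e' by (simp add: det3_alt vdot_commute)
  let ?\<alpha> = "cr e e'" and ?\<beta> = "cr e' (v i)"
  have expand: "y = vdot ?\<alpha> y *s v i + vdot ?\<beta> y *s e + vdot (cr (v i) e) y *s e'" for y
  proof -
    have "det3 y e e' = vdot ?\<alpha> y" "det3 (v i) y e' = vdot ?\<beta> y" "det3 (v i) e y = vdot (cr (v i) e) y"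
      by (simp_all add: vec3_defs algebra_simps)
    then show ?thesis using cramer3[of "v i" e e' y] \<delta> by simp
  qed
  define V where "V = {y \<in> TX. vdot ?\<alpha> (rv (y None)) \<noteq> 0} \<inter> {y \<in> TX. vdot e' (rv (y (Some i))) \<noteq> 0} \<inter>
    {y \<in> TX. \<forall>j. j \<notin> {i} \<longrightarrow> y \<notin> E j} \<inter> (TX - H)"
  have oV: "openin (ktop X) V" unfolding V_def
    by (intro openin_Int openin_X_vdot openin_off_E openin_minus_H)
  have "vdot ?\<alpha> (v i) = 1" using \<delta> by (simp add: det3_def vdot_commute)
  then have "vdot ?\<alpha> (rv (z None)) \<noteq> 0" using vdot_rv_eq_0[OF v_nonzero] zN by simp
  moreover have "z \<notin> E j" if "j \<noteq> i" for j using disjoint_curves(1)[of i j] z that by auto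
  ultimately have zV: "z \<in> V" using zT z disjoint_curves(2)[of i] e' by (auto simp: V_def)
  \<comment> \<open>\<open>True\<close> is the coordinate \<open>x\<close>. \<open>False\<close> is
    the slope \<open>s\<close>, found from the condition that \<open>e\<close> plus \<open>s\<close>
    times \<open>e'\<close> lies on the line \<open>rv (y (Some i))\<close>.\<close>
  define \<kappa> where "\<kappa> y c = (if c then ratio (vdot ?\<beta>) ?\<alpha> 1 (y None)
      else ratio (vdot ((- 1) *s e)) e' 1 (y (Some i)))" for y :: "6 option \<Rightarrow> ('k ^ 3) set" and c
  define G where "G t = v i + t True *s e + (t True * t False) *s e'" for t :: "bool \<Rightarrow> 'k"
  define F where "F t o' = (case o' of None \<Rightarrow> G t
      | Some j \<Rightarrow> if j = i then cr (v i) (e + t False *s e') else cr (v j) (G t))" for t :: "bool \<Rightarrow> 'k" and o'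
  define N where "N = {t. \<forall>o'. F t o' \<noteq> 0}"
  have pG: "polyfun (\<lambda>t. G t $ a)" for a unfolding G_def by (auto intro!: polyfun_intros)
  have pF: "polyfun (\<lambda>t. F t o' $ a)" for o' a
  proof (cases o')
    case None
    then show ?thesis using pG by (simp add: F_def)
  next
    case (Some j)
    have "polyfun (\<lambda>t :: bool \<Rightarrow> 'k. (e + t False *s e') $ a)" for a by (auto intro!: polyfun_intros)
    from polyfun_cr[OF this, of "v i" a] polyfun_cr[OF pG, of "v j" a] Some
    show ?thesis by (cases "j = i") (simp_all add: F_def)
  qed
  have "openin zariski {t :: bool \<Rightarrow> 'k. \<forall>o'. \<exists>a. F t o' $ a \<noteq> 0}"
    by (intro openin_zariski_Collect_all openin_zariski_Collect_ex pF)
  then have oN: "openin zariski N" by (simp add: N_def vec_eq_iff)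
  have \<kappa>F: "\<kappa> y \<in> N" "(\<lambda>o'. vec.span {F (\<kappa> y) o'}) = y" if y: "y \<in> V" for y
  proof -
    have yT: "y \<in> TX" using y by (simp add: V_def)
    let ?w = "rv (y None)" and ?L = "rv (y (Some i))"
    have b: "vdot ?\<alpha> ?w \<noteq> 0" "vdot e' ?L \<noteq> 0" using y by (simp_all add: V_def)
    note L = TX_rv(3,4)[OF yT, of i]
    let ?s = "- vdot e ?L / vdot e' ?L"
    have s: "\<kappa> y False = ?s" by (simp add: \<kappa>_def ratio_def vdot_uminus_left)
    have x: "\<kappa> y True = vdot ?\<beta> ?w / vdot ?\<alpha> ?w" by (simp add: \<kappa>_def ratio_def)
    \<comment> \<open>The point lies on its line with index \<open>i\<close>, which passes through
      \<open>v i\<close>. This forces the coordinate along \<open>e'\<close> to be \<open>s\<close>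
      times that along \<open>e\<close>.\<close>
    have "vdot ?L ?w = vdot ?\<alpha> ?w * vdot ?L (v i) + vdot ?\<beta> ?w * vdot ?L e + vdot (cr (v i) e) ?w * vdot ?L e'"
      by (subst expand[of ?w]) (simp only: vdot_add vdot_scale)
    then have "vdot ?\<beta> ?w * vdot e ?L + vdot (cr (v i) e) ?w * vdot e' ?L = 0"
      using L by (simp add: vdot_commute)
    then have \<beta>': "vdot (cr (v i) e) ?w = vdot ?\<beta> ?w * ?s" using b(2) by (simp add: field_simps eq_neg_iff_add_eq_0)
    have "(1 / vdot ?\<alpha> ?w) *s ?w = (1 / vdot ?\<alpha> ?w) *s (vdot ?\<alpha> ?w *s v i + vdot ?\<beta> ?w *s e + (vdot ?\<beta> ?w * ?s) *s e')"
      using expand[of ?w] \<beta>' by simp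
    also have "\<dots> = G (\<kappa> y)"
      using b by (simp add: G_def s x vector_add_ldistrib vector_smult_assoc)
    finally have G: "G (\<kappa> y) = (1 / vdot ?\<alpha> ?w) *s ?w" by simp
    have c: "1 / vdot ?\<alpha> ?w \<noteq> 0" using b by simp
    have Gn: "vec.span {G (\<kappa> y)} = y None" unfolding G span_scale[OF c] using TX_rv(2)[OF yT] by simp
    have Gnz: "G (\<kappa> y) \<noteq> 0" unfolding G using c TX_rv(1)[OF yT] by simp
    have Ej: "cr (v j) (G (\<kappa> y)) \<noteq> 0" if "j \<noteq> i" for j
    proof -
      have "y \<notin> E j" using y that by (auto simp: V_def)
      then have "cr (v j) ?w \<noteq> 0" using yT by (simp add: E_iff)
      then show ?thesis unfolding G using c by (simp add: cr_scale)
    qed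
    have "vdot (cr (v i) (e + ?s *s e')) e' = 1"
      using \<delta> by (simp add: det3_alt cr_scale vec3_defs algebra_simps)
    then have i: "cr (v i) (e + ?s *s e') \<noteq> 0" by auto
    show "\<kappa> y \<in> N" using i Ej Gnz s by (auto simp: N_def F_def split: option.split)
    have "vec.span {?L} = vec.span {cr (v i) (e + ?s *s e')}"
    proof (rule span_orthogonal[OF L(2) _ i TX_rv(1)[OF yT]])
      have "vdot ?L (e + ?s *s e') = vdot e ?L + ?s * vdot e' ?L"
        by (simp only: vdot_add vdot_scale vdot_commute[of ?L])
      then show "vdot ?L (e + ?s *s e') = 0" using b(2) by simp
    qed
    then have yi: "vec.span {cr (v i) (e + ?s *s e')} = y (Some i)" using TX_rv(2)[OF yT] by simp
    have "vec.span {F (\<kappa> y) o'} = y o'" for o'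
      using Gn yi s some_eq_cr[OF yT Gn[symmetric] Ej] by (cases o') (auto simp: F_def)
    then show "(\<lambda>o'. vec.span {F (\<kappa> y) o'}) = y" by blast
  qed
  have le: "local_equation X (E i) V (\<lambda>y. \<kappa> y True)"
  proof (rule local_equation_chart[OF function_space_X oV oN])
    show "regular X V (\<lambda>y. \<kappa> y j)" for j
    proof -
      have "regular X V (\<lambda>y. ratio (vdot ?\<beta>) ?\<alpha> 1 (y None))"
        by (rule regular_X_ratio_subset[OF is_form_vdot oV]) (simp add: V_def)
      moreover have "regular X V (\<lambda>y. ratio (vdot ((- 1) *s e)) e' 1 (y (Some i)))"
        by (rule regular_X_ratio_subset[OF is_form_vdot oV]) (simp add: V_def)
      ultimately show ?thesis by (cases j) (simp_all add: \<kappa>_def)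
    qed
    show mor: "morphism (subsp affine_sp N) X (\<lambda>t o'. vec.span {F t o'})"
    proof (rule morphism_into_X[OF pF])
      fix t j assume t: "t \<in> N"
      show "vdot (F t (Some j)) (F t None) = 0"
      proof (cases "j = i")
        case True
        have "vdot (cr (v i) (e + t False *s e')) (G t) = 0"
          by (simp add: G_def vec3_defs algebra_simps)
        then show ?thesis using True by (simp add: F_def)
      qed (simp add: F_def)
      show "vdot (F t (Some j)) (v j) = 0" by (simp add: F_def)
    qed (simp add: N_def)
    fix y assume y: "y \<in> V" "y \<in> E i"
    then have yT: "y \<in> TX" and c: "cr (v i) (rv (y None)) = 0" by (auto simp: E_iff)
    obtain c where "rv (y None) = c *s v i" using cr_eq_0[OF c v_nonzero] by metis
    then show "\<kappa> y True = 0" by (simp add: \<kappa>_def ratio_def vdot_scale)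
  next
    fix t assume t: "t \<in> N" "t True = 0"
    have "(\<lambda>o'. vec.span {F t o'}) \<in> TX"
    proof (rule TX_I)
      fix j
      have "vdot (cr (v i) (e + t False *s e')) (G t) = 0"
        by (simp add: G_def vec3_defs algebra_simps)
      then show "vdot (F t (Some j)) (F t None) = 0" by (simp add: F_def)
      show "vdot (F t (Some j)) (v j) = 0" by (simp add: F_def)
    qed (use t in \<open>simp add: N_def\<close>)
    then show "(\<lambda>o'. vec.span {F t o'}) \<in> E i" using t(2) by (simp add: E_None F_def G_def)
  qed (use \<kappa>F in auto)
  show ?thesis
    by (rule that[OF oV zV _ _ le]) (auto simp: V_def)
qed

lemma good_generic_exists: "\<exists>u. good u \<and> vdot h u \<noteq> 0"
proof -
  obtain z where "z \<in> E 0" using E_nonempty by blast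
  then have "z \<in> TX" by (simp add: E_None)
  then have "TX \<noteq> {}" by (metis emptyE)
  then have ne: "{x :: 3 \<Rightarrow> 'k. good (\<chi> a. x a) \<and> plane_pt (\<chi> a. x a) \<in> TX} \<noteq> {}"
    by (rule dense_plane[OF openin_topspace])
  have o: "openin zariski {x :: 3 \<Rightarrow> 'k. vdot h (\<chi> a. x a) \<noteq> 0}"
    by (rule openin_zariski_nonzero) (auto simp: vdot_def intro!: polyfun_intros)
  obtain e where "vdot h e \<noteq> 0" using avoid by blast
  then have "(\<lambda>a. e $ a) \<in> {x :: 3 \<Rightarrow> 'k. vdot h (\<chi> a. x a) \<noteq> 0}" by simp
  then have "{x :: 3 \<Rightarrow> 'k. vdot h (\<chi> a. x a) \<noteq> 0} \<noteq> {}" by (metis emptyE)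
  from zariski_irreducible[OF openin_plane_preimage[OF openin_topspace] o ne this] show ?thesis by blast
qed

sublocale X: divisor_space X curves
proof
  show "U \<inter> V \<noteq> {}" if "openin (ktop X) U" "openin (ktop X) V" "U \<noteq> {}" "V \<noteq> {}" for U V
    using that by (rule X_irreducible)
  show "finite curves" by (simp add: curves_def)
  show "closedin (ktop X) C" if "C \<in> curves" for C
    using that openin_minus_E openin_minus_H
    by (auto simp: curves_def closedin_def E_iff H_iff)
  show "TX - \<Union> curves \<noteq> {}"
  proof -
    obtain u where "good u" "vdot h u \<noteq> 0" using good_generic_exists by blast
    then have "plane_pt u \<in> TX - \<Union> curves" using plane_pt_TX plane_pt_curves by (auto simp: curves_def)
    then show ?thesis by blast
  qed
  fix z assume z: "z \<in> TX"
  \<comment> \<open>The curves are pairwise disjoint, so at most one passes through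
    \<open>z\<close>. On a neighbourhood missing the others, the constant 1 is an equation of each
    of them.\<close>
  consider "z \<in> H" | i where "z \<in> E i" | "z \<notin> H" "\<And>i. z \<notin> E i" by blast
  then show "\<exists>V t. openin (ktop X) V \<and> z \<in> V \<and> (\<forall>C\<in>curves. local_equation X C V (t C))"
  proof cases
    case 1
    from local_equation_H[OF this] obtain b V where V: "openin (ktop X) V" "z \<in> V" "\<And>i. V \<inter> E i = {}"
      "local_equation X H V (\<lambda>y. ratio (vdot h) b 1 (y None))" by metis
    then show ?thesis
      by (intro exI[of _ V] exI[of _ "\<lambda>C. if C = H then (\<lambda>y. ratio (vdot h) b 1 (y None)) else (\<lambda>_. 1)"])
        (auto simp: curves_def curves_distinct intro: X.local_equation_trivial)
  next
    case (2 i)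
    from local_equation_E[OF this] obtain V t where V: "openin (ktop X) V" "z \<in> V" "V \<inter> H = {}"
      "\<And>j. j \<noteq> i \<Longrightarrow> V \<inter> E j = {}" "local_equation X (E i) V t" by metis
    then show ?thesis
      by (intro exI[of _ V] exI[of _ "\<lambda>C. if C = E i then t else (\<lambda>_. 1)"])
        (auto simp: curves_def curves_distinct intro: X.local_equation_trivial)
  next
    case 3
    let ?V = "{z \<in> TX. \<forall>i. i \<notin> {} \<longrightarrow> z \<notin> E i} \<inter> (TX - H)"
    have "openin (ktop X) ?V" by (intro openin_Int openin_off_E openin_minus_H)
    then show ?thesis using z 3
      by (intro exI[of _ ?V] exI[of _ "\<lambda>C _. 1"])
        (auto simp: curves_def intro!: X.local_equation_trivial)
  qed
qed

lemma generic_part_iff: "z \<in> X.generic_part \<longleftrightarrow> (\<exists>u. good u \<and> vdot h u \<noteq> 0 \<and> z = plane_pt u)"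
proof
  assume "z \<in> X.generic_part"
  then have z: "z \<in> TX" "z \<notin> H" "\<And>i. z \<notin> E i" unfolding X.generic_part_def by (auto simp: curves_def)
  then show "\<exists>u. good u \<and> vdot h u \<noteq> 0 \<and> z = plane_pt u"
    using not_curves[OF z(1,3)] by (auto simp: H_iff)
next
  assume "\<exists>u. good u \<and> vdot h u \<noteq> 0 \<and> z = plane_pt u"
  then show "z \<in> X.generic_part"
    using plane_pt_TX plane_pt_curves unfolding X.generic_part_def by (auto simp: curves_def)
qed

end

context six_points
begin

section \<open>Sections of line bundles on the blow-up\<close>

lemma off_E_disjoint: "j \<notin> J \<Longrightarrow> {z \<in> A. \<forall>i. i \<notin> J \<longrightarrow> z \<notin> E i} \<inter> B \<inter> E j = {}"
  by blast

abbreviation dv :: "int \<times> (6 \<Rightarrow> int) \<Rightarrow> (6 option \<Rightarrow> ('k ^ 3) set) set \<Rightarrow> int" where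
  "dv \<equiv> divisor_of (pts v) h"

lemma dv_eq: "dv (d, m) C = (if C = H then d else 0) + (\<Sum>i\<in>UNIV. if C = E i then m i else 0)"
  by (simp add: divisor_of_def H_def E_def)

lemma dv_H: "dv (d, m) H = d"
  by (simp add: dv_eq curves_distinct)

lemma dv_E: "dv (d, m) (E j) = m j"
  by (simp add: dv_eq curves_distinct)

lemma dv_supp: "{C. dv D C \<noteq> 0} \<subseteq> curves"
proof
  fix C assume "C \<in> {C. dv D C \<noteq> 0}"
  then have "dv (fst D, snd D) C \<noteq> 0" by simp
  then have "C = H \<or> (\<exists>i. C = E i)"
    unfolding dv_eq by (auto split: if_splits)
  then show "C \<in> curves" by (auto simp: curves_def)
qed

lemma dv_diff:
  "(\<lambda>C. dv D2 C - dv D1 C) = dv (fst D2 - fst D1, \<lambda>i. snd D2 i - snd D1 i)"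
proof
  fix C
  have "(\<Sum>i\<in>UNIV. if C = E i then snd D2 i - snd D1 i else 0) =
     (\<Sum>i\<in>UNIV. if C = E i then snd D2 i else 0) - (\<Sum>i\<in>UNIV. if C = E i then snd D1 i else 0)"
    unfolding sum_subtractf[symmetric] by (rule sum.cong) auto
  then show "dv D2 C - dv D1 C = dv (fst D2 - fst D1, \<lambda>i. snd D2 i - snd D1 i) C"
    using dv_eq[of "fst D2" "snd D2" C] dv_eq[of "fst D1" "snd D1" C] by (simp add: dv_eq)
qed

definition frac :: "nat \<Rightarrow> ('k ^ 3 \<Rightarrow> 'k) \<Rightarrow> (6 option \<Rightarrow> ('k ^ 3) set) \<Rightarrow> 'k" where
  "frac d F z = ratio F h d (z None)"

lemma frac_plane_pt: "is_form d F \<Longrightarrow> good u \<Longrightarrow> frac d F (plane_pt u) = F u / vdot h u ^ d"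
  by (simp add: frac_def plane_pt_None ratio_span good_nonzero)

lemma frac_E:
  assumes "is_form d F" "z \<in> E i" "F (v i) = 0"
  shows "frac d F z = 0"
  using assms by (simp add: frac_def E_None ratio_span v_nonzero)

lemma eqn_prod_only_H:
  fixes t :: "(6 option \<Rightarrow> ('k ^ 3) set) set \<Rightarrow> (6 option \<Rightarrow> ('k ^ 3) set) \<Rightarrow> 'k"
  assumes "\<And>C. C \<noteq> H \<Longrightarrow> t C = (\<lambda>_. 1)"
  shows "X.eqn_prod t (dv (int d, m)) y = t H y ^ d"
proof -
  have "X.eqn_prod t (dv (int d, m)) y = (\<Prod>C\<in>curves. if C = H then t H y ^ d else 1)"
    unfolding X.eqn_prod_def by (rule prod.cong) (auto simp: assms dv_H)
  then show ?thesis by (simp add: curves_def)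
qed

lemma generic_part_h: "y \<in> X.generic_part \<Longrightarrow> y \<in> TX \<and> vdot h (rv (y None)) \<noteq> 0"
  unfolding X.generic_part_def by (auto simp: curves_def H_iff)

text \<open>\<open>F / h ^ d\<close> has a pole of order at most \<open>d\<close> along
  \<open>H\<close> and no other pole, and it vanishes on the exceptional curve over each zero
  \<open>v i\<close> of \<open>F\<close>, which allows multiplicity -1 there.\<close>

lemma sec_frac:
  assumes F: "is_form d F" and m: "\<And>i. m i \<ge> - 1" "\<And>i. m i < 0 \<Longrightarrow> F (v i) = 0"
  shows "X.sec (dv (int d, m)) TX (frac d F)"
proof (rule X.sec_local[OF openin_topspace])
  fix z assume z: "z \<in> TX"
  consider "z \<in> H" | i where "z \<in> E i" | "z \<notin> H" "\<And>i. z \<notin> E i" by blast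
  then show "\<exists>V. z \<in> V \<and> X.sec (dv (int d, m)) V (frac d F)"
  proof cases
    case 1
    from local_equation_H[OF this] obtain b V where V: "openin (ktop X) V" "z \<in> V" "\<And>i. V \<inter> E i = {}"
      "\<And>y. y \<in> V \<Longrightarrow> vdot b (rv (y None)) \<noteq> 0"
      "local_equation X H V (\<lambda>y. ratio (vdot h) b 1 (y None))" by metis
    define t :: "(6 option \<Rightarrow> ('k ^ 3) set) set \<Rightarrow> (6 option \<Rightarrow> ('k ^ 3) set) \<Rightarrow> 'k"
      where "t C = (if C = H then (\<lambda>y. ratio (vdot h) b 1 (y None)) else (\<lambda>_. 1))" for C
    have t: "\<forall>C\<in>curves. local_equation X C V (t C)"
      using V by (auto simp: curves_def t_def curves_distinct intro: X.local_equation_trivial)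
    have "X.sec (dv (int d, m)) V (frac d F)"
    proof (rule X.secI[OF V(1)])
      fix x assume x: "x \<in> V"
      \<comment> \<open>Multiplying \<open>F / h ^ d\<close> by the power \<open>d\<close> of the
        equation \<open>h / b\<close> gives \<open>F / b ^ d\<close>, which is regular where
        \<open>b\<close> does not vanish.\<close>
      have "regular X V (\<lambda>y. ratio F b d (y None))"
        using V by (intro regular_X_ratio_subset[OF F]) auto
      moreover have "frac d F y * X.eqn_prod t (dv (int d, m)) y = ratio F b d (y None)"
        if "y \<in> V \<inter> V \<inter> X.generic_part" for y
      proof -
        have "X.eqn_prod t (dv (int d, m)) y = t H y ^ d" by (rule eqn_prod_only_H) (simp add: t_def)
        moreover have "vdot h (rv (y None)) \<noteq> 0" using generic_part_h that by blast
        ultimately show ?thesis by (simp add: frac_def ratio_def t_def power_divide)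
      qed
      ultimately show "\<exists>W t g. x \<in> W \<and> openin (ktop X) W \<and> regular X W g \<and>
          (\<forall>C\<in>curves. local_equation X C W (t C)) \<and>
          (\<forall>y\<in>W \<inter> V \<inter> X.generic_part. frac d F y * X.eqn_prod t (dv (int d, m)) y = g y)"
        using V(1) x t by (intro exI[of _ V] exI[of _ t] exI[of _ "\<lambda>y. ratio F b d (y None)"]) auto
    qed
    then show ?thesis using V(2) by blast
  next
    case (2 i)
    let ?V = "{z \<in> TX. \<forall>j. j \<notin> {i} \<longrightarrow> z \<notin> E j} \<inter> (TX - H)"
    have o: "openin (ktop X) ?V" by (intro openin_Int openin_off_E openin_minus_H)
    have zV: "z \<in> ?V" using 2 z disjoint_curves by blast
    have r: "regular X ?V (frac d F)"
      unfolding frac_def by (intro regular_X_ratio_subset[OF F] o) (auto simp: H_iff)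
    show ?thesis
    proof (cases "m i < 0")
      case True
      have "X.sec (dv (int d, m)) ?V (frac d F)"
        using r
      proof (rule X.sec_vanishing[where ?C0.0 = "E i"])
        show "E i \<in> curves" by (simp add: curves_def)
        show "- 1 \<le> dv (int d, m) (E i)" using m(1) by (simp add: dv_E)
        show "frac d F y = 0" if "y \<in> E i" for y using F that m(2)[OF True] by (rule frac_E)
        fix C assume "C \<in> curves" "C \<noteq> E i"
        then have "C = H \<or> (\<exists>j. C = E j \<and> j \<noteq> i)" unfolding curves_def by blast
        then show "?V \<inter> C = {}"
        proof
          assume "C = H"
          then show ?thesis by blast
        next
          assume "\<exists>j. C = E j \<and> j \<noteq> i"
          then obtain j where j: "C = E j" "j \<notin> {i}" by auto
          show ?thesis unfolding j(1) by (rule off_E_disjoint[OF j(2)])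
        qed
      qed
      with zV show ?thesis by (intro exI[of _ ?V] conjI)
    next
      case False
      have "X.sec (dv (int d, m)) ?V (frac d F)"
        using r
      proof (rule X.sec_regular)
        fix C assume C: "C \<in> curves" "dv (int d, m) C < 0"
        then have "C \<noteq> H" "C \<noteq> E i" using False by (auto simp: dv_E dv_H)
        then obtain j where j: "C = E j" "j \<notin> {i}" using C(1) unfolding curves_def by blast
        show "?V \<inter> C = {}" unfolding j(1) by (rule off_E_disjoint[OF j(2)])
      qed
      with zV show ?thesis by (intro exI[of _ ?V] conjI)
    qed
  next
    case 3
    let ?V = "{z \<in> TX. \<forall>i. i \<notin> {} \<longrightarrow> z \<notin> E i} \<inter> (TX - H)"
    have o: "openin (ktop X) ?V" by (intro openin_Int openin_off_E openin_minus_H)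
    have r: "regular X ?V (frac d F)"
      unfolding frac_def by (intro regular_X_ratio_subset[OF F] o) (auto simp: H_iff)
    have "X.sec (dv (int d, m)) ?V (frac d F)"
      using r by (rule X.sec_regular) (auto simp: curves_def)
    moreover have "z \<in> ?V" using z 3 by blast
    ultimately show ?thesis by (intro exI[of _ ?V] conjI)
  qed
qed

lemma regular_line:
  assumes G: "regular X V G" and aw: "cr a w \<noteq> 0" and t0: "line_pt a w t0 \<in> V"
  obtains A B where "poly B t0 \<noteq> 0"
    "\<And>s. poly B s \<noteq> 0 \<Longrightarrow> line_pt a w s \<in> V \<and> G (line_pt a w s) = poly A s / poly B s"
proof -
  let ?l = "\<lambda>t :: unit \<Rightarrow> 'k. line_pt a w (t ())"
  let ?W = "{t :: unit \<Rightarrow> 'k. ?l t \<in> V}"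
  have r: "regular affine_sp ?W (G \<circ> ?l)"
    using morphism_regular_preimage[OF morphism_line_pt[OF aw] X.regular_openin[OF G] G] by simp
  have "(\<lambda>_. t0) \<in> ?W" using t0 by simp
  from regular_affine_spE[OF r this] obtain A' B' where 1: "polyfun A'" "polyfun B'" "B' (\<lambda>_. t0) \<noteq> 0"
    "{y. B' y \<noteq> 0} \<subseteq> ?W" "\<And>y. B' y \<noteq> 0 \<Longrightarrow> (G \<circ> ?l) y = A' y / B' y" by metis
  obtain A where A: "\<And>t. A' (\<lambda>_. t) = poly A t" using polyfun_unit[OF 1(1)] by metis
  obtain B where B: "\<And>t. B' (\<lambda>_. t) = poly B t" using polyfun_unit[OF 1(2)] by metis
  show ?thesis
  proof (rule that[of B A])
    show "poly B t0 \<noteq> 0" using 1(3) B by simp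
    fix s assume s: "poly B s \<noteq> 0"
    then have nz: "B' (\<lambda>_. s) \<noteq> 0" using B by simp
    then have "(\<lambda>_. s) \<in> {y. B' y \<noteq> 0}" by simp
    then have "(\<lambda>_. s) \<in> ?W" using 1(4) by (rule subsetD[rotated])
    then show "line_pt a w s \<in> V \<and> G (line_pt a w s) = poly A s / poly B s"
      using 1(5)[OF nz] A B by simp
  qed
qed

text \<open>With \<open>vdot h a = 1\<close> and \<open>vdot h w = 0\<close> the form
  \<open>h\<close> is 1 along the line, whose only point on \<open>H\<close> is its point at
  infinity \<open>w\<close>. The pole there has order at most \<open>d\<close>, which bounds the
  degree. At the points \<open>v i\<close> on the line the multiplicity is at most 0, so there is no
  other pole, and a negative multiplicity gives a zero.\<close>

lemma sec_on_line:
  assumes r: "X.sec (dv (int d, m)) TX r" and aw: "cr a w \<noteq> 0" and ha: "vdot h a = 1" and hw: "vdot h w = 0"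
    and m: "\<And>i. det3 (v i) a w = 0 \<Longrightarrow> m i \<le> 0"
  obtains P where "degree P \<le> d" "\<And>t. good (a + t *s w) \<Longrightarrow> r (plane_pt (a + t *s w)) = poly P t"
    "\<And>t i. cr (v i) (a + t *s w) = 0 \<Longrightarrow> m i < 0 \<Longrightarrow> poly P t = 0"
proof -
  let ?u = "\<lambda>t. a + t *s w"
  define T where "T = {t. \<not> good (?u t)}"
  define f where "f t = r (plane_pt (?u t))" for t
  have hu: "vdot h (?u t) = 1" for t using ha hw by (simp add: vdot_add vdot_scale)
  have T: "finite T" unfolding T_def by (rule finite_not_good[OF aw])
  have gp: "line_pt a w s \<in> X.generic_part \<and> r (line_pt a w s) = f s" if "s \<notin> T" for s
    using that hu[of s] line_pt_plane_pt[OF aw] by (auto simp: T_def f_def generic_part_iff)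
  have lpN: "line_pt a w t None = vec.span {?u t}" for t by (simp add: line_pt_def)
  have onE: "line_pt a w t \<in> E i \<longleftrightarrow> cr (v i) (?u t) = 0" for t i
    using line_pt_TX[OF aw] span_eq_iff[OF line_point_nonzero[OF aw] v_nonzero] cr_eq_0_commute[of "v i"]
    by (auto simp: E_None lpN)
  have onH: "line_pt a w t \<notin> H" for t
    using H_None[OF line_pt_TX[OF aw] lpN] hu by simp
  have loc: "\<exists>A B. poly B t \<noteq> 0 \<and> (\<forall>s. s \<notin> T \<longrightarrow> poly B s \<noteq> 0 \<longrightarrow> f s = poly A s / poly B s) \<and>
      ((\<exists>i. cr (v i) (?u t) = 0 \<and> m i < 0) \<longrightarrow> poly A t = 0)" for t
  proof -
    have "dv (int d, m) C \<le> 0" if C: "C \<in> curves" "line_pt a w t \<in> C" for C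
    proof -
      obtain i where i: "C = E i" using C onH by (auto simp: curves_def)
      then have "cr (v i) (?u t) = 0" using C onE by simp
      then have "det3 (v i) a w = 0" using line_cr_nonzero by blast
      then show ?thesis using m i by (simp add: dv_E)
    qed
    note D = this
    have "\<exists>V g. openin (ktop X) V \<and> line_pt a w t \<in> V \<and> regular X V g \<and>
      (\<forall>y\<in>V \<inter> X.generic_part. r y = g y) \<and>
      (\<forall>C\<in>curves. line_pt a w t \<in> C \<longrightarrow> dv (int d, m) C < 0 \<longrightarrow> g (line_pt a w t) = 0)"
      by (rule X.sec_value[OF r line_pt_TX[OF aw]]) (rule D)
    then obtain V g where
      V: "openin (ktop X) V" "line_pt a w t \<in> V" "regular X V g"
      "\<forall>y\<in>V \<inter> X.generic_part. r y = g y"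
      "\<forall>C\<in>curves. line_pt a w t \<in> C \<longrightarrow> dv (int d, m) C < 0 \<longrightarrow> g (line_pt a w t) = 0"
      by (elim exE conjE)
    obtain A B where AB: "poly B t \<noteq> 0"
      "\<And>s. poly B s \<noteq> 0 \<Longrightarrow> line_pt a w s \<in> V \<and> g (line_pt a w s) = poly A s / poly B s"
      using regular_line[OF V(3) aw V(2)] by metis
    have "f s = poly A s / poly B s" if "s \<notin> T" "poly B s \<noteq> 0" for s
    proof -
      have "r (line_pt a w s) = g (line_pt a w s)" using gp[OF that(1)] AB(2)[OF that(2)] V(4) by blast
      then show ?thesis using gp[OF that(1)] AB(2)[OF that(2)] by simp
    qed
    moreover have "poly A t = 0" if i: "cr (v i) (?u t) = 0" "m i < 0" for i
    proof -
      have "g (line_pt a w t) = 0" using V(5) i onE dv_E[of "int d" m i] by (auto simp: curves_def)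
      then show ?thesis using AB(2)[OF AB(1)] AB(1) by simp
    qed
    ultimately show ?thesis using AB(1) by blast
  qed
  have inf: "\<exists>A B. poly B 0 \<noteq> 0 \<and>
      (\<forall>s. s \<noteq> 0 \<longrightarrow> 1 / s \<notin> T \<longrightarrow> poly B s \<noteq> 0 \<longrightarrow> s ^ d * f (1 / s) = poly A s / poly B s)"
  proof -
    \<comment> \<open>Near infinity the line is run through as \<open>w\<close> plus
      \<open>s\<close> times \<open>a\<close>, which is \<open>s\<close> times the point with
      parameter \<open>1 / s\<close>; at \<open>s = 0\<close> it reaches the point \<open>w\<close>
      of \<open>H\<close>.\<close>
    have wa: "cr w a \<noteq> 0" using aw cr_eq_0_commute by blast
    let ?z = "line_pt w a 0"
    have zT: "?z \<in> TX" using line_pt_TX[OF wa] .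
    have "?z None = vec.span {w}" by (simp add: line_pt_def)
    then have "?z \<in> H" using H_None[OF zT] hw by simp
    from local_equation_H[OF this] obtain b V where V: "openin (ktop X) V" "?z \<in> V" "\<And>i. V \<inter> E i = {}"
      "\<And>y. y \<in> V \<Longrightarrow> vdot b (rv (y None)) \<noteq> 0"
      "local_equation X H V (\<lambda>y. ratio (vdot h) b 1 (y None))" by metis
    define t :: "(6 option \<Rightarrow> ('k ^ 3) set) set \<Rightarrow> (6 option \<Rightarrow> ('k ^ 3) set) \<Rightarrow> 'k"
      where "t C = (if C = H then (\<lambda>y. ratio (vdot h) b 1 (y None)) else (\<lambda>_. 1))" for C
    have t: "\<forall>C\<in>curves. local_equation X C V (t C)"
      using V by (auto simp: curves_def t_def curves_distinct intro: X.local_equation_trivial)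
    obtain W g where W: "openin (ktop X) W" "?z \<in> W" "W \<subseteq> V" "regular X W g"
      "\<And>y. y \<in> W \<Longrightarrow> y \<in> X.generic_part \<Longrightarrow> r y * X.eqn_prod t (dv (int d, m)) y = g y"
      using X.sec_at[OF r zT V(2,1) t] by metis
    obtain A B where AB: "poly B 0 \<noteq> 0"
      "\<And>s. poly B s \<noteq> 0 \<Longrightarrow> line_pt w a s \<in> W \<and> g (line_pt w a s) = poly A s / poly B s"
      using regular_line[OF W(4) wa W(2)] by metis
    \<comment> \<open>\<open>?q\<close> is \<open>b\<close> along the line, and \<open>s\<close>
      divided by it is the local equation \<open>h / b\<close> of \<open>H\<close>.\<close>
    let ?q = "[:vdot b w, vdot b a:]"
    have "s ^ d * f (1 / s) = poly (A * ?q ^ d) s / poly B s"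
      if s: "s \<noteq> 0" "1 / s \<notin> T" "poly B s \<noteq> 0" for s
    proof -
      have g1: "good (?u (1 / s))" using s(2) by (simp add: T_def)
      have eq: "w + s *s a = s *s ?u (1 / s)" using s(1) by (simp add: vector_add_ldistrib vector_smult_assoc add.commute)
      have g2: "good (w + s *s a)" unfolding eq using g1 s(1) good_scale by blast
      have lp: "line_pt w a s = plane_pt (w + s *s a)" using line_pt_plane_pt[OF wa g2] .
      also have "\<dots> = plane_pt (?u (1 / s))" unfolding eq using plane_pt_scale[OF s(1) g1] .
      finally have l: "r (line_pt w a s) = f (1 / s)" by (simp add: f_def)
      have hs: "vdot h (w + s *s a) = s" using ha hw by (simp add: vdot_add vdot_scale)
      have gen: "line_pt w a s \<in> X.generic_part" using lp g2 hs s(1) by (auto simp: generic_part_iff)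
      have inW: "line_pt w a s \<in> W" using AB(2)[OF s(3)] by simp
      have bs: "vdot b (w + s *s a) \<noteq> 0"
        using V(4)[of "line_pt w a s"] inW W(3) lp good_nonzero[OF g2] by (auto simp: plane_pt_None vdot_rv_eq_0)
      have "X.eqn_prod t (dv (int d, m)) (line_pt w a s) = t H (line_pt w a s) ^ d"
        by (rule eqn_prod_only_H) (simp add: t_def)
      also have "t H (line_pt w a s) = s / vdot b (w + s *s a)"
        using ratio_span[OF is_form_vdot good_nonzero[OF g2], of h b] hs by (simp add: t_def lp plane_pt_None)
      finally have "f (1 / s) * (s / vdot b (w + s *s a)) ^ d = poly A s / poly B s"
        using W(5)[OF inW gen] AB(2)[OF s(3)] l by simp
      moreover have "vdot b (w + s *s a) = poly ?q s" by (simp add: vdot_add vdot_scale)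
      ultimately show ?thesis using bs by (simp add: power_divide field_simps)
    qed
    then show ?thesis using AB(1) by blast
  qed
  have loc': "\<exists>A B. poly B t \<noteq> 0 \<and> (\<forall>s. s \<notin> T \<longrightarrow> poly B s \<noteq> 0 \<longrightarrow> f s = poly A s / poly B s)" for t
    using loc[of t] by blast
  from regular_on_line_is_poly[OF T loc' inf] obtain P where P: "degree P \<le> d"
    "\<forall>t. t \<notin> T \<longrightarrow> f t = poly P t"
    "\<forall>t A B. poly B t \<noteq> 0 \<longrightarrow> (\<forall>s. s \<notin> T \<longrightarrow> poly B s \<noteq> 0 \<longrightarrow> f s = poly A s / poly B s) \<longrightarrow>
       poly P t = poly A t / poly B t" by (elim exE conjE)
  show ?thesis
  proof (rule that[of P])
    show "degree P \<le> d" by (rule P(1))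
    show "r (plane_pt (?u t)) = poly P t" if "good (?u t)" for t
      using P(2) that by (simp add: T_def f_def)
    show "poly P t = 0" if i: "cr (v i) (?u t) = 0" "m i < 0" for t i
    proof -
      obtain A B where AB: "poly B t \<noteq> 0" "\<forall>s. s \<notin> T \<longrightarrow> poly B s \<noteq> 0 \<longrightarrow> f s = poly A s / poly B s"
        "poly A t = 0" using loc[of t] i by blast
      then have "poly P t = poly A t / poly B t"
        using P(3)[THEN spec[of _ t], THEN spec[of _ A], THEN spec[of _ B]] by simp
      then show ?thesis using AB(3) by simp
    qed
  qed
qed

end

section \<open>Vanishing of sections from zeros on lines\<close>

lemma cr_affine:
  "cr (x *s a) (y *s b - x *s a) = (x * y) *s cr a b" "cr (x *s a) (b - x *s a) = x *s cr a b"
  by (simp_all add: vec3_defs algebra_simps)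

lemma det3_affine: "det3 a b (x *s a + t *s (y *s b - x *s a)) = 0"
  by (simp add: vec3_defs algebra_simps)

lemma vdot_minus: "vdot a (u - w) = vdot a u - vdot a w"
  by (simp add: vec3_defs algebra_simps)

lemma det3_uminus: "det3 a b (- c) = - det3 a b c"
  by (simp add: vec3_defs algebra_simps)

text \<open>The induction keeps one nonzero polynomial \<open>f\<close> whose nonvanishing forces
  all conditions met so far; each new linear form is multiplied to it.\<close>

lemma avoid_hyperplanes:
  fixes S :: "('k::field_char_0 ^ 3) set"
  assumes "finite S" "\<And>n. n \<in> S \<Longrightarrow> n \<noteq> 0"
  shows "\<exists>w. \<forall>n\<in>S. vdot n w \<noteq> 0"
proof -
  have "\<exists>f x. polyfun f \<and> f x \<noteq> 0 \<and> (\<forall>x :: 3 \<Rightarrow> 'k. f x \<noteq> 0 \<longrightarrow> (\<forall>n\<in>S. vdot n (\<chi> a. x a) \<noteq> 0))"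
    using assms
  proof (induction S)
    case empty
    show ?case by (rule exI[of _ "\<lambda>_. 1"]) (simp add: polyfun.const)
  next
    case (insert n S)
    then obtain f x where f: "polyfun f" "f x \<noteq> 0"
      "\<And>x :: 3 \<Rightarrow> 'k. f x \<noteq> 0 \<Longrightarrow> (\<forall>n\<in>S. vdot n (\<chi> a. x a) \<noteq> 0)" by auto
    let ?g = "\<lambda>x :: 3 \<Rightarrow> 'k. vdot n (\<chi> a. x a)"
    obtain y where "vdot y n = 1" using vdot_exists insert.prems[of n] by blast
    then have "?g (\<lambda>a. y $ a) \<noteq> 0" by (simp add: vdot_commute)
    moreover have g: "polyfun ?g"
      unfolding vdot_def by (auto intro!: polyfun_intros)
    ultimately obtain z where "f z \<noteq> 0" "?g z \<noteq> 0"
      using polyfun_nonzero_common[of f ?g x "\<lambda>a. y $ a"] f(1,2) by blast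
    then show ?case
    proof (intro exI[of _ "\<lambda>x. f x * ?g x"] exI[of _ z] conjI allI impI)
      show "polyfun (\<lambda>x. f x * ?g x)" using f(1) g by (rule polyfun.mult)
      show "\<forall>k\<in>insert n S. vdot k (\<chi> a. x a) \<noteq> 0" if "f x * ?g x \<noteq> 0" for x
        using f(3)[of x] that by simp
    qed simp
  qed
  then obtain f and x :: "3 \<Rightarrow> 'k" where "polyfun f" "f x \<noteq> 0"
    "\<forall>x. f x \<noteq> 0 \<longrightarrow> (\<forall>n\<in>S. vdot n (\<chi> a. x a) \<noteq> 0)" by (elim exE conjE)
  then have "\<forall>n\<in>S. vdot n (\<chi> a. x a) \<noteq> 0" by simp
  then show ?thesis by blast
qed

context six_points
begin

lemma cr_h_nonzero:
  assumes "n \<noteq> 0" "vdot n u = 0" "vdot h u \<noteq> 0"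
  shows "cr h n \<noteq> 0"
proof
  assume "cr h n = 0"
  then obtain c where c: "n = c *s h" using cr_eq_0 h_nonzero by metis
  then have "c = 0" using assms(2,3) by (simp add: vdot_scale_left)
  then show False using c assms(1) by simp
qed

text \<open>Both \<open>u - a\<close> and \<open>w\<close> are annihilated by the two independent
  forms \<open>h\<close> and \<open>cr a w\<close>, so they are proportional.\<close>

lemma on_affine_line:
  assumes "cr a w \<noteq> 0" "vdot h a = 1" "vdot h w = 0" "vdot (cr a w) u = 0" "vdot h u = 1"
  obtains t where "u = a + t *s w"
proof -
  let ?n = "cr a w"
  have "w \<noteq> 0" using assms(1) by auto
  have "vdot ?n (u - a) = 0" "vdot h (u - a) = 0"
    using assms(2,4,5) vdot_add[of _ "u - a" a] by simp_all
  moreover have "vdot ?n w = 0" by simp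
  moreover have hn: "cr h ?n \<noteq> 0" by (rule cr_h_nonzero[OF assms(1), of a]) (use assms(2) in simp_all)
  ultimately have "cr (cr h ?n) (u - a) = 0" "cr (cr h ?n) w = 0"
    using assms(3) by (simp_all add: vdot_cr_expand)
  then obtain c d where c: "u - a = c *s cr h ?n" and d: "w = d *s cr h ?n"
    using cr_eq_0 hn by metis
  have d0: "d \<noteq> 0" using d \<open>w \<noteq> 0\<close> by auto
  have "(c / d) *s w = (c / d) *s (d *s cr h ?n)" using d by (rule arg_cong)
  also have "\<dots> = u - a" using d0 unfolding c by (simp add: vector_smult_assoc)
  finally have "u - a = (c / d) *s w" by simp
  then have "u = a + (c / d) *s w" by (metis add.commute diff_add_cancel)
  then show ?thesis by (rule that)
qed

text \<open>Directions annihilated by \<open>h\<close> are taken of the form \<open>cr h y\<close>,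
  on which \<open>n\<close> becomes the form \<open>cr n h\<close> of \<open>y\<close>. It is
  nonzero because the line \<open>n\<close> differs from \<open>h\<close>.\<close>

lemma avoid_forms:
  assumes "finite S" "\<And>n. n \<in> S \<Longrightarrow> cr h n \<noteq> 0"
  shows "\<exists>w. vdot h w = 0 \<and> (\<forall>n\<in>S. vdot n w \<noteq> 0)"
proof -
  have eq: "vdot n (cr h y) = vdot (cr n h) y" for n y by (simp add: vec3_defs algebra_simps)
  have "\<exists>w. \<forall>n\<in>(\<lambda>n. cr n h) ` S. vdot n w \<noteq> 0"
  proof (rule avoid_hyperplanes)
    fix x assume "x \<in> (\<lambda>n. cr n h) ` S"
    then obtain n where "n \<in> S" "x = cr n h" by blast
    then show "x \<noteq> 0" using assms(2)[of n] cr_eq_0_commute[of n h] by simp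
  qed (simp add: assms(1))
  then obtain y where "\<forall>n\<in>(\<lambda>n. cr n h) ` S. vdot n y \<noteq> 0" by blast
  then show ?thesis by (intro exI[of _ "cr h y"]) (simp add: eq)
qed

lemma poly_many_zeros:
  assumes "degree P \<le> d" "finite Z" "card Z > d" "\<And>t. t \<in> Z \<Longrightarrow> poly P t = 0"
  shows "P = (0 :: 'k poly)"
proof (rule ccontr)
  assume P: "P \<noteq> 0"
  have "card Z \<le> card {t. poly P t = 0}"
    by (rule card_mono[OF poly_roots_finite[OF P]]) (use assms(4) in auto)
  also have "\<dots> \<le> degree P" by (rule card_poly_roots_bound[OF P])
  finally show False using assms by simp
qed

lemma line_vanish:
  assumes r: "X.sec (dv (int d, m)) TX r" and m: "\<And>i. m i \<le> 0"
    and aw: "cr a w \<noteq> 0" "vdot h a = 1" "vdot h w = 0"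
    and Z: "finite Z" "card Z > d"
      "\<And>t. t \<in> Z \<Longrightarrow> (good (a + t *s w) \<and> r (plane_pt (a + t *s w)) = 0) \<or>
         (\<exists>i. cr (v i) (a + t *s w) = 0 \<and> m i < 0)"
    and u: "good u" "vdot h u = 1" "vdot (cr a w) u = 0"
  shows "r (plane_pt u) = 0"
proof -
  obtain P where P: "degree P \<le> d" "\<And>t. good (a + t *s w) \<Longrightarrow> r (plane_pt (a + t *s w)) = poly P t"
    "\<And>t i. cr (v i) (a + t *s w) = 0 \<Longrightarrow> m i < 0 \<Longrightarrow> poly P t = 0"
    using sec_on_line[OF r aw m] by metis
  have "P = 0" by (rule poly_many_zeros[OF P(1) Z(1,2)]) (use Z(3) P(2,3) in fastforce)
  moreover obtain t where "u = a + t *s w" using on_affine_line[OF aw u(3,2)] .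
  ultimately show ?thesis using P(2)[of t] u(1) by simp
qed

text \<open>A general line through \<open>u\<close> meets the \<open>d + 1\<close> lines
  \<open>n k\<close> in \<open>d + 1\<close> different points, so the section, a polynomial of
  degree at most \<open>d\<close> on it, is zero there and in particular at
  \<open>u\<close>.\<close>

lemma vanish_by_lines:
  assumes r: "X.sec (dv (int d, m)) TX r" and m: "\<And>i. m i \<le> 0"
    and n: "\<And>k. k \<le> d \<Longrightarrow> cr h (n k) \<noteq> 0"
      "\<And>k l. k \<le> d \<Longrightarrow> l \<le> d \<Longrightarrow> k \<noteq> l \<Longrightarrow> cr (n k) (n l) \<noteq> 0"
      "\<And>k u. k \<le> d \<Longrightarrow> good u \<Longrightarrow> vdot h u = 1 \<Longrightarrow> vdot (n k) u = 0 \<Longrightarrow> r (plane_pt u) = 0"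
    and u: "good u" "vdot h u = 1"
  shows "r (plane_pt u) = 0"
proof (cases "\<exists>k\<le>d. vdot (n k) u = 0")
  case True
  then show ?thesis using n(3) u by blast
next
  case False
  let ?c = "\<lambda>k. vdot (n k) u"
  \<comment> \<open>\<open>?N k l\<close> is the line through \<open>u\<close> and the common point
    of \<open>n k\<close> and \<open>n l\<close>. The direction \<open>w\<close> must avoid it, as
    otherwise two intersection points coincide. It must also avoid the joins of \<open>u\<close>
    with the six points and the directions of the lines \<open>n k\<close>.\<close>
  let ?N = "\<lambda>k l. ?c k *s n l - ?c l *s n k"
  let ?S = "range (\<lambda>i. cr (v i) u) \<union> n ` {..d} \<union> (\<lambda>(k, l). ?N k l) ` {(k, l). k \<le> d \<and> l \<le> d \<and> k \<noteq> l}"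
  have nz: "cr (v i) u \<noteq> 0" for i using u(1) by (simp add: good_def)
  have Nu: "vdot (?N k l) u = 0" for k l
    by (simp add: vec3_defs algebra_simps)
  have Nnz: "?N k l \<noteq> 0" if "k \<le> d" "l \<le> d" "k \<noteq> l" for k l
  proof
    assume "?N k l = 0"
    then have "cr (n k) (?N k l) = 0" by simp
    moreover have "cr (n k) (?N k l) = ?c k *s cr (n k) (n l)" by (simp add: vec3_defs algebra_simps)
    ultimately show False using n(2)[OF that] False that by simp
  qed
  have fin: "finite {(k, l). k \<le> d \<and> l \<le> d \<and> k \<noteq> l}"
    by (rule finite_subset[of _ "{..d} \<times> {..d}"]) auto
  have "cr h x \<noteq> 0" if "x \<in> ?S" for x
    using that n(1) cr_h_nonzero[OF nz, where u = u] cr_h_nonzero[OF Nnz Nu] u(2) by auto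
  then have "\<exists>w. vdot h w = 0 \<and> (\<forall>x\<in>?S. vdot x w \<noteq> 0)"
    using fin by (intro avoid_forms) auto
  then obtain w where w: "vdot h w = 0" "\<forall>x\<in>?S. vdot x w \<noteq> 0" by blast
  have w1: "vdot (cr (v i) u) w \<noteq> 0" for i using w(2) by blast
  have w2: "vdot (n k) w \<noteq> 0" if "k \<le> d" for k using w(2) that by blast
  have w3: "vdot (?N k l) w \<noteq> 0" if "k \<le> d" "l \<le> d" "k \<noteq> l" for k l
  proof (rule bspec[OF w(2)])
    show "?N k l \<in> ?S" using that by (intro UnI2 image_eqI[of _ _ "(k, l)"]) auto
  qed
  have det: "det3 (v i) u w \<noteq> 0" for i using w1[of i] by (simp add: det3_alt)
  have uw: "cr u w \<noteq> 0" using det[of 0] by (auto simp: det3_def)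
  obtain P where P: "degree P \<le> d" "\<And>t. good (u + t *s w) \<Longrightarrow> r (plane_pt (u + t *s w)) = poly P t"
    using sec_on_line[OF r uw u(2) w(1)] m by metis
  \<comment> \<open>The parameter at which the line through \<open>u\<close> meets
    \<open>n k\<close>.\<close>
  define t where "t k = - ?c k / vdot (n k) w" for k
  have inj: "inj_on t {..d}"
  proof (rule inj_onI, rule ccontr)
    fix k l assume kl: "k \<in> {..d}" "l \<in> {..d}" "t k = t l" "k \<noteq> l"
    then have "?c k * vdot (n l) w = ?c l * vdot (n k) w"
      using w2[of k] w2[of l] by (simp add: t_def field_simps)
    then have "vdot (?N k l) w = 0" by (simp add: vec3_defs algebra_simps)
    then show False using w3[of k l] kl by simp
  qed
  have "P = 0"
  proof (rule poly_many_zeros[OF P(1)])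
    show "finite (t ` {..d})" by simp
    show "card (t ` {..d}) > d" using inj by (simp add: card_image)
    fix s assume "s \<in> t ` {..d}"
    then obtain k where k: "k \<le> d" "s = t k" by auto
    have g: "good (u + s *s w)" unfolding good_def using line_cr_nonzero det by blast
    have hu: "vdot h (u + s *s w) = 1" using u(2) w(1) by (simp add: vdot_add vdot_scale)
    have "vdot (n k) (u + s *s w) = 0"
      using w2[OF k(1)] by (simp add: vdot_add vdot_minus vdot_scale k(2) t_def)
    from n(3)[OF k(1) g hu this] show "poly P s = 0" using P(2)[OF g] by simp
  qed
  then show ?thesis using P(2)[of 0] u(1) by simp
qed

text \<open>On the line through \<open>v i\<close> and \<open>v j\<close> the section has degree at
  most 2 and three zeros: at \<open>v i\<close> and \<open>v j\<close> because of their negative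
  multiplicities, and at \<open>q\<close>.\<close>

lemma pair_line_vanish:
  assumes r: "X.sec (dv (int 2, m)) TX r" and m: "\<And>i. m i \<le> 0" "m i < 0" "m j < 0" "i \<noteq> j"
    and q: "good q" "vdot h q \<noteq> 0" "det3 (v i) (v j) q = 0" "r (plane_pt q) = 0"
    and u: "good u" "vdot h u = 1" "det3 (v i) (v j) u = 0"
  shows "r (plane_pt u) = 0"
proof -
  define a where "a = (1 / vdot h (v i)) *s v i"
  define b where "b = (1 / vdot h (v j)) *s v j"
  define q' where "q' = (1 / vdot h q) *s q"
  have ha: "vdot h a = 1" "vdot h b = 1" "vdot h q' = 1"
    using avoid q(2) by (simp_all add: a_def b_def q'_def vdot_scale)
  let ?w = "b - a"
  have w: "vdot h ?w = 0" using ha vdot_add[of h "b - a" a] by simp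
  have cw: "cr a ?w = (1 / vdot h (v i) * (1 / vdot h (v j))) *s cr (v i) (v j)"
    unfolding a_def b_def by (rule cr_affine)
  then have nz: "cr a ?w \<noteq> 0" using avoid cr_v_nonzero[OF m(4)] by simp
  have "vdot (cr a ?w) q' = 0"
    unfolding cw q'_def using q(3) by (simp add: vdot_scale vdot_scale_left det3_alt)
  then obtain s where s: "q' = a + s *s ?w" using on_affine_line[OF nz ha(1) w _ ha(3)] by metis
  have gq: "good q'" "plane_pt q' = plane_pt q"
    unfolding q'_def using q(1,2) good_scale plane_pt_scale by auto
  have "s \<noteq> 0"
  proof
    assume "s = 0"
    then have "cr (v i) q' = 0" using s by (simp add: a_def cr_scale)
    then show False using gq(1) by (simp add: good_def)
  qed
  moreover have "s \<noteq> 1"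
  proof
    assume "s = 1"
    then have "cr (v j) q' = 0" using s by (simp add: b_def cr_scale)
    then show False using gq(1) by (simp add: good_def)
  qed
  \<comment> \<open>The parameters 0, 1 and \<open>s\<close> belong to \<open>v i\<close>,
    \<open>v j\<close> and \<open>q\<close>.\<close>
  ultimately have card: "card {0, 1, s} > 2" by simp
  show ?thesis
  proof (rule line_vanish[OF r m(1) nz ha(1) w _ card _ u(1,2)])
    show "vdot (cr a ?w) u = 0" unfolding cw using u(3) by (simp add: vdot_scale_left det3_alt)
    fix t assume "t \<in> {0, 1, s}"
    then consider "t = 0" | "t = 1" | "t = s" by auto
    then show "(good (a + t *s ?w) \<and> r (plane_pt (a + t *s ?w)) = 0) \<or>
         (\<exists>i. cr (v i) (a + t *s ?w) = 0 \<and> m i < 0)"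
    proof cases
      case 1
      then have "cr (v i) (a + t *s ?w) = 0" by (simp add: a_def cr_scale)
      then show ?thesis using m(2) by blast
    next
      case 2
      then have "cr (v j) (a + t *s ?w) = 0" by (simp add: b_def cr_scale)
      then show ?thesis using m(3) by blast
    next
      case 3
      then show ?thesis using gq q(4) s by simp
    qed
  qed simp
qed

text \<open>One of the six points on the line \<open>i j\<close> must be \<open>v i\<close> or
  \<open>v j\<close>, since no three are collinear; the same for \<open>k l\<close>, and the pairs
  are disjoint.\<close>

lemma not_on_two_lines:
  assumes "distinct [i, j, k, l]" "q \<noteq> 0" "det3 (v i) (v j) q = 0" "det3 (v k) (v l) q = 0"
  shows "good q"
  unfolding good_def
proof (intro allI notI)
  fix x assume "cr (v x) q = 0"
  then obtain c where c: "q = c *s v x" using cr_eq_0 v_nonzero by metis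
  then have "c \<noteq> 0" using assms(2) by auto
  then have "det3 (v i) (v j) (v x) = 0" "det3 (v k) (v l) (v x) = 0"
    using assms(3,4) c by (simp_all add: det3_linear)
  then have "x = i \<or> x = j" "x = k \<or> x = l"
    using det_nonzero[of i j x] det_nonzero[of k l x] assms(1) by auto
  then show False using assms(1) by auto
qed

text \<open>Starting from \<open>q0\<close> the section vanishes on the line \<open>i1 i2\<close>,
  hence where the lines \<open>i3 i4\<close> and \<open>i3 i5\<close> meet it, hence on these lines
  as well by \<open>pair_line_vanish\<close>. Three lines suffice for degree 2. The conditions
  \<open>h1\<close> and \<open>h2\<close> keep the two meeting points off \<open>h\<close>, so that
  the vanishing on the line \<open>i1 i2\<close> covers them.\<close>

lemma conic_vanish_core:
  assumes r: "X.sec (dv (int 2, m)) TX r" and m: "\<And>i. m i \<le> 0" "m i1 < 0" "m i2 < 0" "m i3 < 0" "m i4 < 0" "m i5 < 0"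
    and d: "distinct [i1, i2, i3, i4, i5]"
    and q0: "good q0" "vdot h q0 \<noteq> 0" "det3 (v i1) (v i2) q0 = 0" "r (plane_pt q0) = 0"
    and h1: "det3 h (cr (v i1) (v i2)) (cr (v i3) (v i4)) \<noteq> 0"
    and h2: "det3 h (cr (v i1) (v i2)) (cr (v i3) (v i5)) \<noteq> 0"
    and u: "good u" "vdot h u = 1"
  shows "r (plane_pt u) = 0"
proof -
  let ?n = "cr (v i1) (v i2)"
  have L0: "r (plane_pt u) = 0" if "good u" "vdot h u = 1" "det3 (v i1) (v i2) u = 0" for u
    using pair_line_vanish[OF r m(1,2,3) _ q0 that] d by auto
  have L: "r (plane_pt u) = 0"
    if ij: "distinct [i1, i2, i, j]" "m i < 0" "m j < 0" "det3 h ?n (cr (v i) (v j)) \<noteq> 0"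
      and u: "good u" "vdot h u = 1" "det3 (v i) (v j) u = 0" for i j u
  proof -
    let ?q = "cr ?n (cr (v i) (v j))"
    have q: "vdot h ?q \<noteq> 0" using ij(4) by (simp add: det3_def)
    then have "?q \<noteq> 0" by auto
    moreover have z: "det3 (v i1) (v i2) ?q = 0" "det3 (v i) (v j) ?q = 0" by (simp_all add: det3_alt)
    ultimately have g: "good ?q" by (intro not_on_two_lines[OF ij(1)])
    let ?p = "(1 / vdot h ?q) *s ?q"
    have "good ?p" "vdot h ?p = 1" "det3 (v i1) (v i2) ?p = 0" "plane_pt ?p = plane_pt ?q"
      using g q z(1) good_scale plane_pt_scale by (simp_all add: vdot_scale det3_linear)
    then have "r (plane_pt ?q) = 0" using L0 by metis
    then show ?thesis using pair_line_vanish[OF r m(1) ij(2,3) _ g q z(2) _ u] ij(1) by auto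
  qed
  define n where "n k = (if k = (0::nat) then ?n else if k = 1 then cr (v i3) (v i4) else cr (v i3) (v i5))" for k
  have n34: "cr ?n (cr (v i3) (v i4)) \<noteq> 0" "cr ?n (cr (v i3) (v i5)) \<noteq> 0"
    using h1 h2 by (auto simp: det3_def)
  have "cr (cr (v i3) (v i4)) (cr (v i3) (v i5)) = det3 (v i3) (v i4) (v i5) *s v i3"
    by (simp add: vec3_defs algebra_simps)
  moreover have "det3 (v i3) (v i4) (v i5) \<noteq> 0" using d by (intro det_nonzero) auto
  ultimately have n45: "cr (cr (v i3) (v i4)) (cr (v i3) (v i5)) \<noteq> 0" using v_nonzero by simp
  have hn: "cr h (cr (v i) (v j)) \<noteq> 0" if "i \<noteq> j" for i j
    using cr_h_nonzero[OF cr_v_nonzero[OF that], of "v i"] avoid by simp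
  show ?thesis
  proof (rule vanish_by_lines[OF r m(1), of n])
    fix k :: nat assume k: "k \<le> 2"
    then have kk: "k = 0 \<or> k = 1 \<or> k = 2" by auto
    then show "cr h (n k) \<noteq> 0" using hn d by (auto simp: n_def)
    show "cr (n k) (n l) \<noteq> 0" if "l \<le> 2" "k \<noteq> l" for l
    proof -
      have "l = 0 \<or> l = 1 \<or> l = 2" using that by auto
      then show ?thesis using kk that(2) n34 n45 by (auto simp: n_def cr_eq_0_commute)
    qed
    fix u assume u: "good u" "vdot h u = 1" "vdot (n k) u = 0"
    then show "r (plane_pt u) = 0"
      using kk L0[OF u(1,2)] L[OF _ m(4,5) h1 u(1,2)] L[OF _ m(4,6) h2 u(1,2)] d
      by (auto simp: n_def det3_alt)
  qed (rule u)+
qed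

text \<open>Otherwise the common point of \<open>h\<close> with the line \<open>i1 i2\<close> would
  lie on both lines \<open>i3 i4\<close> and \<open>i3 i5\<close>, hence be \<open>v i3\<close>,
  which is not on \<open>h\<close>.\<close>

lemma lines_not_parallel:
  assumes "distinct [i1, i2, i3, i4, i5]"
  shows "det3 h (cr (v i1) (v i2)) (cr (v i3) (v i4)) \<noteq> 0 \<or> det3 h (cr (v i1) (v i2)) (cr (v i3) (v i5)) \<noteq> 0"
proof (rule ccontr)
  assume *: "\<not> ?thesis"
  let ?n = "cr (v i1) (v i2)"
  let ?g = "cr h ?n"
  have g0: "?g \<noteq> 0" using cr_h_nonzero[OF cr_v_nonzero, of i1 i2 "v i1"] avoid assms by auto
  have "cr (cr (v i3) (v i4)) (cr (v i3) (v i5)) = det3 (v i3) (v i4) (v i5) *s v i3"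
    by (simp add: vec3_defs algebra_simps)
  moreover have "det3 (v i3) (v i4) (v i5) \<noteq> 0" using assms by (intro det_nonzero) auto
  moreover have "vdot ?g (cr (v i3) (v i4)) = 0" "vdot ?g (cr (v i3) (v i5)) = 0"
    using * by (simp_all add: det3_alt)
  moreover then have "cr (cr (cr (v i3) (v i4)) (cr (v i3) (v i5))) ?g = 0"
    unfolding vdot_cr_expand[of "cr (v i3) (v i4)" "cr (v i3) (v i5)" ?g]
    by (simp add: vdot_commute[of _ ?g])
  ultimately have "cr (v i3) ?g = 0" by (simp add: cr_scale_left)
  then obtain c where c: "?g = c *s v i3" using cr_eq_0 v_nonzero by metis
  have "vdot h ?g = 0" by simp
  then have "c = 0" using avoid c by (simp add: vdot_scale)
  then show False using c g0 by simp
qed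

text \<open>Applied with each of the three indices as common point,
  \<open>lines_not_parallel\<close> shows that at most one of the three lines joining two of
  \<open>v i3\<close>, \<open>v i4\<close>, \<open>v i5\<close> meets the line \<open>i1 i2\<close>
  on \<open>h\<close>. The other two share one of the points, which takes the place of
  \<open>v i3\<close> in \<open>conic_vanish_core\<close>.\<close>

lemma conic_vanish:
  assumes r: "X.sec (dv (int 2, m)) TX r" and m: "\<And>i. m i \<le> 0" "m i1 < 0" "m i2 < 0" "m i3 < 0" "m i4 < 0" "m i5 < 0"
    and d: "distinct [i1, i2, i3, i4, i5]"
    and q0: "good q0" "vdot h q0 \<noteq> 0" "det3 (v i1) (v i2) q0 = 0" "r (plane_pt q0) = 0"
    and u: "good u" "vdot h u = 1"
  shows "r (plane_pt u) = 0"
proof -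
  let ?D = "\<lambda>i j. det3 h (cr (v i1) (v i2)) (cr (v i) (v j)) \<noteq> 0"
  have sym: "?D i j \<longleftrightarrow> ?D j i" for i j
    by (subst cr_antisym[of "v i"]) (simp add: det3_uminus)
  note core = conic_vanish_core[OF r m(1,2,3) _ _ _ _ q0 _ _ u]
  have "?D i3 i4 \<or> ?D i3 i5" "?D i4 i3 \<or> ?D i4 i5" "?D i5 i3 \<or> ?D i5 i4"
    using lines_not_parallel[of i1 i2 i3 i4 i5] lines_not_parallel[of i1 i2 i4 i3 i5]
      lines_not_parallel[of i1 i2 i5 i3 i4] d by auto
  then consider "?D i3 i4" "?D i3 i5" | "?D i4 i3" "?D i4 i5" | "?D i5 i3" "?D i5 i4"
    using sym by blast
  then show ?thesis
  proof cases
    case 1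
    then show ?thesis using core[of i3 i4 i5] m d by auto
  next
    case 2
    then show ?thesis using core[of i4 i3 i5] m d by auto
  next
    case 3
    then show ?thesis using core[of i5 i3 i4] m d by auto
  qed
qed

section \<open>Uniqueness of the sections belonging to conics, lines and constants\<close>

lemma generic_partI: "good u \<Longrightarrow> vdot h u = 1 \<Longrightarrow> plane_pt u \<in> X.generic_part"
  by (auto simp: generic_part_iff)

lemma generic_partE:
  assumes "z \<in> X.generic_part"
  obtains u where "good u" "vdot h u = 1" "z = plane_pt u"
proof -
  obtain u where u: "good u" "vdot h u \<noteq> 0" "z = plane_pt u" using assms by (auto simp: generic_part_iff)
  let ?u = "(1 / vdot h u) *s u"
  have "good ?u" "vdot h ?u = 1" "z = plane_pt ?u"
    using u good_scale plane_pt_scale by (simp_all add: vdot_scale)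
  then show ?thesis by (rule that)
qed

lemma sec_subtract_frac:
  assumes "X.sec (dv (int d, m)) TX r" "X.sec (dv (int d, m)) TX (frac d F)" "is_form d F"
    "\<And>i. m i \<ge> - 1" "\<And>i. m i < 0 \<Longrightarrow> F (v i) = 0"
  shows "X.sec (dv (int d, m)) TX (\<lambda>z. r z + (- c) * frac d F z)"
proof (rule X.sec_add[OF assms(1)])
  have "X.sec (dv (int d, m)) TX (frac d (\<lambda>u. (- c) * F u))"
    by (rule sec_frac[OF is_form_cmult[OF assms(3)]]) (use assms(4,5) in auto)
  then show "X.sec (dv (int d, m)) TX (\<lambda>z. (- c) * frac d F z)"
    by (simp add: frac_def[abs_def] ratio_def)
qed

text \<open>By \<open>van\<close>, a section vanishing at the single point \<open>q\<close> is zero.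
  It applies to the difference of \<open>r\<close> and the multiple of \<open>F / h ^ d\<close> with
  the same value at \<open>q\<close>. This multiple exists because \<open>F / h ^ d\<close> cannot
  vanish at \<open>q\<close>, as \<open>F u0 \<noteq> 0\<close>.\<close>

lemma sec_unique:
  assumes F: "is_form d F" "\<And>i. m i \<ge> - 1" "\<And>i. m i < 0 \<Longrightarrow> F (v i) = 0"
    and r: "X.sec (dv (int d, m)) TX r" and q: "good q" "vdot h q = 1" and u0: "good u0" "vdot h u0 = 1" "F u0 \<noteq> 0"
    and van: "\<And>s u. X.sec (dv (int d, m)) TX s \<Longrightarrow> s (plane_pt q) = 0 \<Longrightarrow> good u \<Longrightarrow> vdot h u = 1 \<Longrightarrow>
      s (plane_pt u) = 0"
  shows "\<exists>c. \<forall>z\<in>X.generic_part. r z = c * frac d F z"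
proof -
  have sF: "X.sec (dv (int d, m)) TX (frac d F)" by (rule sec_frac[OF F])
  have "frac d F (plane_pt q) \<noteq> 0"
    using van[OF sF _ u0(1,2)] u0 frac_plane_pt[OF F(1) u0(1)] by auto
  moreover define c where "c = r (plane_pt q) / frac d F (plane_pt q)"
  ultimately have "r (plane_pt q) + (- c) * frac d F (plane_pt q) = 0" by simp
  then have "r z + (- c) * frac d F z = 0" if "z \<in> X.generic_part" for z
    using van[OF sec_subtract_frac[OF r sF F, of c]] that generic_partE by metis
  then show ?thesis by (intro exI[of _ c]) (simp add: eq_neg_iff_add_eq_0 add_eq_0_iff)
qed

lemma good_line_point_exists:
  assumes "cr a w \<noteq> 0" "finite T"
  obtains t where "good (a + t *s w)" "t \<notin> T"
proof -
  have "finite ({t. \<not> good (a + t *s w)} \<union> T)" using finite_not_good[OF assms(1)] assms(2) by blast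
  from ex_new_if_finite[OF infinite_UNIV_char_0 this] show ?thesis using that by blast
qed

lemma normalized_good_exists:
  obtains u where "good u" "vdot h u = 1"
proof -
  obtain u where u: "good u" "vdot h u \<noteq> 0" using good_generic_exists by blast
  have "good ((1 / vdot h u) *s u)" "vdot h ((1 / vdot h u) *s u) = 1"
    using u good_scale by (simp_all add: vdot_scale)
  then show ?thesis by (rule that)
qed

text \<open>The test point \<open>?q\<close> is a good point on the line through \<open>v i1\<close>
  and \<open>v i2\<close>, as \<open>conic_vanish\<close> requires. Density provides a normalised
  good point where \<open>F\<close> does not vanish.\<close>

lemma conic_unique:
  assumes F: "is_form 2 F" "\<And>i. i \<noteq> a \<Longrightarrow> F (v i) = 0" and u0: "F u0 \<noteq> 0"
    and m: "m a = 0" "\<And>i. i \<noteq> a \<Longrightarrow> m i = - 1"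
    and r: "X.sec (dv (int 2, m)) TX r"
    and d: "distinct [a, i1, i2, i3, i4, i5]"
  shows "\<exists>c. \<forall>z\<in>X.generic_part. r z = c * frac 2 F z"
proof -
  have m': "m i \<le> 0" "m i \<ge> - 1" for i using m by (cases "i = a"; simp)+
  have mF: "F (v i) = 0" if "m i < 0" for i using F(2)[of i] m(1) that by (cases "i = a") auto
  let ?A = "(1 / vdot h (v i1)) *s v i1" and ?B = "(1 / vdot h (v i2)) *s v i2"
  have hA: "vdot h ?A = 1" "vdot h ?B = 1" using avoid by (simp_all add: vdot_scale)
  have c: "cr ?A (?B - ?A) = (1 / vdot h (v i1) * (1 / vdot h (v i2))) *s cr (v i1) (v i2)"
    by (rule cr_affine)
  then have nz: "cr ?A (?B - ?A) \<noteq> 0" using avoid cr_v_nonzero[of i1 i2] d by simp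
  obtain t where t: "good (?A + t *s (?B - ?A))" using good_line_point_exists[OF nz, of "{}"] by auto
  let ?q = "?A + t *s (?B - ?A)"
  have "vdot h (?B - ?A) = 0" using hA vdot_add[of h "?B - ?A" ?A] by simp
  then have hq: "vdot h ?q = 1" using hA by (simp only: vdot_add vdot_scale) simp
  have dq: "det3 (v i1) (v i2) ?q = 0" by (rule det3_affine)
  have "polyfun (\<lambda>x. F (\<chi> a. x a))" using F(1) by (simp add: is_form_def)
  moreover have "F (\<chi> a. u0 $ a) \<noteq> 0" using u0 by simp
  moreover obtain g0 where g0: "good g0" "vdot h g0 = 1" by (rule normalized_good_exists)
  moreover obtain f where f: "polyfun f" "f (\<lambda>a. g0 $ a) \<noteq> 0" "{x. f x \<noteq> 0} \<subseteq> {x. good (\<chi> a. x a)}"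
    using openin_zariskiE[OF openin_good, of "\<lambda>a. g0 $ a"] g0 by auto
  moreover have "polyfun (\<lambda>x. f x * vdot h (\<chi> a. x a))"
    using f(1) unfolding vdot_def by (auto intro!: polyfun_intros)
  ultimately obtain x where x: "F (\<chi> a. x a) \<noteq> 0" "f x * vdot h (\<chi> a. x a) \<noteq> 0"
    using polyfun_nonzero_common[of "\<lambda>x. F (\<chi> a. x a)" "\<lambda>x. f x * vdot h (\<chi> a. x a)" "\<lambda>a. u0 $ a" "\<lambda>a. g0 $ a"] by auto
  let ?x = "\<chi> a. x a"
  let ?u = "(1 / vdot h ?x) *s ?x"
  have "good ?x" using f(3) x by auto
  then have gu: "good ?u" "vdot h ?u = 1" using x good_scale by (simp_all add: vdot_scale)
  have Fu: "F ?u \<noteq> 0" using x is_form_scale[OF F(1)] by simp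
  show ?thesis
  proof (rule sec_unique[OF F(1) m'(2) mF r t hq gu Fu])
    fix s u assume s: "X.sec (dv (int 2, m)) TX s" "s (plane_pt ?q) = 0" "good u" "vdot h u = 1"
    show "s (plane_pt u) = 0"
      by (rule conic_vanish[OF s(1) m'(1) _ _ _ _ _ _ t _ dq s(2,3,4), of i3 i4 i5])
        (use d hq m(2) in auto)
  qed
qed

text \<open>A section vanishing at a point \<open>?q\<close> off the line vanishes on the lines from
  \<open>?q\<close> to \<open>v b\<close> and to \<open>v c\<close>, each carrying two zeros, and
  two lines suffice for degree 1.\<close>

lemma line_unique:
  assumes bc: "b \<noteq> c" and m: "m b = - 1" "m c = - 1" "\<And>i. i \<noteq> b \<Longrightarrow> i \<noteq> c \<Longrightarrow> m i = 0"
    and r: "X.sec (dv (int 1, m)) TX r"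
  shows "\<exists>k. \<forall>z\<in>X.generic_part. r z = k * frac 1 (det3 (v b) (v c)) z"
proof -
  have F: "is_form 1 (det3 (v b) (v c))"
    using is_form_vdot[of "cr (v b) (v c)"] by (simp add: det3_alt[abs_def])
  have m': "m i \<le> 0" "m i \<ge> - 1" for i using m by (cases "i = b"; cases "i = c"; simp)+
  have mF: "det3 (v b) (v c) (v i) = 0" if "m i < 0" for i
    using m(3)[of i] that by (cases "i = b"; cases "i = c") auto
  obtain g0 where g0: "good g0" "vdot h g0 = 1" by (rule normalized_good_exists)
  obtain f where f: "polyfun f" "f (\<lambda>a. g0 $ a) \<noteq> 0" "{x. f x \<noteq> 0} \<subseteq> {x. good (\<chi> a. x a)}"
    using openin_zariskiE[OF openin_good, of "\<lambda>a. g0 $ a"] g0 by auto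
  obtain u0 where "vdot u0 (cr (v b) (v c)) = 1" using vdot_exists[OF cr_v_nonzero[OF bc]] .
  then have "vdot (cr (v b) (v c)) (\<chi> a. u0 $ a) \<noteq> 0" by (simp add: vdot_commute)
  moreover have "polyfun (\<lambda>x. vdot (cr (v b) (v c)) (\<chi> a. x a))"
    unfolding vdot_def by (auto intro!: polyfun_intros)
  moreover have "polyfun (\<lambda>x. f x * vdot h (\<chi> a. x a))"
    using f(1) unfolding vdot_def by (auto intro!: polyfun_intros)
  ultimately obtain x where x: "vdot (cr (v b) (v c)) (\<chi> a. x a) \<noteq> 0" "f x * vdot h (\<chi> a. x a) \<noteq> 0"
    using polyfun_nonzero_common[of "\<lambda>x. vdot (cr (v b) (v c)) (\<chi> a. x a)" "\<lambda>x. f x * vdot h (\<chi> a. x a)"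
      "\<lambda>a. u0 $ a" "\<lambda>a. g0 $ a"] f(2) g0(2) by auto
  let ?x = "\<chi> a. x a"
  let ?q = "(1 / vdot h ?x) *s ?x"
  have "good ?x" using f(3) x by auto
  then have q: "good ?q" "vdot h ?q = 1" using x good_scale by (simp_all add: vdot_scale)
  have Fq: "det3 (v b) (v c) ?q \<noteq> 0" using x is_form_scale[OF F] by (simp add: det3_alt)
  show ?thesis
  proof (rule sec_unique[OF F m'(2) mF r q q Fq])
    fix s u assume s: "X.sec (dv (int 1, m)) TX s" "s (plane_pt ?q) = 0" "good u" "vdot h u = 1"
    have L: "s (plane_pt u) = 0"
      if i: "m i < 0" and u: "good u" "vdot h u = 1" "vdot (cr (v i) ?q) u = 0" for i u
    proof -
      let ?A = "(1 / vdot h (v i)) *s v i"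
      have hA: "vdot h ?A = 1" using avoid by (simp add: vdot_scale)
      have c: "cr ?A (?q - ?A) = (1 / vdot h (v i)) *s cr (v i) ?q"
        by (rule cr_affine)
      then have nz: "cr ?A (?q - ?A) \<noteq> 0" using avoid q(1) by (simp add: good_def)
      have w: "vdot h (?q - ?A) = 0" using hA q(2) vdot_add[of h "?q - ?A" ?A] by simp
      show ?thesis
      proof (rule line_vanish[OF s(1) m'(1) nz hA w, of "{0, 1}"])
        show "vdot (cr ?A (?q - ?A)) u = 0" unfolding c using u(3) by (simp add: vdot_scale_left)
        fix t :: 'k assume "t \<in> {0, 1}"
        moreover have "cr (v i) ?A = 0" by (simp add: cr_scale)
        ultimately show "(good (?A + t *s (?q - ?A)) \<and> s (plane_pt (?A + t *s (?q - ?A))) = 0) \<or>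
           (\<exists>i. cr (v i) (?A + t *s (?q - ?A)) = 0 \<and> m i < 0)"
          using q(1) s(2) i by auto
      qed (use u in auto)
    qed
    define n where "n k = (if k = (0::nat) then cr (v b) ?q else cr (v c) ?q)" for k
    have nz: "cr (v i) ?q \<noteq> 0" for i using q(1) by (simp add: good_def)
    have "cr (cr (v b) ?q) (cr (v c) ?q) = det3 (v b) (v c) ?q *s ?q"
      by (simp add: vec3_defs algebra_simps)
    then have n01: "cr (cr (v b) ?q) (cr (v c) ?q) \<noteq> 0" using Fq good_nonzero[OF q(1)] by simp
    show "s (plane_pt u) = 0"
    proof (rule vanish_by_lines[OF s(1) m'(1), of n])
      fix k :: nat assume k: "k \<le> 1"
      then have kk: "k = 0 \<or> k = 1" by auto
      then show "cr h (n k) \<noteq> 0" using cr_h_nonzero[OF nz, where u = ?q] q(2) by (auto simp: n_def)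
      show "cr (n k) (n l) \<noteq> 0" if "l \<le> 1" "k \<noteq> l" for l
      proof -
        have "l = 0 \<or> l = 1" using that by auto
        then show ?thesis using kk that(2) n01 by (auto simp: n_def cr_eq_0_commute)
      qed
      fix u assume u: "good u" "vdot h u = 1" "vdot (n k) u = 0"
      then show "s (plane_pt u) = 0" using kk L[where i = b and u = u] L[where i = c and u = u] m by (auto simp: n_def)
    qed (rule s)+
  qed
qed

text \<open>Multiplicity 1 allows a pole along the exceptional curve over \<open>v a\<close>, so
  only lines missing \<open>v a\<close> are used; on them the section is constant. Two points
  collinear with \<open>v a\<close> are compared through a third one.\<close>

lemma const_unique:
  assumes m: "m a = 1" "\<And>i. i \<noteq> a \<Longrightarrow> m i = 0" and r: "X.sec (dv (int 0, m)) TX r"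
  shows "\<exists>k. \<forall>z\<in>X.generic_part. r z = k * frac 0 (\<lambda>_. 1) z"
proof -
  have two: "r (plane_pt u) = r (plane_pt w)"
    if u: "good u" "vdot h u = 1" and w: "good w" "vdot h w = 1" and det: "det3 (v a) u w \<noteq> 0" for u w
  proof -
    let ?w = "w - u"
    have "cr u ?w = cr u w" by (simp add: vec3_defs algebra_simps)
    then have nz: "cr u ?w \<noteq> 0" using det by (auto simp: det3_def)
    have hw: "vdot h ?w = 0" using u w vdot_add[of h "w - u" u] by simp
    have dw: "det3 (v a) u ?w = det3 (v a) u w" by (simp add: vec3_defs algebra_simps)
    have "m i \<le> 0" if "det3 (v i) u ?w = 0" for i
      using that dw det m(2)[of i] by (cases "i = a") auto
    from sec_on_line[OF r nz u(2) hw this] obtain P where P: "degree P \<le> 0"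
      "\<And>t. good (u + t *s ?w) \<Longrightarrow> r (plane_pt (u + t *s ?w)) = poly P t" by metis
    obtain c where "P = [:c:]" using P(1) degree_eq_zeroE by blast
    then show ?thesis using P(2)[of 0] P(2)[of 1] u w by simp
  qed
  obtain q where q: "good q" "vdot h q = 1" by (rule normalized_good_exists)
  have "r (plane_pt u) = r (plane_pt q)" if u: "good u" "vdot h u = 1" for u
  proof -
    have nu: "cr (v a) u \<noteq> 0" "cr (v a) q \<noteq> 0" using u q by (auto simp: good_def)
    have "cr h n \<noteq> 0" if "n \<in> {cr (v a) u, cr (v a) q}" for n
      using that cr_h_nonzero[OF nu(1), of u] cr_h_nonzero[OF nu(2), of q] u q by auto
    then have "\<exists>w. vdot h w = 0 \<and> (\<forall>n\<in>{cr (v a) u, cr (v a) q}. vdot n w \<noteq> 0)"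
      by (intro avoid_forms) auto
    then obtain w where
      w: "vdot h w = 0" "vdot (cr (v a) u) w \<noteq> 0" "vdot (cr (v a) q) w \<noteq> 0" by auto
    have uw: "cr u w \<noteq> 0" using w(2) by (metis det3_alt det3_def vdot_zero(1))
    \<comment> \<open>The excluded parameters are the one where the line meets the join of
      \<open>v a\<close> and \<open>q\<close>, and the one that gives \<open>u\<close>
      itself.\<close>
    let ?T = "{- vdot (cr (v a) q) u / vdot (cr (v a) q) w, 0}"
    obtain t where t: "good (u + t *s w)" "t \<notin> ?T" using good_line_point_exists[OF uw, of ?T] by auto
    let ?p = "u + t *s w"
    have hp: "vdot h ?p = 1" using u w by (simp add: vdot_add vdot_scale)
    have "det3 (v a) u ?p \<noteq> 0" using w(2) t(2) by (simp add: det3_alt vdot_add vdot_scale)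
    then have 1: "r (plane_pt u) = r (plane_pt ?p)" using two[OF u t(1) hp] by blast
    have "vdot (cr (v a) q) ?p \<noteq> 0"
      using w(3) t(2) by (simp add: vdot_add vdot_scale field_simps eq_neg_iff_add_eq_0)
    then have "det3 (v a) q ?p \<noteq> 0" by (simp add: det3_alt)
    then show ?thesis using 1 two[OF q t(1) hp] by simp
  qed
  then have "r z = r (plane_pt q) * frac 0 (\<lambda>_. 1) z" if "z \<in> X.generic_part" for z
    using that generic_partE frac_plane_pt[OF is_form_const, of _ 1] by (metis div_by_1 mult_1_right power_0)
  then show ?thesis by blast
qed

end

section \<open>The homomorphisms between the line bundles\<close>

lemma three_cases: "a = 0 \<or> a = 1 \<or> a = (2 :: 3)"
  using exhaust_3[of a] by auto

lemma three_numerals: "(3 :: 3) = 0" "(4 :: 3) = 1"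
  by simp_all

lemma sum_three: "sum f (UNIV :: 3 set) = f 0 + f 1 + f 2"
  by (simp add: sum_3 add_ac three_numerals)

lemma UNIV_three: "UNIV = {a, a + 1, a + (2 :: 3)}"
  using three_cases[of a] UNIV_3 by (auto simp: three_numerals)

lemma three_neq_cases: "a \<noteq> b \<Longrightarrow> b = a + 1 \<or> b = a + (2 :: 3)"
  using three_cases[of a] three_cases[of b] by auto

text \<open>\<open>E_class (a, 1)\<close> is the class of the exceptional curve of \<open>pt1 a\<close>, and \<open>E_class (w, 2)\<close> is \<open>l\<close> minus
  that of \<open>pt2 w\<close>.\<close>

definition pt1 :: "3 \<Rightarrow> 6" where
  "pt1 a = (if a = 0 then 1 else if a = 1 then 2 else 3)"

definition pt2 :: "3 \<Rightarrow> 6" where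
  "pt2 w = (if w = 0 then 4 else if w = 1 then 5 else 6)"

lemma pt_neq: "a \<noteq> b \<Longrightarrow> pt1 a \<noteq> pt1 b" "a \<noteq> b \<Longrightarrow> pt2 a \<noteq> pt2 b" "pt1 a \<noteq> pt2 w" "pt2 w \<noteq> pt1 a"
  using three_cases[of a] three_cases[of b] three_cases[of w] by (auto simp: pt1_def pt2_def)

lemma three_shift_neq [simp]: "a + 1 \<noteq> a" "a + 2 \<noteq> a" "a \<noteq> a + 1" "a \<noteq> a + 2" "a + 1 \<noteq> a + 2" "a + 2 \<noteq> a + (1 :: 3)"
  by auto

lemma pt_cases: "(\<exists>a. i = pt1 a) \<or> (\<exists>w. i = pt2 w)"
proof -
  have "card (pt1 ` UNIV \<union> pt2 ` UNIV) = card (pt1 ` UNIV) + card (pt2 ` UNIV)"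
    by (rule card_Un_disjoint) (use pt_neq(3) in auto)
  moreover have "inj pt1" "inj pt2" by (rule injI, metis pt_neq(1), rule injI, metis pt_neq(2))
  then have "card (pt1 ` UNIV) = 3" "card (pt2 ` UNIV) = 3" by (simp_all add: card_image)
  ultimately have "pt1 ` UNIV \<union> pt2 ` UNIV = UNIV"
    by (intro card_subset_eq) simp_all
  then show ?thesis by blast
qed

text \<open>By Cramer's rule, \<open>det3 a b c\<close> times \<open>x\<close> is a combination of
  \<open>a\<close>, \<open>b\<close>, \<open>c\<close>. Take \<open>x = w\<close> or
  \<open>x = u\<close> and form the bracket with \<open>w\<close> and \<open>u\<close>: the left
  side becomes 0.\<close>

lemma pluecker:
  "det3 b c w * det3 a w u + det3 c a w * det3 b w u + det3 a b w * det3 c w u = 0"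
  "det3 b c u * det3 a w u + det3 c a u * det3 b w u + det3 a b u * det3 c w u = 0"
  by (simp_all add: vec3_defs algebra_simps)

lemma bracket_expand:
  "det3 a p u * det3 p q r = det3 a p q * det3 u r p - det3 a r p * det3 u p q"
  by (simp add: vec3_defs algebra_simps)

text \<open>The standard quadratic transformation of the plane: the reciprocals of the coordinates
  with denominators cleared.\<close>

definition cremona :: "'k::field \<Rightarrow> 'k \<Rightarrow> 'k \<Rightarrow> 'k ^ 3" where
  "cremona x y z = vector [y * z, z * x, x * y]"

lemma cremona_cyclic:
  "det3 (cremona x y z) (cremona x' y' z') (cremona x'' y'' z'') =
   det3 (cremona y z x) (cremona y' z' x') (cremona y'' z'' x'')"
  by (simp add: cremona_def vec3_defs algebra_simps)

text \<open>The third point lies on the line from the first one to the vertex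
  \<open>(1, 0, 0)\<close> of the transformation. The factored form shows when the conic determined
  by the first two points and the vertices misses it.\<close>

lemma cremona_shift:
  "det3 (cremona x y z) (cremona x' y' z') (cremona (x + d) y z) = d * y * z * x' * (z' * y - y' * z)"
  by (simp add: cremona_def vec3_defs algebra_simps)

text \<open>Each factor \<open>x1 * (z1 * y - y1 * z)\<close> is the pairing of the image of
  \<open>(x1, y1, z1)\<close> with \<open>(0, y, - z)\<close>. By Cramer's rule the sum is a
  multiple of the pairing of \<open>cremona x y z\<close> with \<open>(0, y, - z)\<close>, which is
  0.\<close>

lemma cremona_relation:
  "x1 * (det3 (cremona x2 y2 z2) (cremona x3 y3 z3) (cremona x y z) * (z1 * y - y1 * z)) +
   x2 * (det3 (cremona x3 y3 z3) (cremona x1 y1 z1) (cremona x y z) * (z2 * y - y2 * z)) +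
   x3 * (det3 (cremona x1 y1 z1) (cremona x2 y2 z2) (cremona x y z) * (z3 * y - y3 * z)) = 0"
  by (simp add: cremona_def vec3_defs algebra_simps)

text \<open>Up to the common factor in \<open>coordinate_expand\<close>, the coordinate of
  \<open>u\<close> along \<open>v (pt2 w)\<close> with respect to the last three points.\<close>

definition coordinate :: "(6 \<Rightarrow> 'k::field ^ 3) \<Rightarrow> 3 \<Rightarrow> 'k ^ 3 \<Rightarrow> 'k" where
  "coordinate v w u = det3 u (v (pt2 (w + 1))) (v (pt2 (w + 2)))"

definition cremona_map :: "(6 \<Rightarrow> 'k::field ^ 3) \<Rightarrow> 'k ^ 3 \<Rightarrow> 'k ^ 3" where
  "cremona_map v u = cremona (coordinate v 0 u) (coordinate v 1 u) (coordinate v 2 u)"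

text \<open>\<open>a\<close> is the middle vertex: this belongs to the path from
  \<open>(i, 0)\<close> through \<open>(a, 1)\<close> to \<open>(w, 2)\<close>.\<close>

definition coefficient :: "(6 \<Rightarrow> 'k::field ^ 3) \<Rightarrow> 3 \<Rightarrow> 3 \<Rightarrow> 3 \<Rightarrow> 'k" where
  "coefficient v i a w = (if i = 0 then det3 (v (pt1 (a + 1))) (v (pt1 (a + 2))) (v (pt2 w))
     else if i = 1 then coordinate v w (v (pt1 a)) else 1)"

lemma coordinate_pt2: "w \<noteq> w' \<Longrightarrow> coordinate v w (v (pt2 w')) = 0"
  using three_neq_cases[of w w'] three_neq_cases[of w' w] by (auto simp: coordinate_def)

lemma coordinate_add: "coordinate v w (u + u') = coordinate v w u + coordinate v w u'"
  by (simp add: coordinate_def det3_linear)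

lemma coefficient_nonzero:
  assumes "\<And>i j k. i \<noteq> j \<Longrightarrow> j \<noteq> k \<Longrightarrow> i \<noteq> k \<Longrightarrow> det3 (v i) (v j) (v k) \<noteq> 0"
  shows "coefficient v i a w \<noteq> 0"
proof -
  have "det3 (v (pt1 (a + 1))) (v (pt1 (a + 2))) (v (pt2 w)) \<noteq> 0"
    "det3 (v (pt1 a)) (v (pt2 (w + 1))) (v (pt2 (w + 2))) \<noteq> 0"
    by (intro assms pt_neq; simp)+
  then show ?thesis by (simp add: coefficient_def coordinate_def)
qed

context six_points
begin

abbreviation "co \<equiv> coordinate v"

abbreviation "sig \<equiv> cremona_map v"

abbreviation "coef \<equiv> coefficient v"

lemmas co_def = coordinate_def[of v]

lemmas sig_def = cremona_map_def[of v]

lemmas coef_def = coefficient_def[of v]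

text \<open>The forms defining the arrows out of \<open>(i, 0)\<close>: the conic for \<open>i = 1\<close> passes through all
  points except \<open>v (pt1 a)\<close>.\<close>

definition form1 :: "3 \<Rightarrow> 3 \<Rightarrow> 'k ^ 3 \<Rightarrow> 'k" where
  "form1 i a u = (if i = 0 then 1
     else if i = 1 then det3 (sig (v (pt1 (a + 1)))) (sig (v (pt1 (a + 2)))) (sig u)
     else det3 (v (pt1 (a + 1))) (v (pt1 (a + 2))) u)"

definition deg1 :: "3 \<Rightarrow> nat" where
  "deg1 i = (if i = 0 then 0 else if i = 1 then 2 else 1)"

definition form2 :: "3 \<Rightarrow> 3 \<Rightarrow> 'k ^ 3 \<Rightarrow> 'k" where
  "form2 a w u = det3 (v (pt1 a)) (v (pt2 w)) u"

text \<open>The determinant is invariant under cyclic shifts of the coordinates. So the coordinate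
  \<open>w\<close> can be put first, and one computation serves all three vertices.\<close>

lemma sig_cyclic:
  "det3 (sig a) (sig b) (sig u) = det3 (cremona (co w a) (co (w + 1) a) (co (w + 2) a))
     (cremona (co w b) (co (w + 1) b) (co (w + 2) b)) (cremona (co w u) (co (w + 1) u) (co (w + 2) u))"
proof -
  consider "w = 0" | "w = 1" | "w = 2" using three_cases[of w] by blast
  then show ?thesis
  proof cases
    case 1
    then show ?thesis by (simp add: sig_def)
  next
    case 2
    then show ?thesis unfolding sig_def by (subst cremona_cyclic) (simp add: three_numerals)
  next
    case 3
    then show ?thesis unfolding sig_def by (subst (2) cremona_cyclic) (simp add: three_numerals)
  qed
qed

lemma co_pt1: "co w (v (pt1 a)) \<noteq> 0"
  unfolding co_def by (intro det_nonzero pt_neq) simp_all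

lemma co_pt2: "co w (v (pt2 w)) \<noteq> 0" "w \<noteq> w' \<Longrightarrow> co w (v (pt2 w')) = 0"
proof -
  show "co w (v (pt2 w)) \<noteq> 0" unfolding co_def by (intro det_nonzero pt_neq) simp_all
  show "co w (v (pt2 w')) = 0" if "w \<noteq> w'"
    using that by (rule coordinate_pt2)
qed

lemma coef_nonzero: "coef i a w \<noteq> 0"
  by (rule coefficient_nonzero[OF det_nonzero])

text \<open>The line from \<open>v (pt1 a)\<close> to the vertex \<open>v (pt2 w)\<close> does not
  involve the coordinate belonging to this vertex.\<close>

lemma form2_expand:
  "form2 a w u * co w (v (pt2 w)) =
     co (w + 2) (v (pt1 a)) * co (w + 1) u - co (w + 1) (v (pt1 a)) * co (w + 2) u"
proof -
  have 3: "w + 1 + 1 = w + 2" "w + 1 + 2 = w" "w + 2 + 1 = w" "w + 2 + 2 = w + (1 :: 3)" by (simp_all add: add.assoc)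
  show ?thesis
    unfolding form2_def co_def 3 using bracket_expand[of "v (pt1 a)" "v (pt2 w)" u] by simp
qed

text \<open>The two Pluecker relations give \<open>i = 0\<close> and \<open>i = 2\<close>. For
  \<open>i = 1\<close>, multiplying by the nonzero factor of \<open>form2_expand\<close> turns the
  sum into \<open>cremona_relation\<close>.\<close>

lemma relation_identity:
  "(\<Sum>a\<in>UNIV. coef i a w * (form1 i a u * form2 a w u)) = 0"
proof -
  consider "i = 0" | "i = 1" | "i = 2" using three_cases[of i] by blast
  then show ?thesis
  proof cases
    case 1
    then show ?thesis
      using pluecker(1)[of "v (pt1 1)" "v (pt1 2)" "v (pt2 w)" "v (pt1 0)" u]
      by (simp add: sum_three coef_def form1_def form2_def three_numerals)
  next
    case 3
    then show ?thesis
      using pluecker(2)[of "v (pt1 1)" "v (pt1 2)" u "v (pt1 0)" "v (pt2 w)"]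
      by (simp add: sum_three coef_def form1_def form2_def three_numerals)
  next
    case 2
    have Q: "form1 1 a u = det3 (cremona (co w (v (pt1 (a + 1)))) (co (w + 1) (v (pt1 (a + 1)))) (co (w + 2) (v (pt1 (a + 1)))))
        (cremona (co w (v (pt1 (a + 2)))) (co (w + 1) (v (pt1 (a + 2)))) (co (w + 2) (v (pt1 (a + 2)))))
        (cremona (co w u) (co (w + 1) u) (co (w + 2) u))" for a
      by (simp add: form1_def sig_cyclic[of _ _ _ w])
    let ?\<delta> = "co w (v (pt2 w))"
    have "?\<delta> * (\<Sum>a\<in>UNIV. coef 1 a w * (form1 1 a u * form2 a w u)) =
        (\<Sum>a\<in>UNIV. co w (v (pt1 a)) * (form1 1 a u * (form2 a w u * ?\<delta>)))"
      by (simp add: sum_distrib_left coef_def mult_ac)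
    also have "\<dots> = 0"
      unfolding form2_expand Q sum_three using cremona_relation by (simp add: three_numerals)
    finally show ?thesis using co_pt2(1) 2 by simp
  qed
qed

text \<open>The point \<open>v (pt1 b) + v (pt2 w)\<close> lies on the line
  \<open>form2 b w\<close>, so it removes one of the three terms of a relation; here the factors of
  the other terms are seen to be nonzero. For the conic, the point differs from
  \<open>v (pt1 b)\<close> only in the coordinate \<open>w\<close>, and \<open>cremona_shift\<close>
  factors the value.\<close>

lemma form1_nonzero:
  assumes "a \<noteq> b"
  shows "form1 i a (v (pt1 b) + v (pt2 w)) \<noteq> 0"
proof -
  have b: "b = a + 1 \<or> b = a + 2" using three_neq_cases[OF assms] .
  consider "i = 0" | "i = 1" | "i = 2" using three_cases[of i] by blast
  then show ?thesis
  proof cases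
    case 1
    then show ?thesis by (simp add: form1_def)
  next
    case 3
    have "det3 (v (pt1 (a + 1))) (v (pt1 (a + 2))) (v (pt2 w)) \<noteq> 0" by (intro det_nonzero pt_neq) simp_all
    then show ?thesis using 3 b by (auto simp: form1_def det3_linear)
  next
    case 2
    let ?u = "v (pt1 b) + v (pt2 w)"
    let ?\<delta> = "co w (v (pt2 w))"
    have cu: "co w ?u = co w (v (pt1 b)) + ?\<delta>" "co (w + 1) ?u = co (w + 1) (v (pt1 b))" "co (w + 2) ?u = co (w + 2) (v (pt1 b))"
      using co_pt2(2)[of "w + 1" w] co_pt2(2)[of "w + 2" w] by (simp_all add: coordinate_add)
    have nz: "det3 (sig (v (pt1 b))) (sig (v (pt1 c))) (sig ?u) \<noteq> 0" if "c \<noteq> b" for c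
    proof -
      have "form2 c w (v (pt1 b)) \<noteq> 0" unfolding form2_def using that by (intro det_nonzero pt_neq) simp_all
      then have "co (w + 2) (v (pt1 c)) * co (w + 1) (v (pt1 b)) - co (w + 1) (v (pt1 c)) * co (w + 2) (v (pt1 b)) \<noteq> 0"
        using form2_expand[of c w "v (pt1 b)"] co_pt2(1)[of w] by (metis mult_eq_0_iff)
      then show ?thesis
        unfolding sig_cyclic[of _ _ _ w] cu cremona_shift using co_pt1 co_pt2(1) by simp
    qed
    from b show ?thesis
    proof
      assume "b = a + 1"
      then show ?thesis using 2 nz[of "a + 2"] by (simp add: form1_def)
    next
      assume "b = a + 2"
      then show ?thesis using 2 nz[of "a + 1"] det3_swap(1)[of "sig (v (pt1 (a + 1)))"]
        by (simp add: form1_def)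
    qed
  qed
qed

text \<open>At the point of \<open>form1_nonzero\<close>, with \<open>b\<close> the third index, the
  given relation and \<open>relation_identity\<close> become two linear relations between the same
  two products, the one at \<open>a\<close> being nonzero. So \<open>g\<close> and
  \<open>coef\<close> are proportional on \<open>a\<close> and \<open>c\<close>.\<close>

lemma relation_unique:
  assumes g: "\<And>u. (\<Sum>a\<in>UNIV. g a * (form1 i a u * form2 a w u)) = 0"
  shows "\<exists>t. \<forall>a. g a = t * coef i a w"
proof -
  have cross: "g a * coef i c w = g c * coef i a w" if ac: "a \<noteq> c" for a c
  proof -
    define b where "b = (if c = a + 1 then a + 2 else a + 1)"
    have three: "UNIV = {a, b, c}" "b \<noteq> a" "b \<noteq> c"
      using three_neq_cases[OF ac] UNIV_three[of a] by (auto simp: b_def)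
    let ?u = "v (pt1 b) + v (pt2 w)"
    let ?P = "\<lambda>a. form1 i a ?u * form2 a w ?u"
    have Fb: "form2 b w ?u = 0" by (simp add: form2_def det3_linear)
    have "form2 a w ?u \<noteq> 0"
    proof -
      have "det3 (v (pt1 a)) (v (pt2 w)) (v (pt1 b)) \<noteq> 0" using three by (intro det_nonzero pt_neq) auto
      then show ?thesis by (simp add: form2_def det3_linear)
    qed
    then have Pa: "?P a \<noteq> 0" using form1_nonzero[of a b i w] three(2) by simp
    have S: "(\<Sum>x\<in>UNIV. f x * ?P x) = f a * ?P a + f c * ?P c" for f
    proof -
      have "a \<notin> {b, c}" "b \<notin> {c}" using three(2,3) ac by auto
      then have "sum F {a, b, c} = F a + (F b + F c)" for F :: "3 \<Rightarrow> 'k" by simp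
      then have "(\<Sum>x\<in>UNIV. f x * ?P x) = f a * ?P a + (f b * ?P b + f c * ?P c)"
        unfolding three(1)[symmetric] .
      then show ?thesis unfolding Fb by simp
    qed
    have 1: "g a * ?P a + g c * ?P c = 0" "coef i a w * ?P a + coef i c w * ?P c = 0"
      using g[of ?u, unfolded S] relation_identity[of i w ?u, unfolded S] .
    have "(g a * coef i c w - g c * coef i a w) * ?P a =
        coef i c w * (g a * ?P a + g c * ?P c) - g c * (coef i a w * ?P a + coef i c w * ?P c)"
      by (simp add: algebra_simps)
    then show ?thesis unfolding 1 using Pa by simp
  qed
  have "g a = g 0 / coef i 0 w * coef i a w" for a
    using cross[of a 0] coef_nonzero[of i 0 w] by (cases "a = 0") (simp_all add: field_simps)
  then show ?thesis by blast
qed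

lemma is_form_vdot_left: "is_form 1 (\<lambda>u. det3 u a b)"
proof -
  have "(\<lambda>u. det3 u a b) = vdot (cr a b)" by (rule ext) (simp add: det3_def vdot_commute)
  then show ?thesis using is_form_vdot by simp
qed

lemma is_form_co: "is_form 1 (co w)"
  using is_form_vdot_left[of "v (pt2 (w + 1))" "v (pt2 (w + 2))"] by (simp add: co_def[abs_def])

lemma is_form_form2: "is_form 1 (form2 a w)"
  unfolding form2_def[abs_def] det3_alt by (rule is_form_vdot)

lemma is_form_det_sig: "is_form 2 (\<lambda>u. det3 a b (sig u))"
proof -
  have 2: "is_form 2 (\<lambda>u. co i u * co j u)" for i j
    using is_form_mult[OF is_form_co is_form_co, of i j] by (simp add: numeral_2_eq_2)
  have "is_form 2 (\<lambda>u. cr a b $ 1 * (co 1 u * co 2 u) + cr a b $ 2 * (co 2 u * co 0 u) + cr a b $ 3 * (co 0 u * co 1 u))"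
    by (intro is_form_add is_form_cmult 2)
  moreover have "det3 a b (sig u) = cr a b $ 1 * (co 1 u * co 2 u) + cr a b $ 2 * (co 2 u * co 0 u) + cr a b $ 3 * (co 0 u * co 1 u)" for u
    unfolding det3_alt vdot_def sig_def cremona_def by (simp add: vector_3)
  ultimately show ?thesis by simp
qed

lemma is_form_form1: "is_form (deg1 i) (form1 i a)"
proof -
  have "is_form 1 (\<lambda>u. det3 p q u)" for p q unfolding det3_alt by (rule is_form_vdot)
  then show ?thesis
    using is_form_const[of 1] is_form_det_sig unfolding form1_def[abs_def] deg1_def by auto
qed

text \<open>At each of the last three points two coordinates vanish, so its image under
  \<open>sig\<close> is zero. At the other two of the first three points the determinant has a
  repeated argument.\<close>

lemma form1_conic_vanish:
  assumes "j \<noteq> pt1 a"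
  shows "form1 1 a (v j) = 0"
proof -
  from pt_cases[of j] show ?thesis
  proof (elim disjE exE)
    fix b assume "j = pt1 b"
    then have "a \<noteq> b" using assms by auto
    then have "b = a + 1 \<or> b = a + 2" by (rule three_neq_cases)
    then show ?thesis using \<open>j = pt1 b\<close> by (auto simp: form1_def)
  next
    fix w assume w: "j = pt2 w"
    have "co (w + 1) (v j) = 0" "co (w + 2) (v j) = 0" using w co_pt2(2) by simp_all
    then have "cremona (co w (v j)) (co (w + 1) (v j)) (co (w + 2) (v j)) = 0"
      by (simp add: cremona_def vec3_defs)
    moreover have "form1 1 a (v j) = det3 (sig (v (pt1 (a + 1)))) (sig (v (pt1 (a + 2)))) (sig (v j))"
      by (simp add: form1_def)
    ultimately show ?thesis unfolding sig_cyclic[of _ _ _ w] by (simp add: det3_def)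
  qed
qed

text \<open>A nonzero polynomial is nonzero at some good vector off \<open>h\<close>, and
  homogeneity allows scaling it to \<open>vdot h u = 1\<close>.\<close>

lemma form_zero:
  assumes F: "is_form d F" and zero: "\<And>u. good u \<Longrightarrow> vdot h u = 1 \<Longrightarrow> F u = 0"
  shows "F u = 0"
proof (rule ccontr)
  assume u: "F u \<noteq> 0"
  obtain g0 where g0: "good g0" "vdot h g0 = 1" by (rule normalized_good_exists)
  obtain f where f: "polyfun f" "f (\<lambda>a. g0 $ a) \<noteq> 0" "{x. f x \<noteq> 0} \<subseteq> {x. good (\<chi> a. x a)}"
    using openin_zariskiE[OF openin_good, of "\<lambda>a. g0 $ a"] g0 by auto
  have 1: "polyfun (\<lambda>x. F (\<chi> a. x a))" using F by (simp add: is_form_def)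
  have 2: "polyfun (\<lambda>x. f x * vdot h (\<chi> a. x a))"
    using f(1) unfolding vdot_def by (auto intro!: polyfun_intros)
  obtain x where x: "F (\<chi> a. x a) \<noteq> 0" "f x * vdot h (\<chi> a. x a) \<noteq> 0"
    using polyfun_nonzero_common[OF 1 2, of "\<lambda>a. u $ a" "\<lambda>a. g0 $ a"] u f(2) g0(2) by auto
  let ?x = "\<chi> a. x a"
  let ?u = "(1 / vdot h ?x) *s ?x"
  have "good ?x" using f(3) x by auto
  then have "good ?u" "vdot h ?u = 1" using x good_scale by (simp_all add: vdot_scale)
  then have "F ?u = 0" by (rule zero)
  then show False using x is_form_scale[OF F] by simp
qed

lemma form_generic_nonzero:
  assumes "is_form d F" "F u \<noteq> 0"
  obtains z where "z \<in> X.generic_part" "frac d F z \<noteq> 0"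
proof -
  obtain y where y: "good y" "vdot h y = 1" "F y \<noteq> 0" using form_zero[OF assms(1)] assms(2) by blast
  then have "frac d F (plane_pt y) \<noteq> 0" by (simp add: frac_plane_pt[OF assms(1)])
  then show ?thesis using that generic_partI y by blast
qed

section \<open>The section attached to each arrow\<close>

fun arrow_form :: "arrow \<Rightarrow> 'k ^ 3 \<Rightarrow> 'k" where
  "arrow_form (i, j, k) = (if j = 0 then form1 i (i + k) else form2 i (i + k))"

fun arrow_deg :: "arrow \<Rightarrow> nat" where
  "arrow_deg (i, j, k) = (if j = 0 then deg1 i else 1)"

definition mult :: "arrow \<Rightarrow> (6 option \<Rightarrow> ('k ^ 3) set) \<Rightarrow> 'k" where
  "mult a = frac (arrow_deg a) (arrow_form a)"

lemma E_class_1: "E_class (a, 1) = (0, single (pt1 a))"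
  using three_cases[of a] by (auto simp: E_class_def pt1_def)

lemma E_class_2: "E_class (w, 2) = (1, \<lambda>m. - single (pt2 w) m)"
  using three_cases[of w] by (auto simp: E_class_def pt2_def)

lemma E_class_0:
  "E_class (0, 0) = (0, \<lambda>_. 0)" "E_class (1, 0) = (- 2, \<lambda>_. 1)"
  "E_class (2, 0) = (- 1, \<lambda>m. single (pt1 0) m + single (pt1 1) m + single (pt1 2) m)"
  by (simp_all add: E_class_def pt1_def)

abbreviation Ediv :: "vertex \<Rightarrow> (6 option \<Rightarrow> ('k ^ 3) set) set \<Rightarrow> int" where
  "Ediv w \<equiv> dv (E_class w)"

definition spans :: "int \<times> (6 \<Rightarrow> int) \<Rightarrow> nat \<Rightarrow> ('k ^ 3 \<Rightarrow> 'k) \<Rightarrow> bool" where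
  "spans D d F \<longleftrightarrow> X.sec (dv D) TX (frac d F) \<and> (\<exists>z\<in>X.generic_part. frac d F z \<noteq> 0) \<and>
     (\<forall>r. X.sec (dv D) TX r \<longrightarrow> (\<exists>c. \<forall>z\<in>X.generic_part. r z = c * frac d F z))"

lemma spansI:
  assumes "is_form d F" "F u \<noteq> 0" "\<And>i. m i \<ge> - 1" "\<And>i. m i < 0 \<Longrightarrow> F (v i) = 0"
    "\<And>r. X.sec (dv (int d, m)) TX r \<Longrightarrow> \<exists>c. \<forall>z\<in>X.generic_part. r z = c * frac d F z"
  shows "spans (int d, m) d F"
  unfolding spans_def
proof (intro conjI allI impI)
  show "X.sec (dv (int d, m)) TX (frac d F)" by (rule sec_frac[OF assms(1,3,4)])
  show "\<exists>z\<in>X.generic_part. frac d F z \<noteq> 0" using form_generic_nonzero[OF assms(1,2)] by blast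
qed (rule assms(5))

lemma spans_line:
  assumes "b \<noteq> c" "m b = - 1" "m c = - 1" "\<And>i. i \<noteq> b \<Longrightarrow> i \<noteq> c \<Longrightarrow> m i = 0"
  shows "spans (1, m) 1 (det3 (v b) (v c))"
proof -
  obtain u where "vdot u (cr (v b) (v c)) = 1" using vdot_exists[OF cr_v_nonzero[OF assms(1)]] .
  then have u: "det3 (v b) (v c) u \<noteq> 0" by (simp add: det3_alt vdot_commute)
  have F: "is_form 1 (det3 (v b) (v c))"
    using is_form_vdot[of "cr (v b) (v c)"] by (simp add: det3_alt[abs_def])
  have "spans (int 1, m) 1 (det3 (v b) (v c))"
  proof (rule spansI[OF F u])
    fix i
    show "- 1 \<le> m i" using assms by (cases "i = b"; cases "i = c"; simp)
    show "det3 (v b) (v c) (v i) = 0" if "m i < 0"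
      using assms(4)[of i] that by (cases "i = b"; cases "i = c"; simp)
  qed (rule line_unique[OF assms])
  then show ?thesis by simp
qed

text \<open>The differences of the classes are an exceptional class \<open>l_a\<close> for the
  arrows from \<open>(0, 0)\<close>, the class \<open>2 l - (l_1 + ... + l_6) + l_a\<close> of
  conics through five points from \<open>(1, 0)\<close>, and the classes
  \<open>l - l_b - l_c\<close> of lines through two points from \<open>(2, 0)\<close> and from the
  middle vertices.\<close>

lemma spans_arrow:
  assumes "a \<in> arrows"
  shows "spans (fst (E_class (tgt a)) - fst (E_class (src a)), \<lambda>i. snd (E_class (tgt a)) i - snd (E_class (src a)) i)
    (arrow_deg a) (arrow_form a)"
proof -
  obtain i j k where a: "a = (i, j, k)" by (metis prod_cases3)
  then have "j = 0 \<or> j = 1" using assms three_cases[of j] by (auto simp: arrows_def)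
  then show ?thesis
  proof
    assume j: "j = 1"
    have "spans (1, \<lambda>m. - single (pt2 (i + k)) m - single (pt1 i) m) 1 (det3 (v (pt1 i)) (v (pt2 (i + k))))"
      by (rule spans_line) (auto simp: single_def pt_neq)
    then show ?thesis using a j by (simp add: E_class_1 E_class_2 form2_def[abs_def])
  next
    assume j: "j = 0"
    let ?a = "i + k"
    consider "i = 0" | "i = 1" | "i = 2" using three_cases[of i] by blast
    then show ?thesis
    proof cases
      case 1
      have "spans (int 0, single (pt1 ?a)) 0 (\<lambda>_. 1)"
      proof (rule spansI[OF is_form_const])
        show "\<exists>c. \<forall>z\<in>X.generic_part. r z = c * frac 0 (\<lambda>_. 1) z"
          if "X.sec (dv (int 0, single (pt1 ?a))) TX r" for r
          by (rule const_unique[OF _ _ that, of "pt1 ?a"]) (auto simp: single_def)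
      qed (auto simp: single_def split: if_splits)
      then show ?thesis using a j 1 by (simp add: E_class_1 E_class_0 form1_def[abs_def] deg1_def)
    next
      case 2
      let ?m = "\<lambda>m. single (pt1 ?a) m - 1"
      have "spans (int 2, ?m) 2 (form1 1 ?a)"
      proof (rule spansI)
        show F: "is_form 2 (form1 1 ?a)" using is_form_form1[of 1 ?a] by (simp add: deg1_def)
        show nz: "form1 1 ?a (v (pt1 (?a + 1)) + v (pt2 0)) \<noteq> 0" by (rule form1_nonzero) simp
        show "- 1 \<le> ?m i" for i by (simp add: single_def)
        show "form1 1 ?a (v i) = 0" if "?m i < 0" for i
          using that form1_conic_vanish by (auto simp: single_def split: if_splits)
        have d: "distinct [pt1 ?a, pt1 (?a + 1), pt1 (?a + 2), pt2 0, pt2 1, pt2 2]"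
          by (simp add: pt_neq)
        show "\<exists>c. \<forall>z\<in>X.generic_part. r z = c * frac 2 (form1 1 ?a) z" if "X.sec (dv (int 2, ?m)) TX r" for r
          by (rule conic_unique[OF F form1_conic_vanish nz _ _ that d]) (auto simp: single_def)
      qed
      then show ?thesis using a j 2 by (simp add: E_class_1 E_class_0 deg1_def)
    next
      case 3
      let ?m = "\<lambda>m. single (pt1 ?a) m - (single (pt1 0) m + single (pt1 1) m + single (pt1 2) m)"
      have m: "?m x = - (single (pt1 (?a + 1)) x + single (pt1 (?a + 2)) x)" for x
        using three_cases[of ?a] by (elim disjE) (simp_all add: three_numerals)
      have "spans (1, ?m) 1 (det3 (v (pt1 (?a + 1))) (v (pt1 (?a + 2))))"
        unfolding m by (rule spans_line) (auto simp: single_def pt_neq)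
      then show ?thesis using a j 3 by (simp add: E_class_1 E_class_0 form1_def[abs_def] deg1_def)
    qed
  qed
qed

lemma E_bundle_eq: "E_bundle (pts v) h w = line_bundle X (Ediv w)"
  by (simp add: E_bundle_def)

lemma arrow_basis:
  assumes "a \<in> arrows"
  shows "\<exists>\<phi>. is_basis_hom X (E_bundle (pts v) h (src a)) (E_bundle (pts v) h (tgt a)) \<phi>"
    and "is_basis_hom X (E_bundle (pts v) h (src a)) (E_bundle (pts v) h (tgt a)) \<phi> \<Longrightarrow>
      \<exists>c. c \<noteq> 0 \<and> X.hom_mult (Ediv (src a)) (Ediv (tgt a)) \<phi> (\<lambda>y. c * mult a y)"
proof -
  have s: "X.sec (\<lambda>C. Ediv (tgt a) C - Ediv (src a) C) TX (mult a)"
    and u: "\<And>r. X.sec (\<lambda>C. Ediv (tgt a) C - Ediv (src a) C) TX r \<Longrightarrow> \<exists>c. \<forall>z\<in>X.generic_part. r z = c * mult a z"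
    using spans_arrow[OF assms] unfolding spans_def dv_diff mult_def by blast+
  obtain z where z: "z \<in> X.generic_part" "mult a z \<noteq> 0"
    using spans_arrow[OF assms] unfolding spans_def mult_def by blast
  note b = X.basis_hom[OF dv_supp dv_supp s z u]
  show "\<exists>\<phi>. is_basis_hom X (E_bundle (pts v) h (src a)) (E_bundle (pts v) h (tgt a)) \<phi>"
    unfolding E_bundle_eq by (rule b(1))
  show "is_basis_hom X (E_bundle (pts v) h (src a)) (E_bundle (pts v) h (tgt a)) \<phi> \<Longrightarrow>
      \<exists>c. c \<noteq> 0 \<and> X.hom_mult (Ediv (src a)) (Ediv (tgt a)) \<phi> (\<lambda>y. c * mult a y)"
    unfolding E_bundle_eq by (rule b(2))
qed

end

section \<open>Paths and the ideal of relations\<close>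

lemma is_path_cases:
  assumes "is_path (i, j) as"
  shows "as = [] \<or> (j \<noteq> 2 \<and> (\<exists>k. as = [(i, j, k)])) \<or> (j = 0 \<and> (\<exists>k k'. as = [(i, 0, k), (i + k, 1, k')]))"
proof (cases as)
  case (Cons a bs)
  then obtain k where a: "a = (i, j, k)" "j \<noteq> 2" and bs: "is_path (i + k, j + 1) bs"
    using assms by (cases a) (auto simp: arrows_def)
  show ?thesis
  proof (cases bs)
    case Nil
    then show ?thesis using Cons a by simp
  next
    case (Cons b cs)
    then obtain k' where b: "b = (i + k, j + 1, k')" "j + 1 \<noteq> 2" and cs: "is_path (i + k + k', j + 1 + 1) cs"
      using bs by (cases b) (auto simp: arrows_def)
    have j: "j = 0" using three_cases[of j] a(2) b(2) by auto
    have "cs = []" using cs j by (cases cs) (auto simp: arrows_def)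
    then show ?thesis using \<open>as = a # bs\<close> Cons a b j by simp
  qed
qed simp

text \<open>Two-step paths are indexed by start, first step and end, so that those between fixed
  vertices \<open>(i, 0)\<close> and \<open>(w, 2)\<close> are parametrised by \<open>j\<close>
  alone.\<close>

definition double_path :: "3 \<Rightarrow> 3 \<Rightarrow> 3 \<Rightarrow> qpath" where
  "double_path i j w = ((i, 0), [(i, 0, j), (i + j, 1, w - i - j)])"

lemma finite_paths: "finite paths"
proof (rule finite_subset)
  show "paths \<subseteq> range (\<lambda>v. (v, [])) \<union> range (\<lambda>(i, j, k). ((i, j), [(i, j, k)])) \<union>
     range (\<lambda>(i, k, k'). ((i, 0), [(i, 0, k), (i + k, 1, k')]))"
  proof
    fix q assume "q \<in> paths"
    then obtain i j as where q: "q = ((i, j), as)" "is_path (i, j) as" by (auto simp: paths_def)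
    show "q \<in> range (\<lambda>v. (v, [])) \<union> range (\<lambda>(i, j, k). ((i, j), [(i, j, k)])) \<union>
     range (\<lambda>(i, k, k'). ((i, 0), [(i, 0, k), (i + k, 1, k')]))"
      using is_path_cases[OF q(2)]
    proof (elim disjE exE conjE)
      assume "as = []"
      then show ?thesis using q by simp
    next
      fix k assume "as = [(i, j, k)]"
      then show ?thesis using q by (intro UnI1 UnI2 image_eqI[of _ _ "(i, j, k)"]) simp_all
    next
      fix k k' assume "j = 0" "as = [(i, 0, k), (i + k, 1, k')]"
      then show ?thesis using q by (intro UnI2 image_eqI[of _ _ "(i, k, k')"]) simp_all
    qed
  qed
qed simp

definition paths_between :: "vertex \<Rightarrow> vertex \<Rightarrow> arrow list set" where
  "paths_between v w = {as. is_path v as \<and> path_end (v, as) = w}"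

lemma finite_paths_between: "finite (paths_between v w)"
proof -
  have "Pair v ` paths_between v w \<subseteq> paths" by (auto simp: paths_between_def paths_def)
  then have "finite (Pair v ` paths_between v w)" using finite_paths finite_subset by blast
  then show ?thesis by (rule finite_imageD) (simp add: inj_on_def)
qed

lemma paths_Sigma: "{(v, as). (v, as) \<in> paths \<and> path_end (v, as) = w} = (SIGMA v:UNIV. paths_between v w)"
  by (auto simp: paths_between_def paths_def)

lemma end_image_eq:
  "end_image Y E x \<alpha> U s w z = (\<Sum>v\<in>UNIV. \<Sum>as\<in>paths_between v w. \<alpha> (v, as) * path_hom Y E x v as U (s v) z)"
  unfolding end_image_def paths_Sigma by (rule sum.Sigma[symmetric]) (simp_all add: finite_paths_between)

lemma paths_between_same: "paths_between v v = {[]}"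
proof -
  obtain i j where v: "v = (i, j)" by (cases v)
  have "as = []" if "as \<in> paths_between v v" for as
    using that is_path_cases[of i j as] by (auto simp: paths_between_def v)
  moreover have "[] \<in> paths_between v v" by (simp add: paths_between_def)
  ultimately show ?thesis by blast
qed

lemma paths_between_arrow:
  assumes "j \<noteq> 2"
  shows "paths_between (i, j) (i + k, j + 1) = {[(i, j, k)]}"
proof -
  have "as = [(i, j, k)]" if "as \<in> paths_between (i, j) (i + k, j + 1)" for as
    using that is_path_cases[of i j as] by (auto simp: paths_between_def)
  moreover have "[(i, j, k)] \<in> paths_between (i, j) (i + k, j + 1)"
    using assms by (simp add: paths_between_def arrows_def)
  ultimately show ?thesis by blast
qed

lemma paths_between_double:
  "paths_between (i, 0) (w, 2) = (\<lambda>j. [(i, 0, j), (i + j, 1, w - i - j)]) ` UNIV"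
proof
  show "paths_between (i, 0) (w, 2) \<subseteq> (\<lambda>j. [(i, 0, j), (i + j, 1, w - i - j)]) ` UNIV"
  proof
    fix as assume as: "as \<in> paths_between (i, 0) (w, 2)"
    then obtain k k' where "as = [(i, 0, k), (i + k, 1, k')]"
      using is_path_cases[of i 0 as] by (auto simp: paths_between_def)
    moreover then have "k' = w - i - k" using as by (auto simp: paths_between_def)
    ultimately show "as \<in> (\<lambda>j. [(i, 0, j), (i + j, 1, w - i - j)]) ` UNIV" by blast
  qed
  show "(\<lambda>j. [(i, 0, j), (i + j, 1, w - i - j)]) ` UNIV \<subseteq> paths_between (i, 0) (w, 2)"
    by (auto simp: paths_between_def arrows_def)
qed

lemma path_end_Cons: "path_end (u, a # as) = path_end (tgt a, as)"
  by simp

lemma sum_shift_three: "(\<Sum>j\<in>UNIV. f (i + j)) = (\<Sum>a\<in>UNIV. f (a :: 3))"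
  by (rule sum.reindex_bij_witness[of _ "\<lambda>a. a - i" "\<lambda>j. i + j"]) auto

lemma relation_double_path:
  "relation c (i, w) (double_path i' j' w') = (if i = i' \<and> w = w' then c (i, j', w - i - j') else 0)"
proof -
  have "relation c (i, w) (double_path i' j' w') =
    (\<Sum>p\<in>{(j, k). j + k = w - i}. if p = (j', w' - i' - j') then (if i = i' then c (i, j', w' - i' - j') else 0) else 0)"
    unfolding relation_def double_path_def prod.case
  proof (rule sum.cong[OF refl])
    fix p :: "3 \<times> 3"
    show "(case p of (j, k) \<Rightarrow> if ((i', 0), [(i', 0, j'), (i' + j', 1, w' - i' - j')]) =
        ((i, 0), [(i, 0, j), (i + j, 1, k)]) then c (i, j, k) else 0) =
      (if p = (j', w' - i' - j') then (if i = i' then c (i, j', w' - i' - j') else 0) else 0)"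
      by (cases p) auto
  qed
  also have "\<dots> = (if (j', w' - i' - j') \<in> {(j, k). j + k = w - i} then (if i = i' then c (i, j', w' - i' - j') else 0) else 0)"
    by (subst sum.delta) (auto intro: finite_subset[of _ UNIV])
  finally show ?thesis by auto
qed

lemma relation_other:
  assumes "\<And>j. q \<noteq> double_path i j w"
  shows "relation c (i, w) q = 0"
proof -
  have "(if q = ((i, 0), [(i, 0, j), (i + j, 1, k)]) then c (i, j, k) else 0) = 0" if "j + k = w - i" for j k
  proof -
    have "k = w - i - j" using that by (metis add_diff_cancel_left')
    then show ?thesis using assms[of j] by (auto simp: double_path_def)
  qed
  then show ?thesis unfolding relation_def by (auto intro!: sum.neutral)
qed

lemma relation_combination:
  "(\<Sum>r\<in>UNIV. t r * relation c r (double_path i j w)) = t (i, w) * c (i, j, w - i - j)"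
  "(\<And>i j w. q \<noteq> double_path i j w) \<Longrightarrow> (\<Sum>r\<in>UNIV. t r * relation c r q) = 0"
proof -
  have "(\<Sum>r\<in>UNIV. t r * relation c r (double_path i j w)) =
     (\<Sum>r\<in>UNIV. if r = (i, w) then t (i, w) * c (i, j, w - i - j) else 0)"
    by (rule sum.cong) (auto simp: relation_double_path split: if_splits)
  then show "(\<Sum>r\<in>UNIV. t r * relation c r (double_path i j w)) = t (i, w) * c (i, j, w - i - j)" by simp
  show "(\<Sum>r\<in>UNIV. t r * relation c r q) = 0" if "\<And>i j w. q \<noteq> double_path i j w"
  proof (rule sum.neutral, rule ballI)
    fix r :: "3 \<times> 3"
    obtain i w where "r = (i, w)" by (cases r)
    then show "t r * relation c r q = 0" using relation_other[of q i w c] that by simp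
  qed
qed

lemma double_path_in_paths: "double_path i j w \<in> paths"
  by (simp add: double_path_def paths_def arrows_def)

context six_points
begin

abbreviation L :: "vertex \<Rightarrow> (6 option \<Rightarrow> ('k ^ 3) set, 'k) fsheaf" where
  "L w \<equiv> line_bundle X (Ediv w)"

lemma path_hom_value:
  assumes x: "\<And>a. a \<in> arrows \<Longrightarrow> X.hom_mult (Ediv (src a)) (Ediv (tgt a)) (x a) (\<rho> a)"
    and U: "openin (ktop X) U"
  shows "is_path u as \<Longrightarrow> f \<in> L u U \<Longrightarrow> path_hom X L x u as U f \<in> L (path_end (u, as)) U \<and>
    (\<forall>y\<in>U \<inter> X.generic_part. path_hom X L x u as U f y = (\<Prod>a\<leftarrow>as. \<rho> a y) * f y)"
proof (induction as arbitrary: u f)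
  case Nil
  then show ?case using U by (simp add: id_hom_def)
next
  case (Cons a as)
  then have a: "a \<in> arrows" "src a = u" "is_path (tgt a) as" by auto
  have m: "X.hom_mult (Ediv u) (Ediv (tgt a)) (x a) (\<rho> a)" using x[OF a(1)] a(2) by simp
  then have "x a \<in> Hom X (L u) (L (tgt a))" by (simp add: X.hom_mult_def)
  then have f: "x a U f \<in> L (tgt a) U" using U Cons.prems(2) by (rule Hom_maps)
  have v: "x a U f y = \<rho> a y * f y" if "y \<in> U \<inter> X.generic_part" for y
    using m U Cons.prems(2) that by (simp add: X.hom_mult_def)
  from Cons.IH[OF a(3) f] v show ?case
    unfolding path_end_Cons by (simp add: comp_hom_def mult_ac)
qed

lemma line_bundle_sum:
  assumes "finite A" "openin (ktop X) U" "\<And>i. i \<in> A \<Longrightarrow> g i \<in> L w U"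
  shows "(\<lambda>z. \<Sum>i\<in>A. g i z) \<in> L w U"
  using assms(1,3)
proof (induction A)
  case empty
  then show ?case using X.line_bundle_zero[OF dv_supp assms(2)] by simp
next
  case (insert a A)
  then show ?case using X.line_bundle_add[OF dv_supp assms(2)] by simp
qed

text \<open>Necessity is tested on the section that is 1 over \<open>generic_part\<close> in one
  summand and 0 in the others, which isolates the paths starting at \<open>u\<close>. Sufficiency
  holds since sections agreeing on \<open>generic_part\<close> are equal.\<close>

lemma relation_ideal_iff:
  assumes x: "\<And>a. a \<in> arrows \<Longrightarrow> X.hom_mult (Ediv (src a)) (Ediv (tgt a)) (x a) (\<rho> a)"
  shows "\<alpha> \<in> relation_ideal X L x \<longleftrightarrow> \<alpha> \<in> path_algebra \<and>
    (\<forall>u w. \<forall>z\<in>X.generic_part. (\<Sum>as\<in>paths_between u w. \<alpha> (u, as) * (\<Prod>a\<leftarrow>as. \<rho> a z)) = 0)"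
proof
  assume \<alpha>: "\<alpha> \<in> relation_ideal X L x"
  have "(\<Sum>as\<in>paths_between u w. \<alpha> (u, as) * (\<Prod>a\<leftarrow>as. \<rho> a z)) = 0" if z: "z \<in> X.generic_part" for u w z
  proof -
    let ?G = "X.generic_part"
    define s :: "vertex \<Rightarrow> (6 option \<Rightarrow> ('k ^ 3) set) \<Rightarrow> 'k" where "s u' = (if u' = u then restr ?G (\<lambda>_. 1) else (\<lambda>_. 0))" for u'
    have s: "s u' \<in> L u' ?G" for u'
      unfolding s_def using X.line_bundle_generic_one[OF dv_supp]
        X.line_bundle_zero[OF dv_supp X.openin_generic_part] by simp
    have "end_image X L x \<alpha> ?G s = (\<lambda>_ _. 0)"
      using \<alpha> s X.openin_generic_part unfolding relation_ideal_def by blast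
    then have "0 = end_image X L x \<alpha> ?G s w z" by simp
    also have "\<dots> = (\<Sum>u'\<in>UNIV. \<Sum>as\<in>paths_between u' w. \<alpha> (u', as) * ((\<Prod>a\<leftarrow>as. \<rho> a z) * s u' z))"
      unfolding end_image_eq
    proof (intro sum.cong refl)
      fix u' as assume "as \<in> paths_between u' w"
      then have "is_path u' as" by (simp add: paths_between_def)
      from path_hom_value[OF x X.openin_generic_part this s] z
      show "\<alpha> (u', as) * path_hom X L x u' as ?G (s u') z = \<alpha> (u', as) * ((\<Prod>a\<leftarrow>as. \<rho> a z) * s u' z)" by simp
    qed
    also have "\<dots> = (\<Sum>u'\<in>UNIV. if u' = u then \<Sum>as\<in>paths_between u w. \<alpha> (u, as) * (\<Prod>a\<leftarrow>as. \<rho> a z) else 0)"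
      by (rule sum.cong) (auto simp: s_def restr_def z)
    finally show ?thesis by simp
  qed
  moreover have "\<alpha> \<in> path_algebra" using \<alpha> unfolding relation_ideal_def by blast
  ultimately show "\<alpha> \<in> path_algebra \<and>
    (\<forall>u w. \<forall>z\<in>X.generic_part. (\<Sum>as\<in>paths_between u w. \<alpha> (u, as) * (\<Prod>a\<leftarrow>as. \<rho> a z)) = 0)" by blast
next
  assume \<alpha>: "\<alpha> \<in> path_algebra \<and>
    (\<forall>u w. \<forall>z\<in>X.generic_part. (\<Sum>as\<in>paths_between u w. \<alpha> (u, as) * (\<Prod>a\<leftarrow>as. \<rho> a z)) = 0)"
  have "end_image X L x \<alpha> U s = (\<lambda>_ _. 0)" if U: "openin (ktop X) U" and s: "\<forall>u. s u \<in> L u U" for U s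
  proof
    fix w
    show "end_image X L x \<alpha> U s w = (\<lambda>_. 0)"
    proof (rule X.line_bundle_eqI[OF dv_supp U _ X.line_bundle_zero[OF dv_supp U]])
      have "(\<lambda>z. \<Sum>u\<in>UNIV. \<Sum>as\<in>paths_between u w. \<alpha> (u, as) * path_hom X L x u as U (s u) z) \<in> L w U"
      proof (intro line_bundle_sum U finite_paths_between)
        fix u as assume "as \<in> paths_between u w"
        then have p: "is_path u as" "path_end (u, as) = w" by (auto simp: paths_between_def)
        have "path_hom X L x u as U (s u) \<in> L w U"
          using path_hom_value[OF x U p(1) spec[OF s]] unfolding p(2) by blast
        then show "(\<lambda>z. \<alpha> (u, as) * path_hom X L x u as U (s u) z) \<in> L w U"
          by (rule X.line_bundle_scale[OF dv_supp U X.regular_const[OF U]])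
      qed simp
      then show "end_image X L x \<alpha> U s w \<in> L w U" by (simp add: end_image_eq[abs_def])
      fix z assume z: "z \<in> U" "z \<in> X.generic_part"
      have "end_image X L x \<alpha> U s w z =
          (\<Sum>u\<in>UNIV. (\<Sum>as\<in>paths_between u w. \<alpha> (u, as) * (\<Prod>a\<leftarrow>as. \<rho> a z)) * s u z)"
        unfolding end_image_eq sum_distrib_right
      proof (intro sum.cong refl)
        fix u as assume "as \<in> paths_between u w"
        then have "is_path u as" by (simp add: paths_between_def)
        from path_hom_value[OF x U this spec[OF s]] z
        have "path_hom X L x u as U (s u) z = (\<Prod>a\<leftarrow>as. \<rho> a z) * s u z" by blast
        then show "\<alpha> (u, as) * path_hom X L x u as U (s u) z = \<alpha> (u, as) * (\<Prod>a\<leftarrow>as. \<rho> a z) * s u z" by simp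
      qed
      also have "\<dots> = 0"
      proof (rule sum.neutral, rule ballI)
        fix u
        have "(\<Sum>as\<in>paths_between u w. \<alpha> (u, as) * (\<Prod>a\<leftarrow>as. \<rho> a z)) = 0" using \<alpha> z(2) by blast
        then show "(\<Sum>as\<in>paths_between u w. \<alpha> (u, as) * (\<Prod>a\<leftarrow>as. \<rho> a z)) * s u z = 0" by simp
      qed
      finally show "end_image X L x \<alpha> U s w z = 0" .
    qed
  qed
  then show "\<alpha> \<in> relation_ideal X L x" using \<alpha> unfolding relation_ideal_def by blast
qed

lemma mult_generic:
  assumes "good u" "vdot h u = 1"
  shows "mult (i, 0, j) (plane_pt u) = form1 i (i + j) u" "mult (i, 1, j) (plane_pt u) = form2 i (i + j) u"
  using assms by (simp_all add: mult_def frac_plane_pt[OF is_form_form1] frac_plane_pt[OF is_form_form2] del: One_nat_def)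

text \<open>In terms of the middle vertex \<open>a = i + j\<close> the sum comes from a form of
  degree \<open>deg1 i + 1\<close>. Vanishing on \<open>generic_part\<close> makes this form zero by
  \<open>form_zero\<close>, and \<open>relation_unique\<close> applies.\<close>

lemma double_relation_iff:
  "(\<forall>z\<in>X.generic_part. (\<Sum>j\<in>UNIV. \<beta> j * (mult (i, 0, j) z * mult (i + j, 1, w - i - j) z)) = 0) \<longleftrightarrow>
   (\<exists>t. \<forall>j. \<beta> j = t * coef i (i + j) w)"
proof -
  have val: "(\<Sum>j\<in>UNIV. \<beta> j * (mult (i, 0, j) (plane_pt u) * mult (i + j, 1, w - i - j) (plane_pt u))) =
      (\<Sum>a\<in>UNIV. \<beta> (a - i) * (form1 i a u * form2 a w u))" if "good u" "vdot h u = 1" for u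
  proof -
    have "i + j + (w - i - j) = w" for j by simp
    then show ?thesis
      unfolding sum_shift_three[of "\<lambda>a. \<beta> (a - i) * (form1 i a u * form2 a w u)" i, symmetric] mult_generic[OF that]
      by simp
  qed
  show ?thesis
  proof
    assume *: "\<forall>z\<in>X.generic_part. (\<Sum>j\<in>UNIV. \<beta> j * (mult (i, 0, j) z * mult (i + j, 1, w - i - j) z)) = 0"
    let ?F = "\<lambda>u. \<Sum>a\<in>UNIV. \<beta> (a - i) * (form1 i a u * form2 a w u)"
    have "is_form (deg1 i + 1) ?F"
      unfolding sum_three by (intro is_form_add is_form_cmult is_form_mult is_form_form1 is_form_form2)
    then have "?F u = 0" for u
    proof (rule form_zero)
      show "?F u = 0" if "good u" "vdot h u = 1" for u
        unfolding val[OF that, symmetric] using * generic_partI[OF that] by blast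
    qed
    then have "\<exists>t. \<forall>a. \<beta> (a - i) = t * coef i a w" by (rule relation_unique)
    then obtain t where "\<forall>a. \<beta> (a - i) = t * coef i a w" by (elim exE)
    then have "\<forall>j. \<beta> j = t * coef i (i + j) w" by (metis add_diff_cancel_left')
    then show "\<exists>t. \<forall>j. \<beta> j = t * coef i (i + j) w" by blast
  next
    assume "\<exists>t. \<forall>j. \<beta> j = t * coef i (i + j) w"
    then obtain t where t: "\<And>j. \<beta> j = t * coef i (i + j) w" by blast
    have "(\<Sum>a\<in>UNIV. \<beta> (a - i) * (form1 i a u * form2 a w u)) = 0" for u
    proof -
      have "(\<Sum>a\<in>UNIV. \<beta> (a - i) * (form1 i a u * form2 a w u)) = t * (\<Sum>a\<in>UNIV. coef i a w * (form1 i a u * form2 a w u))"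
        by (simp add: t sum_distrib_left mult_ac)
      then show ?thesis by (simp add: relation_identity)
    qed
    note zero = this
    show "\<forall>z\<in>X.generic_part. (\<Sum>j\<in>UNIV. \<beta> j * (mult (i, 0, j) z * mult (i + j, 1, w - i - j) z)) = 0"
    proof
      fix z assume "z \<in> X.generic_part"
      then obtain u where u: "good u" "vdot h u = 1" "z = plane_pt u" by (rule generic_partE)
      show "(\<Sum>j\<in>UNIV. \<beta> j * (mult (i, 0, j) z * mult (i + j, 1, w - i - j) z)) = 0"
        unfolding u(3) val[OF u(1,2)] by (rule zero)
    qed
  qed
qed

lemma mult_nonzero: "a \<in> arrows \<Longrightarrow> \<exists>z\<in>X.generic_part. mult a z \<noteq> 0"
  using spans_arrow[of a] unfolding spans_def mult_def by blast

text \<open>A trivial path or a single arrow is the only path between its ends, and its multiplier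
  is not identically zero, so its coefficient is 0. On two-step paths the scalars \<open>l\<close>
  of the chosen bases are moved into the coefficients, and \<open>double_relation_iff\<close>
  applies.\<close>

lemma relation_ideal_char:
  assumes x: "\<And>a. a \<in> arrows \<Longrightarrow> l a \<noteq> 0 \<and> X.hom_mult (Ediv (src a)) (Ediv (tgt a)) (x a) (\<lambda>y. l a * mult a y)"
  shows "\<alpha> \<in> relation_ideal X L x \<longleftrightarrow> (\<forall>q. (\<forall>i j w. q \<noteq> double_path i j w) \<longrightarrow> \<alpha> q = 0) \<and>
    (\<forall>i w. \<exists>t. \<forall>j. \<alpha> (double_path i j w) * (l (i, 0, j) * l (i + j, 1, w - i - j)) = t * coef i (i + j) w)"
proof -
  let ?\<rho> = "\<lambda>a y. l a * mult a y"
  have D: "(\<Sum>as\<in>paths_between (i, 0) (w, 2). \<alpha> ((i, 0), as) * (\<Prod>a\<leftarrow>as. ?\<rho> a z)) =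
      (\<Sum>j\<in>UNIV. \<alpha> (double_path i j w) * (l (i, 0, j) * l (i + j, 1, w - i - j)) *
         (mult (i, 0, j) z * mult (i + j, 1, w - i - j) z))" for i w z
    unfolding paths_between_double
    by (subst sum.reindex) (auto simp: inj_on_def double_path_def mult_ac)
  have iff: "\<alpha> \<in> relation_ideal X L x \<longleftrightarrow> \<alpha> \<in> path_algebra \<and>
    (\<forall>u w. \<forall>z\<in>X.generic_part. (\<Sum>as\<in>paths_between u w. \<alpha> (u, as) * (\<Prod>a\<leftarrow>as. ?\<rho> a z)) = 0)"
    by (rule relation_ideal_iff) (use x in blast)
  show ?thesis
  proof
    assume "\<alpha> \<in> relation_ideal X L x"
    then have \<alpha>: "\<alpha> \<in> path_algebra"
      "\<And>u w z. z \<in> X.generic_part \<Longrightarrow> (\<Sum>as\<in>paths_between u w. \<alpha> (u, as) * (\<Prod>a\<leftarrow>as. ?\<rho> a z)) = 0"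
      unfolding iff by blast+
    have "\<alpha> q = 0" if q: "\<forall>i j w. q \<noteq> double_path i j w" for q
    proof (cases "q \<in> paths")
      case False
      then show ?thesis using \<alpha>(1) unfolding path_algebra_def by blast
    next
      case True
      then obtain i j as where ij: "q = ((i, j), as)" "is_path (i, j) as" by (auto simp: paths_def)
      from is_path_cases[OF ij(2)] show ?thesis
      proof (elim disjE exE conjE)
        assume "as = []"
        moreover obtain z where "z \<in> X.generic_part" using X.generic_part_nonempty by blast
        ultimately show ?thesis using \<alpha>(2)[of z "(i, j)" "(i, j)"] ij(1) by (simp add: paths_between_same)
      next
        fix k assume k: "j \<noteq> 2" "as = [(i, j, k)]"
        then have a: "(i, j, k) \<in> arrows" by (simp add: arrows_def)
        obtain z where "z \<in> X.generic_part" "mult (i, j, k) z \<noteq> 0" using mult_nonzero[OF a] by blast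
        then show ?thesis
          using \<alpha>(2)[of z "(i, j)" "(i + k, j + 1)"] ij(1) k x[OF a] by (simp add: paths_between_arrow)
      next
        fix k k' assume "j = 0" "as = [(i, 0, k), (i + k, 1, k')]"
        then have "q = double_path i k (i + k + k')" using ij(1) by (simp add: double_path_def)
        then show ?thesis using q by blast
      qed
    qed
    moreover have "\<exists>t. \<forall>j. \<alpha> (double_path i j w) * (l (i, 0, j) * l (i + j, 1, w - i - j)) = t * coef i (i + j) w" for i w
      using \<alpha>(2)[of _ "(i, 0)" "(w, 2)"] unfolding D double_relation_iff[symmetric] by blast
    ultimately show "(\<forall>q. (\<forall>i j w. q \<noteq> double_path i j w) \<longrightarrow> \<alpha> q = 0) \<and>
      (\<forall>i w. \<exists>t. \<forall>j. \<alpha> (double_path i j w) * (l (i, 0, j) * l (i + j, 1, w - i - j)) = t * coef i (i + j) w)"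
      by blast
  next
    assume "(\<forall>q. (\<forall>i j w. q \<noteq> double_path i j w) \<longrightarrow> \<alpha> q = 0) \<and>
      (\<forall>i w. \<exists>t. \<forall>j. \<alpha> (double_path i j w) * (l (i, 0, j) * l (i + j, 1, w - i - j)) = t * coef i (i + j) w)"
    then have \<alpha>: "\<And>q. (\<forall>i j w. q \<noteq> double_path i j w) \<Longrightarrow> \<alpha> q = 0"
      "\<And>i w. \<exists>t. \<forall>j. \<alpha> (double_path i j w) * (l (i, 0, j) * l (i + j, 1, w - i - j)) = t * coef i (i + j) w"
      by blast+
    have "\<alpha> q = 0" if "q \<notin> paths" for q
      by (rule \<alpha>(1)) (use that double_path_in_paths in blast)
    then have "\<alpha> \<in> path_algebra" unfolding path_algebra_def by blast
    moreover have "(\<Sum>as\<in>paths_between u w. \<alpha> (u, as) * (\<Prod>a\<leftarrow>as. ?\<rho> a z)) = 0"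
      if z: "z \<in> X.generic_part" for u w z
    proof (cases "snd u = 0 \<and> snd w = 2")
      case True
      then obtain i w' where uw: "u = (i, 0)" "w = (w', 2)" by (metis prod.collapse)
      show ?thesis
        unfolding uw D using \<alpha>(2)[of i w'] z unfolding double_relation_iff[symmetric] by blast
    next
      case False
      show ?thesis
      proof (rule sum.neutral, rule ballI)
        fix as assume as: "as \<in> paths_between u w"
        have "\<alpha> (u, as) = 0"
        proof (rule \<alpha>(1), intro allI notI)
          fix i j w' assume "(u, as) = double_path i j w'"
          then have "u = (i, 0)" "w = (w', 2)" using as by (auto simp: double_path_def paths_between_def)
          then show False using False by simp
        qed
        then show "\<alpha> (u, as) * (\<Prod>a\<leftarrow>as. ?\<rho> a z) = 0" by simp
      qed
    qed
    ultimately show "\<alpha> \<in> relation_ideal X L x" unfolding iff by blast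
  qed
qed

end

section \<open>The coefficient vector of a marked cubic surface\<close>

definition standard_vector :: "(6 \<Rightarrow> 'k::field ^ 3) \<Rightarrow> 3 \<times> 3 \<times> 3 \<Rightarrow> 'k" where
  "standard_vector v = (\<lambda>(i, j, k). coefficient v i (i + j) (i + j + k))"

lemma standard_vector_torus:
  assumes "\<And>i j k. i \<noteq> j \<Longrightarrow> j \<noteq> k \<Longrightarrow> i \<noteq> k \<Longrightarrow> det3 (v i) (v j) (v k) \<noteq> 0"
  shows "standard_vector v \<in> torus27"
  using coefficient_nonzero[of v] assms by (auto simp: torus27_def standard_vector_def)

text \<open>In terms of the vertices \<open>(i, 0)\<close>, \<open>(a, 1)\<close>,
  \<open>(w, 2)\<close> of a two-step path, the image of \<open>rho\<close> consists of the products
  of a function of \<open>(i, w)\<close>, one of \<open>(a, w)\<close> and one of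
  \<open>(i, a)\<close>. The parameters with middle index 2 act like arrows from
  \<open>(w, 2)\<close> back to \<open>(i, 0)\<close>.\<close>

lemma rho_I:
  assumes "\<And>i w. g i w \<noteq> 0" "\<And>i a w. \<kappa> (i, a - i, w - a) = g i w * b a w * f i a"
    "\<And>a w. b a w \<noteq> 0" "\<And>i a. f i a \<noteq> (0 :: 'k::field)"
  shows "\<kappa> \<in> rho ` torus27"
proof -
  define \<alpha> :: "3 \<times> 3 \<times> 3 \<Rightarrow> 'k" where "\<alpha> = (\<lambda>(p, q, r). if q = 2 then g (p + r) p else if q = 1 then b p (p + r) else f p (p + r))"
  have "\<kappa> (i, j, k) = rho \<alpha> (i, j, k)" for i j k
    using assms(2)[of i "i + j" "i + j + k"] by (simp add: rho_def \<alpha>_def add.assoc)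
  then have "\<kappa> = rho \<alpha>" by (simp add: fun_eq_iff)
  moreover have "\<alpha> \<in> torus27" using assms(1,3,4) by (auto simp: torus27_def \<alpha>_def)
  ultimately show ?thesis by blast
qed

lemma rho_E:
  assumes "\<kappa> \<in> rho ` torus27"
  obtains g b f where "\<And>i w. g i w \<noteq> 0" "\<And>a w. b a w \<noteq> 0" "\<And>i a. f i a \<noteq> (0 :: 'k::field)"
    "\<And>i a w. \<kappa> (i, a - i, w - a) = g i w * b a w * f i a"
proof -
  obtain \<alpha> where \<alpha>: "\<alpha> \<in> torus27" "\<kappa> = rho \<alpha>" using assms by blast
  show ?thesis
  proof (rule that[of "\<lambda>i w. \<alpha> (w, 2, i - w)" "\<lambda>a w. \<alpha> (a, 1, w - a)" "\<lambda>i a. \<alpha> (i, 0, a - i)"])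
    show "\<kappa> (i, a - i, w - a) = \<alpha> (w, 2, i - w) * \<alpha> (a, 1, w - a) * \<alpha> (i, 0, a - i)" for i a w
      by (simp add: \<alpha>(2) rho_def algebra_simps)
  qed (use \<alpha>(1) in \<open>auto simp: torus27_def\<close>)
qed

lemma rho_mult:
  "rho \<alpha> r * rho \<beta> r = rho (\<lambda>x. \<alpha> x * \<beta> x) r"
  by (cases r) (simp add: rho_def mult_ac)

lemma rho_torus: "\<kappa> \<in> rho ` torus27 \<Longrightarrow> \<kappa> r \<noteq> (0 :: 'k::field)"
  by (cases r) (auto simp: rho_def torus27_def)

lemma K_class_self: "c \<in> K_class c"
proof -
  have "(\<lambda>_. 1) \<in> rho ` torus27" by (rule rho_I[of "\<lambda>_ _. 1" _ "\<lambda>_ _. 1" "\<lambda>_ _. 1"]) auto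
  then show ?thesis unfolding K_class_def by force
qed

lemma K_class_subset:
  assumes "\<kappa> \<in> rho ` torus27"
  shows "K_class (\<lambda>r. \<kappa> r * c r) \<subseteq> K_class c"
proof
  fix x assume "x \<in> K_class (\<lambda>r. \<kappa> r * c r)"
  then obtain \<alpha> where \<alpha>: "\<alpha> \<in> torus27" "x = (\<lambda>r. rho \<alpha> r * (\<kappa> r * c r))" unfolding K_class_def by blast
  obtain \<beta> where \<beta>: "\<beta> \<in> torus27" "\<kappa> = rho \<beta>" using assms by blast
  have "x = (\<lambda>r. rho (\<lambda>x. \<alpha> x * \<beta> x) r * c r)"
    unfolding \<alpha>(2) \<beta>(2) by (simp add: rho_mult[symmetric] mult.assoc)
  moreover have "(\<lambda>x. \<alpha> x * \<beta> x) \<in> torus27" using \<alpha>(1) \<beta>(1) by (simp add: torus27_def)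
  ultimately show "x \<in> K_class c" unfolding K_class_def by blast
qed

lemma K_class_eqI:
  assumes \<kappa>: "\<kappa> \<in> rho ` torus27" and c: "\<And>r. c r = \<kappa> r * c' r"
  shows "K_class c = K_class c'"
proof
  have eq: "c = (\<lambda>r. \<kappa> r * c' r)" using c by blast
  show "K_class c \<subseteq> K_class c'" unfolding eq by (rule K_class_subset[OF \<kappa>])
  obtain g b f where 1: "\<And>i w. g i w \<noteq> 0" "\<And>a w. b a w \<noteq> 0" "\<And>i a. f i a \<noteq> 0"
    "\<And>i a w. \<kappa> (i, a - i, w - a) = g i w * b a w * f i a" using rho_E[OF \<kappa>] by metis
  have "(\<lambda>r. inverse (\<kappa> r)) \<in> rho ` torus27"
    by (rule rho_I[of "\<lambda>i w. inverse (g i w)" _ "\<lambda>a w. inverse (b a w)" "\<lambda>i a. inverse (f i a)"]) (simp_all add: 1)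
  from K_class_subset[OF this, of c] show "K_class c' \<subseteq> K_class c"
    using rho_torus[OF \<kappa>] by (simp add: eq mult.assoc[symmetric])
qed

lemma K_class_eqD:
  assumes "K_class c = K_class c'"
  obtains \<kappa> where "\<kappa> \<in> rho ` torus27" "c = (\<lambda>r. \<kappa> r * c' r)"
  using K_class_self[of c] unfolding assms by (auto simp: K_class_def)

context six_points
begin

text \<open>The relation with index \<open>(i, w)\<close> lies in the ideal, so its coefficients
  times the scalars \<open>l\<close> are a multiple \<open>t i w\<close> of \<open>coef\<close>, and
  \<open>row\<close> makes \<open>t\<close> nonzero. The resulting factor is a product of a function
  of \<open>(i, w)\<close> and one for each of the two arrows, so it is in the image of
  \<open>rho\<close>.\<close>

lemma coefficients_of_relations:
  assumes x: "\<forall>a\<in>arrows. is_basis_hom X (E_bundle (pts v) h (src a)) (E_bundle (pts v) h (tgt a)) (x a)"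
    and row: "\<forall>i w. \<exists>j k. j + k = w - i \<and> c (i, j, k) \<noteq> 0"
    and c: "relation_ideal X (E_bundle (pts v) h) x = range (\<lambda>t q. \<Sum>r\<in>UNIV. t r * relation c r q)"
  shows "\<exists>\<kappa>\<in>rho ` torus27. \<forall>r. c r = \<kappa> r * standard_vector v r"
proof -
  have "\<forall>a\<in>arrows. \<exists>l. l \<noteq> 0 \<and> X.hom_mult (Ediv (src a)) (Ediv (tgt a)) (x a) (\<lambda>y. l * mult a y)"
    by (intro ballI, rule arrow_basis(2), assumption, rule bspec[OF x])
  from bchoice[OF this] obtain l where
    l': "\<forall>a\<in>arrows. l a \<noteq> 0 \<and> X.hom_mult (Ediv (src a)) (Ediv (tgt a)) (x a) (\<lambda>y. l a * mult a y)"
    by (elim exE)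
  have l: "l a \<noteq> 0 \<and> X.hom_mult (Ediv (src a)) (Ediv (tgt a)) (x a) (\<lambda>y. l a * mult a y)" if "a \<in> arrows" for a
    using l' that by (rule bspec)
  have ideal_iff: "\<alpha> \<in> relation_ideal X L x \<longleftrightarrow> (\<forall>q. (\<forall>i j w. q \<noteq> double_path i j w) \<longrightarrow> \<alpha> q = 0) \<and>
      (\<forall>i w. \<exists>t. \<forall>j. \<alpha> (double_path i j w) * (l (i, 0, j) * l (i + j, 1, w - i - j)) = t * coef i (i + j) w)" for \<alpha>
    by (rule relation_ideal_char) (rule l)
  have EL: "E_bundle (pts v) h = L" by (rule ext) (rule E_bundle_eq)
  have l1: "l (i, 0, j) \<noteq> 0" "l (i, 1, k) \<noteq> 0" for i j k using l by (auto simp: arrows_def)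
  have "\<exists>t. \<forall>j. c (i, j, w - i - j) * (l (i, 0, j) * l (i + j, 1, w - i - j)) = t * coef i (i + j) w" for i w
  proof -
    \<comment> \<open>Choosing the scalars as an indicator function singles out one of the nine
      relations.\<close>
    let ?e = "\<lambda>q. \<Sum>r\<in>UNIV. (if r = (i, w) then 1 else 0) * relation c r q"
    have "?e \<in> relation_ideal X L x" unfolding EL[symmetric] c
      by (rule range_eqI[where x = "\<lambda>r. if r = (i, w) then 1 else 0"]) (rule refl)
    then have "\<exists>t. \<forall>j. ?e (double_path i j w) * (l (i, 0, j) * l (i + j, 1, w - i - j)) = t * coef i (i + j) w"
      unfolding ideal_iff by blast
    then show ?thesis unfolding relation_combination by simp
  qed
  then obtain t where t: "\<And>i j w. c (i, j, w - i - j) * (l (i, 0, j) * l (i + j, 1, w - i - j)) = t i w * coef i (i + j) w"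
    by metis
  have t0: "t i w \<noteq> 0" for i w
  proof -
    obtain j k where jk: "j + k = w - i" "c (i, j, k) \<noteq> 0" using row by blast
    then have k: "k = w - i - j" by (metis add_diff_cancel_left')
    show ?thesis using t[of i j w] jk(2) l1(1)[of i j] l1(2)[of "i + j" "w - i - j"] unfolding k by auto
  qed
  define \<kappa> where "\<kappa> = (\<lambda>(i, j, k). t i (i + j + k) / (l (i, 0, j) * l (i + j, 1, k)))"
  have "\<kappa> \<in> rho ` torus27"
    by (rule rho_I[of t _ "\<lambda>a w. inverse (l (a, 1, w - a))" "\<lambda>i a. inverse (l (i, 0, a - i))"])
      (use t0 l1 in \<open>simp_all add: \<kappa>_def field_simps\<close>)
  moreover have "c r = \<kappa> r * standard_vector v r" for r
  proof -
    obtain i j k where r: "r = (i, j, k)" by (metis prod_cases3)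
    have "i + j + k - i - j = k" by simp
    then show ?thesis using t[of i j "i + j + k"] l1 by (simp add: r \<kappa>_def standard_vector_def field_simps)
  qed
  ultimately show ?thesis by blast
qed

text \<open>The coefficients are \<open>coef\<close> divided by the scalars of the chosen bases. The
  nine relations span because the coefficients of any element of the ideal at \<open>(i, w)\<close>
  are a multiple of these.\<close>

lemma coefficients_exist:
  obtains x c where
    "\<forall>a\<in>arrows. is_basis_hom X (E_bundle (pts v) h (src a)) (E_bundle (pts v) h (tgt a)) (x a)"
    "\<forall>i w. \<exists>j k. j + k = w - i \<and> c (i, j, k) \<noteq> 0"
    "relation_ideal X (E_bundle (pts v) h) x = range (\<lambda>t q. \<Sum>r\<in>UNIV. t r * relation c r q)"
proof -
  have "\<forall>a\<in>arrows. \<exists>\<phi>. is_basis_hom X (E_bundle (pts v) h (src a)) (E_bundle (pts v) h (tgt a)) \<phi>"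
    by (intro ballI) (rule arrow_basis(1))
  from bchoice[OF this] obtain x where
    x: "\<forall>a\<in>arrows. is_basis_hom X (E_bundle (pts v) h (src a)) (E_bundle (pts v) h (tgt a)) (x a)" by (elim exE)
  have "\<forall>a\<in>arrows. \<exists>l. l \<noteq> 0 \<and> X.hom_mult (Ediv (src a)) (Ediv (tgt a)) (x a) (\<lambda>y. l * mult a y)"
    by (intro ballI, rule arrow_basis(2), assumption, rule bspec[OF x])
  from bchoice[OF this] obtain l where
    l': "\<forall>a\<in>arrows. l a \<noteq> 0 \<and> X.hom_mult (Ediv (src a)) (Ediv (tgt a)) (x a) (\<lambda>y. l a * mult a y)"
    by (elim exE)
  have l: "l a \<noteq> 0 \<and> X.hom_mult (Ediv (src a)) (Ediv (tgt a)) (x a) (\<lambda>y. l a * mult a y)" if "a \<in> arrows" for a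
    using l' that by (rule bspec)
  have ideal_iff: "\<alpha> \<in> relation_ideal X L x \<longleftrightarrow> (\<forall>q. (\<forall>i j w. q \<noteq> double_path i j w) \<longrightarrow> \<alpha> q = 0) \<and>
      (\<forall>i w. \<exists>t. \<forall>j. \<alpha> (double_path i j w) * (l (i, 0, j) * l (i + j, 1, w - i - j)) = t * coef i (i + j) w)" for \<alpha>
    by (rule relation_ideal_char) (rule l)
  have EL: "E_bundle (pts v) h = L" by (rule ext) (rule E_bundle_eq)
  have l1: "l (i, 0, j) \<noteq> 0" "l (i, 1, k) \<noteq> 0" for i j k using l by (auto simp: arrows_def)
  define c where "c = (\<lambda>(i, j, k). coef i (i + j) (i + j + k) / (l (i, 0, j) * l (i + j, 1, k)))"
  have cw: "c (i, j, w - i - j) * (l (i, 0, j) * l (i + j, 1, w - i - j)) = coef i (i + j) w" for i j w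
    using l1 by (simp add: c_def)
  have c0: "c (i, j, k) \<noteq> 0" for i j k using coef_nonzero l1 by (simp add: c_def)
  have "relation_ideal X L x = range (\<lambda>t q. \<Sum>r\<in>UNIV. t r * relation c r q)"
  proof (intro set_eqI iffI)
    fix \<alpha> assume "\<alpha> \<in> relation_ideal X L x"
    then have \<alpha>: "\<And>q. (\<And>i j w. q \<noteq> double_path i j w) \<Longrightarrow> \<alpha> q = 0"
      "\<And>i w. \<exists>t. \<forall>j. \<alpha> (double_path i j w) * (l (i, 0, j) * l (i + j, 1, w - i - j)) = t * coef i (i + j) w"
      unfolding ideal_iff by blast+
    then obtain t where t: "\<And>i w j. \<alpha> (double_path i j w) * (l (i, 0, j) * l (i + j, 1, w - i - j)) = t i w * coef i (i + j) w"
      by metis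
    have "\<alpha> q = (\<Sum>r\<in>UNIV. (\<lambda>(i, w). t i w) r * relation c r q)" for q
    proof (cases "\<exists>i j w. q = double_path i j w")
      case True
      then obtain i j w where q: "q = double_path i j w" by blast
      have "\<alpha> q * (l (i, 0, j) * l (i + j, 1, w - i - j)) = t i w * c (i, j, w - i - j) * (l (i, 0, j) * l (i + j, 1, w - i - j))"
        using t[of i j w] cw[of i j w] by (simp add: q mult.assoc)
      then have "\<alpha> q = t i w * c (i, j, w - i - j)" using l1 by simp
      then show ?thesis unfolding q relation_combination by simp
    next
      case False
      then show ?thesis using \<alpha>(1)[of q] relation_combination(2)[of q] by simp
    qed
    then show "\<alpha> \<in> range (\<lambda>t q. \<Sum>r\<in>UNIV. t r * relation c r q)" by blast
  next
    fix \<alpha> assume "\<alpha> \<in> range (\<lambda>t q. \<Sum>r\<in>UNIV. t r * relation c r q)"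
    then obtain t where t: "\<alpha> = (\<lambda>q. \<Sum>r\<in>UNIV. t r * relation c r q)" by blast
    have "\<alpha> (double_path i j w) * (l (i, 0, j) * l (i + j, 1, w - i - j)) = t (i, w) * coef i (i + j) w" for i j w
      unfolding t relation_combination(1) using cw[of i j w] by (simp add: mult.assoc)
    moreover have "\<alpha> q = 0" if "\<forall>i j w. q \<noteq> double_path i j w" for q
      unfolding t by (rule relation_combination(2)) (use that in blast)
    ultimately show "\<alpha> \<in> relation_ideal X L x" unfolding ideal_iff by blast
  qed
  moreover have "\<forall>i w. \<exists>j k. j + k = w - i \<and> c (i, j, k) \<noteq> 0"
  proof (intro allI)
    fix i w :: 3
    show "\<exists>j k. j + k = w - i \<and> c (i, j, k) \<noteq> 0" by (intro exI[of _ 0] exI[of _ "w - i"]) (simp add: c0)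
  qed
  ultimately show ?thesis using that[OF x] unfolding EL by blast
qed

end

lemma avoiding_line_iff:
  "avoiding_line (pts v) h \<longleftrightarrow> h \<noteq> 0 \<and> (\<forall>i. vdot h (v i) \<noteq> 0)"
  by (simp add: avoiding_line_def pts_def on_line_span)

text \<open>Whatever line \<open>h\<close> and bases are used, the class is that of
  \<open>standard_vector v\<close>, so it is independent of these choices.\<close>

lemma coefficient_vector_sound:
  fixes v :: "6 \<Rightarrow> 'k::{alg_closed_field, field_char_0} ^ 3"
  assumes det: "\<And>i j k. i \<noteq> j \<Longrightarrow> j \<noteq> k \<Longrightarrow> i \<noteq> k \<Longrightarrow> det3 (v i) (v j) (v k) \<noteq> 0"
    and c: "coefficient_vector (pts v) c"
  shows "c \<in> torus27" "K_class c = K_class (standard_vector v)"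
proof -
  obtain h x where h: "avoiding_line (pts v) h" and
    x: "\<forall>a\<in>arrows. is_basis_hom (blowup (pts v)) (E_bundle (pts v) h (src a)) (E_bundle (pts v) h (tgt a)) (x a)"
    "\<forall>i w. \<exists>j k. j + k = w - i \<and> c (i, j, k) \<noteq> 0"
    "relation_ideal (blowup (pts v)) (E_bundle (pts v) h) x = range (\<lambda>t q. \<Sum>r\<in>UNIV. t r * relation c r q)"
    using c unfolding coefficient_vector_def by (elim exE conjE)
  interpret six_points v h using det h by unfold_locales (auto simp: avoiding_line_iff)
  obtain \<kappa> where \<kappa>: "\<kappa> \<in> rho ` torus27" "\<And>r. c r = \<kappa> r * standard_vector v r"
    using coefficients_of_relations[OF x] by blast
  show "c \<in> torus27" using rho_torus[OF \<kappa>(1)] \<kappa>(2) standard_vector_torus[OF det] by (auto simp: torus27_def)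
  show "K_class c = K_class (standard_vector v)" using \<kappa> by (rule K_class_eqI)
qed

lemma coefficient_vector_exists:
  fixes v :: "6 \<Rightarrow> 'k::{alg_closed_field, field_char_0} ^ 3"
  assumes det: "\<And>i j k. i \<noteq> j \<Longrightarrow> j \<noteq> k \<Longrightarrow> i \<noteq> k \<Longrightarrow> det3 (v i) (v j) (v k) \<noteq> 0"
    and nz: "\<And>i. v i \<noteq> 0"
  shows "\<exists>c. coefficient_vector (pts v) c"
proof -
  have "\<exists>h. \<forall>n\<in>range v. vdot n h \<noteq> 0" by (rule avoid_hyperplanes) (use nz in auto)
  then obtain h where h: "\<And>i. vdot h (v i) \<noteq> 0" by (auto simp: vdot_commute)
  then have "h \<noteq> 0" by auto
  interpret six_points v h using det h by unfold_locales
  obtain x c where "\<forall>a\<in>arrows. is_basis_hom X (E_bundle (pts v) h (src a)) (E_bundle (pts v) h (tgt a)) (x a)"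
    "\<forall>i w. \<exists>j k. j + k = w - i \<and> c (i, j, k) \<noteq> 0"
    "relation_ideal X (E_bundle (pts v) h) x = range (\<lambda>t q. \<Sum>r\<in>UNIV. t r * relation c r q)"
    by (rule coefficients_exist)
  moreover have "avoiding_line (pts v) h" using h \<open>h \<noteq> 0\<close> by (simp add: avoiding_line_iff)
  ultimately show ?thesis unfolding coefficient_vector_def by blast
qed

section \<open>Points in general position\<close>

text \<open>Nonzero kernel vectors of the matrix with rows \<open>a\<close>, \<open>b\<close>,
  \<open>c\<close> are the lines containing the three points.\<close>

lemma det3_kernel:
  "det3 a b c = 0 \<longleftrightarrow> (\<exists>h. h \<noteq> 0 \<and> vdot h a = 0 \<and> vdot h b = 0 \<and> vdot h (c :: 'k::field ^ 3) = 0)"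
proof -
  let ?A = "vector [a, b, c] :: 'k ^ 3 ^ 3"
  have "det ?A = det3 a b c" by (simp add: det_3 vec3_defs algebra_simps)
  moreover have "?A *v h = 0 \<longleftrightarrow> vdot h a = 0 \<and> vdot h b = 0 \<and> vdot h c = 0" for h
    by (simp add: vec_eq_iff forall_3 matrix_vector_mult_def sum_3 vdot_def mult.commute)
  moreover have "det ?A \<noteq> 0 \<longleftrightarrow> (\<forall>h. ?A *v h = 0 \<longrightarrow> h = 0)"
    using invertible_det_nz[of ?A] invertible_left_inverse[of ?A] matrix_left_invertible_ker[of ?A] by simp
  ultimately show ?thesis by auto
qed

section \<open>Conics and the quadratic transformation\<close>

definition bform :: "'k::field ^ 3 ^ 3 \<Rightarrow> 'k ^ 3 \<Rightarrow> 'k ^ 3 \<Rightarrow> 'k" where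
  "bform Q u w = (\<Sum>a\<in>UNIV. \<Sum>b\<in>UNIV. Q $ a $ b * u $ a * w $ b)"

lemma qform_eq: "qform Q u = bform Q u u"
  by (simp add: qform_def bform_def)

lemma bform_linear:
  "bform Q (u + u') w = bform Q u w + bform Q u' w" "bform Q u (w + w') = bform Q u w + bform Q u w'"
  "bform Q (t *s u) w = t * bform Q u w" "bform Q u (t *s w) = t * bform Q u w"
  by (simp_all add: bform_def sum.distrib sum_distrib_left algebra_simps)

lemma qform_expand:
  "qform Q (x *s a + y *s b + z *s c) = x\<^sup>2 * qform Q a + y\<^sup>2 * qform Q b + z\<^sup>2 * qform Q c +
     vdot (vector [bform Q b c + bform Q c b, bform Q c a + bform Q a c, bform Q a b + bform Q b a]) (cremona x y z)"
  by (simp add: qform_eq bform_linear vdot_def cremona_def algebra_simps power2_eq_square)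

lemma qform_vdot_mult:
  "qform (\<chi> i j. \<alpha> * (p $ i * q $ j) + \<beta> * (r $ i * s $ j) + \<gamma> * (k $ i * l $ j)) u =
     \<alpha> * (vdot p u * vdot q u) + \<beta> * (vdot r u * vdot s u) + \<gamma> * (vdot k u * vdot l u)"
  by (simp add: qform_def vdot_def sum_3 algebra_simps)

lemma coordinate_expand:
  "det3 (v (pt2 0)) (v (pt2 1)) (v (pt2 2)) *s u =
     coordinate v 0 u *s v (pt2 0) + coordinate v 1 u *s v (pt2 1) + coordinate v 2 u *s v (pt2 2)"
proof -
  have "coordinate v 1 u = det3 (v (pt2 0)) u (v (pt2 2))" "coordinate v 2 u = det3 (v (pt2 0)) (v (pt2 1)) u"
    unfolding coordinate_def by (simp_all add: three_numerals) (metis det3_rotate)+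
  then show ?thesis using cramer3[of "v (pt2 0)" "v (pt2 1)" "v (pt2 2)" u] by (simp add: coordinate_def)
qed

lemma coordinate_pt2_self:
  "coordinate v w (v (pt2 w)) = det3 (v (pt2 0)) (v (pt2 1)) (v (pt2 2))"
proof -
  have "det3 b c a = det3 a b c" "det3 c a b = det3 a b c" for a b c :: "'a ^ 3" by (metis det3_rotate)+
  then show ?thesis using three_cases[of w] by (auto simp: coordinate_def three_numerals)
qed

lemma cremona_map_pt2: "cremona_map v (v (pt2 w)) = 0"
  using three_cases[of w]
  by (auto simp: cremona_map_def coordinate_pt2 cremona_def vec_eq_iff forall_3)

text \<open>A conic through the last three points has only mixed terms in their coordinates, hence
  is a linear form in \<open>cremona_map\<close>. It passes through the other three points exactly
  when this form annihilates their images.\<close>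

lemma conic_through_six:
  assumes \<delta>: "det3 (v (pt2 0)) (v (pt2 1)) (v (pt2 2)) \<noteq> (0 :: 'k::field)"
  shows "(\<exists>Q. (\<exists>u. qform Q u \<noteq> 0) \<and> (\<forall>i. qform Q (v i) = 0)) \<longleftrightarrow>
     det3 (cremona_map v (v (pt1 0))) (cremona_map v (v (pt1 1))) (cremona_map v (v (pt1 2))) = 0"
    (is "?L \<longleftrightarrow> ?R")
proof
  let ?\<delta> = "det3 (v (pt2 0)) (v (pt2 1)) (v (pt2 2))"
  assume ?L
  then obtain Q u where Q: "qform Q u \<noteq> 0" "\<And>i. qform Q (v i) = 0" by blast
  \<comment> \<open>The coefficients of the mixed terms, in the order of the entries of
    \<open>cremona\<close>.\<close>
  define \<gamma> :: "'k ^ 3" where "\<gamma> = vector [bform Q (v (pt2 1)) (v (pt2 2)) + bform Q (v (pt2 2)) (v (pt2 1)),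
    bform Q (v (pt2 2)) (v (pt2 0)) + bform Q (v (pt2 0)) (v (pt2 2)),
    bform Q (v (pt2 0)) (v (pt2 1)) + bform Q (v (pt2 1)) (v (pt2 0))]"
  have key: "?\<delta>\<^sup>2 * qform Q u = vdot \<gamma> (cremona_map v u)" for u
  proof -
    have "qform Q (?\<delta> *s u) = vdot \<gamma> (cremona_map v u)"
      unfolding coordinate_expand qform_expand Q(2) by (simp add: \<gamma>_def cremona_map_def)
    then show ?thesis by (simp add: qform_eq bform_linear power2_eq_square mult.assoc)
  qed
  have "\<gamma> \<noteq> 0" using key[of u] Q(1) \<delta> by auto
  moreover have "vdot \<gamma> (cremona_map v (v i)) = 0" for i using key[of "v i"] Q(2) by simp
  ultimately show ?R unfolding det3_kernel by blast
next
  assume ?R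
  then obtain \<gamma> where \<gamma>: "\<gamma> \<noteq> 0" "vdot \<gamma> (cremona_map v (v (pt1 0))) = 0"
    "vdot \<gamma> (cremona_map v (v (pt1 1))) = 0" "vdot \<gamma> (cremona_map v (v (pt1 2))) = 0"
    unfolding det3_kernel by blast
  \<comment> \<open>The sides of the triangle of the last three points; the conic sought is a
    combination of products of two sides.\<close>
  define n where "n w = cr (v (pt2 (w + 1))) (v (pt2 (w + 2)))" for w
  have n: "vdot (n w) u = coordinate v w u" for w u
    by (simp add: n_def coordinate_def det3_def vdot_commute)
  obtain Q where Q: "\<And>u. qform Q u = vdot \<gamma> (cremona_map v u)"
  proof
    show "qform (\<chi> i j. \<gamma> $ 1 * (n 1 $ i * n 2 $ j) + \<gamma> $ 2 * (n 2 $ i * n 0 $ j) + \<gamma> $ 3 * (n 0 $ i * n 1 $ j)) u =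
      vdot \<gamma> (cremona_map v u)" for u
      unfolding qform_vdot_mult n by (simp add: vdot_def cremona_map_def cremona_def)
  qed
  have vanish: "qform Q (v i) = 0" for i
    using pt_cases[of i] three_cases \<gamma>(2-4) by (auto simp: Q cremona_map_pt2) metis
  have diag: "coordinate v w (v (pt2 w)) \<noteq> 0" for w using \<delta> by (simp add: coordinate_pt2_self)
  \<comment> \<open>On the sum of two vertices only one product of coordinates survives, so the
    values of the conic at these three sums recover the entries of \<open>\<gamma>\<close> up to
    nonzero factors.\<close>
  have cm: "cremona_map v (v (pt2 1) + v (pt2 2)) = vector [coordinate v 1 (v (pt2 1)) * coordinate v 2 (v (pt2 2)), 0, 0]"
    "cremona_map v (v (pt2 2) + v (pt2 0)) = vector [0, coordinate v 2 (v (pt2 2)) * coordinate v 0 (v (pt2 0)), 0]"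
    "cremona_map v (v (pt2 0) + v (pt2 1)) = vector [0, 0, coordinate v 0 (v (pt2 0)) * coordinate v 1 (v (pt2 1))]"
    by (simp_all add: cremona_map_def cremona_def coordinate_add coordinate_pt2)
  have "\<exists>u. qform Q u \<noteq> 0"
  proof (rule ccontr)
    assume "\<not> ?thesis"
    then have "vdot \<gamma> (cremona_map v u) = 0" for u using Q by simp
    from this[of "v (pt2 1) + v (pt2 2)"] this[of "v (pt2 2) + v (pt2 0)"] this[of "v (pt2 0) + v (pt2 1)"]
    have "\<gamma> $ 1 = 0" "\<gamma> $ 2 = 0" "\<gamma> $ 3 = 0" unfolding cm vdot_def using diag by auto
    then show False using \<gamma>(1) by (simp add: vec_eq_iff forall_3)
  qed
  with vanish show ?L by blast
qed

text \<open>General position as the nonvanishing of a single polynomial in the vectors; the last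
  factor is the condition on the conic.\<close>

definition discriminant :: "(6 \<Rightarrow> 'k::field ^ 3) \<Rightarrow> 'k" where
  "discriminant v = (\<Prod>(i, j, k) | i \<noteq> j \<and> j \<noteq> k \<and> i \<noteq> k. det3 (v i) (v j) (v k)) *
     det3 (cremona_map v (v (pt1 0))) (cremona_map v (v (pt1 1))) (cremona_map v (v (pt1 2)))"

lemma discriminant_nonzero:
  "discriminant v \<noteq> 0 \<longleftrightarrow> (\<forall>i j k. i \<noteq> j \<and> j \<noteq> k \<and> i \<noteq> k \<longrightarrow> det3 (v i) (v j) (v k) \<noteq> 0) \<and>
     det3 (cremona_map v (v (pt1 0))) (cremona_map v (v (pt1 1))) (cremona_map v (v (pt1 2))) \<noteq> 0"
  unfolding discriminant_def by (auto simp: prod_zero_iff)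

lemma discriminant_det: "discriminant v \<noteq> 0 \<Longrightarrow> i \<noteq> j \<Longrightarrow> j \<noteq> k \<Longrightarrow> i \<noteq> k \<Longrightarrow> det3 (v i) (v j) (v k) \<noteq> 0"
  by (simp add: discriminant_nonzero)

lemma discriminant_v_nonzero:
  assumes "discriminant v \<noteq> 0"
  shows "v i \<noteq> 0"
proof
  assume i: "v i = 0"
  have "\<exists>a b. pt1 a \<noteq> i \<and> pt2 b \<noteq> i" by (metis pt_neq(1,2) three_shift_neq(1))
  then obtain a b where "pt1 a \<noteq> i" "pt2 b \<noteq> i" by blast
  then have "det3 (v i) (v (pt1 a)) (v (pt2 b)) \<noteq> 0" using assms pt_neq(3) by (intro discriminant_det) auto
  then show False by (simp add: i det3_def)
qed

lemma general_position_iff: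
  assumes nz: "\<And>i. v i \<noteq> (0 :: 'k::field ^ 3)"
  shows "pts v \<in> general_position \<longleftrightarrow> discriminant v \<noteq> 0"
proof -
  have "pts v \<in> topspace (ktop proj_power)"
    unfolding topspace_proj_power pts_def using nz by blast
  moreover have "(\<exists>h. h \<noteq> 0 \<and> on_line h (pts v i) \<and> on_line h (pts v j) \<and> on_line h (pts v k)) \<longleftrightarrow>
      det3 (v i) (v j) (v k) = 0" for i j k
    by (simp add: pts_def on_line_span det3_kernel)
  moreover have "(\<forall>u\<in>pts v i. qform Q u = 0) \<longleftrightarrow> qform Q (v i) = 0" for Q i
  proof
    show "qform Q (v i) = 0" if "\<forall>u\<in>pts v i. qform Q u = 0"
      using that vec.span_base[of "v i" "{v i}"] by (simp add: pts_def)
    show "\<forall>u\<in>pts v i. qform Q u = 0" if "qform Q (v i) = 0"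
      using that by (auto simp: pts_def span_single qform_eq bform_linear)
  qed
  ultimately have "pts v \<in> general_position \<longleftrightarrow>
    (\<forall>i j k. i \<noteq> j \<and> j \<noteq> k \<and> i \<noteq> k \<longrightarrow> det3 (v i) (v j) (v k) \<noteq> 0) \<and>
    \<not> (\<exists>Q. (\<exists>u. qform Q u \<noteq> 0) \<and> (\<forall>i. qform Q (v i) = 0))"
    unfolding general_position_def mem_Collect_eq by (simp only: simp_thms)
  also have "\<dots> \<longleftrightarrow> discriminant v \<noteq> 0"
  proof (cases "\<forall>i j k. i \<noteq> j \<and> j \<noteq> k \<and> i \<noteq> k \<longrightarrow> det3 (v i) (v j) (v k) \<noteq> 0")
    case True
    then have "det3 (v (pt2 0)) (v (pt2 1)) (v (pt2 2)) \<noteq> 0" by (simp add: pt_neq)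
    from conic_through_six[OF this] show ?thesis unfolding discriminant_nonzero by blast
  next
    case False
    then show ?thesis unfolding discriminant_nonzero by blast
  qed
  finally show ?thesis .
qed

lemma general_positionE:
  assumes "p \<in> general_position"
  obtains v where "p = pts v" "discriminant v \<noteq> 0"
proof -
  have "\<forall>i. \<exists>u. u \<noteq> 0 \<and> p i = vec.span {u}"
    using assms by (simp add: general_position_def topspace_proj_power)
  from choice[OF this] obtain v where v: "\<forall>i. v i \<noteq> 0 \<and> p i = vec.span {v i}" by (elim exE)
  then have "p = pts v" by (simp add: pts_def fun_eq_iff)
  moreover have "discriminant v \<noteq> 0" using general_position_iff[of v] v assms \<open>p = pts v\<close> by simp
  ultimately show ?thesis by (rule that)
qed

section \<open>Projective equivalence\<close>

definition equivalent :: "('i \<Rightarrow> 'k::field ^ 3) \<Rightarrow> ('i \<Rightarrow> 'k ^ 3) \<Rightarrow> bool" where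
  "equivalent v v' \<longleftrightarrow> (\<exists>A. invertible A \<and> (\<forall>i. \<exists>c. c \<noteq> 0 \<and> v' i = c *s (A *v v i)))"

lemma equivalentE:
  assumes "equivalent v v'"
  obtains A c where "invertible A" "\<And>i. c i \<noteq> 0" "\<And>i. v' i = c i *s (A *v v i)"
proof -
  obtain A where A: "invertible A" "\<forall>i. \<exists>c. c \<noteq> 0 \<and> v' i = c *s (A *v v i)"
    using assms unfolding equivalent_def by blast
  from choice[OF A(2)] obtain c where "\<forall>i. c i \<noteq> 0 \<and> v' i = c i *s (A *v v i)" by (elim exE)
  with A(1) show ?thesis using that[of A c] by simp
qed

lemma matrix_image_span: "(\<lambda>u. A *v u) ` vec.span {u} = vec.span {A *v (u :: 'k::field ^ 3)}"
proof -
  have "A *v (c *s u) = c *s (A *v u)" for c by (rule vector_scalar_commute)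
  then show ?thesis by (auto simp: span_single image_def)
qed

lemma aut_orbit_pts:
  "aut_orbit (pts v) = {\<lambda>i. vec.span {A *v v i} | A :: 'k::field ^ 3 ^ 3. invertible A}"
  unfolding aut_orbit_def pts_def matrix_image_span ..

lemma equivalent_aut_orbit:
  assumes "equivalent v v'"
  shows "aut_orbit (pts v) = aut_orbit (pts v')"
proof -
  obtain A c where A: "invertible A" "\<And>i. c i \<noteq> 0" "\<And>i. v' i = c i *s (A *v v i)"
    using equivalentE[OF assms] by metis
  obtain B where B: "A ** B = mat 1" "B ** A = mat 1" using A(1) unfolding invertible_def by blast
  then have Bi: "invertible B" unfolding invertible_def by blast
  have sp: "vec.span {M *v v' i} = vec.span {(M ** A) *v v i}" for M :: "'a ^ 3 ^ 3" and i
    using span_scale[OF A(2)[of i], of "M *v (A *v v i)"] by (simp add: A(3) vector_scalar_commute matrix_vector_mul_assoc)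
  show ?thesis
    unfolding aut_orbit_pts
  proof (intro set_eqI iffI)
    fix p assume "p \<in> {\<lambda>i. vec.span {A *v v i} | A :: 'a ^ 3 ^ 3. invertible A}"
    then obtain M where M: "invertible M" "p = (\<lambda>i. vec.span {M *v v i})" by blast
    have "vec.span {(M ** B) *v v' i} = vec.span {M *v v i}" for i
      using sp[of "M ** B" i] by (simp add: matrix_mul_assoc[symmetric] B)
    then have "p = (\<lambda>i. vec.span {(M ** B) *v v' i})" using M(2) by simp
    moreover have "invertible (M ** B)" using M(1) Bi by (rule invertible_mult)
    ultimately show "p \<in> {\<lambda>i. vec.span {A *v v' i} | A :: 'a ^ 3 ^ 3. invertible A}" by blast
  next
    fix p assume "p \<in> {\<lambda>i. vec.span {A *v v' i} | A :: 'a ^ 3 ^ 3. invertible A}"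
    then obtain M where M: "invertible M" "p = (\<lambda>i. vec.span {M *v v' i})" by blast
    moreover have "invertible (M ** A)" using M(1) A(1) by (rule invertible_mult)
    ultimately show "p \<in> {\<lambda>i. vec.span {A *v v i} | A :: 'a ^ 3 ^ 3. invertible A}" unfolding sp by blast
  qed
qed

lemma aut_orbit_equivalent:
  assumes eq: "aut_orbit (pts v) = aut_orbit (pts v')" and nz: "\<And>i. v' i \<noteq> 0"
  shows "equivalent v v'"
proof -
  have "pts v' = (\<lambda>i. vec.span {mat 1 *v v' i})" "invertible (mat 1 :: 'a ^ 3 ^ 3)"
    by (simp_all add: pts_def fun_eq_iff invertible_det_nz)
  then have "pts v' \<in> aut_orbit (pts v')" unfolding aut_orbit_pts by blast
  then have "\<exists>A :: 'a ^ 3 ^ 3. pts v' = (\<lambda>i. vec.span {A *v v i}) \<and> invertible A"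
    unfolding eq[symmetric] unfolding aut_orbit_pts mem_Collect_eq .
  then obtain A where A: "pts v' = (\<lambda>i. vec.span {A *v v i})" "invertible A"
    by (elim exE conjE)
  have "\<exists>c. c \<noteq> 0 \<and> v' i = c *s (A *v v i)" for i
  proof -
    have "vec.span {A *v v i} = vec.span {v' i}" using fun_cong[OF A(1), of i] by (simp add: pts_def)
    then show ?thesis using span_eqD[OF _ nz] by metis
  qed
  then show ?thesis unfolding equivalent_def using A(2) by (intro exI[of _ A]) simp
qed

lemma det3_matrix: "det3 (A *v a) (A *v b) (A *v c) = det A * det3 a b (c :: 'k::field ^ 3)"
  by (simp add: det_3 vec3_defs matrix_vector_mult_def sum_3 algebra_simps)

lemma det3_scale: "det3 (x *s a) (y *s b) (z *s c) = x * y * z * det3 a b c"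
  by (simp add: det3_linear)

text \<open>The factors \<open>r\<close> rescale the vectors of the points and the factors
  \<open>k\<close> the three coordinates. Each image is scaled by the square of its
  \<open>r\<close>, and each of its entries by two of the \<open>k\<close>, whence the
  square.\<close>

lemma cremona_scale:
  "det3 (cremona (r * k0 * x) (r * k1 * y) (r * k2 * z)) (cremona (r' * k0 * x') (r' * k1 * y') (r' * k2 * z'))
     (cremona (r'' * k0 * x'') (r'' * k1 * y'') (r'' * k2 * z'')) =
   (r * r' * r'' * k0 * k1 * k2)\<^sup>2 * det3 (cremona x y z) (cremona x' y' z') (cremona x'' y'' z'')"
  by (simp add: cremona_def vec3_defs algebra_simps power2_eq_square)

context
  fixes A :: "'k::field ^ 3 ^ 3" and c :: "6 \<Rightarrow> 'k" and v v' :: "6 \<Rightarrow> 'k ^ 3"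
  assumes A: "invertible A" and c: "\<And>i. c i \<noteq> 0" and v': "\<And>i. v' i = c i *s (A *v v i)"
begin

lemma det3_transform: "det3 (v' i) (v' j) (v' k) = c i * c j * c k * det A * det3 (v i) (v j) (v k)"
  by (simp add: v' det3_scale det3_matrix)

lemma coordinate_transform:
  "coordinate v' w (v' i) = c i * (c (pt2 (w + 1)) * c (pt2 (w + 2)) * det A) * coordinate v w (v i)"
  by (simp add: coordinate_def det3_transform)

lemma discriminant_transform: "discriminant v' \<noteq> 0 \<longleftrightarrow> discriminant v \<noteq> 0"
proof -
  have "det A \<noteq> 0" using A by (simp add: invertible_det_nz)
  then show ?thesis
    unfolding discriminant_nonzero cremona_map_def coordinate_transform cremona_scale
    using c by (simp add: det3_transform)
qed

lemma coefficient_transform: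
  "coefficient v' 0 a w = (c (pt1 (a + 1)) * c (pt1 (a + 2))) * (c (pt2 w) * det A) * coefficient v 0 a w"
  "coefficient v' 1 a w = c (pt1 a) * (c (pt2 (w + 1)) * c (pt2 (w + 2)) * det A) * coefficient v 1 a w"
  by (simp_all add: coefficient_def det3_transform coordinate_transform)

text \<open>Brackets change by \<open>det A\<close> and a factor for each point. In
  \<open>coefficient\<close> these combine to one factor for \<open>(i, w)\<close> and one for
  \<open>(i, a)\<close>, and both kinds are in the image of \<open>rho\<close>.\<close>

lemma standard_vector_transform: "K_class (standard_vector v') = K_class (standard_vector v)"
proof -
  define g where "g i w = (if i = 0 then c (pt2 w) * det A else if i = 1 then
    c (pt2 (w + 1)) * c (pt2 (w + 2)) * det A else 1)" for i w :: 3
  define f where "f i a = (if i = 0 then c (pt1 (a + 1)) * c (pt1 (a + 2)) else if i = 1 then c (pt1 a) else 1)" for i a :: 3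
  have nz: "det A \<noteq> 0" using A by (simp add: invertible_det_nz)
  have coef: "coefficient v' i a w = g i w * f i a * coefficient v i a w" for i a w
    using coefficient_transform three_cases[of i] by (auto simp: g_def f_def coefficient_def mult_ac)
  show ?thesis
  proof (rule K_class_eqI)
    show "(\<lambda>(i, j, k). g i (i + j + k) * f i (i + j)) \<in> rho ` torus27"
      by (rule rho_I[of g _ "\<lambda>_ _. 1" f]) (use c nz in \<open>auto simp: g_def f_def\<close>)
    show "standard_vector v' r = (case r of (i, j, k) \<Rightarrow> g i (i + j + k) * f i (i + j)) * standard_vector v r" for r
      by (cases r) (simp add: standard_vector_def coef)
  qed
qed

end

lemma equivalent_discriminant:
  assumes "equivalent v v'"
  shows "discriminant v' \<noteq> 0 \<longleftrightarrow> discriminant v \<noteq> 0"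
proof -
  obtain A c where "invertible A" "\<And>i. c i \<noteq> 0" "\<And>i. v' i = c i *s (A *v v i)"
    using equivalentE[OF assms] by metis
  then show ?thesis by (rule discriminant_transform)
qed

lemma equivalent_standard_vector:
  assumes "equivalent v v'"
  shows "K_class (standard_vector v') = K_class (standard_vector v)"
proof -
  obtain A c where "invertible A" "\<And>i. c i \<noteq> 0" "\<And>i. v' i = c i *s (A *v v i)"
    using equivalentE[OF assms] by metis
  then show ?thesis by (rule standard_vector_transform)
qed

lemma discriminant_torus: "discriminant v \<noteq> 0 \<Longrightarrow> standard_vector v \<in> torus27"
  by (rule standard_vector_torus) (rule discriminant_det)

section \<open>Reconstructing the points from the coefficients\<close>

text \<open>Up to row and column scaling, \<open>entry c 0\<close> and \<open>entry c 1\<close> are the matrices of quotients of the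
  coefficients for \<open>i = 0\<close> and \<open>i = 1\<close> by those for \<open>i = 2\<close>, with denominators cleared.\<close>

definition entry :: "(3 \<times> 3 \<times> 3 \<Rightarrow> 'k::field) \<Rightarrow> 3 \<Rightarrow> 3 \<Rightarrow> 3 \<Rightarrow> 'k" where
  "entry c i a w = c (i, a - i, w - a) * c (2, a - 2, w + 1 - a) * c (2, a - 2, w + 2 - a)"

text \<open>The last three points are put at the coordinate points and the first three at the rows
  of \<open>entry c 1\<close>. The shift \<open>m - 1\<close> matches the vector indices 1, 2, 3
  with \<open>w = 0, 1, 2\<close>.\<close>

definition points_of :: "(3 \<times> 3 \<times> 3 \<Rightarrow> 'k::field) \<Rightarrow> 6 \<Rightarrow> 'k ^ 3" where
  "points_of c i = (if i = 1 then \<chi> m. entry c 1 0 (m - 1) else if i = 2 then \<chi> m. entry c 1 1 (m - 1)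
     else if i = 3 then \<chi> m. entry c 1 2 (m - 1) else if i = 4 then axis 1 1 else if i = 5 then axis 2 1
     else axis 3 1)"

lemma points_of_pt1: "points_of c (pt1 a) = (\<chi> m. entry c 1 a (m - 1))"
  using three_cases[of a] by (auto simp: points_of_def pt1_def)

lemma points_of_pt2: "points_of c (pt2 w) = axis (w + 1) 1"
  using three_cases[of w] by (auto simp: points_of_def pt2_def)

lemma det3_axis:
  "det3 u (axis 2 1) (axis 3 1) = u $ 1" "det3 u (axis 3 1) (axis 1 1) = u $ 2"
  "det3 u (axis 1 1) (axis 2 1) = u $ 3"
  by (simp_all add: det3_def vdot_def cr_def vector_3 axis_def)

lemma coordinate_points_of: "coordinate (points_of c) w u = u $ (w + 1)"
proof -
  consider "w = 0" | "w = 1" | "w = 2" using three_cases[of w] by blast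
  then show ?thesis
  proof cases
    case 1
    have "(0 :: 3) + 1 + 1 = 2" "(0 :: 3) + 2 + 1 = 3" "(0 :: 3) + 1 = 1" by simp_all
    then show ?thesis by (simp only: 1 coordinate_def points_of_pt2 det3_axis)
  next
    case 2
    have "(1 :: 3) + 1 + 1 = 3" "(1 :: 3) + 2 + 1 = 1" "(1 :: 3) + 1 = 2" by simp_all
    then show ?thesis unfolding 2 coordinate_def points_of_pt2 by (simp only: det3_axis)
  next
    case 3
    have "(2 :: 3) + 1 + 1 = 1" "(2 :: 3) + 2 + 1 = 2" "(2 :: 3) + 1 = 3" by simp_all
    then show ?thesis unfolding 3 coordinate_def points_of_pt2 by (metis det3_axis(3))
  qed
qed

lemma prod_three: "(\<Prod>x\<in>UNIV. b x) = b w * b (w + 1) * b (w + (2 :: 3))"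
  unfolding UNIV_three[of w] by (simp add: mult.assoc)

text \<open>For nonzero coefficients, \<open>entry c i a w\<close> is
  \<open>c (i, a - i, w - a)\<close> divided by \<open>c (2, a - 2, w - a)\<close> and multiplied by
  the product of the latter over all three columns. The factor of \<open>\<kappa>\<close> that
  depends on \<open>(a, w)\<close> thus contributes only the product of its row, and only row and
  column factors remain.\<close>

lemma entry_scale:
  assumes "\<kappa> \<in> rho ` torus27"
  shows "\<exists>r s. (\<forall>i a. r i a \<noteq> 0) \<and> (\<forall>i w. s i w \<noteq> (0 :: 'k::field)) \<and>
    (\<forall>c i a w. entry (\<lambda>x. \<kappa> x * c x) i a w = r i a * s i w * entry c i a w)"
proof -
  obtain g b f where \<kappa>: "\<And>i w. g i w \<noteq> 0" "\<And>a w. b a w \<noteq> 0" "\<And>i a. f i a \<noteq> 0"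
    "\<And>i a w. \<kappa> (i, a - i, w - a) = g i w * b a w * f i a" using rho_E[OF assms] by metis
  show ?thesis
  proof (intro exI conjI allI)
    show "entry (\<lambda>x. \<kappa> x * c x) i a w =
      f i a * f 2 a * f 2 a * (\<Prod>x\<in>UNIV. b a x) * (g i w * g 2 (w + 1) * g 2 (w + 2)) * entry c i a w" for c i a w
      unfolding entry_def prod_three[of "b a" w] \<kappa>(4) by (simp add: mult_ac)
  qed (use \<kappa> in auto)
qed

text \<open>Row factors of \<open>entry c 1\<close> rescale the vectors of the first three points,
  and column factors form a diagonal matrix, which only rescales the coordinate points.\<close>

lemma equivalent_points_of:
  assumes "K_class c = K_class c'"
  shows "equivalent (points_of c') (points_of c)"
proof -
  obtain \<kappa> where \<kappa>: "\<kappa> \<in> rho ` torus27" "c = (\<lambda>r. \<kappa> r * c' r)" using K_class_eqD[OF assms] by metis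
  obtain r s where rs': "\<forall>i a. r i a \<noteq> 0" "\<forall>i w. s i w \<noteq> 0"
    "\<forall>c i a w. entry (\<lambda>x. \<kappa> x * c x) i a w = r i a * s i w * entry c i a w"
    using entry_scale[OF \<kappa>(1)] by (elim exE conjE)
  note rs = rs'[rule_format]
  define A :: "'a ^ 3 ^ 3" where "A = (\<chi> m n. if m = n then s 1 (m - 1) else 0)"
  have A: "(A *v u) $ m = s 1 (m - 1) * u $ m" for u m
  proof -
    have "(A *v u) $ m = (\<Sum>n\<in>UNIV. if m = n then s 1 (m - 1) * u $ n else 0)"
      unfolding A_def matrix_vector_mult_def by (simp only: vec_lambda_beta, intro sum.cong) auto
    then show ?thesis by simp
  qed
  have "det A = s 1 (1 - 1) * s 1 (2 - 1) * s 1 (3 - 1)" by (simp add: det_3 A_def)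
  then have "invertible A" using rs(2) by (simp add: invertible_det_nz)
  moreover have "\<exists>k. k \<noteq> 0 \<and> points_of c i = k *s (A *v points_of c' i)" for i
  proof -
    consider a where "i = pt1 a" | w where "i = pt2 w" using pt_cases[of i] by blast
    then show ?thesis
    proof cases
      case 1
      then show ?thesis using rs(1)
        by (intro exI[of _ "r 1 a"]) (simp add: points_of_pt1 vec_eq_iff A \<kappa>(2) rs(3) mult_ac)
    next
      case 2
      then show ?thesis using rs(2)
        by (intro exI[of _ "inverse (s 1 w)"]) (auto simp: points_of_pt2 vec_eq_iff A axis_def)
    qed
  qed
  ultimately show ?thesis unfolding equivalent_def by blast
qed

text \<open>Where the brackets are nonzero, this says that the entrywise quotient of
  \<open>entry c 0\<close> by the brackets of the reconstructed points has rank at most one: its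
  two-by-two minors vanish. With denominators cleared the condition is polynomial, hence
  closed.\<close>

definition compatible :: "(3 \<times> 3 \<times> 3 \<Rightarrow> 'k::field) \<Rightarrow> bool" where
  "compatible c \<longleftrightarrow> (\<forall>a b w x.
     entry c 0 a w * entry c 0 b x * coefficient (points_of c) 0 a x * coefficient (points_of c) 0 b w =
     entry c 0 a x * entry c 0 b w * coefficient (points_of c) 0 a w * coefficient (points_of c) 0 b x)"

lemma compatible_scale:
  assumes "\<And>a w. entry c 0 a w = r a * s w * e a w" "\<And>a w. coefficient (points_of c) 0 a w = r' a * s' w * n a w"
    and "\<And>a b w x. e a w * e b x * n a x * n b w = e a x * e b w * n a w * n b x"
  shows "compatible c"
  unfolding compatible_def assms(1,2)
proof (intro allI)
  fix a b w x
  let ?k = "r a * r b * s w * s x * r' a * r' b * s' w * s' x"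
  have "?k * (e a w * e b x * n a x * n b w) = ?k * (e a x * e b w * n a w * n b x)" by (simp only: assms(3))
  then show "r a * s w * e a w * (r b * s x * e b x) * (r' a * s' x * n a x) * (r' b * s' w * n b w) =
    r a * s x * e a x * (r b * s w * e b w) * (r' a * s' w * n a w) * (r' b * s' x * n b x)"
    by (simp add: mult_ac)
qed

lemma compatible_K_class:
  assumes eq: "K_class c = K_class c'" and c': "compatible c'"
  shows "compatible c"
proof -
  obtain \<kappa> where \<kappa>: "\<kappa> \<in> rho ` torus27" "c = (\<lambda>r. \<kappa> r * c' r)" using K_class_eqD[OF eq] by metis
  obtain r s where rs: "\<forall>c i a w. entry (\<lambda>x. \<kappa> x * c x) i a w = r i a * s i w * entry c i a w"
    using entry_scale[OF \<kappa>(1)] by (elim exE conjE)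
  obtain A k where A: "invertible A" "\<And>i. k i \<noteq> 0" "\<And>i. points_of c i = k i *s (A *v points_of c' i)"
    using equivalentE[OF equivalent_points_of[OF eq]] by metis
  show ?thesis
  proof (rule compatible_scale)
    show "entry c 0 a w = r 0 a * s 0 w * entry c' 0 a w" for a w unfolding \<kappa>(2) by (rule rs[rule_format])
    show "coefficient (points_of c) 0 a w = (k (pt1 (a + 1)) * k (pt1 (a + 2))) * (k (pt2 w) * det A) *
      coefficient (points_of c') 0 a w" for a w
      by (rule coefficient_transform(1)[OF A])
  qed (use c' in \<open>simp add: compatible_def\<close>)
qed

lemma entry_standard_vector: "entry (standard_vector v) i a w = coefficient v i a w"
  by (simp add: entry_def standard_vector_def coefficient_def)

text \<open>The matrix whose rows are the three coordinate forms maps the last three points to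
  multiples of the coordinate vectors and the first three to the vectors used by
  \<open>points_of\<close>.\<close>

lemma equivalent_points_of_standard_vector:
  assumes d: "discriminant v \<noteq> 0"
  shows "equivalent v (points_of (standard_vector v))"
proof -
  define A :: "'a ^ 3 ^ 3" where "A = (\<chi> m. cr (v (pt2 m)) (v (pt2 (m + 1))))"
  have A: "(A *v u) $ m = coordinate v (m - 1) u" for u m
  proof -
    have "(A *v u) $ m = vdot (cr (v (pt2 m)) (v (pt2 (m + 1)))) u"
      by (simp add: A_def matrix_vector_mult_def vdot_def sum_3)
    moreover have "m - 1 + 1 = m" "m - 1 + 2 = m + 1" by simp_all
    ultimately show ?thesis by (simp only: coordinate_def det3_def vdot_commute[of u])
  qed
  let ?\<delta> = "det3 (v (pt2 0)) (v (pt2 1)) (v (pt2 2))"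
  have \<delta>: "?\<delta> \<noteq> 0" by (intro discriminant_det[OF d] pt_neq) simp_all
  have "u = 0" if "A *v u = 0" for u
  proof -
    have "coordinate v w u = 0" for w using A[of u "w + 1"] that by simp
    then have "?\<delta> *s u = 0" unfolding coordinate_expand by simp
    then show ?thesis using \<delta> by simp
  qed
  then have "invertible A"
    unfolding invertible_left_inverse matrix_left_invertible_ker by blast
  moreover have "\<exists>k. k \<noteq> 0 \<and> points_of (standard_vector v) i = k *s (A *v v i)" for i
  proof -
    consider a where "i = pt1 a" | w where "i = pt2 w" using pt_cases[of i] by blast
    then show ?thesis
    proof cases
      case 1
      then show ?thesis
        by (intro exI[of _ 1]) (simp add: points_of_pt1 vec_eq_iff A entry_standard_vector coefficient_def)
    next
      case 2
      have "(A *v v (pt2 w)) $ m = (if m = w + 1 then ?\<delta> else 0)" for m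
        unfolding A using coordinate_pt2[of "m - 1" w v] coordinate_pt2_self[of v w] by (auto simp: diff_eq_eq)
      then show ?thesis using \<delta> 2
        by (intro exI[of _ "inverse ?\<delta>"]) (auto simp: points_of_pt2 vec_eq_iff axis_def)
    qed
  qed
  ultimately show ?thesis unfolding equivalent_def by blast
qed

lemma compatible_standard_vector:
  assumes "discriminant v \<noteq> 0"
  shows "compatible (standard_vector v)"
proof -
  obtain A k where A: "invertible A" "\<And>i. k i \<noteq> 0" "\<And>i. points_of (standard_vector v) i = k i *s (A *v v i)"
    using equivalentE[OF equivalent_points_of_standard_vector[OF assms]] by metis
  show ?thesis
  proof (rule compatible_scale)
    show "entry (standard_vector v) 0 a w = 1 * 1 * coefficient v 0 a w" for a w
      by (simp add: entry_standard_vector)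
    show "coefficient (points_of (standard_vector v)) 0 a w = (k (pt1 (a + 1)) * k (pt1 (a + 2))) * (k (pt2 w) * det A) *
      coefficient v 0 a w" for a w
      by (rule coefficient_transform(1)[OF A])
  qed (simp add: mult_ac)
qed

text \<open>The quotient \<open>R\<close> of \<open>entry c 0\<close> by the brackets of the
  reconstructed points has rank one by \<open>compatible\<close>, so it is a row factor times a
  column factor. Together with \<open>c2\<close> and the row products \<open>P\<close> these are the
  three kinds of factors allowed by \<open>rho_I\<close>.\<close>

lemma standard_vector_points_of:
  assumes c: "c \<in> torus27" and d: "discriminant (points_of c) \<noteq> 0" and compat: "compatible c"
  shows "K_class (standard_vector (points_of c)) = K_class c"
proof -
  let ?N = "coefficient (points_of c) 0"
  define c2 where "c2 a w = c (2, a - 2, w - a)" for a w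
  define P where "P a = (\<Prod>x\<in>UNIV. c2 a x)" for a
  define R where "R a w = entry c 0 a w / ?N a w" for a w
  have c0: "c r \<noteq> 0" for r using c unfolding torus27_def by blast
  then have c20: "c2 a w \<noteq> 0" and P0: "P a \<noteq> 0" for a w by (auto simp: c2_def P_def)
  have N0: "?N a w \<noteq> 0" for a w
    by (rule coefficient_nonzero[OF discriminant_det[OF d]])
  have R0: "R a w \<noteq> 0" for a w using c0 N0 by (simp add: R_def entry_def)
  have R: "R a w * R 0 0 = R a 0 * R 0 w" for a w
    using compat[unfolded compatible_def, rule_format, of a w 0 0] N0 by (simp add: R_def field_simps)
  \<comment> \<open>Multiplying by the missing column completes the product in \<open>entry\<close>
    to the whole row product \<open>P a\<close>.\<close>
  have eP: "entry c i a w * c2 a w = c (i, a - i, w - a) * P a" for i a w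
    unfolding P_def prod_three[of "c2 a" w] by (simp add: entry_def c2_def)
  define g where "g i w = (if i = 0 then R 0 w / R 0 0 else 1)" for i w :: 3
  define f where "f i a = (if i = 0 then R a 0 / P a else if i = 1 then 1 / P a else 1)" for i a :: 3
  have key: "c (i, a - i, w - a) = g i w * c2 a w * f i a * coefficient (points_of c) i a w" for i a w
  proof -
    consider "i = 0" | "i = 1" | "i = 2" using three_cases[of i] by blast
    then show ?thesis
    proof cases
      case 1
      have "c (0, a - 0, w - a) * P a = R a w * ?N a w * c2 a w" using eP[of 0 a w] N0 by (simp add: R_def)
      also have "R a w = R a 0 * R 0 w / R 0 0" using R[of a w] R0 by (simp add: field_simps)
      finally show ?thesis using P0[of a] R0 1 by (simp add: g_def f_def field_simps)
    next
      case 2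
      have "coefficient (points_of c) 1 a w = entry c 1 a w"
        by (simp add: coefficient_def coordinate_points_of points_of_pt1)
      then show ?thesis using eP[of 1 a w] P0[of a] 2 by (simp add: g_def f_def field_simps)
    next
      case 3
      then show ?thesis by (simp add: g_def f_def c2_def coefficient_def)
    qed
  qed
  have "K_class c = K_class (standard_vector (points_of c))"
  proof (rule K_class_eqI)
    show "(\<lambda>(i, j, k). g i (i + j + k) * c2 (i + j) (i + j + k) * f i (i + j)) \<in> rho ` torus27"
      by (rule rho_I[of g _ c2 f]) (use R0 P0 c20 in \<open>auto simp: g_def f_def\<close>)
    show "c r = (case r of (i, j, k) \<Rightarrow> g i (i + j + k) * c2 (i + j) (i + j + k) * f i (i + j)) *
      standard_vector (points_of c) r" for r
    proof (cases r)
      case (fields i j k)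
      then show ?thesis using key[of i "i + j" "i + j + k"] by (simp add: standard_vector_def)
    qed
  qed
  then show ?thesis ..
qed

section \<open>The immersion\<close>

text \<open>The choice of the representing vectors is harmless by \<open>iota_orbit\<close>.\<close>

definition iota :: "(6 \<Rightarrow> ('k::field ^ 3) set) set \<Rightarrow> (3 \<times> 3 \<times> 3 \<Rightarrow> 'k) set" where
  "iota O' = K_class (standard_vector (SOME v. discriminant v \<noteq> 0 \<and> O' = aut_orbit (pts v)))"

lemma iota_orbit:
  assumes "discriminant v \<noteq> 0"
  shows "iota (aut_orbit (pts v)) = K_class (standard_vector v)"
proof -
  let ?v = "SOME v'. discriminant v' \<noteq> 0 \<and> aut_orbit (pts v) = aut_orbit (pts v')"
  have "discriminant ?v \<noteq> 0 \<and> aut_orbit (pts v) = aut_orbit (pts ?v)"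
    by (rule someI[of _ v]) (use assms in simp)
  then have "equivalent v ?v" by (intro aut_orbit_equivalent discriminant_v_nonzero) simp_all
  from equivalent_standard_vector[OF this] show ?thesis by (simp add: iota_def)
qed

definition reconstruct :: "(3 \<times> 3 \<times> 3 \<Rightarrow> 'k::field) set \<Rightarrow> (6 \<Rightarrow> ('k ^ 3) set) set" where
  "reconstruct C = aut_orbit (pts (points_of (SOME c. C = K_class c)))"

lemma reconstruct_K_class: "reconstruct (K_class c) = aut_orbit (pts (points_of c))"
proof -
  have "K_class c = K_class (SOME c'. K_class c = K_class c')" by (rule someI[of _ c]) simp
  from equivalent_aut_orbit[OF equivalent_points_of[OF this]]
  show ?thesis by (simp add: reconstruct_def)
qed

lemma general_position_eq:
  "general_position = pts ` {v :: 6 \<Rightarrow> 'k::field ^ 3. discriminant v \<noteq> 0}"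
proof (intro set_eqI iffI)
  fix p :: "6 \<Rightarrow> ('k ^ 3) set" assume "p \<in> general_position"
  then show "p \<in> pts ` {v. discriminant v \<noteq> 0}" by (rule general_positionE) blast
next
  fix p :: "6 \<Rightarrow> ('k ^ 3) set" assume "p \<in> pts ` {v. discriminant v \<noteq> 0}"
  then obtain v where v: "p = pts v" "discriminant v \<noteq> 0" by blast
  have "v i \<noteq> 0" for i using v(2) by (rule discriminant_v_nonzero)
  then show "p \<in> general_position" using general_position_iff[of v] v by blast
qed

lemma topspace_M_cubic:
  "topspace (ktop M_cubic) = (\<lambda>v. aut_orbit (pts v)) ` {v :: 6 \<Rightarrow> 'k::field ^ 3. discriminant v \<noteq> 0}"
proof -
  have "topspace (ktop proj_power) \<inter> (general_position :: (6 \<Rightarrow> ('k ^ 3) set) set) = general_position"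
    by (auto simp: general_position_def)
  then show ?thesis by (simp add: M_cubic_def general_position_eq image_image)
qed

lemma reconstruct_iota:
  assumes "discriminant v \<noteq> 0"
  shows "reconstruct (iota (aut_orbit (pts v))) = aut_orbit (pts v)"
  unfolding iota_orbit[OF assms] reconstruct_K_class
  by (rule equivalent_aut_orbit[OF equivalent_points_of_standard_vector[OF assms], symmetric])

text \<open>From right to left, the open and the closed condition are given for different
  representatives \<open>c\<close> and \<open>c'\<close>; invariance of \<open>compatible\<close>
  under \<open>K\<close> brings them to the same one. Then \<open>standard_vector_points_of\<close>
  says that the reconstructed points have the class \<open>C\<close>.\<close>

lemma iota_image:
  "iota ` topspace (ktop (M_cubic :: ((6 \<Rightarrow> ('k::field ^ 3) set) set, 'k) kspace)) =
     K_class ` {c \<in> torus27. discriminant (points_of c) \<noteq> 0} \<inter> K_class ` {c \<in> torus27. compatible c}"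
    (is "?L = ?R")
proof (intro set_eqI iffI)
  fix C assume "C \<in> ?L"
  then obtain v :: "6 \<Rightarrow> 'k ^ 3" where v: "discriminant v \<noteq> 0" "C = K_class (standard_vector v)"
    unfolding topspace_M_cubic by (auto simp: iota_orbit)
  have "discriminant (points_of (standard_vector v)) \<noteq> 0"
    using equivalent_discriminant[OF equivalent_points_of_standard_vector[OF v(1)]] v(1) by blast
  then show "C \<in> ?R" using v discriminant_torus[OF v(1)] compatible_standard_vector[OF v(1)] by blast
next
  fix C assume "C \<in> ?R"
  then obtain c c' where c: "c \<in> torus27" "discriminant (points_of c) \<noteq> 0" "C = K_class c"
    "C = K_class c'" "compatible c'" by blast
  then have "compatible c" using compatible_K_class by metis
  from standard_vector_points_of[OF c(1,2) this]
  have "C = iota (aut_orbit (pts (points_of c)))" using c(2,3) by (simp add: iota_orbit)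
  then show "C \<in> ?L" unfolding topspace_M_cubic using c(2) by blast
qed

section \<open>Regularity of the map and of its inverse\<close>

definition tuple :: "('i \<times> 3 \<Rightarrow> 'k::field) \<Rightarrow> 'i \<Rightarrow> 'k ^ 3" where
  "tuple x i = (\<chi> a. x (i, a))"

lemma lines_eq: "lines x = pts (tuple x)"
  by (simp add: lines_def pts_def tuple_def fun_eq_iff)

lemma pcone_tuple: "x \<in> pcone \<longleftrightarrow> (\<forall>i. tuple x i \<noteq> 0)"
  by (simp add: pcone_vec tuple_def)

lemma polyfun_det3:
  assumes "\<And>a. polyfun (\<lambda>t. F t $ a)" "\<And>a. polyfun (\<lambda>t. G t $ a)" "\<And>a. polyfun (\<lambda>t. H t $ a)"
  shows "polyfun (\<lambda>t. det3 (F t) (G t) (H t))"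
  unfolding det3_def vdot_def cr_def vector_3 by (intro polyfun_intros assms)

lemma polyfun_coefficient:
  assumes "\<And>i a. polyfun (\<lambda>t. F t i $ a)"
  shows "polyfun (\<lambda>t. coefficient (F t) i a w)"
  unfolding coefficient_def coordinate_def
  by (cases "i = 0"; cases "i = 1") (simp_all add: polyfun_det3 assms polyfun.const)

lemma polyfun_discriminant:
  assumes F: "\<And>i a. polyfun (\<lambda>t. F t i $ a)"
  shows "polyfun (\<lambda>t. discriminant (F t))"
proof -
  have "polyfun (\<lambda>t. coordinate (F t) w (F t i))" for w i
    unfolding coordinate_def by (intro polyfun_det3 F)
  then have "polyfun (\<lambda>t. cremona_map (F t) (F t i) $ a)" for i a
    using exhaust_3[of a] by (auto simp: cremona_map_def cremona_def vector_3 intro!: polyfun_intros)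
  then show ?thesis
    unfolding discriminant_def
    by (intro polyfun.mult polyfun_prod polyfun_det3) (auto split: prod.split intro!: polyfun_det3 F)
qed

lemma polyfun_tuple: "polyfun (\<lambda>x. tuple x i $ a)"
  by (simp add: tuple_def polyfun.coord)

lemma polyfun_entry: "polyfun (\<lambda>c. entry c i a w)"
  unfolding entry_def by (intro polyfun_intros)

lemma polyfun_points_of: "polyfun (\<lambda>c. points_of c i $ a)"
  using pt_cases[of i]
  by (auto simp: points_of_pt1 points_of_pt2 intro: polyfun_entry polyfun.const)

lemma openin_general_position:
  "openin (ktop proj_power) (general_position :: (6 \<Rightarrow> ('k::field ^ 3) set) set)"
proof -
  have "{x :: 6 \<times> 3 \<Rightarrow> 'k. x \<in> pcone \<and> lines x \<in> general_position} = pcone \<inter> {x. discriminant (tuple x) \<noteq> 0}"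
    using general_position_iff by (auto simp: lines_eq pcone_tuple)
  moreover have "openin zariski (pcone \<inter> {x :: 6 \<times> 3 \<Rightarrow> 'k. discriminant (tuple x) \<noteq> 0})"
    by (intro openin_Int openin_pcone openin_zariski_nonzero polyfun_discriminant polyfun_tuple)
  ultimately show ?thesis unfolding openin_proj_power by (auto simp: general_position_def)
qed

text \<open>On vectors with nonzero discriminant the map is \<open>standard_vector\<close>, which is
  polynomial. It descends first to tuples of points of the plane and then to orbits.\<close>

lemma morphism_iota:
  "morphism M_cubic M_circ (iota :: (6 \<Rightarrow> ('k::field ^ 3) set) set \<Rightarrow> _)"
  unfolding M_cubic_def
proof (rule morphism_from_quotsp)
  let ?P = "subsp affine_sp (pcone :: (6 \<times> 3 \<Rightarrow> 'k) set)"
  let ?S = "{x \<in> topspace (ktop ?P). lines x \<in> general_position}"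
  interpret A: function_space "affine_sp :: (6 \<times> 3 \<Rightarrow> 'k, 'k) kspace" by (rule function_space_affine_sp)
  interpret P: function_space ?P by (rule A.function_space_subsp)
  interpret S: function_space "subsp ?P ?S" by (rule P.function_space_subsp)
  have disc: "discriminant (tuple x) \<noteq> 0" if "x \<in> ?S" for x
    using that general_position_iff[of "tuple x"] by (auto simp: lines_eq pcone_tuple)
  have "polyfun (\<lambda>x. standard_vector (tuple x) r)" for r :: "3 \<times> 3 \<times> 3"
    by (cases r) (simp add: standard_vector_def polyfun_coefficient polyfun_tuple)
  then have "morphism affine_sp affine_sp (\<lambda>x :: 6 \<times> 3 \<Rightarrow> 'k. standard_vector (tuple x))"
    by (rule morphism_polyfun)
  then have "morphism (subsp ?P ?S) affine_sp (\<lambda>x. standard_vector (tuple x))"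
    by (intro P.morphism_from_subsp A.morphism_from_subsp)
  then have "morphism (subsp ?P ?S) (subsp affine_sp torus27) (\<lambda>x. standard_vector (tuple x))"
  proof (rule S.morphism_into_subsp)
    fix x assume "x \<in> topspace (ktop (subsp ?P ?S))"
    then have "x \<in> ?S" by simp
    then show "standard_vector (tuple x) \<in> torus27" by (rule discriminant_torus[OF disc])
  qed
  then have "morphism (subsp ?P ?S) M_circ (\<lambda>x. K_class (standard_vector (tuple x)))"
    unfolding M_circ_def by (rule morphism_compose) (rule morphism_quotsp)
  then have *: "morphism (subsp ?P ?S) M_circ (\<lambda>x. iota (aut_orbit (lines x)))"
  proof (rule morphism_cong[OF S.function_space_axioms])
    fix x assume "x \<in> topspace (ktop (subsp ?P ?S))"
    then have "x \<in> ?S" by simp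
    then have "discriminant (tuple x) \<noteq> 0" by (rule disc)
    then show "K_class (standard_vector (tuple x)) = iota (aut_orbit (lines x))"
      unfolding lines_eq by (rule iota_orbit[symmetric])
  qed
  have "openin (quot_topology (ktop ?P) lines) general_position"
    using openin_general_position by (simp add: proj_power_eq)
  from P.morphism_from_subsp_quotsp[OF this *]
  show "morphism (subsp proj_power general_position) M_circ (\<lambda>p :: 6 \<Rightarrow> ('k ^ 3) set. iota (aut_orbit p))"
    by (simp only: proj_power_eq)
qed

text \<open>A condition invariant under \<open>K\<close> defines a saturated set, so the preimage of
  its image in the quotient is the set itself.\<close>

lemma openin_M_circ:
  assumes "openin zariski {c. Q c}" "\<And>c c'. K_class c = K_class c' \<Longrightarrow> Q c \<Longrightarrow> Q c'"
  shows "openin (ktop M_circ) (K_class ` {c \<in> torus27. Q (c :: 3 \<times> 3 \<times> 3 \<Rightarrow> 'k::field)})"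
proof -
  have "{c \<in> torus27. K_class c \<in> K_class ` {c \<in> torus27. Q c}} = {c. Q c} \<inter> torus27"
    using assms(2) by blast
  then show ?thesis
    using assms(1) by (auto simp: M_circ_def openin_quot_topology openin_subtopology)
qed

text \<open>On representatives the map is \<open>points_of\<close>, again polynomial, and the open
  set is the one where the reconstructed points are in general position.\<close>

lemma morphism_reconstruct:
  "morphism (subsp M_circ (K_class ` {c \<in> torus27. discriminant (points_of c) \<noteq> 0}))
     (M_cubic :: (_, 'k::field) kspace) reconstruct"
proof -
  let ?T = "subsp affine_sp (torus27 :: (3 \<times> 3 \<times> 3 \<Rightarrow> 'k) set)"
  let ?G = "K_class ` {c :: 3 \<times> 3 \<times> 3 \<Rightarrow> 'k. c \<in> torus27 \<and> discriminant (points_of c) \<noteq> 0}"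
  let ?S = "{c \<in> topspace (ktop ?T). K_class c \<in> ?G}"
  let ?N = "{c :: 3 \<times> 3 \<times> 3 \<Rightarrow> 'k. discriminant (points_of c) \<noteq> 0}"
  interpret A: function_space "affine_sp :: (3 \<times> 3 \<times> 3 \<Rightarrow> 'k, 'k) kspace" by (rule function_space_affine_sp)
  interpret T: function_space ?T by (rule A.function_space_subsp)
  interpret S: function_space "subsp ?T ?S" by (rule T.function_space_subsp)
  have inv: "discriminant (points_of c') \<noteq> 0" if "K_class c = K_class c'" "discriminant (points_of c) \<noteq> 0" for c c' :: "3 \<times> 3 \<times> 3 \<Rightarrow> 'k"
    using equivalent_discriminant[OF equivalent_points_of[OF that(1)]] that(2) by blast
  have N: "c \<in> ?N" if "c \<in> topspace (ktop (subsp ?T ?S))" for c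
    using that inv by auto
  have "morphism affine_sp affine_sp (\<lambda>c :: 3 \<times> 3 \<times> 3 \<Rightarrow> 'k. c)"
    by (rule morphism_polyfun) (rule polyfun.coord)
  then have "morphism (subsp ?T ?S) affine_sp (\<lambda>c. c)"
    by (intro T.morphism_from_subsp A.morphism_from_subsp)
  then have "morphism (subsp ?T ?S) (subsp affine_sp ?N) (\<lambda>c. c)"
    by (rule S.morphism_into_subsp) (rule N)
  moreover have "morphism (subsp affine_sp ?N) proj_power (\<lambda>c i. vec.span {points_of c i})"
    by (rule morphism_into_proj_power) (rule polyfun_points_of, rule discriminant_v_nonzero, simp)
  ultimately have "morphism (subsp ?T ?S) proj_power (\<lambda>c. pts (points_of c))"
    unfolding pts_def[abs_def] by (rule morphism_compose)
  then have "morphism (subsp ?T ?S) (subsp proj_power general_position) (\<lambda>c. pts (points_of c))"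
  proof (rule S.morphism_into_subsp)
    show "pts (points_of c) \<in> general_position" if "c \<in> topspace (ktop (subsp ?T ?S))" for c
      using N[OF that] unfolding general_position_eq by blast
  qed
  then have "morphism (subsp ?T ?S) M_cubic (\<lambda>c. aut_orbit (pts (points_of c)))"
    unfolding M_cubic_def by (rule morphism_compose) (rule morphism_quotsp)
  then have *: "morphism (subsp ?T ?S) M_cubic (\<lambda>c. reconstruct (K_class c))"
    by (simp only: reconstruct_K_class)
  have "openin (ktop M_circ) ?G"
    by (rule openin_M_circ) (rule openin_zariski_nonzero, rule polyfun_discriminant, rule polyfun_points_of, rule inv)
  then have "openin (quot_topology (ktop ?T) K_class) ?G" by (simp add: M_circ_def)
  from T.morphism_from_subsp_quotsp[OF this *] show ?thesis by (simp only: M_circ_def)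
qed

lemma image_diff_saturated:
  assumes sat: "\<And>c c'. f c = f c' \<Longrightarrow> Q c' \<Longrightarrow> Q c"
  shows "f ` T - f ` {c \<in> T. Q c} = f ` {c \<in> T. \<not> Q c}"
proof (intro set_eqI iffI)
  fix x assume "x \<in> f ` {c \<in> T. \<not> Q c}"
  then obtain c where c: "c \<in> T" "\<not> Q c" "x = f c" by blast
  have "x \<noteq> f c'" if "Q c'" for c'
  proof
    assume "x = f c'"
    then have "f c = f c'" using c(3) by simp
    then show False using sat[of c c'] that c(2) by simp
  qed
  then show "x \<in> f ` T - f ` {c \<in> T. Q c}" using c by (auto simp: image_iff)
qed auto

text \<open>Failure of \<open>compatible\<close> is the nonvanishing of one of finitely many
  polynomials, and it is invariant under \<open>K\<close>.\<close>

lemma closedin_compatible: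
  "closedin (ktop M_circ) (K_class ` {c :: 3 \<times> 3 \<times> 3 \<Rightarrow> 'k::field. c \<in> torus27 \<and> compatible c})"
proof -
  let ?l = "\<lambda>(a, b, w, x) c. entry c 0 a w * entry c 0 b x * coefficient (points_of c) 0 a x * coefficient (points_of c) 0 b w -
     entry c 0 a x * entry c 0 b w * coefficient (points_of c) 0 a w * coefficient (points_of c) 0 b x"
  have "{c :: 3 \<times> 3 \<times> 3 \<Rightarrow> 'k. \<not> compatible c} = {c. \<exists>j. ?l j c \<noteq> 0}"
    unfolding compatible_def by (auto simp: split_paired_Ex)
  moreover have "polyfun (?l j)" for j
    by (cases j) (auto intro!: polyfun_intros polyfun_entry polyfun_coefficient polyfun_points_of)
  then have "openin zariski {c. \<exists>j. ?l j c \<noteq> 0}" by (rule openin_zariski_Collect_ex)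
  ultimately have "openin zariski {c :: 3 \<times> 3 \<times> 3 \<Rightarrow> 'k. \<not> compatible c}" by simp
  then have "openin (ktop M_circ) (K_class ` {c :: 3 \<times> 3 \<times> 3 \<Rightarrow> 'k. c \<in> torus27 \<and> \<not> compatible c})"
    by (rule openin_M_circ) (metis compatible_K_class)
  moreover have "topspace (ktop M_circ) - K_class ` {c :: 3 \<times> 3 \<times> 3 \<Rightarrow> 'k. c \<in> torus27 \<and> compatible c} =
    K_class ` {c. c \<in> torus27 \<and> \<not> compatible c}"
  proof -
    have "topspace (ktop M_circ) = K_class ` (torus27 :: (3 \<times> 3 \<times> 3 \<Rightarrow> 'k) set)" by (simp add: M_circ_def)
    then show ?thesis by (simp only:) (rule image_diff_saturated, rule compatible_K_class)
  qed
  moreover have "K_class ` {c :: 3 \<times> 3 \<times> 3 \<Rightarrow> 'k. c \<in> torus27 \<and> compatible c} \<subseteq> topspace (ktop M_circ)"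
    by (auto simp: M_circ_def)
  ultimately show ?thesis unfolding closedin_def by simp
qed

text \<open>The image lies in the open set on which \<open>reconstruct\<close> is a morphism, and
  restricting that morphism to the image gives the inverse. The second inverse law follows from the
  first because every point of the image is some \<open>iota x\<close>.\<close>

lemma locally_closed_immersion_iota:
  "locally_closed_immersion (M_cubic :: ((6 \<Rightarrow> ('k::field ^ 3) set) set, 'k) kspace) M_circ iota"
proof -
  let ?M = "M_cubic :: ((6 \<Rightarrow> ('k ^ 3) set) set, 'k) kspace"
  let ?C = "M_circ :: ((3 \<times> 3 \<times> 3 \<Rightarrow> 'k) set, 'k) kspace"
  let ?Z = "iota ` topspace (ktop ?M)"
  let ?G = "K_class ` {c :: 3 \<times> 3 \<times> 3 \<Rightarrow> 'k. c \<in> torus27 \<and> discriminant (points_of c) \<noteq> 0}"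
  have C: "function_space ?C"
    unfolding M_circ_def by (intro function_space.function_space_quotsp function_space.function_space_subsp function_space_affine_sp)
  have M: "function_space ?M"
    unfolding M_cubic_def by (intro function_space.function_space_quotsp function_space.function_space_subsp function_space_proj_power)
  have inv: "discriminant (points_of c') \<noteq> 0" if "K_class c = K_class c'" "discriminant (points_of c) \<noteq> 0" for c c' :: "3 \<times> 3 \<times> 3 \<Rightarrow> 'k"
    using equivalent_discriminant[OF equivalent_points_of[OF that(1)]] that(2) by blast
  have "openin (ktop ?C) ?G"
    by (rule openin_M_circ) (rule openin_zariski_nonzero, rule polyfun_discriminant, rule polyfun_points_of, rule inv)
  then have "locally_closed_in (ktop ?C) ?Z"
    unfolding locally_closed_in_def iota_image using closedin_compatible by blast
  moreover have "isomorphism ?M (subsp ?C ?Z) iota"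
    unfolding isomorphism_def
  proof (intro conjI exI[of _ reconstruct] ballI)
    show "morphism ?M (subsp ?C ?Z) iota"
      by (rule function_space.morphism_into_subsp[OF M morphism_iota]) blast
    have "?Z \<subseteq> ?G" unfolding iota_image by blast
    then have "morphism (subsp ?C ?Z) (subsp (subsp ?C ?G) ?Z) (\<lambda>x. x)" by (rule subsp_subsp_open[OF C])
    moreover have "morphism (subsp (subsp ?C ?G) ?Z) ?M reconstruct"
      by (rule function_space.morphism_from_subsp[OF function_space.function_space_subsp[OF C] morphism_reconstruct])
    ultimately show "morphism (subsp ?C ?Z) ?M reconstruct" by (rule morphism_compose)
    have inverse: "reconstruct (iota x) = x" if "x \<in> topspace (ktop ?M)" for x
      using that unfolding topspace_M_cubic by (auto simp: reconstruct_iota)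
    then show "reconstruct (iota x) = x" if "x \<in> topspace (ktop ?M)" for x using that .
    show "iota (reconstruct y) = y" if "y \<in> topspace (ktop (subsp ?C ?Z))" for y
    proof -
      have "y \<in> ?Z" using that by simp
      then obtain x where "x \<in> topspace (ktop ?M)" "y = iota x" by (rule imageE)
      then show ?thesis by (simp add: inverse)
    qed
  qed
  ultimately show ?thesis unfolding locally_closed_immersion_def by blast
qed

theorem theorem1p2:
  shows "\<exists>\<iota> :: (6 \<Rightarrow> ('k::{alg_closed_field, field_char_0} ^ 3) set) set \<Rightarrow>
           (3 \<times> 3 \<times> 3 \<Rightarrow> 'k) set.
    (\<forall>p \<in> (general_position :: (6 \<Rightarrow> ('k ^ 3) set) set).
       (\<exists>c. coefficient_vector p c) \<and>
       (\<forall>c. coefficient_vector p c \<longrightarrow> c \<in> torus27 \<and> \<iota> (aut_orbit p) = K_class c)) \<and>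
    locally_closed_immersion M_cubic M_circ \<iota>"
proof (intro exI[of _ iota] conjI ballI allI impI)
  fix p :: "6 \<Rightarrow> ('k ^ 3) set" assume "p \<in> general_position"
  then obtain v where v: "p = pts v" "discriminant v \<noteq> 0" by (rule general_positionE)
  show "\<exists>c. coefficient_vector p c"
    unfolding v(1) by (intro coefficient_vector_exists discriminant_det[OF v(2)] discriminant_v_nonzero[OF v(2)])
  fix c assume c: "coefficient_vector p c"
  have "c \<in> torus27 \<and> K_class c = K_class (standard_vector v)"
    using coefficient_vector_sound[OF discriminant_det[OF v(2)] c[unfolded v(1)]] by blast
  then show "c \<in> torus27" "iota (aut_orbit p) = K_class c"
    unfolding v(1) iota_orbit[OF v(2)] by simp_all
qed (rule locally_closed_immersion_iota)

end
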